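(* Let $1<p<\infty$, $p'=p/(p-1)$, and let $\phi,\psi,\psi_h,I,D,I_h$ be as in the context (in particular, strong duality $\inf I=\sup D$ holds, and $I_h$ satisfies the strong coercivity property with the functional $\sigma_{I_h}$). Let $u\in W^{1,p}_D(\Omega)$ and $u_h\in\mathcal{S}^{1,cr}_D(\mathcal{T}_h)$ be minimizers of $I$ and $I_h$, respectively, and let $z$ be a solution of the dual problem (a maximizer of $D$ in $W^{p'}_N(\operatorname{div};\Omega)$) with $z\in W^1_N(\operatorname{div};\Omega)\cap W^{1,1}(\Omega;\mathbb{R}^d)$. (i) Assume that for $f\in L^{p'}(\Omega)$ and $f_h=\Pi_{h,0}f$ we have $\psi(x,s)=-f(x)s$ and $\psi_h(x,s)=-f_h(x)s$. Then $$\sigma_{I_h}^2(u_h,\mathcal{I}_{cr}u)\le\int_\Omega\big(D\phi^*(z)-D\phi^*(\Pi_{h,0}\mathcal{I}_{RT}z)\big)\cdot(z-\Pi_{h,0}\mathcal{I}_{RT}z)\,dx.$$ (ii) Assume that for $g\in L^2(\Omega)$ and $g_h=\Pi_{h,0}g$ we have $\psi(x,s)=(g(x)-s)^2/2$ and $\psi_h(x,s)=(g_h(x)-s)^2/2$. Then $$\sigma_{I_h}^2(u_h,\mathcal{I}_{cr}u)\le\int_\Omega\big(D\phi^*(z)-D\phi^*(\Pi_{h,0}\mathcal{I}_{RT}z)\big)\cdot(z-\Pi_{h,0}\mathcal{I}_{RT}z)\,dx+\|u-\Pi_{h,0}\mathcal{I}_{cr}u\|^2.$$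
   Context: Let $d\in\{2,3\}$ and let $\Omega\subset\mathbb{R}^d$ be a bounded polyhedral Lipschitz domain, $\Gamma_D\subset\partial\Omega$, $\Gamma_N=\partial\Omega\setminus\Gamma_D$. $\mathcal{T}_h$ is a regular (conforming) triangulation of $\Omega$ into triangles ($d=2$) or tetrahedra ($d=3$), with set of sides (edges/faces) $\mathcal{S}_h$; every boundary side belongs to $\Gamma_D$ or to $\Gamma_N$ (up to null sets). $x_S,x_T$ denote barycenters of sides $S$ and elements $T$; $n$ is the outer unit normal on $\partial\Omega$, $n_S$ a fixed unit normal on each side. $\|\cdot\|$ is the $L^2(\Omega)$ norm. $W^{1,p}_D(\Omega)=\{v\in W^{1,p}(\Omega): v|_{\Gamma_D}=0\}$; $W^{q}_N(\operatorname{div};\Omega)=\{y\in L^q(\Omega;\mathbb{R}^d):\operatorname{div}y\in L^q(\Omega),\ y\cdot n=0\text{ on }\Gamma_N\}$, the boundary condition being understood weakly, i.e. $\int_\Omega y\cdot\nabla v+v\operatorname{div}y\,dx=0$ for all $v\in W^{1,q'}_D(\Omega)$. $\mathcal{L}^k(\mathcal{T}_h)^\ell$: elementwise polynomials of total degree at most $k$ with values in $\mathbb{R}^\ell$. $\Pi_{h,0}$: $L^2$ projection onto $\mathcal{L}^0(\mathcal{T}_h)^\ell$ (elementwise averaging). Crouzeix--Raviart space: $\mathcal{S}^{1,cr}(\mathcal{T}_h)=\{v_h\in\mathcal{L}^1(\mathcal{T}_h): v_h\text{ continuous at }x_S\ \forall S\in\mathcal{S}_h\}$; $\mathcal{S}^{1,cr}_D(\mathcal{T}_h)$: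 those with $v_h(x_S)=0$ for sides $S\subset\Gamma_D$; $\nabla_h$: elementwise gradient; $\mathcal{I}_{cr}v\in\mathcal{S}^{1,cr}(\mathcal{T}_h)$ is determined by $(\mathcal{I}_{cr}v)(x_S)=|S|^{-1}\int_Sv\,ds$ for all $S$. Raviart--Thomas space $\mathcal{RT}^0(\mathcal{T}_h)$: fields $y_h\in L^1(\Omega;\mathbb{R}^d)$ with $\operatorname{div}y_h\in L^1(\Omega)$ and $y_h|_T(x)=a_T+b_T(x-x_T)$, $a_T\in\mathbb{R}^d,b_T\in\mathbb{R}$; for $z\in W^{1,1}(\Omega;\mathbb{R}^d)$, $\mathcal{I}_{RT}z\in\mathcal{RT}^0(\mathcal{T}_h)$ is determined by $(\mathcal{I}_{RT}z)|_S\cdot n_S=|S|^{-1}\int_Sz\cdot n_S\,ds$ for all $S$. Continuous problems: $\phi:\mathbb{R}^d\to\mathbb{R}$ is convex and, with $\psi$ as in (i) or (ii), $$I(u)=\int_\Omega\phi(\nabla u)\,dx+\int_\Omega\psi(x,u)\,dx$$ on $W^{1,p}_D(\Omega)$ is bounded from below, coercive, weakly lower semicontinuous and not identically $+\infty$. The dual problem is to maximize $$D(z)=-\int_\Omega\phi^*(z)\,dx-\int_\Omega\psi^*(x,\operatorname{div}z)\,dx$$ over $W^{p'}_N(\operatorname{div};\Omega)$; a solution is assumed to exist, and strong duality $\inf_{W^{1,p}_D(\Omega)}I=\sup_{W^{p'}_N(\operatorname{div};\Omega)}D$ is assumed. Then solutions satisfy $z=D\phi(\nabla u)$ (equivalently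 $\nabla u=D\phi^*(z)$) and $\operatorname{div}z=D\psi(\cdot,u)$, with $D\psi$ the derivative in the second argument. Conjugates: $\phi^*(t)=\sup_{s\in\mathbb{R}^d}t\cdot s-\phi(s)$, $\psi^*(x,t)=\sup_{s\in\mathbb{R}}ts-\psi(x,s)$. Discrete problem: $$I_h(u_h)=\int_\Omega\phi(\nabla_hu_h)\,dx+\int_\Omega\psi_h(x,\Pi_{h,0}u_h)\,dx,\quad u_h\in\mathcal{S}^{1,cr}_D(\mathcal{T}_h).$$ Strong coercivity: with the variational derivative $\delta I_h$, $$I_h(v_h)+\delta I_h(v_h)[w_h-v_h]+\sigma_{I_h}^2(v_h,w_h)\le I_h(w_h)\quad\text{for all }v_h,w_h\in\mathcal{S}^{1,cr}_D(\mathcal{T}_h),$$ with a definite functional $\sigma_{I_h}$ ($\sigma_{I_h}\ge0$, vanishing only if $v_h=w_h$). The functions $\phi,\phi^*$ are assumed differentiable so that the derivatives appearing are defined, and all integrals in the estimates are assumed to be well defined. *)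

theory Defs
  imports "HOL-Analysis.Analysis"
begin

section \<open>Differential calculus on Euclidean space\<close>

definition gradient :: "('a::euclidean_space \<Rightarrow> real) \<Rightarrow> 'a \<Rightarrow> 'a" where
  "gradient f x = (\<Sum>b\<in>Basis. frechet_derivative f (at x) b *\<^sub>R b)"

primrec Ck :: "nat \<Rightarrow> ('a::euclidean_space \<Rightarrow> real) \<Rightarrow> bool" where
  "Ck 0 f \<longleftrightarrow> continuous_on UNIV f"
| "Ck (Suc k) f \<longleftrightarrow> (\<forall>x. f differentiable (at x)) \<and>
     (\<forall>b\<in>Basis. Ck k (\<lambda>x. frechet_derivative f (at x) b))"

definition test_function :: "'a::euclidean_space set \<Rightarrow> ('a \<Rightarrow> real) \<Rightarrow> bool" where
  "test_function \<Omega> \<eta> \<longleftrightarrow> (\<forall>k. Ck k \<eta>) \<and>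
     compact (closure {x. \<eta> x \<noteq> 0}) \<and> closure {x. \<eta> x \<noteq> 0} \<subseteq> \<Omega>"


section \<open>Lebesgue and Sobolev spaces\<close>

text \<open>Elements of these spaces are represented by functions on the whole type; only their values
  almost everywhere in \<open>\<Omega>\<close> matter. Exponents range over \<open>[1, \<infinity>]\<close>.\<close>

definition Lspace :: "ereal \<Rightarrow> 'a::euclidean_space set \<Rightarrow> ('a \<Rightarrow> 'b::euclidean_space) set" where
  "Lspace p \<Omega> = {f \<in> borel_measurable (lebesgue_on \<Omega>).
     if p = \<infinity> then \<exists>C. AE x in lebesgue_on \<Omega>. norm (f x) \<le> C
     else integrable (lebesgue_on \<Omega>) (\<lambda>x. norm (f x) powr real_of_ereal p)}"

definition conj_exp :: "ereal \<Rightarrow> ereal" where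
  "conj_exp p = (if p = 1 then \<infinity> else if p = \<infinity> then 1 else p / (p - 1))"

definition loc_integrable :: "'a::euclidean_space set \<Rightarrow> ('a \<Rightarrow> 'b::euclidean_space) \<Rightarrow> bool" where
  "loc_integrable \<Omega> f \<longleftrightarrow> (\<forall>K. compact K \<and> K \<subseteq> \<Omega> \<longrightarrow> integrable (lebesgue_on K) f)"

definition has_weak_grad :: "'a::euclidean_space set \<Rightarrow> ('a \<Rightarrow> real) \<Rightarrow> ('a \<Rightarrow> 'a) \<Rightarrow> bool" where
  "has_weak_grad \<Omega> v G \<longleftrightarrow> loc_integrable \<Omega> v \<and> loc_integrable \<Omega> G \<and>
     (\<forall>\<eta>. test_function \<Omega> \<eta> \<longrightarrow>
        (LINT x|lebesgue_on \<Omega>. v x *\<^sub>R gradient \<eta> x) = - (LINT x|lebesgue_on \<Omega>. \<eta> x *\<^sub>R G x))"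

definition weak_grad :: "'a::euclidean_space set \<Rightarrow> ('a \<Rightarrow> real) \<Rightarrow> 'a \<Rightarrow> 'a" where
  "weak_grad \<Omega> v = (SOME G. has_weak_grad \<Omega> v G)"

definition has_weak_div :: "'a::euclidean_space set \<Rightarrow> ('a \<Rightarrow> 'a) \<Rightarrow> ('a \<Rightarrow> real) \<Rightarrow> bool" where
  "has_weak_div \<Omega> y r \<longleftrightarrow> loc_integrable \<Omega> y \<and> loc_integrable \<Omega> r \<and>
     (\<forall>\<eta>. test_function \<Omega> \<eta> \<longrightarrow>
        (LINT x|lebesgue_on \<Omega>. y x \<bullet> gradient \<eta> x) = - (LINT x|lebesgue_on \<Omega>. \<eta> x * r x))"

definition weak_div :: "'a::euclidean_space set \<Rightarrow> ('a \<Rightarrow> 'a) \<Rightarrow> 'a \<Rightarrow> real" where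
  "weak_div \<Omega> y = (SOME r. has_weak_div \<Omega> y r)"

definition sobolev :: "ereal \<Rightarrow> 'a::euclidean_space set \<Rightarrow> ('a \<Rightarrow> real) set" where
  "sobolev p \<Omega> = {v \<in> Lspace p \<Omega>. \<exists>G \<in> Lspace p \<Omega>. has_weak_grad \<Omega> v G}"

definition sobolev_norm :: "real \<Rightarrow> 'a::euclidean_space set \<Rightarrow> ('a \<Rightarrow> real) \<Rightarrow> real" where
  "sobolev_norm p \<Omega> v =
     ((LINT x|lebesgue_on \<Omega>. \<bar>v x\<bar> powr p) +
      (LINT x|lebesgue_on \<Omega>. norm (weak_grad \<Omega> v x) powr p)) powr (1 / p)"

definition weakly_convergent_to ::
    "real \<Rightarrow> 'a::euclidean_space set \<Rightarrow> (nat \<Rightarrow> 'a \<Rightarrow> real) \<Rightarrow> ('a \<Rightarrow> real) \<Rightarrow> bool" where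
  "weakly_convergent_to p \<Omega> vs v \<longleftrightarrow>
     (\<forall>l. (\<forall>a b. \<forall>f\<in>sobolev (ereal p) \<Omega>. \<forall>g\<in>sobolev (ereal p) \<Omega>.
             l (\<lambda>x. a * f x + b * g x) = a * l f + b * l g) \<and>
          (\<exists>C. \<forall>f\<in>sobolev (ereal p) \<Omega>. \<bar>l f\<bar> \<le> C * sobolev_norm p \<Omega> f)
        \<longrightarrow> (\<lambda>k. l (vs k)) \<longlonglongrightarrow> (l v :: real))"


section \<open>Surface measure and traces\<close>

text \<open>The surface measure of a set \<open>F\<close> contained in a hyperplane (the affine hull of \<open>F\<close>): the
  volume of the orthogonal prism of height one over a subset of \<open>F\<close> is the
  \<open>(d-1)\<close>-dimensional volume of that subset.\<close>

definition surface_measure :: "'a::euclidean_space set \<Rightarrow> 'a measure" where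
  "surface_measure F =
     (let pr = closest_point (affine hull F)
      in distr (lebesgue_on {x. pr x \<in> F \<and> dist x (pr x) \<le> 1 / 2}) borel pr)"

text \<open>\<open>g\<close> is the trace on the flat piece \<open>F\<close> of \<open>closure \<Omega>\<close> of \<open>v\<close> in \<open>W\<^sup>1\<^sup>,\<^sup>1(\<Omega>)\<close>: the trace operator
  is the continuous extension of the restriction of functions that are smooth up to the
  boundary. On a bounded \<open>\<Omega>\<close> this covers the traces of \<open>W\<^sup>1\<^sup>,\<^sup>p(\<Omega>)\<close> for all \<open>p \<ge> 1\<close>.\<close>

definition has_trace :: "'a::euclidean_space set \<Rightarrow> 'a set \<Rightarrow> ('a \<Rightarrow> real) \<Rightarrow> ('a \<Rightarrow> real) \<Rightarrow> bool" where
  "has_trace \<Omega> F v g \<longleftrightarrow> v \<in> sobolev 1 \<Omega> \<and> integrable (surface_measure F) g \<and>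
     (\<exists>\<theta>. (\<forall>j k. Ck k (\<theta> j)) \<and>
        (\<lambda>j. sobolev_norm 1 \<Omega> (\<lambda>x. \<theta> j x - v x)) \<longlonglongrightarrow> 0 \<and>
        (\<lambda>j::nat. LINT x|surface_measure F. \<bar>\<theta> j x - g x\<bar>) \<longlonglongrightarrow> 0)"

text \<open>The boundary of a polyhedral \<open>\<Omega>\<close> is covered by the \<open>(d-1)\<close>-simplices contained in it, so
  vanishing on \<open>\<Gamma>D\<close> can be required on each of them.\<close>

definition sobolev_D ::
    "ereal \<Rightarrow> 'a::euclidean_space set \<Rightarrow> 'a set \<Rightarrow> ('a \<Rightarrow> real) set" where
  "sobolev_D p \<Omega> \<Gamma>D = {v \<in> sobolev p \<Omega>.
     \<forall>F. (int DIM('a) - 1) simplex F \<and> F \<subseteq> frontier \<Omega> \<longrightarrow>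
       (\<exists>g. has_trace \<Omega> F v g \<and> (AE x in surface_measure F. x \<in> \<Gamma>D \<longrightarrow> g x = 0))}"

definition div_space_N ::
    "ereal \<Rightarrow> 'a::euclidean_space set \<Rightarrow> 'a set \<Rightarrow> ('a \<Rightarrow> 'a) set" where
  "div_space_N q \<Omega> \<Gamma>D = {y \<in> Lspace q \<Omega>. (\<exists>r \<in> Lspace q \<Omega>. has_weak_div \<Omega> y r) \<and>
     (\<forall>v \<in> sobolev_D (conj_exp q) \<Omega> \<Gamma>D.
        (LINT x|lebesgue_on \<Omega>. y x \<bullet> weak_grad \<Omega> v x + v x * weak_div \<Omega> y x) = 0)}"


section \<open>Polyhedral domains and triangulations\<close>

definition lipschitz_boundary :: "'a::euclidean_space set \<Rightarrow> bool" where
  "lipschitz_boundary \<Omega> \<longleftrightarrow>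
     (\<forall>x\<in>frontier \<Omega>. \<exists>U e L \<gamma>. open U \<and> x \<in> U \<and> norm e = 1 \<and> lipschitz_on L {y. y \<bullet> e = 0} \<gamma> \<and>
        \<Omega> \<inter> U = {y \<in> U. \<gamma> (y - (y \<bullet> e) *\<^sub>R e) < y \<bullet> e})"

definition polyhedral_lipschitz_domain :: "'a::euclidean_space set \<Rightarrow> bool" where
  "polyhedral_lipschitz_domain \<Omega> \<longleftrightarrow>
     open \<Omega> \<and> connected \<Omega> \<and> \<Omega> \<noteq> {} \<and> bounded \<Omega> \<and> lipschitz_boundary \<Omega> \<and>
     (\<exists>\<P>. finite \<P> \<and> (\<forall>P\<in>\<P>. polytope P) \<and> closure \<Omega> = \<Union>\<P>)"

definition regular_triangulation :: "'a::euclidean_space set \<Rightarrow> 'a set set \<Rightarrow> bool" where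
  "regular_triangulation \<Omega> \<T> \<longleftrightarrow>
     triangulation \<T> \<and> (\<forall>T\<in>\<T>. int DIM('a) simplex T) \<and> \<Union>\<T> = closure \<Omega>"

definition sides :: "'a::euclidean_space set set \<Rightarrow> 'a set set" where
  "sides \<T> = {S. \<exists>T\<in>\<T>. S facet_of T}"

definition sides_in :: "'a::euclidean_space set set \<Rightarrow> 'a set \<Rightarrow> 'a set \<Rightarrow> 'a set set" where
  "sides_in \<T> \<Omega> \<Gamma> = {S \<in> sides \<T>. S \<subseteq> frontier \<Omega> \<and> (AE x in surface_measure S. x \<in> \<Gamma>)}"

definition boundary_resolved :: "'a::euclidean_space set set \<Rightarrow> 'a set \<Rightarrow> 'a set \<Rightarrow> bool" where
  "boundary_resolved \<T> \<Omega> \<Gamma>D \<longleftrightarrow>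
     (\<forall>S\<in>sides \<T>. S \<subseteq> frontier \<Omega> \<longrightarrow> S \<in> sides_in \<T> \<Omega> \<Gamma>D \<union> sides_in \<T> \<Omega> (frontier \<Omega> - \<Gamma>D))"

definition unit_normals :: "'a::euclidean_space set set \<Rightarrow> ('a set \<Rightarrow> 'a) \<Rightarrow> bool" where
  "unit_normals \<T> n \<longleftrightarrow>
     (\<forall>S\<in>sides \<T>. norm (n S) = 1 \<and> (\<forall>x\<in>S. \<forall>y\<in>S. n S \<bullet> (x - y) = 0))"

definition barycenter :: "'a::euclidean_space set \<Rightarrow> 'a" where
  "barycenter S = (\<Sum>v | v extreme_point_of S. v) /\<^sub>R real (card {v. v extreme_point_of S})"


section \<open>Finite element spaces\<close>

text \<open>Elementwise polynomials are represented by the functions that are polynomial on the interior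
  of each element and, to make the representation unique, vanish on the remaining null set
  and outside the domain. Values on sides are limits taken from within the elements.\<close>

definition elem_interiors :: "'a::euclidean_space set set \<Rightarrow> 'a set" where
  "elem_interiors \<T> = (\<Union>T\<in>\<T>. interior T)"

definition pw_affine :: "'a::euclidean_space set set \<Rightarrow> ('a \<Rightarrow> real) set" where
  "pw_affine \<T> = {v. (\<forall>T\<in>\<T>. \<exists>a b. \<forall>x\<in>interior T. v x = a + b \<bullet> x) \<and>
     (\<forall>x. x \<notin> elem_interiors \<T> \<longrightarrow> v x = 0)}"

definition proj0 ::
    "'a::euclidean_space set set \<Rightarrow> ('a \<Rightarrow> 'b::euclidean_space) \<Rightarrow> 'a \<Rightarrow> 'b" where
  "proj0 \<T> v x =
     (\<Sum>T\<in>\<T>. indicator (interior T) x *\<^sub>R ((LINT y|lebesgue_on T. v y) /\<^sub>R measure lebesgue T))"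

definition grad_h :: "'a::euclidean_space set set \<Rightarrow> ('a \<Rightarrow> real) \<Rightarrow> 'a \<Rightarrow> 'a" where
  "grad_h \<T> v x = (if x \<in> elem_interiors \<T> then gradient v x else 0)"

definition has_side_value ::
    "'a::euclidean_space set set \<Rightarrow> ('a \<Rightarrow> real) \<Rightarrow> 'a set \<Rightarrow> real \<Rightarrow> bool" where
  "has_side_value \<T> v S c \<longleftrightarrow> (v \<longlongrightarrow> c) (at (barycenter S) within elem_interiors \<T>)"

definition CR :: "'a::euclidean_space set set \<Rightarrow> ('a \<Rightarrow> real) set" where
  "CR \<T> = {v \<in> pw_affine \<T>. \<forall>S\<in>sides \<T>. \<exists>c. has_side_value \<T> v S c}"

definition CR_D ::
    "'a::euclidean_space set set \<Rightarrow> 'a set \<Rightarrow> 'a set \<Rightarrow> ('a \<Rightarrow> real) set" where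
  "CR_D \<T> \<Omega> \<Gamma>D = {v \<in> CR \<T>. \<forall>S\<in>sides_in \<T> \<Omega> \<Gamma>D. has_side_value \<T> v S 0}"

definition side_average :: "'a::euclidean_space set \<Rightarrow> ('a \<Rightarrow> real) \<Rightarrow> real" where
  "side_average S g = (LINT s|surface_measure S. g s) / measure (surface_measure S) UNIV"

text \<open>The interpolation operators are given by their graphs: a function \<open>w\<close> is the interpolant of \<open>v\<close>
  iff it satisfies the conditions below. On Lipschitz domains traces exist and are unique almost
  everywhere on each side, and the side values determine the discrete function.\<close>

definition is_CR_interpolant ::
    "'a::euclidean_space set set \<Rightarrow> 'a set \<Rightarrow> ('a \<Rightarrow> real) \<Rightarrow> ('a \<Rightarrow> real) \<Rightarrow> bool" where
  "is_CR_interpolant \<T> \<Omega> v w \<longleftrightarrow> w \<in> CR \<T> \<and>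
     (\<forall>S\<in>sides \<T>. \<exists>g. has_trace \<Omega> S v g \<and> has_side_value \<T> w S (side_average S g))"

definition RT :: "'a::euclidean_space set set \<Rightarrow> 'a set \<Rightarrow> ('a \<Rightarrow> 'a) set" where
  "RT \<T> \<Omega> = {y \<in> Lspace 1 \<Omega>. (\<exists>r \<in> Lspace 1 \<Omega>. has_weak_div \<Omega> y r) \<and>
     (\<forall>T\<in>\<T>. \<exists>a b. \<forall>x\<in>interior T. y x = a + b *\<^sub>R (x - barycenter T)) \<and>
     (\<forall>x. x \<notin> elem_interiors \<T> \<longrightarrow> y x = 0)}"

text \<open>Normal components are evaluated in the relative interior of a side, away from
  its lower-dimensional faces, where elements not containing the side may accumulate.\<close>

definition has_normal_component ::
    "'a::euclidean_space set set \<Rightarrow> ('a set \<Rightarrow> 'a) \<Rightarrow> ('a \<Rightarrow> 'a) \<Rightarrow> 'a set \<Rightarrow> real \<Rightarrow> bool" where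
  "has_normal_component \<T> n y S c \<longleftrightarrow>
     (\<forall>s\<in>rel_interior S. ((\<lambda>x. y x \<bullet> n S) \<longlongrightarrow> c) (at s within elem_interiors \<T>))"

definition is_RT_interpolant ::
    "'a::euclidean_space set set \<Rightarrow> 'a set \<Rightarrow> ('a set \<Rightarrow> 'a) \<Rightarrow> ('a \<Rightarrow> 'a) \<Rightarrow> ('a \<Rightarrow> 'a) \<Rightarrow> bool" where
  "is_RT_interpolant \<T> \<Omega> n z y \<longleftrightarrow> y \<in> RT \<T> \<Omega> \<and>
     (\<forall>S\<in>sides \<T>. \<exists>g. has_trace \<Omega> S (\<lambda>x. z x \<bullet> n S) g \<and>
        has_normal_component \<T> n y S (side_average S g))"


section \<open>Functionals\<close>

text \<open>The integral with values in the extended reals, for functions whose positive or negative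
  part has a finite integral.\<close>

definition ext_integral :: "'a measure \<Rightarrow> ('a \<Rightarrow> ereal) \<Rightarrow> ereal" where
  "ext_integral M f =
     enn2ereal (\<integral>\<^sup>+x. e2ennreal (f x) \<partial>M) - enn2ereal (\<integral>\<^sup>+x. e2ennreal (- f x) \<partial>M)"

definition fconj :: "('b::real_inner \<Rightarrow> real) \<Rightarrow> 'b \<Rightarrow> ereal" where
  "fconj \<phi> t = (SUP s. ereal (t \<bullet> s - \<phi> s))"

definition grad_conj :: "('b::euclidean_space \<Rightarrow> real) \<Rightarrow> 'b \<Rightarrow> 'b" where
  "grad_conj \<phi> = gradient (\<lambda>t. real_of_ereal (fconj \<phi> t))"

definition primal ::
    "('a::euclidean_space \<Rightarrow> real) \<Rightarrow> ('a \<Rightarrow> real \<Rightarrow> real) \<Rightarrow> 'a set \<Rightarrow> ('a \<Rightarrow> real) \<Rightarrow> ereal" where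
  "primal \<phi> \<psi> \<Omega> v =
     ext_integral (lebesgue_on \<Omega>) (\<lambda>x. ereal (\<phi> (weak_grad \<Omega> v x))) +
     ext_integral (lebesgue_on \<Omega>) (\<lambda>x. ereal (\<psi> x (v x)))"

definition dual ::
    "('a::euclidean_space \<Rightarrow> real) \<Rightarrow> ('a \<Rightarrow> real \<Rightarrow> real) \<Rightarrow> 'a set \<Rightarrow> ('a \<Rightarrow> 'a) \<Rightarrow> ereal" where
  "dual \<phi> \<psi> \<Omega> y =
     - ext_integral (lebesgue_on \<Omega>) (\<lambda>x. fconj \<phi> (y x)) -
     ext_integral (lebesgue_on \<Omega>) (\<lambda>x. fconj (\<psi> x) (weak_div \<Omega> y x))"

definition primal_h ::
    "('a::euclidean_space \<Rightarrow> real) \<Rightarrow> ('a \<Rightarrow> real \<Rightarrow> real) \<Rightarrow> 'a set set \<Rightarrow> 'a set \<Rightarrow> ('a \<Rightarrow> real) \<Rightarrow> real" where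
  "primal_h \<phi> \<psi>h \<T> \<Omega> v =
     (LINT x|lebesgue_on \<Omega>. \<phi> (grad_h \<T> v x)) + (LINT x|lebesgue_on \<Omega>. \<psi>h x (proj0 \<T> v x))"

definition variation :: "(('a \<Rightarrow> real) \<Rightarrow> real) \<Rightarrow> ('a \<Rightarrow> real) \<Rightarrow> ('a \<Rightarrow> real) \<Rightarrow> real" where
  "variation J v h = deriv (\<lambda>t. J (\<lambda>x. v x + t * h x)) 0"

definition strongly_coercive ::
    "('a \<Rightarrow> real) set \<Rightarrow> (('a \<Rightarrow> real) \<Rightarrow> real) \<Rightarrow> (('a \<Rightarrow> real) \<Rightarrow> ('a \<Rightarrow> real) \<Rightarrow> real) \<Rightarrow> bool" where
  "strongly_coercive V J \<sigma> \<longleftrightarrow>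
     (\<forall>v\<in>V. \<forall>w\<in>V. 0 \<le> \<sigma> v w \<and> (\<sigma> v w = 0 \<longrightarrow> v = w) \<and>
        J v + variation J v (\<lambda>x. w x - v x) + (\<sigma> v w)\<^sup>2 \<le> J w)"

definition coercive_on ::
    "real \<Rightarrow> 'a::euclidean_space set \<Rightarrow> ('a \<Rightarrow> real) set \<Rightarrow> (('a \<Rightarrow> real) \<Rightarrow> ereal) \<Rightarrow> bool" where
  "coercive_on p \<Omega> V J \<longleftrightarrow> (\<forall>M::real. \<exists>R. \<forall>v\<in>V. R \<le> sobolev_norm p \<Omega> v \<longrightarrow> ereal M \<le> J v)"

definition weakly_lsc_on ::
    "real \<Rightarrow> 'a::euclidean_space set \<Rightarrow> ('a \<Rightarrow> real) set \<Rightarrow> (('a \<Rightarrow> real) \<Rightarrow> ereal) \<Rightarrow> bool" where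
  "weakly_lsc_on p \<Omega> V J \<longleftrightarrow>
     (\<forall>vs v. (\<forall>k. vs k \<in> V) \<and> v \<in> V \<and> weakly_convergent_to p \<Omega> vs v \<longrightarrow>
        J v \<le> liminf (\<lambda>k. J (vs k)))"

end

theory Submission
  imports Defs "HOL-Real_Asymp.Real_Asymp"
begin

text \<open>
  Since \<open>u\<^sub>h\<close> minimizes \<open>I\<^sub>h\<close>, the first variation vanishes there and strong coercivity gives
  \<open>\<sigma>\<^sup>2(u\<^sub>h, I\<^sub>c\<^sub>r u) \<le> I\<^sub>h(I\<^sub>c\<^sub>r u) - I\<^sub>h(u\<^sub>h)\<close>. The elementwise gradient of \<open>I\<^sub>c\<^sub>r u\<close> is the mean of \<open>\<nabla>u\<close>,
  so Jensen's inequality bounds the first energy, while the second is bounded from below by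
  Fenchel's inequality tested with \<open>y = \<Pi> I\<^sub>R\<^sub>T z\<close> and the discrete integration by parts formula for
  Crouzeix-Raviart and Raviart-Thomas functions, in which \<open>div I\<^sub>R\<^sub>T z = \<Pi> div z\<close>. What remains is
  \<open>\<integral> \<phi>(\<nabla>u) - \<nabla>u \<bullet> y + \<phi>\<^sup>*(y)\<close> (plus a projection error in case (ii)); by strong duality
  \<open>\<phi>(\<nabla>u) = z \<bullet> \<nabla>u - \<phi>\<^sup>*(z)\<close> and \<open>\<nabla>u = D\<phi>\<^sup>*(z)\<close>, and the gradient inequality for \<open>\<phi>\<^sup>*\<close> at \<open>y\<close> concludes.

  The facts on traces all come from one identity: on the cone \<open>T\<close> with apex \<open>P\<close> over a side \<open>S\<close> at height \<open>h\<close>,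
  \<open>h \<integral>\<^bsub>S\<^esub> v = \<integral>\<^bsub>T\<^esub> (x - P) \<bullet> \<nabla>v + d v\<close>. It holds for smooth \<open>v\<close> by Fubini and passes to traces by
  density, so that neither the divergence theorem nor the uniqueness of traces is needed.
\<close>


section \<open>Smooth functions and weak derivatives\<close>

text \<open>The data are weak. The Neumann condition on \<open>z\<close> is an identity tested with
  \<open>sobolev_D\<close>, traces are limits of smooth functions, and no pointwise relation between
  \<open>u\<close> and \<open>z\<close> is given. The optimality conditions therefore come from one
  scalar equation: under strong duality the Fenchel-Young gaps of \<phi> and \<psi>, both
  nonnegative, have integrals that add up to zero. The vanishing of the mean normal component of
  \<open>z\<close> on a Neumann side needs smooth test functions concentrated at that single side
  and away from every other element. The exponent 1 in the regularity of \<open>z\<close> admits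
  test functions with exponent \<infinity>, hence such bumps. Their construction rests on how
  elements meet along a side, and there the Lipschitz boundary matters: it excludes slits, so a side
  with elements on both sides has its relative interior in \<Omega>, and a boundary side belongs to
  one element only. Both cases share one estimate: the lower-order discrete energy is the pairing
  with \<open>\<Pi> div z\<close> plus a remainder, which is zero in case (i) and half a squared
  distance of projections in case (ii).\<close>

abbreviation smooth :: "('a::euclidean_space \<Rightarrow> real) \<Rightarrow> bool" where
  "smooth f \<equiv> \<forall>k. Ck k f"

section \<open>Gradients and the classes \<open>Ck\<close>\<close>

lemma gradient_inner_Basis: "b \<in> Basis \<Longrightarrow> gradient f x \<bullet> b = frechet_derivative f (at x) b"
  unfolding gradient_def by (simp add: inner_sum_left inner_Basis if_distrib sum.If_cases cong: if_cong)

lemma has_derivative_gradient: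
  assumes "f differentiable (at x)"
  shows "(f has_derivative (\<lambda>v. gradient f x \<bullet> v)) (at x)"
proof -
  have D: "(f has_derivative frechet_derivative f (at x)) (at x)"
    using assms frechet_derivative_works by blast
  then have lin: "linear (frechet_derivative f (at x))"
    by (rule has_derivative_linear)
  have "frechet_derivative f (at x) = (\<lambda>v. gradient f x \<bullet> v)"
  proof (rule linear_eq_stdbasis[OF lin])
    show "linear (\<lambda>v. gradient f x \<bullet> v)" by (simp add: bounded_linear.linear bounded_linear_inner_right)
  qed (simp add: gradient_inner_Basis)
  with D show ?thesis by simp
qed

lemma gradient_eqI:
  assumes "(f has_derivative (\<lambda>v. g \<bullet> v)) (at x)"
  shows "gradient f x = g"
proof -
  have "frechet_derivative f (at x) = (\<lambda>v. g \<bullet> v)"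
    using assms frechet_derivative_at by metis
  then show ?thesis by (simp add: gradient_def euclidean_representation)
qed

lemma Ck_Suc_iff_gradient:
  "Ck (Suc k) f \<longleftrightarrow> (\<forall>x. f differentiable (at x)) \<and> (\<forall>b\<in>Basis. Ck k (\<lambda>x. gradient f x \<bullet> b))"
  by (simp add: gradient_inner_Basis cong: ball_cong)

lemma Ck_SucI:
  assumes "\<And>x. (f has_derivative (\<lambda>v. g x \<bullet> v)) (at x)" "\<And>b. b \<in> Basis \<Longrightarrow> Ck k (\<lambda>x. g x \<bullet> b)"
  shows "Ck (Suc k) f"
proof -
  have "gradient f = g" using gradient_eqI[OF assms(1)] by auto
  then show ?thesis unfolding Ck_Suc_iff_gradient using assms by (auto simp: differentiable_def)
qed

lemma Ck_Suc_imp: "Ck (Suc k) f \<Longrightarrow> Ck k f"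
proof (induction k arbitrary: f)
  case 0
  then show ?case
    by (auto intro!: continuous_at_imp_continuous_on differentiable_imp_continuous_within)
next
  case (Suc k)
  from Suc.prems have "\<forall>x. f differentiable (at x)"
      and "\<forall>b\<in>Basis. Ck (Suc k) (\<lambda>x. frechet_derivative f (at x) b)"
    unfolding Ck.simps(2)[of "Suc k"] by auto
  then show ?case using Suc.IH by (simp only: Ck.simps(2) simp_thms) blast
qed

lemma Ck_const: "Ck k (\<lambda>x. c)"
proof (induction k arbitrary: c)
  case (Suc k)
  show ?case by (rule Ck_SucI[where g = "\<lambda>x. 0"]) (auto simp: Suc)
qed simp

lemma Ck_affine: "Ck k (\<lambda>x. a + l \<bullet> x)"
proof (cases k)
  case (Suc m)
  show ?thesis unfolding Suc
    by (rule Ck_SucI[where g = "\<lambda>x. l"]) (auto simp: Ck_const intro!: derivative_eq_intros)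
qed (auto intro!: continuous_intros)

lemma Ck_add: "Ck k f \<Longrightarrow> Ck k g \<Longrightarrow> Ck k (\<lambda>x. f x + g x)"
proof (induction k arbitrary: f g)
  case 0 then show ?case by (auto intro: continuous_on_add)
next
  case (Suc k)
  show ?case
  proof (rule Ck_SucI)
    show "((\<lambda>x. f x + g x) has_derivative (\<lambda>v. (gradient f x + gradient g x) \<bullet> v)) (at x)" for x
      unfolding inner_add_left using Suc(2,3) by (intro has_derivative_add has_derivative_gradient) auto
    show "b \<in> Basis \<Longrightarrow> Ck k (\<lambda>x. (gradient f x + gradient g x) \<bullet> b)" for b
      unfolding inner_add_left using Suc(2,3) by (intro Suc.IH) (auto simp only: Ck_Suc_iff_gradient)
  qed
qed

lemma Ck_mult: "Ck k f \<Longrightarrow> Ck k g \<Longrightarrow> Ck k (\<lambda>x. f x * g x)"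
proof (induction k arbitrary: f g)
  case 0 then show ?case by (auto intro: continuous_on_mult)
next
  case (Suc k)
  show ?case
  proof (rule Ck_SucI)
    fix x
    have "((\<lambda>x. f x * g x) has_derivative (\<lambda>v. f x * (gradient g x \<bullet> v) + (gradient f x \<bullet> v) * g x)) (at x)"
      using Suc(2,3) by (intro has_derivative_mult has_derivative_gradient) auto
    then show "((\<lambda>x. f x * g x) has_derivative (\<lambda>v. (f x *\<^sub>R gradient g x + g x *\<^sub>R gradient f x) \<bullet> v)) (at x)"
      by (simp add: inner_add_left mult.commute)
  next
    fix b :: 'a assume b: "b \<in> Basis"
    show "Ck k (\<lambda>x. (f x *\<^sub>R gradient g x + g x *\<^sub>R gradient f x) \<bullet> b)"
      unfolding inner_add_left inner_scaleR_left
      using Suc(2,3)[unfolded Ck_Suc_iff_gradient] b Ck_Suc_imp[OF Suc(2)] Ck_Suc_imp[OF Suc(3)]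
      by (intro Ck_add Suc.IH) auto
  qed
qed

lemma Ck_prod: "(\<And>i. i \<in> I \<Longrightarrow> Ck k (f i)) \<Longrightarrow> Ck k (\<lambda>x. \<Prod>i\<in>I. f i x)"
  by (induction I rule: infinite_finite_induct) (auto intro: Ck_const Ck_mult)

lemma smooth_continuous: "smooth f \<Longrightarrow> continuous_on UNIV f"
  by (drule spec[of _ 0]) simp

lemma smooth_differentiable: "smooth f \<Longrightarrow> f differentiable (at x)"
  by (drule spec[of _ "Suc 0"]) simp

lemma smooth_has_derivative: "smooth f \<Longrightarrow> (f has_derivative (\<lambda>v. gradient f x \<bullet> v)) (at x)"
  by (rule has_derivative_gradient[OF smooth_differentiable])

lemma smooth_continuous_gradient: 
  assumes "smooth f" shows "continuous_on UNIV (gradient f)"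
proof (subst continuous_on_componentwise, rule ballI)
  fix b :: 'a assume "b \<in> Basis"
  then show "continuous_on UNIV (\<lambda>x. gradient f x \<bullet> b)"
    using assms Ck_Suc_iff_gradient[of 0 f] by simp
qed

lemma gradient_mult:
  assumes "f differentiable (at x)" "g differentiable (at x)"
  shows "gradient (\<lambda>x. f x * g x) x = f x *\<^sub>R gradient g x + g x *\<^sub>R gradient f x"
proof (rule gradient_eqI)
  have "((\<lambda>x. f x * g x) has_derivative (\<lambda>v. f x * (gradient g x \<bullet> v) + (gradient f x \<bullet> v) * g x)) (at x)"
    using assms by (intro has_derivative_mult has_derivative_gradient) auto
  then show "((\<lambda>x. f x * g x) has_derivative (\<lambda>v. (f x *\<^sub>R gradient g x + g x *\<^sub>R gradient f x) \<bullet> v)) (at x)"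
    by (simp add: inner_add_left mult.commute)
qed

lemma gradient_affine: "gradient (\<lambda>x. a + l \<bullet> x) x = l"
  by (rule gradient_eqI) (auto intro!: derivative_eq_intros)

text \<open>The factor \<open>t\<^sup>-\<^sup>n\<close> makes the family closed under differentiation: \<open>f\<^sub>n' = f\<^sub>n\<^sub>+\<^sub>2 - n f\<^sub>n\<^sub>+\<^sub>1\<close>.\<close>

definition flat_exp :: "nat \<Rightarrow> real \<Rightarrow> real" where
  "flat_exp n t = (if t > 0 then exp (- 1 / t) / t ^ n else 0)"

lemma flat_exp_nonneg: "0 \<le> flat_exp n t"
  by (simp add: flat_exp_def)

lemma flat_exp_le_1: "flat_exp 0 t \<le> 1"
  by (simp add: flat_exp_def)

lemma flat_exp_0_iff: "flat_exp n t = 0 \<longleftrightarrow> t \<le> 0"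
  by (simp add: flat_exp_def)

text \<open>From the right the substitution \<open>y = 1 / t\<close> leads to
  \<open>y ^ n / exp y\<close>, which tends to 0 at infinity; from the left the function
  vanishes.\<close>

lemma flat_exp_tendsto_0: "((\<lambda>t. flat_exp n t) \<longlongrightarrow> 0) (at 0)"
proof -
  have "((\<lambda>y::real. y ^ n / exp y) \<longlongrightarrow> 0) at_top"
    by (rule tendsto_power_div_exp_0)
  then have "((\<lambda>t::real. (inverse t) ^ n / exp (inverse t)) \<longlongrightarrow> 0) (at_right 0)"
    by (rule filterlim_compose) (rule filterlim_inverse_at_top_right)
  then have R: "((\<lambda>t. flat_exp n t) \<longlongrightarrow> 0) (at_right 0)"
    by (rule Lim_transform_eventually)
       (rule eventually_mono[OF eventually_at_right_less[of "0::real"]],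
        simp add: flat_exp_def exp_minus field_simps)
  have L: "((\<lambda>t. flat_exp n t) \<longlongrightarrow> 0) (at_left 0)"
    by (rule Lim_transform_eventually[OF tendsto_const])
       (rule eventually_mono[OF eventually_at_left_real[of "-1::real" 0]], auto simp: flat_exp_def)
  show ?thesis using L R by (simp add: filterlim_split_at)
qed

lemma flat_exp_DERIV:
  "(flat_exp n has_real_derivative (flat_exp (n + 2) t - of_nat n * flat_exp (n + 1) t)) (at t)"
proof (cases t "0::real" rule: linorder_cases)
  case less
  have "((\<lambda>t. 0::real) has_real_derivative 0) (at t)" by simp
  then have "(flat_exp n has_real_derivative 0) (at t)"
    by (rule has_field_derivative_transform_within_open[where S = "{..<0}"]) (use less in \<open>auto simp: flat_exp_def\<close>)
  then show ?thesis using less by (simp add: flat_exp_def)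
next
  case equal
  \<comment> \<open>At 0 the difference quotient is again a member of the family,
    \<open>flat_exp (n + 1)\<close>, and hence tends to 0.\<close>
  have "((\<lambda>h. (flat_exp n (0 + h) - flat_exp n 0) / h) \<longlongrightarrow> 0) (at 0)"
  proof (rule Lim_transform_eventually[OF flat_exp_tendsto_0[of "n + 1"]])
    show "\<forall>\<^sub>F x in at 0. flat_exp (n + 1) x = (flat_exp n (0 + x) - flat_exp n 0) / x"
      by (rule eventually_at_filter[THEN iffD2]) (auto simp: flat_exp_def field_simps)
  qed
  then have "(flat_exp n has_real_derivative 0) (at 0)"
    unfolding DERIV_def by simp
  then show ?thesis using equal by (simp add: flat_exp_def)
next
  case greater
  have "((\<lambda>t. exp (- 1 / t) / t ^ n) has_real_derivative
     (flat_exp (n + 2) t - of_nat n * flat_exp (n + 1) t)) (at t)"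
  proof (cases n)
    case 0
    then show ?thesis using greater
      by (auto intro!: derivative_eq_intros simp: flat_exp_def power2_eq_square divide_simps)
  next
    case (Suc m)
    show ?thesis using greater unfolding Suc
      by (auto intro!: derivative_eq_intros simp: flat_exp_def power2_eq_square divide_simps)
         (cases m; simp add: algebra_simps power_add)
  qed
  then show ?thesis
    by (rule has_field_derivative_transform_within_open[where S = "{0<..}"]) (use greater in \<open>auto simp: flat_exp_def\<close>)
qed

lemma flat_exp_has_derivative_affine:
  "((\<lambda>x. flat_exp n (a + l \<bullet> x)) has_derivative
     (\<lambda>v. ((flat_exp (n + 2) (a + l \<bullet> x) - of_nat n * flat_exp (n + 1) (a + l \<bullet> x)) *\<^sub>R l) \<bullet> v)) (at x)"
proof -
  have "((\<lambda>x. a + l \<bullet> x) has_derivative (\<lambda>v. l \<bullet> v)) (at x)"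
    by (auto intro!: derivative_eq_intros)
  from has_derivative_compose[OF this flat_exp_DERIV[unfolded has_field_derivative_def]]
  show ?thesis by (simp add: mult.commute)
qed

text \<open>The induction runs over all \<open>n\<close> at once, because differentiation raises the
  index by one and by two.\<close>

lemma Ck_flat_exp: "Ck k (\<lambda>x. flat_exp n (a + l \<bullet> x))"
proof (induction k arbitrary: n)
  case 0
  then show ?case unfolding Ck.simps
    by (intro continuous_at_imp_continuous_on ballI has_derivative_continuous[OF flat_exp_has_derivative_affine])
next
  case (Suc k)
  show ?case
  proof (rule Ck_SucI[OF flat_exp_has_derivative_affine])
    fix b :: 'a
    have "Ck k (\<lambda>x. (flat_exp (n + 2) (a + l \<bullet> x) + (- of_nat n) * flat_exp (n + 1) (a + l \<bullet> x)) * (l \<bullet> b))"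
      by (intro Ck_mult Ck_add Suc Ck_const)
    then show "Ck k (\<lambda>x. ((flat_exp (n + 2) (a + l \<bullet> x) - real n * flat_exp (n + 1) (a + l \<bullet> x)) *\<^sub>R l) \<bullet> b)"
      by simp
  qed
qed

lemma gradient_flat_exp: "gradient (\<lambda>x. flat_exp 0 (a + l \<bullet> x)) x = flat_exp 2 (a + l \<bullet> x) *\<^sub>R l"
  using gradient_eqI[OF flat_exp_has_derivative_affine[of 0 a l x]] by (simp add: numeral_2_eq_2)

section \<open>Smooth approximation of boxes and the fundamental lemma of the calculus of
  variations\<close>

lemma flat_exp_tendsto_1:
  assumes "0 < t" shows "(\<lambda>k. flat_exp 0 (real k * t - c)) \<longlonglongrightarrow> 1"
proof -
  have lim: "filterlim (\<lambda>k. real k * t - c) at_top sequentially"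
    using assms by real_asymp
  have "((\<lambda>s::real. exp (- 1 / s)) \<longlongrightarrow> 1) at_top" by real_asymp
  from filterlim_compose[OF this lim]
  have lim1: "(\<lambda>k. exp (- 1 / (real k * t - c))) \<longlonglongrightarrow> 1" .
  have "\<forall>\<^sub>F k in sequentially. 0 < real k * t - c"
    using lim unfolding filterlim_at_top_dense by blast
  then have "\<forall>\<^sub>F k in sequentially. exp (- 1 / (real k * t - c)) = flat_exp 0 (real k * t - c)"
    by (rule eventually_mono) (simp add: flat_exp_def)
  then show ?thesis by (rule Lim_transform_eventually[OF lim1])
qed

text \<open>The positive and the negative part of a Borel representative of \<open>f\<close> are
  densities of two measures that agree and are finite on open boxes. Boxes are stable under
  intersection and generate the Borel sets, so the measures coincide, and densities with respect to
  \<open>lborel\<close> are unique almost everywhere.\<close>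

lemma AE_zero_if_box_integrals_zero:
  fixes f :: "'a::euclidean_space \<Rightarrow> real"
  assumes int: "integrable lebesgue f"
    and box: "\<And>a b. (LINT x|lebesgue. indicator (box a b) x * f x) = 0"
  shows "AE x in lebesgue. f x = 0"
proof -
  obtain g where g[measurable]: "g \<in> borel_measurable lborel" and fg: "AE x in lborel. f x = g x"
    using completion_ex_borel_measurable_real[of f lborel] int by auto
  have fg': "AE x in lebesgue. f x = g x" using fg by (rule AE_completion)
  have "integrable lebesgue g"
    using int fg' measurable_completion[OF g]
    by (subst integrable_cong_AE[of g _ f]) (auto intro: borel_measurable_integrable)
  then have gint: "integrable lborel g" using g by (simp add: integrable_completion)
  have gbox: "(LINT x|lborel. indicator (box a b) x * g x) = 0" for a b
  proof -
    have "(LINT x|lborel. indicator (box a b) x * g x) = (LINT x|lebesgue. indicator (box a b) x * g x)"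
      by (rule integral_completion[symmetric]) measurable
    also have "\<dots> = (LINT x|lebesgue. indicator (box a b) x * f x)"
      using fg' borel_measurable_integrable[OF int] borel_measurable_integrable[OF \<open>integrable lebesgue g\<close>]
      by (intro integral_cong_AE borel_measurable_times borel_measurable_indicator) auto
    finally show ?thesis using box by simp
  qed
  define P where "P = density lborel (\<lambda>x. ennreal (g x))"
  define N where "N = density lborel (\<lambda>x. ennreal (- g x))"
  have em: "emeasure P (box a b) = emeasure N (box a b)" "emeasure P (box a b) \<noteq> \<infinity>" for a b
  proof -
    have i1: "integrable lborel (\<lambda>x. indicator (box a b) x * max 0 (g x))"
      by (rule Bochner_Integration.integrable_bound[OF gint]) (auto simp: indicator_def)
    have i2: "integrable lborel (\<lambda>x. indicator (box a b) x * max 0 (- g x))"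
      by (rule Bochner_Integration.integrable_bound[OF gint]) (auto simp: indicator_def)
    have "emeasure P (box a b) = (\<integral>\<^sup>+x. ennreal (indicator (box a b) x * max 0 (g x)) \<partial>lborel)"
      unfolding P_def by (subst emeasure_density)
        (auto intro!: nn_integral_cong simp: indicator_def max_def ennreal_neg)
    also have "\<dots> = ennreal (LINT x|lborel. indicator (box a b) x * max 0 (g x))"
      by (rule nn_integral_eq_integral[OF i1]) auto
    finally have P: "emeasure P (box a b) = ennreal (LINT x|lborel. indicator (box a b) x * max 0 (g x))" .
    have "emeasure N (box a b) = (\<integral>\<^sup>+x. ennreal (indicator (box a b) x * max 0 (- g x)) \<partial>lborel)"
      unfolding N_def by (subst emeasure_density)
        (auto intro!: nn_integral_cong simp: indicator_def max_def ennreal_neg)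
    also have "\<dots> = ennreal (LINT x|lborel. indicator (box a b) x * max 0 (- g x))"
      by (rule nn_integral_eq_integral[OF i2]) auto
    finally have N: "emeasure N (box a b) = ennreal (LINT x|lborel. indicator (box a b) x * max 0 (- g x))" .
    have "(LINT x|lborel. indicator (box a b) x * max 0 (g x)) - (LINT x|lborel. indicator (box a b) x * max 0 (- g x))
        = (LINT x|lborel. indicator (box a b) x * g x)"
      by (subst Bochner_Integration.integral_diff[OF i1 i2, symmetric])
         (auto intro!: Bochner_Integration.integral_cong simp: max_def)
    then have "(LINT x|lborel. indicator (box a b) x * max 0 (g x)) = (LINT x|lborel. indicator (box a b) x * max 0 (- g x))"
      using gbox by simp
    then show "emeasure P (box a b) = emeasure N (box a b)" "emeasure P (box a b) \<noteq> \<infinity>" using P N by auto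
  qed
  have "P = N"
  proof (rule measure_eqI_generator_eq)
    let ?E = "range (\<lambda>(a, b). box a b::'a set)"
    show "Int_stable ?E" by (auto simp: Int_stable_def box_Int_box)
    show "?E \<subseteq> Pow UNIV" "sets P = sigma_sets UNIV ?E" "sets N = sigma_sets UNIV ?E"
      by (simp_all add: P_def N_def borel_eq_box)
    let ?A = "\<lambda>n::nat. box (- (real n *\<^sub>R One)) (real n *\<^sub>R One) :: 'a set"
    show "range ?A \<subseteq> ?E" "(\<Union>i. ?A i) = UNIV" unfolding UN_box_eq_UNIV by auto
    show "emeasure P (?A i) \<noteq> \<infinity>" for i by (rule em)
    show "emeasure P X = emeasure N X" if "X \<in> ?E" for X using that em by auto
  qed
  then have "AE x in lborel. ennreal (g x) = ennreal (- g x)"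
    unfolding P_def N_def by (intro sigma_finite_measure.density_unique[OF sigma_finite_lborel]) auto
  then have "AE x in lborel. f x = 0"
    using fg
  proof eventually_elim
    case (elim x)
    \<comment> \<open>\<open>ennreal\<close> truncates negative numbers to 0, and one of
      \<open>g x\<close> and \<open>- g x\<close> is nonpositive. Equality of the truncated values
      therefore leaves no positive one.\<close>
    have "g x \<le> 0 \<and> - g x \<le> 0"
      using elim(1) ennreal_neg[of "g x"] ennreal_neg[of "- g x"] ennreal_eq_0_iff[of "g x"] ennreal_eq_0_iff[of "- g x"]
      by (cases "0 \<le> g x") auto
    then show ?case using elim(2) by simp
  qed
  then show ?thesis by (rule AE_completion)
qed

text \<open>A smooth stand-in for the indicator of \<open>box a b\<close>: each coordinate has one
  factor that switches on above \<open>a \<bullet> i\<close> and one that switches off at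
  \<open>b \<bullet> i\<close>. The arguments are \<open>k\<close> times the signed distances to the
  two faces, expanded into the affine form for which smoothness of \<open>flat_exp\<close> is
  known.\<close>

definition box_bump :: "'a::euclidean_space \<Rightarrow> 'a \<Rightarrow> nat \<Rightarrow> 'a \<Rightarrow> real" where
  "box_bump a b k x = (\<Prod>i\<in>Basis. flat_exp 0 (- (real k * (a \<bullet> i)) + (real k *\<^sub>R i) \<bullet> x) *
                                    flat_exp 0 (real k * (b \<bullet> i) + (- real k *\<^sub>R i) \<bullet> x))"

lemma smooth_box_bump: "smooth (box_bump a b k)"
  unfolding box_bump_def by (intro allI Ck_prod Ck_mult Ck_flat_exp)

lemma box_bump_bounds: "0 \<le> box_bump a b k x" "box_bump a b k x \<le> 1"
  unfolding box_bump_def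
  by (auto intro!: prod_nonneg prod_le_1 mult_nonneg_nonneg mult_le_one flat_exp_nonneg flat_exp_le_1)

lemma box_bump_eq_0:
  assumes "x \<notin> box a b" shows "box_bump a b k x = 0"
proof -
  obtain i where i: "i \<in> Basis" "\<not> (a \<bullet> i < x \<bullet> i \<and> x \<bullet> i < b \<bullet> i)"
    using assms by (auto simp: mem_box)
  have "real k * (x \<bullet> i) \<le> real k * (a \<bullet> i) \<or> real k * (b \<bullet> i) \<le> real k * (x \<bullet> i)"
    using i by (auto intro!: mult_left_mono simp: not_less)
  then show ?thesis unfolding box_bump_def
    using i by (intro prod_zero) (auto intro!: bexI[of _ i] simp: flat_exp_0_iff inner_commute[of x])
qed

lemma box_bump_tendsto: "(\<lambda>k. box_bump a b k x) \<longlonglongrightarrow> indicator (box a b) x"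
proof (cases "x \<in> box a b")
  case True
  have "(\<lambda>k. box_bump a b k x) \<longlonglongrightarrow> (\<Prod>i\<in>(Basis::'a set). 1 * 1)"
    unfolding box_bump_def
  proof (intro tendsto_prod tendsto_mult)
    fix i :: 'a assume i: "i \<in> Basis"
    have "(\<lambda>k. flat_exp 0 (real k * (x \<bullet> i - a \<bullet> i) - 0)) \<longlonglongrightarrow> 1"
      by (rule flat_exp_tendsto_1) (use True i in \<open>auto simp: mem_box\<close>)
    then show "(\<lambda>k. flat_exp 0 (- (real k * (a \<bullet> i)) + (real k *\<^sub>R i) \<bullet> x)) \<longlonglongrightarrow> 1"
      by (simp add: algebra_simps inner_commute)
    have "(\<lambda>k. flat_exp 0 (real k * (b \<bullet> i - x \<bullet> i) - 0)) \<longlonglongrightarrow> 1"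
      by (rule flat_exp_tendsto_1) (use True i in \<open>auto simp: mem_box\<close>)
    then show "(\<lambda>k. flat_exp 0 (real k * (b \<bullet> i) + (- real k *\<^sub>R i) \<bullet> x)) \<longlonglongrightarrow> 1"
      by (simp add: algebra_simps inner_commute)
  qed
  then show ?thesis using True by simp
qed (simp add: box_bump_eq_0)

lemma closure_nonzero_subset:
  fixes f :: "'a::topological_space \<Rightarrow> real"
  assumes "closed K" "\<And>x. x \<notin> K \<Longrightarrow> f x = 0"
  shows "closure {x. f x \<noteq> 0} \<subseteq> K"
  using assms by (intro closure_minimal) auto

lemma test_functionI:
  fixes \<eta> :: "'a::euclidean_space \<Rightarrow> real"
  assumes "smooth \<eta>" "compact K" "K \<subseteq> \<Omega>" "\<And>x. x \<notin> K \<Longrightarrow> \<eta> x = 0"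
  shows "test_function \<Omega> \<eta>"
proof -
  have "closure {x. \<eta> x \<noteq> 0} \<subseteq> K"
    using assms by (intro closure_nonzero_subset compact_imp_closed) auto
  then show ?thesis using assms unfolding test_function_def
    by (meson closed_closure compact_Int_closed compact_eq_bounded_closed bounded_subset order_trans)
qed

lemma gradient_outside_support:
  fixes \<eta> :: "'a::euclidean_space \<Rightarrow> real"
  assumes "closed K" "\<And>x. x \<notin> K \<Longrightarrow> \<eta> x = 0" "x \<notin> K"
  shows "gradient \<eta> x = 0"
proof (rule gradient_eqI)
  have "((\<lambda>x. 0) has_derivative (\<lambda>v. 0 \<bullet> v)) (at x)" by simp
  then show "(\<eta> has_derivative (\<lambda>v. 0 \<bullet> v)) (at x)"
    by (rule has_derivative_transform_within_open[where s = "- K"]) (use assms in auto)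
qed

lemma integrable_continuous_scaleR:
  fixes f :: "'a::euclidean_space \<Rightarrow> 'b::euclidean_space" and g :: "'a \<Rightarrow> real"
  assumes f: "integrable (lebesgue_on K) f" and K: "compact K" "K \<subseteq> \<Omega>" and Om: "\<Omega> \<in> sets lebesgue"
    and g: "continuous_on UNIV g" "\<And>x. x \<notin> K \<Longrightarrow> g x = 0"
  shows "integrable (lebesgue_on \<Omega>) (\<lambda>x. g x *\<^sub>R f x)"
proof -
  have Kl: "K \<in> sets lebesgue" using K by (auto intro: lmeasurable_compact fmeasurableD)
  have fK: "integrable lebesgue (\<lambda>x. indicator K x *\<^sub>R f x)"
    using f Kl by (simp add: integrable_restrict_space)
  obtain M where M: "\<And>x. x \<in> K \<Longrightarrow> \<bar>g x\<bar> \<le> M"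
    using compact_imp_bounded[OF compact_continuous_image[OF continuous_on_subset[OF g(1)] K(1)]]
    by (auto simp: bounded_iff)
  have gm: "g \<in> borel_measurable lebesgue"
    using borel_measurable_continuous_onI[OF g(1)] by (simp add: measurable_completion)
  have "integrable lebesgue (\<lambda>x. g x *\<^sub>R (indicator K x *\<^sub>R f x))"
  proof (rule Bochner_Integration.integrable_bound)
    show "integrable lebesgue (\<lambda>x. M *\<^sub>R norm (indicator K x *\<^sub>R f x))"
      by (intro integrable_scaleR_right integrable_norm fK)
    show "(\<lambda>x. g x *\<^sub>R indicat_real K x *\<^sub>R f x) \<in> borel_measurable lebesgue"
      using gm borel_measurable_integrable[OF fK] by (rule borel_measurable_scaleR)
    show "AE x in lebesgue. norm (g x *\<^sub>R indicat_real K x *\<^sub>R f x) \<le> norm (M *\<^sub>R norm (indicat_real K x *\<^sub>R f x))"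
      using order_trans[OF M abs_ge_self]
      by (intro AE_I2) (auto simp: indicator_def abs_mult intro!: mult_right_mono)
  qed
  also have "(\<lambda>x. g x *\<^sub>R (indicator K x *\<^sub>R f x)) = (\<lambda>x. indicator \<Omega> x *\<^sub>R (g x *\<^sub>R f x))"
    using K(2) g(2) by (auto simp: indicator_def fun_eq_iff)
  finally show ?thesis using Om by (simp add: integrable_restrict_space)
qed

lemma test_function_support:
  assumes "test_function \<Omega> \<eta>"
  obtains K where "compact K" "K \<subseteq> \<Omega>" "\<And>x. x \<notin> K \<Longrightarrow> \<eta> x = 0" "\<And>x. x \<notin> K \<Longrightarrow> gradient \<eta> x = 0"
proof
  let ?K = "closure {x. \<eta> x \<noteq> 0}"
  show "compact ?K" "?K \<subseteq> \<Omega>" using assms by (auto simp: test_function_def)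
  show 0: "\<eta> x = 0" if "x \<notin> ?K" for x using that closure_subset[of "{x. \<eta> x \<noteq> 0}"] by auto
  show "gradient \<eta> x = 0" if "x \<notin> ?K" for x by (rule gradient_outside_support[OF _ 0 that]) auto
qed

lemma integrable_test_function_scaleR:
  fixes f :: "'a::euclidean_space \<Rightarrow> 'b::euclidean_space"
  assumes "loc_integrable \<Omega> f" "\<Omega> \<in> sets lebesgue" "test_function \<Omega> \<eta>"
  shows "integrable (lebesgue_on \<Omega>) (\<lambda>x. \<eta> x *\<^sub>R f x)"
    and "integrable (lebesgue_on \<Omega>) (\<lambda>x. (gradient \<eta> x \<bullet> c) *\<^sub>R f x)"
proof -
  from assms(3) have sm: "smooth \<eta>" by (auto simp: test_function_def)
  obtain K where K: "compact K" "K \<subseteq> \<Omega>" "\<And>x. x \<notin> K \<Longrightarrow> \<eta> x = 0" "\<And>x. x \<notin> K \<Longrightarrow> gradient \<eta> x = 0"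
    using test_function_support[OF assms(3)] by blast
  have f: "integrable (lebesgue_on K) f" using assms(1) K by (auto simp: loc_integrable_def)
  show "integrable (lebesgue_on \<Omega>) (\<lambda>x. \<eta> x *\<^sub>R f x)"
    by (rule integrable_continuous_scaleR[OF f K(1,2) assms(2) smooth_continuous[OF sm] K(3)])
  show "integrable (lebesgue_on \<Omega>) (\<lambda>x. (gradient \<eta> x \<bullet> c) *\<^sub>R f x)"
    using K(4) by (intro integrable_continuous_scaleR[OF f K(1,2) assms(2)] continuous_intros smooth_continuous_gradient sm) auto
qed

text \<open>The functions \<open>box_bump\<close> over closed boxes inside \<Omega> suffice as test
  functions. By dominated convergence the integral of \<open>w\<close> over each such box vanishes,
  so \<open>w\<close> is zero almost everywhere on the box, and countably many boxes exhaust
  \<Omega>.\<close>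

lemma fundamental_lemma:
  fixes w :: "'a::euclidean_space \<Rightarrow> real"
  assumes "open \<Omega>" and w: "loc_integrable \<Omega> w"
    and test: "\<And>\<eta>. test_function \<Omega> \<eta> \<Longrightarrow> (LINT x|lebesgue_on \<Omega>. \<eta> x * w x) = 0"
  shows "AE x in lebesgue_on \<Omega>. w x = 0"
proof -
  have Om: "\<Omega> \<in> sets lebesgue" using \<open>open \<Omega>\<close> by simp
  have box0: "(LINT x|lebesgue. indicator (box a b) x * w x) = 0"
      and boxi: "integrable lebesgue (\<lambda>x. indicator (box a b) x * w x)" if sub: "cbox a b \<subseteq> \<Omega>" for a b
  proof -
    have wi: "integrable lebesgue (\<lambda>x. indicator (cbox a b) x *\<^sub>R w x)"
    proof -
      have "integrable (lebesgue_on (cbox a b)) w"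
        using w sub compact_cbox unfolding loc_integrable_def by blast
      then show ?thesis by (simp add: integrable_restrict_space)
    qed
    have "integrable lebesgue (\<lambda>x. indicator (box a b) x *\<^sub>R (indicator (cbox a b) x *\<^sub>R w x))"
      by (intro integrable_mult_indicator wi) auto
    moreover have "(\<lambda>x. indicator (box a b) x *\<^sub>R (indicator (cbox a b) x *\<^sub>R w x)) = (\<lambda>x. indicator (box a b) x * w x)"
      using box_subset_cbox[of a b] by (intro ext) (auto simp: indicator_def subset_iff)
    ultimately show boxi: "integrable lebesgue (\<lambda>x. indicator (box a b) x * w x)" by simp
    have z: "(LINT x|lebesgue. box_bump a b k x * w x) = 0" for k
    proof -
      have t: "test_function \<Omega> (box_bump a b k)"
        by (rule test_functionI[OF smooth_box_bump compact_cbox sub]) (use box_subset_cbox box_bump_eq_0 in blast)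
      have "(LINT x|lebesgue_on \<Omega>. box_bump a b k x * w x) = (LINT x|lebesgue. indicator \<Omega> x *\<^sub>R (box_bump a b k x * w x))"
        using Om by (intro integral_restrict_space) auto
      also have "\<dots> = (LINT x|lebesgue. box_bump a b k x * w x)"
        using sub box_subset_cbox[of a b] box_bump_eq_0[of _ a b k]
        by (intro Bochner_Integration.integral_cong) (auto simp: indicator_def)
      finally show ?thesis using test[OF t] by simp
    qed
    have "(\<lambda>k. LINT x|lebesgue. box_bump a b k x * w x) \<longlonglongrightarrow> (LINT x|lebesgue. indicator (box a b) x * w x)"
    proof (rule integral_dominated_convergence[where w = "\<lambda>x. norm (indicator (cbox a b) x *\<^sub>R w x)"])
      show "(\<lambda>x. indicator (box a b) x * w x) \<in> borel_measurable lebesgue"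
        using boxi by auto
      have m: "(\<lambda>x. box_bump a b k x) \<in> borel_measurable lebesgue" for k
        using borel_measurable_continuous_onI[OF smooth_continuous[OF smooth_box_bump[of a b k]]] by (simp add: measurable_completion)
      have eq: "(\<lambda>x. box_bump a b k x * w x) = (\<lambda>x. box_bump a b k x * (indicator (cbox a b) x *\<^sub>R w x))" for k
        using box_bump_eq_0[of _ a b k] box_subset_cbox[of a b] by (auto simp: indicator_def fun_eq_iff)
      show "(\<lambda>x. box_bump a b k x * w x) \<in> borel_measurable lebesgue" for k
        unfolding eq using m wi by (intro borel_measurable_times) auto
      show "integrable lebesgue (\<lambda>x. norm (indicator (cbox a b) x *\<^sub>R w x))" using wi by (rule integrable_norm)
      show "AE x in lebesgue. (\<lambda>k. box_bump a b k x * w x) \<longlonglongrightarrow> indicator (box a b) x * w x"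
        by (intro AE_I2 tendsto_mult box_bump_tendsto tendsto_const)
      show "AE x in lebesgue. norm (box_bump a b k x * w x) \<le> norm (indicator (cbox a b) x *\<^sub>R w x)" for k
      proof (rule AE_I2)
        fix x
        show "norm (box_bump a b k x * w x) \<le> norm (indicator (cbox a b) x *\<^sub>R w x)"
          using box_bump_eq_0[of x a b k] subsetD[OF box_subset_cbox, of x a b] box_bump_bounds[of a b k x]
          by (cases "x \<in> box a b") (auto simp: indicator_def abs_mult intro!: mult_left_le_one_le)
      qed
    qed
    then show "(LINT x|lebesgue. indicator (box a b) x * w x) = 0" by (simp add: z LIMSEQ_const_iff)
  qed
  have AEbox: "AE x in lebesgue. x \<in> cbox a b \<longrightarrow> w x = 0" if sub: "cbox a b \<subseteq> \<Omega>" for a b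
  proof -
    have "AE x in lebesgue. indicator (box a b) x * w x = 0"
    proof (rule AE_zero_if_box_integrals_zero[OF boxi[OF sub]])
      fix c d
      obtain a' b' where ab: "box c d \<inter> box a b = box a' b'" unfolding box_Int_box by blast
      have "(\<lambda>x. indicator (box c d) x * (indicator (box a b) x * w x)) = (\<lambda>x. indicator (box a' b') x * w x)"
        using ab by (intro ext) (auto simp: indicator_def)
      moreover have "(LINT x|lebesgue. indicator (box a' b') x * w x) = 0"
      proof (cases "box a' b' = {}")
        \<comment> \<open>A nonempty open box has the closed box as its closure, so the inclusion
          passes to \<open>cbox a' b'\<close>. An empty one would give no control of
          \<open>cbox a' b'\<close>.\<close>
        case False
        then have "cbox a' b' \<subseteq> cbox a b"
          using ab by (metis closure_box closure_minimal closed_cbox box_subset_cbox inf_le2 order_trans)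
        then show ?thesis using sub by (intro box0) auto
      qed simp
      ultimately show "(LINT x|lebesgue. indicator (box c d) x * (indicator (box a b) x * w x)) = 0" by (simp only:)
    qed
    moreover have "AE x in lebesgue. x \<notin> cbox a b - box a b"
      by (rule AE_not_in) (use negligible_frontier_interval[of a b] in \<open>simp only: negligible_iff_null_sets\<close>)
    ultimately show ?thesis
    proof eventually_elim
      case (elim x)
      then show ?case by (cases "x \<in> box a b") simp_all
    qed
  qed
  obtain \<D> where D: "countable \<D>" "\<D> \<subseteq> Pow \<Omega>" "\<And>X. X \<in> \<D> \<Longrightarrow> \<exists>a b. X = cbox a b" "\<Union>\<D> = \<Omega>"
    by (rule open_countable_Union_open_cbox[OF \<open>open \<Omega>\<close>], rule that)
  have "AE x in lebesgue. x \<in> X \<longrightarrow> w x = 0" if "X \<in> \<D>" for X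
  proof -
    obtain a b where X: "X = cbox a b" using D(3)[OF \<open>X \<in> \<D>\<close>] by auto
    show ?thesis using AEbox[of a b] D(2) \<open>X \<in> \<D>\<close> unfolding X by blast
  qed
  then have "AE x in lebesgue. \<forall>X\<in>\<D>. x \<in> X \<longrightarrow> w x = 0"
    using D(1) by (subst AE_ball_countable) simp_all
  then have "AE x in lebesgue. x \<in> \<Omega> \<longrightarrow> w x = 0"
    by eventually_elim (use D(4) in auto)
  then show ?thesis using Om by (simp add: AE_restrict_space_iff)
qed

text \<open>The difference quotients of \<eta> in direction \<open>c\<close> integrate to zero by
  translation invariance, and they converge to the directional derivative under one integrable
  bound.\<close>

lemma integral_test_function_gradient_inner:
  fixes \<eta> :: "'a::euclidean_space \<Rightarrow> real"
  assumes test: "test_function \<Omega> \<eta>"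
  shows "(LINT x|lebesgue. gradient \<eta> x \<bullet> c) = 0"
proof -
  from test have sm: "smooth \<eta>" by (auto simp: test_function_def)
  obtain K where K: "compact K" "\<And>x. x \<notin> K \<Longrightarrow> \<eta> x = 0" "\<And>x. x \<notin> K \<Longrightarrow> gradient \<eta> x = 0"
    using test_function_support[OF test] by metis
  obtain M where M0: "\<And>x. x \<in> K \<Longrightarrow> norm (gradient \<eta> x) \<le> M"
    using compact_imp_bounded[OF compact_continuous_image[OF continuous_on_subset[OF smooth_continuous_gradient[OF sm]] K(1)]]
    by (auto simp: bounded_iff)
  define M' where "M' = max 0 M"
  have M: "norm (gradient \<eta> x) \<le> M'" for x using M0[of x] K(3)[of x] unfolding M'_def by (cases "x \<in> K") auto
  obtain R where R: "\<And>x. x \<in> K \<Longrightarrow> norm x \<le> R"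
    using compact_imp_bounded[OF K(1)] by (auto simp: bounded_iff)
  \<comment> \<open>The increments \<open>c / (k + 1)\<close> have length at most
    \<open>norm c\<close>, so this ball contains the supports of all difference quotients.\<close>
  define B where "B = cball (0::'a) (R + norm c)"
  define q where "q k x = (\<eta> (x + (1 / real (Suc k)) *\<^sub>R c) - \<eta> x) * real (Suc k)" for k x
  have cont[measurable]: "\<eta> \<in> borel_measurable borel"
    using borel_measurable_continuous_onI[OF smooth_continuous[OF sm]] .
  have gm[measurable]: "(\<lambda>x. gradient \<eta> x) \<in> borel_measurable borel"
    using borel_measurable_continuous_onI[OF smooth_continuous_gradient[OF sm]] .
  have lip: "\<bar>\<eta> (x + v) - \<eta> x\<bar> \<le> M' * norm v" for x v
  proof -
    have "norm (\<eta> (x + v) - \<eta> x) \<le> M' * norm (x + v - x)"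
    proof (rule differentiable_bound[where S = UNIV and f' = "\<lambda>x v. gradient \<eta> x \<bullet> v"])
      show "(\<eta> has_derivative (\<bullet>) (gradient \<eta> x)) (at x within UNIV)" for x
        by (simp add: smooth_has_derivative[OF sm])
      show "onorm ((\<bullet>) (gradient \<eta> x)) \<le> M'" for x
      proof (rule onorm_bound)
        show "norm (gradient \<eta> x \<bullet> v) \<le> M' * norm v" for v
          unfolding real_norm_def
          by (rule order_trans[OF Cauchy_Schwarz_ineq2 mult_right_mono[OF M norm_ge_zero]])
      qed (simp add: M'_def)
    qed auto
    then show ?thesis by simp
  qed
  have qb: "\<bar>q k x\<bar> \<le> M' * norm c * indicator B x" for k x
  proof -
    have "\<bar>q k x\<bar> = \<bar>\<eta> (x + (1 / real (Suc k)) *\<^sub>R c) - \<eta> x\<bar> * real (Suc k)"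
      unfolding q_def by (simp add: abs_mult del: of_nat_Suc)
    also have "\<dots> \<le> (M' * norm ((1 / real (Suc k)) *\<^sub>R c)) * real (Suc k)"
      by (intro mult_right_mono lip) auto
    also have "\<dots> = M' * norm c" by simp
    finally have b: "\<bar>q k x\<bar> \<le> M' * norm c" .
    show ?thesis
    proof (cases "x \<in> B")
      case False
      have "x \<notin> K" using R[of x] False unfolding B_def by (auto, smt (verit) norm_ge_zero)
      moreover have "x + (1 / real (Suc k)) *\<^sub>R c \<notin> K"
      proof
        assume "x + (1 / real (Suc k)) *\<^sub>R c \<in> K"
        then have "norm (x + (1 / real (Suc k)) *\<^sub>R c) \<le> R" by (rule R)
        moreover have "norm x \<le> norm (x + (1 / real (Suc k)) *\<^sub>R c) + norm ((1 / real (Suc k)) *\<^sub>R c)"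
          using norm_triangle_ineq4[of "x + (1 / real (Suc k)) *\<^sub>R c" "(1 / real (Suc k)) *\<^sub>R c"] by simp
        moreover have "norm ((1 / real (Suc k)) *\<^sub>R c) \<le> norm c"
          by (simp add: divide_le_eq mult_le_cancel_left1)
        ultimately show False using False unfolding B_def by auto
      qed
      ultimately show ?thesis using False K(2) by (simp add: q_def)
    qed (use b in simp)
  qed
  have iB: "integrable lborel (\<lambda>x. M' * norm c * indicator B x)"
    unfolding B_def by (intro integrable_mult_right integrable_real_indicator) (auto intro!: emeasure_bounded_finite[unfolded infinity_ennreal_def])
  have "(\<lambda>k. LINT x|lborel. q k x) \<longlonglongrightarrow> (LINT x|lborel. gradient \<eta> x \<bullet> c)"
  proof (rule integral_dominated_convergence[OF _ _ iB])
    show "AE x in lborel. (\<lambda>k. q k x) \<longlonglongrightarrow> gradient \<eta> x \<bullet> c"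
    proof (rule AE_I2)
      fix x
      have "((\<lambda>t. \<eta> (x + t *\<^sub>R c)) has_derivative (\<lambda>t. gradient \<eta> x \<bullet> (t *\<^sub>R c))) (at 0)"
      proof -
        have "((\<lambda>t. x + t *\<^sub>R c) has_derivative (\<lambda>t. t *\<^sub>R c)) (at 0)"
          by (auto intro!: derivative_eq_intros)
        from has_derivative_compose[OF this, of \<eta> "(\<bullet>) (gradient \<eta> x)"] smooth_has_derivative[OF sm]
        show ?thesis by simp
      qed
      then have "((\<lambda>t. \<eta> (x + t *\<^sub>R c)) has_real_derivative (gradient \<eta> x \<bullet> c)) (at 0)"
        by (simp add: has_field_derivative_def mult_commute_abs)
      then have "((\<lambda>h. (\<eta> (x + h *\<^sub>R c) - \<eta> x) / h) \<longlongrightarrow> gradient \<eta> x \<bullet> c) (at 0)"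
        unfolding DERIV_def by simp
      moreover have "filterlim (\<lambda>k. 1 / real (Suc k)) (at 0) sequentially"
        unfolding filterlim_at using LIMSEQ_inverse_real_of_nat by (auto simp: inverse_eq_divide)
      ultimately have "(\<lambda>k. (\<eta> (x + (1 / real (Suc k)) *\<^sub>R c) - \<eta> x) / (1 / real (Suc k))) \<longlonglongrightarrow> gradient \<eta> x \<bullet> c"
        by (rule filterlim_compose)
      then show "(\<lambda>k. q k x) \<longlonglongrightarrow> gradient \<eta> x \<bullet> c" unfolding q_def by (simp add: field_simps)
    qed
    show "AE x in lborel. norm (q k x) \<le> M' * norm c * indicator B x" for k using qb by simp
  qed (unfold q_def, measurable)
  moreover have "(LINT x|lborel. q k x) = 0" for k
  proof -
    obtain M1 where M1: "\<And>x. x \<in> K \<Longrightarrow> norm (\<eta> x) \<le> M1"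
        using compact_imp_bounded[OF compact_continuous_image[OF continuous_on_subset[OF smooth_continuous[OF sm]] K(1)]]
        by (auto simp: bounded_iff)
    have i: "integrable lborel \<eta>"
    proof (rule Bochner_Integration.integrable_bound)
      from order_trans[OF M1 abs_ge_self]
      show "AE x in lborel. norm (\<eta> x) \<le> norm (M1 * indicator K x)"
        using K(2) by (intro AE_I2) (auto simp: indicator_def)
      show "integrable lborel (\<lambda>x. M1 * indicator K x)"
        using K(1) by (intro integrable_mult_right integrable_real_indicator) (auto intro!: emeasure_compact_finite[unfolded infinity_ennreal_def] borel_compact)
    qed measurable
    define t where "t = (1 / real (Suc k)) *\<^sub>R c"
    have "integrable (distr lborel borel ((+) t)) \<eta>" using i by (simp add: lborel_distr_plus)
    then have i': "integrable lborel (\<lambda>x. \<eta> (t + x))" by (subst (asm) integrable_distr_eq) auto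
    have "(LINT x|lborel. \<eta> x) = (LINT x|distr lborel borel ((+) t). \<eta> x)" by (simp add: lborel_distr_plus)
    also have "\<dots> = (LINT x|lborel. \<eta> (t + x))" by (subst integral_distr) auto
    finally have "(LINT x|lborel. \<eta> (t + x) - \<eta> x) = 0" using i i' by simp
    then show ?thesis unfolding q_def t_def[symmetric] by (simp add: add.commute)
  qed
  ultimately have "(LINT x|lborel. gradient \<eta> x \<bullet> c) = 0" by (simp add: LIMSEQ_const_iff)
  then show ?thesis by (subst integral_completion) auto
qed

section \<open>Calculus of weak gradients and weak divergences\<close>

lemma has_weak_grad_inner:
  assumes "has_weak_grad \<Omega> v G" "\<Omega> \<in> sets lebesgue" "test_function \<Omega> \<eta>"
  shows "(LINT x|lebesgue_on \<Omega>. v x * (gradient \<eta> x \<bullet> c)) = - (LINT x|lebesgue_on \<Omega>. \<eta> x * (G x \<bullet> c))"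
proof -
  have loc: "loc_integrable \<Omega> v" "loc_integrable \<Omega> G" using assms(1) by (auto simp: has_weak_grad_def)
  have i1: "integrable (lebesgue_on \<Omega>) (\<lambda>x. v x *\<^sub>R gradient \<eta> x)"
  proof -
    have "integrable (lebesgue_on \<Omega>) (\<lambda>x. \<Sum>b\<in>Basis. ((gradient \<eta> x \<bullet> b) *\<^sub>R v x) *\<^sub>R b)"
      using integrable_test_function_scaleR(2)[OF loc(1) assms(2,3)]
      by (intro Bochner_Integration.integrable_sum integrable_scaleR_left) auto
    moreover have "(\<Sum>b\<in>Basis. ((gradient \<eta> x \<bullet> b) *\<^sub>R v x) *\<^sub>R b) = v x *\<^sub>R gradient \<eta> x" for x
      by (subst (2) euclidean_representation[symmetric]) (simp add: scaleR_sum_right mult.commute)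
    ultimately show ?thesis by simp
  qed
  have i2: "integrable (lebesgue_on \<Omega>) (\<lambda>x. \<eta> x *\<^sub>R G x)"
    by (rule integrable_test_function_scaleR(1)[OF loc(2) assms(2,3)])
  have "(LINT x|lebesgue_on \<Omega>. v x * (gradient \<eta> x \<bullet> c)) = (LINT x|lebesgue_on \<Omega>. v x *\<^sub>R gradient \<eta> x) \<bullet> c"
    using i1 by (subst integral_inner_left[symmetric]) auto
  also have "\<dots> = - ((LINT x|lebesgue_on \<Omega>. \<eta> x *\<^sub>R G x) \<bullet> c)"
    using assms(1,3) by (simp add: has_weak_grad_def)
  also have "(LINT x|lebesgue_on \<Omega>. \<eta> x *\<^sub>R G x) \<bullet> c = (LINT x|lebesgue_on \<Omega>. \<eta> x * (G x \<bullet> c))"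
    using i2 by (subst integral_inner_left[symmetric]) auto
  finally show ?thesis .
qed

lemma has_weak_gradI:
  assumes "loc_integrable \<Omega> v" "loc_integrable \<Omega> G" "\<Omega> \<in> sets lebesgue"
    and *: "\<And>\<eta> b. test_function \<Omega> \<eta> \<Longrightarrow> b \<in> Basis \<Longrightarrow>
      (LINT x|lebesgue_on \<Omega>. v x * (gradient \<eta> x \<bullet> b)) = - (LINT x|lebesgue_on \<Omega>. \<eta> x * (G x \<bullet> b))"
  shows "has_weak_grad \<Omega> v G"
  unfolding has_weak_grad_def
proof (intro conjI assms allI impI)
  fix \<eta> :: "'a \<Rightarrow> real" assume t: "test_function \<Omega> \<eta>"
  have i1: "integrable (lebesgue_on \<Omega>) (\<lambda>x. v x *\<^sub>R gradient \<eta> x)"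
  proof -
    have "integrable (lebesgue_on \<Omega>) (\<lambda>x. \<Sum>b\<in>Basis. ((gradient \<eta> x \<bullet> b) *\<^sub>R v x) *\<^sub>R b)"
      using integrable_test_function_scaleR(2)[OF assms(1,3) t]
      by (intro Bochner_Integration.integrable_sum integrable_scaleR_left) auto
    moreover have "(\<Sum>b\<in>Basis. ((gradient \<eta> x \<bullet> b) *\<^sub>R v x) *\<^sub>R b) = v x *\<^sub>R gradient \<eta> x" for x
      by (subst (2) euclidean_representation[symmetric]) (simp add: scaleR_sum_right mult.commute)
    ultimately show ?thesis by simp
  qed
  have i2: "integrable (lebesgue_on \<Omega>) (\<lambda>x. \<eta> x *\<^sub>R G x)"
    by (rule integrable_test_function_scaleR(1)[OF assms(2,3) t])
  show "(LINT x|lebesgue_on \<Omega>. v x *\<^sub>R gradient \<eta> x) = - (LINT x|lebesgue_on \<Omega>. \<eta> x *\<^sub>R G x)"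
  proof (rule euclidean_eqI)
    fix b :: 'a assume b: "b \<in> Basis"
    have "(LINT x|lebesgue_on \<Omega>. v x *\<^sub>R gradient \<eta> x) \<bullet> b = (LINT x|lebesgue_on \<Omega>. v x * (gradient \<eta> x \<bullet> b))"
      using i1 by (subst integral_inner_left[symmetric]) auto
    moreover have "(LINT x|lebesgue_on \<Omega>. \<eta> x *\<^sub>R G x) \<bullet> b = (LINT x|lebesgue_on \<Omega>. \<eta> x * (G x \<bullet> b))"
      using i2 by (subst integral_inner_left[symmetric]) auto
    ultimately show "(LINT x|lebesgue_on \<Omega>. v x *\<^sub>R gradient \<eta> x) \<bullet> b = (- (LINT x|lebesgue_on \<Omega>. \<eta> x *\<^sub>R G x)) \<bullet> b"
      using *[OF t b] by simp
  qed
qed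

lemma loc_integrable_diff: "loc_integrable \<Omega> f \<Longrightarrow> loc_integrable \<Omega> g \<Longrightarrow> loc_integrable \<Omega> (\<lambda>x. f x - g x)"
  by (auto simp: loc_integrable_def)

lemma loc_integrable_inner: "loc_integrable \<Omega> f \<Longrightarrow> loc_integrable \<Omega> (\<lambda>x. f x \<bullet> c)"
  by (auto simp: loc_integrable_def)

lemma AE_eq_if_components:
  fixes f g :: "'a \<Rightarrow> 'b::euclidean_space"
  assumes "\<And>b. b \<in> Basis \<Longrightarrow> AE x in M. f x \<bullet> b - g x \<bullet> b = 0"
  shows "AE x in M. f x = g x"
proof -
  have "AE x in M. \<forall>b\<in>Basis. f x \<bullet> b - g x \<bullet> b = 0"
    using assms by (subst AE_ball_countable) (auto intro: countable_finite)
  then show ?thesis by eventually_elim (auto intro: euclidean_eqI)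
qed

lemma has_weak_grad_unique:
  fixes v :: "'a::euclidean_space \<Rightarrow> real"
  assumes "open \<Omega>" "has_weak_grad \<Omega> v G" "has_weak_grad \<Omega> v H"
  shows "AE x in lebesgue_on \<Omega>. G x = H x"
proof (rule AE_eq_if_components)
  fix b :: 'a assume b: "b \<in> Basis"
  have Om: "\<Omega> \<in> sets lebesgue" using assms(1) by simp
  have loc: "loc_integrable \<Omega> (\<lambda>x. G x \<bullet> b)" "loc_integrable \<Omega> (\<lambda>x. H x \<bullet> b)"
    using assms by (auto simp: has_weak_grad_def intro!: loc_integrable_inner)
  show "AE x in lebesgue_on \<Omega>. G x \<bullet> b - H x \<bullet> b = 0"
  proof (rule fundamental_lemma[OF assms(1) loc_integrable_diff[OF loc]])
    fix \<eta> :: "'a \<Rightarrow> real" assume t: "test_function \<Omega> \<eta>"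
    have "(LINT x|lebesgue_on \<Omega>. \<eta> x * (G x \<bullet> b)) = (LINT x|lebesgue_on \<Omega>. \<eta> x * (H x \<bullet> b))"
      using has_weak_grad_inner[OF assms(2) Om t, of b] has_weak_grad_inner[OF assms(3) Om t, of b] by simp
    then show "(LINT x|lebesgue_on \<Omega>. \<eta> x * (G x \<bullet> b - H x \<bullet> b)) = 0"
      using integrable_test_function_scaleR(1)[OF loc(1) Om t] integrable_test_function_scaleR(1)[OF loc(2) Om t]
      by (simp add: right_diff_distrib)
  qed
qed

lemma has_weak_grad_weak_grad: "has_weak_grad \<Omega> v G \<Longrightarrow> has_weak_grad \<Omega> v (weak_grad \<Omega> v)"
  unfolding weak_grad_def by (rule someI[where P = "has_weak_grad \<Omega> v"])

text \<open>\<open>weak_grad\<close> is an arbitrary choice among all weak gradients. Uniqueness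
  pins it down up to a null set, which is why later identities for it hold almost
  everywhere.\<close>

lemma weak_grad_AE_eq:
  "open \<Omega> \<Longrightarrow> has_weak_grad \<Omega> v G \<Longrightarrow> AE x in lebesgue_on \<Omega>. weak_grad \<Omega> v x = G x"
  by (rule has_weak_grad_unique[OF _ has_weak_grad_weak_grad])

lemma has_weak_div_unique:
  fixes y :: "'a::euclidean_space \<Rightarrow> 'a"
  assumes "open \<Omega>" "has_weak_div \<Omega> y r" "has_weak_div \<Omega> y s"
  shows "AE x in lebesgue_on \<Omega>. r x = s x"
proof -
  have Om: "\<Omega> \<in> sets lebesgue" using assms(1) by simp
  have loc: "loc_integrable \<Omega> r" "loc_integrable \<Omega> s"
    using assms by (auto simp: has_weak_div_def)
  have "AE x in lebesgue_on \<Omega>. r x - s x = 0"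
  proof (rule fundamental_lemma[OF assms(1) loc_integrable_diff[OF loc]])
    fix \<eta> :: "'a \<Rightarrow> real" assume t: "test_function \<Omega> \<eta>"
    have "(LINT x|lebesgue_on \<Omega>. \<eta> x * r x) = (LINT x|lebesgue_on \<Omega>. \<eta> x * s x)"
      using assms(2,3) t unfolding has_weak_div_def by (metis neg_equal_iff_equal)
    then show "(LINT x|lebesgue_on \<Omega>. \<eta> x * (r x - s x)) = 0"
      using integrable_test_function_scaleR(1)[OF loc(1) Om t] integrable_test_function_scaleR(1)[OF loc(2) Om t]
      by (simp add: right_diff_distrib)
  qed
  then show ?thesis by eventually_elim simp
qed

lemma has_weak_div_weak_div: "has_weak_div \<Omega> y r \<Longrightarrow> has_weak_div \<Omega> y (weak_div \<Omega> y)"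
  unfolding weak_div_def by (rule someI[where P = "has_weak_div \<Omega> y"])

lemma weak_div_AE_eq:
  "open \<Omega> \<Longrightarrow> has_weak_div \<Omega> y r \<Longrightarrow> AE x in lebesgue_on \<Omega>. weak_div \<Omega> y x = r x"
  by (rule has_weak_div_unique[OF _ has_weak_div_weak_div])

lemma loc_integrable_continuous:
  assumes "continuous_on UNIV f" shows "loc_integrable \<Omega> f"
  unfolding loc_integrable_def
proof safe
  fix K :: "'a set" assume K: "compact K"
  then have "integrable lborel (\<lambda>x. indicator K x *\<^sub>R f x)"
    by (intro borel_integrable_compact continuous_on_subset[OF assms]) auto
  then have "integrable lebesgue (\<lambda>x. indicator K x *\<^sub>R f x)"
    by (subst integrable_completion) auto
  then show "integrable (lebesgue_on K) f" using K 
    by (subst integrable_restrict_space) (auto intro: lmeasurable_compact fmeasurableD)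
qed

lemma test_function_mult:
  assumes "test_function \<Omega> \<eta>" "smooth \<theta>"
  shows "test_function \<Omega> (\<lambda>x. \<theta> x * \<eta> x)"
proof -
  obtain K where K: "compact K" "K \<subseteq> \<Omega>" "\<And>x. x \<notin> K \<Longrightarrow> \<eta> x = 0"
    using test_function_support[OF assms(1)] by metis
  show ?thesis using assms K
    by (intro test_functionI[OF _ K(1,2)] allI Ck_mult) (auto simp: test_function_def)
qed

text \<open>The product of \<theta> and \<eta> is again a test function, so its gradient integrates
  to zero; the product rule splits this into the two sides of the definition.\<close>

lemma smooth_has_weak_grad:
  fixes \<theta> :: "'a::euclidean_space \<Rightarrow> real"
  assumes sm: "smooth \<theta>" and Om: "\<Omega> \<in> sets lebesgue"
  shows "has_weak_grad \<Omega> \<theta> (gradient \<theta>)"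
proof (rule has_weak_gradI[OF loc_integrable_continuous loc_integrable_continuous Om])
  show "continuous_on UNIV \<theta>" "continuous_on UNIV (gradient \<theta>)"
    using sm by (auto intro: smooth_continuous smooth_continuous_gradient)
  fix \<eta> :: "'a \<Rightarrow> real" and b :: 'a assume t: "test_function \<Omega> \<eta>"
  then have sme: "smooth \<eta>" by (simp add: test_function_def)
  obtain K where K: "compact K" "K \<subseteq> \<Omega>" "\<And>x. x \<notin> K \<Longrightarrow> \<eta> x = 0" "\<And>x. x \<notin> K \<Longrightarrow> gradient \<eta> x = 0"
    using test_function_support[OF t] by metis
  note t' = test_function_mult[OF t sm]
  have g: "gradient (\<lambda>x. \<theta> x * \<eta> x) x = \<theta> x *\<^sub>R gradient \<eta> x + \<eta> x *\<^sub>R gradient \<theta> x" for x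
    by (intro gradient_mult smooth_differentiable sm sme)
  have i: "integrable (lebesgue_on \<Omega>) (\<lambda>x. (gradient \<eta> x \<bullet> b) *\<^sub>R \<theta> x)"
    by (rule integrable_test_function_scaleR(2)[OF loc_integrable_continuous[OF smooth_continuous[OF sm]] Om t])
  have j: "integrable (lebesgue_on \<Omega>) (\<lambda>x. \<eta> x *\<^sub>R (gradient \<theta> x \<bullet> b))"
    by (rule integrable_test_function_scaleR(1)[OF loc_integrable_inner[OF loc_integrable_continuous[OF smooth_continuous_gradient[OF sm]]] Om t])
  have "(LINT x|lebesgue_on \<Omega>. gradient (\<lambda>x. \<theta> x * \<eta> x) x \<bullet> b) = (LINT x|lebesgue. indicator \<Omega> x *\<^sub>R (gradient (\<lambda>x. \<theta> x * \<eta> x) x \<bullet> b))"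
    using Om by (intro integral_restrict_space) auto
  also have "\<dots> = (LINT x|lebesgue. gradient (\<lambda>x. \<theta> x * \<eta> x) x \<bullet> b)"
  proof (intro Bochner_Integration.integral_cong refl)
    fix x :: 'a
    show "indicat_real \<Omega> x *\<^sub>R (gradient (\<lambda>x. \<theta> x * \<eta> x) x \<bullet> b) = gradient (\<lambda>x. \<theta> x * \<eta> x) x \<bullet> b"
      unfolding g using K(2) K(3,4)[of x] by (cases "x \<in> K") (auto simp: indicator_def)
  qed
  also have "\<dots> = 0" by (rule integral_test_function_gradient_inner[OF t'])
  finally have "(LINT x|lebesgue_on \<Omega>. (gradient \<eta> x \<bullet> b) *\<^sub>R \<theta> x + \<eta> x *\<^sub>R (gradient \<theta> x \<bullet> b)) = 0"
    unfolding g by (simp only: inner_add_left inner_scaleR_left real_scaleR_def mult.commute)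
  then show "(LINT x|lebesgue_on \<Omega>. \<theta> x * (gradient \<eta> x \<bullet> b)) = - (LINT x|lebesgue_on \<Omega>. \<eta> x * (gradient \<theta> x \<bullet> b))"
    using i j by (simp add: mult.commute)
qed

lemma has_weak_grad_diff:
  fixes v w :: "'a::euclidean_space \<Rightarrow> real"
  assumes Om: "\<Omega> \<in> sets lebesgue" and "has_weak_grad \<Omega> v G" "has_weak_grad \<Omega> w H"
  shows "has_weak_grad \<Omega> (\<lambda>x. v x - w x) (\<lambda>x. G x - H x)"
proof (rule has_weak_gradI[OF loc_integrable_diff loc_integrable_diff Om])
  show l: "loc_integrable \<Omega> v" "loc_integrable \<Omega> w" "loc_integrable \<Omega> G" "loc_integrable \<Omega> H"
    using assms by (auto simp: has_weak_grad_def)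
  fix \<eta> :: "'a \<Rightarrow> real" and b :: 'a assume t: "test_function \<Omega> \<eta>"
  show "(LINT x|lebesgue_on \<Omega>. (v x - w x) * (gradient \<eta> x \<bullet> b)) = - (LINT x|lebesgue_on \<Omega>. \<eta> x * ((G x - H x) \<bullet> b))"
    using has_weak_grad_inner[OF assms(2) Om t, of b] has_weak_grad_inner[OF assms(3) Om t, of b]
      integrable_test_function_scaleR(2)[OF l(1) Om t, of b] integrable_test_function_scaleR(2)[OF l(2) Om t, of b]
      integrable_test_function_scaleR(1)[OF loc_integrable_inner[OF l(3)] Om t, of b]
      integrable_test_function_scaleR(1)[OF loc_integrable_inner[OF l(4)] Om t, of b]
    by (simp add: inner_diff_left left_diff_distrib right_diff_distrib mult.commute)
qed

lemma loc_integrable_lincomb: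
  fixes f :: "'i \<Rightarrow> 'a::euclidean_space \<Rightarrow> 'b::euclidean_space"
  assumes "\<And>i. i \<in> I \<Longrightarrow> loc_integrable \<Omega> (f i)"
  shows "loc_integrable \<Omega> (\<lambda>x. \<Sum>i\<in>I. c i *\<^sub>R f i x)"
  using assms unfolding loc_integrable_def
  by (intro allI impI Bochner_Integration.integrable_sum integrable_scaleR_right) auto

text \<open>Applied to \<open>z \<bullet> v\<close>, which is a combination of the components of
  \<open>z\<close> with constant coefficients.\<close>

lemma has_weak_grad_lincomb:
  fixes v :: "'i \<Rightarrow> 'a::euclidean_space \<Rightarrow> real"
  assumes Om: "\<Omega> \<in> sets lebesgue" and w: "\<And>i. i \<in> I \<Longrightarrow> has_weak_grad \<Omega> (v i) (G i)"
  shows "has_weak_grad \<Omega> (\<lambda>x. \<Sum>i\<in>I. c i * v i x) (\<lambda>x. \<Sum>i\<in>I. c i *\<^sub>R G i x)"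
proof (rule has_weak_gradI[OF _ loc_integrable_lincomb Om])
  have l: "\<And>i. i \<in> I \<Longrightarrow> loc_integrable \<Omega> (v i)" "\<And>i. i \<in> I \<Longrightarrow> loc_integrable \<Omega> (G i)"
    using w by (auto simp: has_weak_grad_def)
  show "loc_integrable \<Omega> (\<lambda>x. \<Sum>i\<in>I. c i * v i x)"
    using loc_integrable_lincomb[of I \<Omega> v c] l by simp
  show "\<And>i. i \<in> I \<Longrightarrow> loc_integrable \<Omega> (G i)" by (rule l)
  fix \<eta> :: "'a \<Rightarrow> real" and b :: 'a assume t: "test_function \<Omega> \<eta>"
  have "(LINT x|lebesgue_on \<Omega>. (\<Sum>i\<in>I. c i * v i x) * (gradient \<eta> x \<bullet> b)) =
      (LINT x|lebesgue_on \<Omega>. (\<Sum>i\<in>I. c i * (v i x * (gradient \<eta> x \<bullet> b))))"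
    by (simp add: sum_distrib_right mult.assoc)
  also have "\<dots> = (\<Sum>i\<in>I. c i * (LINT x|lebesgue_on \<Omega>. v i x * (gradient \<eta> x \<bullet> b)))"
    using integrable_test_function_scaleR(2)[OF l(1) Om t, of _ b]
    by (subst Bochner_Integration.integral_sum) (auto simp: mult.commute)
  also have "\<dots> = (\<Sum>i\<in>I. c i * (- (LINT x|lebesgue_on \<Omega>. \<eta> x * (G i x \<bullet> b))))"
    using has_weak_grad_inner[OF w Om t, of _ b] by (intro sum.cong) auto
  also have "\<dots> = - (\<Sum>i\<in>I. c i * (LINT x|lebesgue_on \<Omega>. \<eta> x * (G i x \<bullet> b)))"
    by (simp add: sum_negf)
  also have "(\<Sum>i\<in>I. c i * (LINT x|lebesgue_on \<Omega>. \<eta> x * (G i x \<bullet> b))) = (LINT x|lebesgue_on \<Omega>. (\<Sum>i\<in>I. c i * (\<eta> x * (G i x \<bullet> b))))"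
    using integrable_test_function_scaleR(1)[OF loc_integrable_inner[OF l(2)] Om t, of _ b]
    by (subst Bochner_Integration.integral_sum) auto
  also have "\<dots> = (LINT x|lebesgue_on \<Omega>. \<eta> x * ((\<Sum>i\<in>I. c i *\<^sub>R G i x) \<bullet> b))"
    by (simp add: inner_sum_left sum_distrib_left mult.left_commute)
  finally show "(LINT x|lebesgue_on \<Omega>. (\<Sum>i\<in>I. c i * v i x) * (gradient \<eta> x \<bullet> b)) = - (LINT x|lebesgue_on \<Omega>. \<eta> x * ((\<Sum>i\<in>I. c i *\<^sub>R G i x) \<bullet> b))" .
qed

lemma has_weak_div_components:
  fixes z :: "'a::euclidean_space \<Rightarrow> 'a"
  assumes Om: "\<Omega> \<in> sets lebesgue" and w: "\<And>b. b \<in> Basis \<Longrightarrow> has_weak_grad \<Omega> (\<lambda>x. z x \<bullet> b) (G b)"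
  shows "has_weak_div \<Omega> z (\<lambda>x. \<Sum>b\<in>Basis. G b x \<bullet> b)"
proof -
  have l: "\<And>b. b \<in> Basis \<Longrightarrow> loc_integrable \<Omega> (\<lambda>x. z x \<bullet> b)" "\<And>b. b \<in> Basis \<Longrightarrow> loc_integrable \<Omega> (G b)"
    using w by (auto simp: has_weak_grad_def)
  have lz: "loc_integrable \<Omega> z"
    unfolding loc_integrable_def
  proof safe
    fix K assume "compact K" "K \<subseteq> \<Omega>"
    then have "integrable (lebesgue_on K) (\<lambda>x. \<Sum>b\<in>Basis. (z x \<bullet> b) *\<^sub>R b)"
      using l(1) by (intro Bochner_Integration.integrable_sum integrable_scaleR_left) (auto simp: loc_integrable_def)
    then show "integrable (lebesgue_on K) z" by (simp add: euclidean_representation)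
  qed
  have lr: "loc_integrable \<Omega> (\<lambda>x. \<Sum>b\<in>Basis. G b x \<bullet> b)"
    using loc_integrable_lincomb[of Basis \<Omega> "\<lambda>b x. G b x \<bullet> b" "\<lambda>_. 1"] l(2) loc_integrable_inner by force
  show ?thesis unfolding has_weak_div_def
  proof (intro conjI lz lr allI impI)
    fix \<eta> :: "'a \<Rightarrow> real" assume t: "test_function \<Omega> \<eta>"
    have "(LINT x|lebesgue_on \<Omega>. z x \<bullet> gradient \<eta> x) = (LINT x|lebesgue_on \<Omega>. (\<Sum>b\<in>Basis. (z x \<bullet> b) * (gradient \<eta> x \<bullet> b)))"
      by (subst euclidean_inner) simp
    also have "\<dots> = (\<Sum>b\<in>Basis. (LINT x|lebesgue_on \<Omega>. (z x \<bullet> b) * (gradient \<eta> x \<bullet> b)))"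
      using integrable_test_function_scaleR(2)[OF l(1) Om t]
      by (subst Bochner_Integration.integral_sum) (auto simp: mult.commute)
    also have "\<dots> = (\<Sum>b\<in>Basis. - (LINT x|lebesgue_on \<Omega>. \<eta> x * (G b x \<bullet> b)))"
      using has_weak_grad_inner[OF w Om t] by (intro sum.cong) auto
    also have "\<dots> = - (LINT x|lebesgue_on \<Omega>. (\<Sum>b\<in>Basis. \<eta> x * (G b x \<bullet> b)))"
      using integrable_test_function_scaleR(1)[OF loc_integrable_inner[OF l(2)] Om t]
      by (subst Bochner_Integration.integral_sum) (auto simp: sum_negf)
    finally show "(LINT x|lebesgue_on \<Omega>. z x \<bullet> gradient \<eta> x) = - (LINT x|lebesgue_on \<Omega>. \<eta> x * (\<Sum>b\<in>Basis. G b x \<bullet> b))"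
      by (simp add: sum_distrib_left)
  qed
qed

section \<open>Surface measure and cones\<close>

text \<open>For a unit vector \<nu> this is the orthogonal projection onto the hyperplane
  \<open>\<nu> \<bullet> x = c\<close>, in an explicit form that can be integrated.\<close>

definition hproj :: "'a::real_inner \<Rightarrow> real \<Rightarrow> 'a \<Rightarrow> 'a" where
  "hproj \<nu> c x = x - (\<nu> \<bullet> x - c) *\<^sub>R \<nu>"

lemma hproj_measurable[measurable]: "hproj (\<nu>::'a::euclidean_space) c \<in> borel_measurable borel"
  unfolding hproj_def by measurable

lemma inner_hproj: "norm \<nu> = 1 \<Longrightarrow> \<nu> \<bullet> hproj \<nu> c x = c"
  by (simp add: hproj_def inner_diff_right dot_square_norm)

lemma closest_point_hyperplane:
  fixes \<nu> :: "'a::euclidean_space"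
  assumes "norm \<nu> = 1"
  shows "closest_point {x. \<nu> \<bullet> x = c} = hproj \<nu> c"
proof
  fix a
  show "closest_point {x. \<nu> \<bullet> x = c} a = hproj \<nu> c a"
  proof (rule closest_point_unique[symmetric])
    show "\<forall>z\<in>{x. \<nu> \<bullet> x = c}. dist a (hproj \<nu> c a) \<le> dist a z"
    proof
      fix z assume z: "z \<in> {x. \<nu> \<bullet> x = c}"
      have "dist a (hproj \<nu> c a) = \<bar>\<nu> \<bullet> a - c\<bar>" using assms by (simp add: hproj_def dist_norm)
      also have "\<dots> = \<bar>\<nu> \<bullet> (a - z)\<bar>" using z by (simp add: inner_diff_right)
      also have "\<dots> \<le> norm \<nu> * norm (a - z)" by (rule Cauchy_Schwarz_ineq2)
      finally show "dist a (hproj \<nu> c a) \<le> dist a z" using assms by (simp add: dist_norm)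
    qed
  qed (use assms in \<open>auto simp: inner_hproj closed_hyperplane convex_hyperplane\<close>)
qed

section \<open>Integration along the normals of a hyperplane\<close>

lemma nn_integral_lborel_translate:
  fixes f :: "'a::euclidean_space \<Rightarrow> ennreal"
  assumes [measurable]: "f \<in> borel_measurable borel"
  shows "(\<integral>\<^sup>+x. f x \<partial>lborel) = (\<integral>\<^sup>+x. f (a + x) \<partial>lborel)"
proof -
  have "(\<integral>\<^sup>+x. f x \<partial>lborel) = (\<integral>\<^sup>+x. f x \<partial>distr lborel borel ((+) a))" by (simp add: lborel_distr_plus)
  then show ?thesis by (simp add: nn_integral_distr)
qed

lemma nn_integral_lborel_affine:
  fixes f :: "'a::euclidean_space \<Rightarrow> ennreal"
  assumes [measurable]: "f \<in> borel_measurable borel" and r: "0 < r"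
  shows "(\<integral>\<^sup>+x. f x \<partial>lborel) = ennreal (r ^ DIM('a)) * (\<integral>\<^sup>+x. f (a + r *\<^sub>R x) \<partial>lborel)"
  by (subst lborel_affine[of r a])
     (use r in \<open>simp_all add: nn_integral_density nn_integral_distr nn_integral_cmult\<close>)

text \<open>Fubini in the direction \<nu> without coordinates; the slab of thickness one around the
  hyperplane plays the role of the base. After replacing \<open>hproj \<nu> c x\<close> by
  \<open>x\<close>, exchanging the integrals and translating by \<open>t *\<^sub>R \<nu>\<close>,
  each point is counted by the \<open>t\<close> of an interval of length one.\<close>

lemma slab_nn_integral:
  fixes \<nu> :: "'a::euclidean_space" and f :: "'a \<Rightarrow> ennreal"
  assumes \<nu>: "norm \<nu> = 1" and [measurable]: "f \<in> borel_measurable borel"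
  shows "(\<integral>\<^sup>+x. f x \<partial>lborel) =
    (\<integral>\<^sup>+x. (if \<bar>\<nu> \<bullet> x - c\<bar> \<le> 1/2 then 1 else 0) * (\<integral>\<^sup>+t. f (hproj \<nu> c x + t *\<^sub>R \<nu>) \<partial>lborel) \<partial>lborel)"
proof -
  have inner: "(\<integral>\<^sup>+t. f (hproj \<nu> c x + t *\<^sub>R \<nu>) \<partial>lborel) = (\<integral>\<^sup>+t. f (x + t *\<^sub>R \<nu>) \<partial>lborel)" for x
  proof -
    have "(\<integral>\<^sup>+t. f (hproj \<nu> c x + t *\<^sub>R \<nu>) \<partial>lborel) = (\<integral>\<^sup>+t. f (hproj \<nu> c x + ((\<nu> \<bullet> x - c) + t) *\<^sub>R \<nu>) \<partial>lborel)"
      by (rule nn_integral_lborel_translate) measurable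
    then show ?thesis by (simp add: hproj_def scaleR_add_left)
  qed
  have "(\<integral>\<^sup>+x. (if \<bar>\<nu> \<bullet> x - c\<bar> \<le> 1/2 then 1 else 0) * (\<integral>\<^sup>+t. f (hproj \<nu> c x + t *\<^sub>R \<nu>) \<partial>lborel) \<partial>lborel) =
     (\<integral>\<^sup>+x. (\<integral>\<^sup>+t. (if \<bar>\<nu> \<bullet> x - c\<bar> \<le> 1/2 then 1 else 0) * f (x + t *\<^sub>R \<nu>) \<partial>lborel) \<partial>lborel)"
    unfolding inner by (intro nn_integral_cong nn_integral_cmult[symmetric]) measurable
  also have "\<dots> = (\<integral>\<^sup>+t. (\<integral>\<^sup>+x. (if \<bar>\<nu> \<bullet> x - c\<bar> \<le> 1/2 then 1 else 0) * f (x + t *\<^sub>R \<nu>) \<partial>lborel) \<partial>lborel)"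
    by (rule lborel_pair.Fubini'[symmetric]) measurable
  also have "\<dots> = (\<integral>\<^sup>+t. (\<integral>\<^sup>+x. (if \<bar>\<nu> \<bullet> x - c - t\<bar> \<le> 1/2 then 1 else 0) * f x \<partial>lborel) \<partial>lborel)"
  proof (rule nn_integral_cong)
    fix t :: real
    have "(\<integral>\<^sup>+x. (if \<bar>\<nu> \<bullet> x - c\<bar> \<le> 1/2 then 1 else 0) * f (x + t *\<^sub>R \<nu>) \<partial>lborel) =
      (\<integral>\<^sup>+x. (if \<bar>\<nu> \<bullet> ((- t) *\<^sub>R \<nu> + x) - c\<bar> \<le> 1/2 then 1 else 0) * f (((- t) *\<^sub>R \<nu> + x) + t *\<^sub>R \<nu>) \<partial>lborel)"
      by (rule nn_integral_lborel_translate) measurable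
    also have "\<dots> = (\<integral>\<^sup>+x. (if \<bar>\<nu> \<bullet> x - c - t\<bar> \<le> 1/2 then 1 else 0) * f x \<partial>lborel)"
      using \<nu> by (intro nn_integral_cong) (simp add: inner_diff_right dot_square_norm algebra_simps)
    finally show "(\<integral>\<^sup>+x. (if \<bar>\<nu> \<bullet> x - c\<bar> \<le> 1/2 then 1 else 0) * f (x + t *\<^sub>R \<nu>) \<partial>lborel) =
      (\<integral>\<^sup>+x. (if \<bar>\<nu> \<bullet> x - c - t\<bar> \<le> 1/2 then 1 else 0) * f x \<partial>lborel)" .
  qed
  also have "\<dots> = (\<integral>\<^sup>+x. (\<integral>\<^sup>+t. (if \<bar>\<nu> \<bullet> x - c - t\<bar> \<le> 1/2 then 1 else 0) * f x \<partial>lborel) \<partial>lborel)"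
    by (rule lborel_pair.Fubini') measurable
  also have "\<dots> = (\<integral>\<^sup>+x. f x \<partial>lborel)"
  proof (rule nn_integral_cong)
    fix x
    have "(\<integral>\<^sup>+t. (if \<bar>\<nu> \<bullet> x - c - t\<bar> \<le> 1/2 then 1 else 0) * f x \<partial>lborel) =
       (\<integral>\<^sup>+t. indicator {\<nu> \<bullet> x - c - 1/2 .. \<nu> \<bullet> x - c + 1/2} t * f x \<partial>lborel)"
    proof (rule nn_integral_cong)
      fix t :: real
      have "\<bar>\<nu> \<bullet> x - c - t\<bar> \<le> 1/2 \<longleftrightarrow> t \<in> {\<nu> \<bullet> x - c - 1/2 .. \<nu> \<bullet> x - c + 1/2}"
        unfolding abs_le_iff atLeastAtMost_iff by linarith
      then show "(if \<bar>\<nu> \<bullet> x - c - t\<bar> \<le> 1/2 then 1 else 0) * f x = indicator {\<nu> \<bullet> x - c - 1/2 .. \<nu> \<bullet> x - c + 1/2} t * f x"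
        unfolding indicator_def by simp
    qed
    also have "\<dots> = f x" by (simp add: nn_integral_multc)
    finally show "(\<integral>\<^sup>+t. (if \<bar>\<nu> \<bullet> x - c - t\<bar> \<le> 1/2 then 1 else 0) * f x \<partial>lborel) = f x" .
  qed
  finally show ?thesis by simp
qed

text \<open>An integrand that is constant along the normals sees only the thickness of the slab.
  This is the preceding formula for the slab of half-width \<open>a\<close>, whose normal sections
  have length \<open>2 * a\<close>.\<close>

lemma slab_thickness:
  fixes \<nu> :: "'a::euclidean_space" and K :: "'a \<Rightarrow> ennreal"
  assumes \<nu>: "norm \<nu> = 1" and [measurable]: "K \<in> borel_measurable borel" and a: "0 \<le> a"
  shows "(\<integral>\<^sup>+x. (if \<bar>\<nu> \<bullet> x - c\<bar> \<le> a then 1 else 0) * K (hproj \<nu> c x) \<partial>lborel) =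
    ennreal (2 * a) * (\<integral>\<^sup>+x. (if \<bar>\<nu> \<bullet> x - c\<bar> \<le> 1/2 then 1 else 0) * K (hproj \<nu> c x) \<partial>lborel)"
proof -
  have h: "\<nu> \<bullet> (hproj \<nu> c x + t *\<^sub>R \<nu>) - c = t" "hproj \<nu> c (hproj \<nu> c x + t *\<^sub>R \<nu>) = hproj \<nu> c x" for x t
  proof -
    show *: "\<nu> \<bullet> (hproj \<nu> c x + t *\<^sub>R \<nu>) - c = t"
      using \<nu> by (simp add: inner_add_right inner_hproj dot_square_norm)
    show "hproj \<nu> c (hproj \<nu> c x + t *\<^sub>R \<nu>) = hproj \<nu> c x"
      unfolding hproj_def[of \<nu> c "hproj \<nu> c x + t *\<^sub>R \<nu>"] * by simp
  qed
  have "(\<integral>\<^sup>+x. (if \<bar>\<nu> \<bullet> x - c\<bar> \<le> a then 1 else 0) * K (hproj \<nu> c x) \<partial>lborel) =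
    (\<integral>\<^sup>+x. (if \<bar>\<nu> \<bullet> x - c\<bar> \<le> 1/2 then 1 else 0) * (\<integral>\<^sup>+t. (if \<bar>t\<bar> \<le> a then 1 else 0) * K (hproj \<nu> c x) \<partial>lborel) \<partial>lborel)"
    by (subst slab_nn_integral[OF \<nu>, of _ c]) (auto simp only: h, measurable)
  also have "\<dots> = (\<integral>\<^sup>+x. ennreal (2 * a) * ((if \<bar>\<nu> \<bullet> x - c\<bar> \<le> 1/2 then 1 else 0) * K (hproj \<nu> c x)) \<partial>lborel)"
  proof (rule nn_integral_cong)
    fix x
    have "(\<integral>\<^sup>+t. (if \<bar>t\<bar> \<le> a then 1 else 0) * K (hproj \<nu> c x) \<partial>lborel) =
       (\<integral>\<^sup>+t. indicator {-a..a} t * K (hproj \<nu> c x) \<partial>lborel)"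
      by (intro nn_integral_cong) (auto simp: indicator_def abs_le_iff)
    also have "\<dots> = ennreal (2 * a) * K (hproj \<nu> c x)" using a by (simp add: nn_integral_multc)
    finally have e: "(\<integral>\<^sup>+t. (if \<bar>t\<bar> \<le> a then 1 else 0) * K (hproj \<nu> c x) \<partial>lborel) = ennreal (2 * a) * K (hproj \<nu> c x)" .
    show "(if \<bar>\<nu> \<bullet> x - c\<bar> \<le> 1/2 then 1 else 0) * (\<integral>\<^sup>+t. (if \<bar>t\<bar> \<le> a then 1 else 0) * K (hproj \<nu> c x) \<partial>lborel) =
       ennreal (2 * a) * ((if \<bar>\<nu> \<bullet> x - c\<bar> \<le> 1/2 then 1 else 0) * K (hproj \<nu> c x))"
      unfolding e by simp
  qed
  also have "\<dots> = ennreal (2 * a) * (\<integral>\<^sup>+x. (if \<bar>\<nu> \<bullet> x - c\<bar> \<le> 1/2 then 1 else 0) * K (hproj \<nu> c x) \<partial>lborel)"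
    by (rule nn_integral_cmult) measurable
  finally show ?thesis .
qed

text \<open>The slice of a cone at height \<open>t\<close> is its base shrunk by
  \<open>r = 1 - t / h\<close>. Scaling about the foot \<open>p\<close> of the apex preserves the
  hyperplane and contributes \<open>r ^ d\<close>; it also changes the thickness of the slab, which
  gives back \<open>1 / r\<close>. What remains is the surface factor
  \<open>r ^ (d - 1)\<close>.\<close>

lemma slab_slice:
  fixes \<nu> P :: "'a::euclidean_space" and G :: "'a \<Rightarrow> ennreal"
  assumes \<nu>: "norm \<nu> = 1" and G[measurable]: "G \<in> borel_measurable borel"
    and P: "\<nu> \<bullet> P = c + h" and h: "0 < h" and t: "t < h"
  defines "r \<equiv> 1 - t / h"
  shows "(\<integral>\<^sup>+x. (if \<bar>\<nu> \<bullet> x - c\<bar> \<le> 1/2 then 1 else 0) * G (hproj \<nu> c x + t *\<^sub>R \<nu>) \<partial>lborel) =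
    ennreal (r ^ (DIM('a) - 1)) * (\<integral>\<^sup>+x. (if \<bar>\<nu> \<bullet> x - c\<bar> \<le> 1/2 then 1 else 0) * G (P + r *\<^sub>R (hproj \<nu> c x - P)) \<partial>lborel)"
proof -
  have r: "0 < r" using h t by (simp add: r_def)
  define p where "p = hproj \<nu> c P"
  have p: "\<nu> \<bullet> p = c" using \<nu> by (simp add: p_def inner_hproj)
  have Pp: "P = p + h *\<^sub>R \<nu>" using P by (simp add: p_def hproj_def)
  have th: "t = (1 - r) * h" using h by (simp add: r_def)
  have e1: "\<nu> \<bullet> ((1 - r) *\<^sub>R p + r *\<^sub>R x) - c = r * (\<nu> \<bullet> x - c)" for x
    using p by (simp add: inner_add_right algebra_simps)
  have e2: "hproj \<nu> c ((1 - r) *\<^sub>R p + r *\<^sub>R x) + t *\<^sub>R \<nu> = P + r *\<^sub>R (hproj \<nu> c x - P)" for x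
    unfolding hproj_def e1 Pp th by (simp add: algebra_simps)
  have e3: "\<bar>r * (\<nu> \<bullet> x - c)\<bar> \<le> 1/2 \<longleftrightarrow> \<bar>\<nu> \<bullet> x - c\<bar> \<le> 1 / (2 * r)" for x
  proof -
    have "\<bar>r * (\<nu> \<bullet> x - c)\<bar> = r * \<bar>\<nu> \<bullet> x - c\<bar>" using r by (simp add: abs_mult)
    then show ?thesis using r by (simp add: pos_le_divide_eq mult_ac)
  qed
  have "(\<integral>\<^sup>+x. (if \<bar>\<nu> \<bullet> x - c\<bar> \<le> 1/2 then 1 else 0) * G (hproj \<nu> c x + t *\<^sub>R \<nu>) \<partial>lborel) =
     ennreal (r ^ DIM('a)) * (\<integral>\<^sup>+x. (if \<bar>\<nu> \<bullet> x - c\<bar> \<le> 1 / (2 * r) then 1 else 0) * G (P + r *\<^sub>R (hproj \<nu> c x - P)) \<partial>lborel)"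
    by (subst nn_integral_lborel_affine[OF _ r, of _ "(1 - r) *\<^sub>R p"]) (simp_all only: e1 e2 e3, measurable)
  also have "\<dots> = ennreal (r ^ DIM('a)) * (ennreal (2 * (1 / (2 * r))) *
      (\<integral>\<^sup>+x. (if \<bar>\<nu> \<bullet> x - c\<bar> \<le> 1/2 then 1 else 0) * G (P + r *\<^sub>R (hproj \<nu> c x - P)) \<partial>lborel))"
    using r by (subst slab_thickness[OF \<nu>, of "\<lambda>y. G (P + r *\<^sub>R (y - P))"]) auto
  also have "\<dots> = ennreal (r ^ DIM('a) * (2 * (1 / (2 * r)))) *
      (\<integral>\<^sup>+x. (if \<bar>\<nu> \<bullet> x - c\<bar> \<le> 1/2 then 1 else 0) * G (P + r *\<^sub>R (hproj \<nu> c x - P)) \<partial>lborel)"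
    using r by (subst ennreal_mult) (auto simp: mult.assoc)
  also have "r ^ DIM('a) * (2 * (1 / (2 * r))) = r ^ (DIM('a) - 1)"
    using r by (simp add: power_diff)
  finally show ?thesis .
qed

text \<open>Coordinates on the cone are the height \<open>t\<close> and the base point, the latter
  integrated over the slab of thickness one. At heights strictly between \<open>0\<close> and
  \<open>h\<close> the base point alone decides membership in \<open>T\<close>; the two extreme
  heights form a null set.\<close>

lemma cone_nn_integral:
  fixes \<nu> P :: "'a::euclidean_space" and f :: "'a \<Rightarrow> ennreal"
  assumes \<nu>: "norm \<nu> = 1" and f[measurable]: "f \<in> borel_measurable borel"
    and P: "\<nu> \<bullet> P = c + h" and h: "0 < h"
    and S: "S \<subseteq> {x. \<nu> \<bullet> x = c}" and [measurable]: "S \<in> sets borel" 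
    and T: "T = (\<lambda>(r, s). P + r *\<^sub>R (s - P)) ` ({0..1} \<times> S)" and [measurable]: "T \<in> sets borel"
  shows "(\<integral>\<^sup>+x. indicator T x * f x \<partial>lborel) =
    (\<integral>\<^sup>+t. (\<integral>\<^sup>+x. ennreal ((if \<bar>\<nu> \<bullet> x - c\<bar> \<le> 1/2 then 1 else 0) * indicator S (hproj \<nu> c x) * indicator {0<..<h} t * (1 - t / h) ^ (DIM('a) - 1)) *
       f (P + (1 - t / h) *\<^sub>R (hproj \<nu> c x - P)) \<partial>lborel) \<partial>lborel)"
proof -
  define G where "G x = indicator T x * f x" for x
  have G[measurable]: "G \<in> borel_measurable borel" unfolding G_def by measurable
  have mem: "indicator T (P + r *\<^sub>R (s - P)) = (indicator S s :: ennreal)" if "0 < r" "r < 1" "\<nu> \<bullet> s = c" for r s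
  proof -
    have "s \<in> S" if "P + r *\<^sub>R (s - P) \<in> T"
    proof -
      from that obtain q where q: "q \<in> {0..1} \<times> S" "P + r *\<^sub>R (s - P) = (case q of (r, s) \<Rightarrow> P + r *\<^sub>R (s - P))"
        unfolding T by (rule imageE)
      obtain r' s' where "q = (r', s')" by (cases q)
      with q have rs: "s' \<in> S" "P + r *\<^sub>R (s - P) = P + r' *\<^sub>R (s' - P)" by auto
      have "\<nu> \<bullet> (P + r *\<^sub>R (s - P)) = \<nu> \<bullet> (P + r' *\<^sub>R (s' - P))" using rs by simp
      then have "r * h = r' * h" using rs(1) S P \<open>\<nu> \<bullet> s = c\<close> by (auto simp: inner_add_right inner_diff_right algebra_simps)
      then have "r = r'" using h by simp
      then show ?thesis using rs \<open>0 < r\<close> by simp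
    qed
    moreover have "P + r *\<^sub>R (s - P) \<in> T" if "s \<in> S" using that \<open>0 < r\<close> \<open>r < 1\<close> unfolding T by force
    ultimately show ?thesis by (auto simp: indicator_def)
  qed
  have out: "G (hproj \<nu> c x + t *\<^sub>R \<nu>) = 0" if "t < 0 \<or> h < t" for t x
  proof -
    have "hproj \<nu> c x + t *\<^sub>R \<nu> \<notin> T"
    proof
      assume "hproj \<nu> c x + t *\<^sub>R \<nu> \<in> T"
      then obtain r s where rs: "r \<in> {0..1}" "s \<in> S" "hproj \<nu> c x + t *\<^sub>R \<nu> = P + r *\<^sub>R (s - P)" using T by auto
      have "\<nu> \<bullet> (hproj \<nu> c x + t *\<^sub>R \<nu>) = \<nu> \<bullet> (P + r *\<^sub>R (s - P))" using rs by simp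
      then have "t = (1 - r) * h"
        using rs(2) S P \<nu> by (auto simp: inner_add_right inner_diff_right inner_hproj dot_square_norm algebra_simps)
      then show False using rs(1) h that by (auto simp: mult_less_0_iff mult_le_cancel_right1)
    qed
    then show ?thesis by (simp add: G_def)
  qed
  have "(\<integral>\<^sup>+x. G x \<partial>lborel) = (\<integral>\<^sup>+x. (\<integral>\<^sup>+t. (if \<bar>\<nu> \<bullet> x - c\<bar> \<le> 1/2 then 1 else 0) * G (hproj \<nu> c x + t *\<^sub>R \<nu>) \<partial>lborel) \<partial>lborel)"
    unfolding slab_nn_integral[OF \<nu> G, of c]
    by (intro nn_integral_cong nn_integral_cmult[symmetric]) measurable
  also have "\<dots> = (\<integral>\<^sup>+t. (\<integral>\<^sup>+x. (if \<bar>\<nu> \<bullet> x - c\<bar> \<le> 1/2 then 1 else 0) * G (hproj \<nu> c x + t *\<^sub>R \<nu>) \<partial>lborel) \<partial>lborel)"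
    by (rule lborel_pair.Fubini'[symmetric]) measurable
  also have "\<dots> = (\<integral>\<^sup>+t. (\<integral>\<^sup>+x. ennreal ((if \<bar>\<nu> \<bullet> x - c\<bar> \<le> 1/2 then 1 else 0) * indicator S (hproj \<nu> c x) * indicator {0<..<h} t * (1 - t / h) ^ (DIM('a) - 1)) *
       f (P + (1 - t / h) *\<^sub>R (hproj \<nu> c x - P)) \<partial>lborel) \<partial>lborel)"
  proof (rule nn_integral_cong_AE)
    have "AE t in lborel. t \<noteq> 0 \<and> t \<noteq> h" using AE_lborel_singleton[of 0] AE_lborel_singleton[of h] by eventually_elim auto
    then show "AE t in lborel. (\<integral>\<^sup>+x. (if \<bar>\<nu> \<bullet> x - c\<bar> \<le> 1/2 then 1 else 0) * G (hproj \<nu> c x + t *\<^sub>R \<nu>) \<partial>lborel) =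
      (\<integral>\<^sup>+x. ennreal ((if \<bar>\<nu> \<bullet> x - c\<bar> \<le> 1/2 then 1 else 0) * indicator S (hproj \<nu> c x) * indicator {0<..<h} t * (1 - t / h) ^ (DIM('a) - 1)) *
       f (P + (1 - t / h) *\<^sub>R (hproj \<nu> c x - P)) \<partial>lborel)"
    proof eventually_elim
      case (elim t)
      show ?case
      proof (cases "0 < t \<and> t < h")
        case True
        define r where "r = 1 - t / h"
        have r: "0 < r" "r < 1" using True h by (auto simp: r_def)
        have "(\<integral>\<^sup>+x. (if \<bar>\<nu> \<bullet> x - c\<bar> \<le> 1/2 then 1 else 0) * G (hproj \<nu> c x + t *\<^sub>R \<nu>) \<partial>lborel) =
            ennreal (r ^ (DIM('a) - 1)) * (\<integral>\<^sup>+x. (if \<bar>\<nu> \<bullet> x - c\<bar> \<le> 1/2 then 1 else 0) * G (P + r *\<^sub>R (hproj \<nu> c x - P)) \<partial>lborel)"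
          unfolding r_def using True by (intro slab_slice[OF \<nu> G P h]) simp
        also have "\<dots> = (\<integral>\<^sup>+x. ennreal (r ^ (DIM('a) - 1)) * ((if \<bar>\<nu> \<bullet> x - c\<bar> \<le> 1/2 then 1 else 0) * G (P + r *\<^sub>R (hproj \<nu> c x - P))) \<partial>lborel)"
          by (rule nn_integral_cmult[symmetric]) measurable
        also have "\<dots> = (\<integral>\<^sup>+x. ennreal ((if \<bar>\<nu> \<bullet> x - c\<bar> \<le> 1/2 then 1 else 0) * indicator S (hproj \<nu> c x) * indicator {0<..<h} t * r ^ (DIM('a) - 1)) *
          f (P + r *\<^sub>R (hproj \<nu> c x - P)) \<partial>lborel)"
        proof (rule nn_integral_cong)
          fix x
          have "G (P + r *\<^sub>R (hproj \<nu> c x - P)) = indicator S (hproj \<nu> c x) * f (P + r *\<^sub>R (hproj \<nu> c x - P))"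
            unfolding G_def by (subst mem[OF r inner_hproj[OF \<nu>]]) simp
          then show "ennreal (r ^ (DIM('a) - 1)) * ((if \<bar>\<nu> \<bullet> x - c\<bar> \<le> 1/2 then 1 else 0) * G (P + r *\<^sub>R (hproj \<nu> c x - P))) =
            ennreal ((if \<bar>\<nu> \<bullet> x - c\<bar> \<le> 1/2 then 1 else 0) * indicator S (hproj \<nu> c x) * indicator {0<..<h} t * r ^ (DIM('a) - 1)) *
            f (P + r *\<^sub>R (hproj \<nu> c x - P))"
            using True by (simp add: indicator_def)
        qed
        finally show ?thesis unfolding r_def .
      next
        case False
        then have "t < 0 \<or> h < t" using elim by auto
        then show ?thesis using False by (simp add: out)
      qed
    qed
  qed
  finally show ?thesis unfolding G_def .
qed

section \<open>Integrals over flat pieces and the cone formula\<close>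

lemma surface_measure_eq:
  fixes \<nu> :: "'a::euclidean_space"
  assumes "norm \<nu> = 1" "affine hull S = {x. \<nu> \<bullet> x = c}"
  shows "surface_measure S = distr (lebesgue_on {x. hproj \<nu> c x \<in> S \<and> \<bar>\<nu> \<bullet> x - c\<bar> \<le> 1/2}) borel (hproj \<nu> c)"
proof -
  have "dist x (hproj \<nu> c x) = \<bar>\<nu> \<bullet> x - c\<bar>" for x
    using assms(1) by (simp add: hproj_def dist_norm)
  then show ?thesis
    unfolding surface_measure_def assms(2) closest_point_hyperplane[OF assms(1)] Let_def by simp
qed

lemma sets_surface_measure[measurable_cong]: "sets (surface_measure S) = sets borel"
  by (simp add: surface_measure_def Let_def)

lemma space_surface_measure[simp]: "space (surface_measure S) = UNIV"
  by (simp add: surface_measure_def Let_def)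

context
  fixes \<nu> :: "'a::euclidean_space" and c :: real and S :: "'a set"
  assumes \<nu>: "norm \<nu> = 1" and aff: "affine hull S = {x. \<nu> \<bullet> x = c}" and [measurable]: "S \<in> sets borel"
begin

lemma prism_borel[measurable]: "{x. hproj \<nu> c x \<in> S \<and> \<bar>\<nu> \<bullet> x - c\<bar> \<le> 1/2} \<in> sets borel"
proof -
  have "{x \<in> space borel. hproj \<nu> c x \<in> S \<and> \<bar>\<nu> \<bullet> x - c\<bar> \<le> 1/2} \<in> sets borel" by measurable
  then show ?thesis by simp
qed

lemma hproj_measurable_lebesgue_on: "hproj \<nu> c \<in> measurable (lebesgue_on A) borel"
  by (intro measurable_restrict_space1 measurable_completion) measurable

lemma indicator_prism: "indicator {x. hproj \<nu> c x \<in> S \<and> \<bar>\<nu> \<bullet> x - c\<bar> \<le> 1/2} x =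
   ((if \<bar>\<nu> \<bullet> x - c\<bar> \<le> 1/2 then 1 else 0) * indicator S (hproj \<nu> c x) :: real)"
  by (auto simp: indicator_def)

text \<open>For a Borel integrand the completed measure on the prism can be replaced by
  \<open>lborel\<close>, where the Fubini arguments take place. The prism turns into the indicator
  factors of the slab formulas.\<close>

lemma surface_integral_eq:
  fixes g :: "'a \<Rightarrow> real"
  assumes [measurable]: "g \<in> borel_measurable borel"
  shows "(LINT s|surface_measure S. g s) =
    (LINT x|lborel. (if \<bar>\<nu> \<bullet> x - c\<bar> \<le> 1/2 then 1 else 0) * indicator S (hproj \<nu> c x) * g (hproj \<nu> c x))"
proof -
  have "(LINT s|surface_measure S. g s) = (LINT x|lebesgue_on {x. hproj \<nu> c x \<in> S \<and> \<bar>\<nu> \<bullet> x - c\<bar> \<le> 1/2}. g (hproj \<nu> c x))"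
    unfolding surface_measure_eq[OF \<nu> aff] by (rule integral_distr[OF hproj_measurable_lebesgue_on]) measurable
  also have "\<dots> = (LINT x|lebesgue. indicator {x. hproj \<nu> c x \<in> S \<and> \<bar>\<nu> \<bullet> x - c\<bar> \<le> 1/2} x *\<^sub>R g (hproj \<nu> c x))"
    using prism_borel by (intro integral_restrict_space) simp
  also have "\<dots> = (LINT x|lborel. indicator {x. hproj \<nu> c x \<in> S \<and> \<bar>\<nu> \<bullet> x - c\<bar> \<le> 1/2} x *\<^sub>R g (hproj \<nu> c x))"
    by (rule integral_completion) measurable
  finally show ?thesis unfolding indicator_prism by simp
qed

lemma surface_integrable_iff:
  fixes g :: "'a \<Rightarrow> real"
  assumes [measurable]: "g \<in> borel_measurable borel"
  shows "integrable (surface_measure S) g \<longleftrightarrow>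
    integrable lborel (\<lambda>x. (if \<bar>\<nu> \<bullet> x - c\<bar> \<le> 1/2 then 1 else 0) * indicator S (hproj \<nu> c x) * g (hproj \<nu> c x))"
proof -
  have "integrable (surface_measure S) g \<longleftrightarrow> integrable (lebesgue_on {x. hproj \<nu> c x \<in> S \<and> \<bar>\<nu> \<bullet> x - c\<bar> \<le> 1/2}) (\<lambda>x. g (hproj \<nu> c x))"
    unfolding surface_measure_eq[OF \<nu> aff] by (rule integrable_distr_eq[OF hproj_measurable_lebesgue_on]) measurable
  also have "\<dots> \<longleftrightarrow> integrable lebesgue (\<lambda>x. indicator {x. hproj \<nu> c x \<in> S \<and> \<bar>\<nu> \<bullet> x - c\<bar> \<le> 1/2} x *\<^sub>R g (hproj \<nu> c x))"
    using prism_borel by (intro integrable_restrict_space) simp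
  also have "\<dots> \<longleftrightarrow> integrable lborel (\<lambda>x. indicator {x. hproj \<nu> c x \<in> S \<and> \<bar>\<nu> \<bullet> x - c\<bar> \<le> 1/2} x *\<^sub>R g (hproj \<nu> c x))"
    by (rule integrable_completion) measurable
  finally show ?thesis unfolding indicator_prism by simp
qed

lemma surface_integrable_continuous:
  fixes g :: "'a \<Rightarrow> real"
  assumes g: "continuous_on UNIV g" and "compact S"
  shows "integrable (surface_measure S) g"
proof -
  let ?A = "{x. hproj \<nu> c x \<in> S \<and> \<bar>\<nu> \<bullet> x - c\<bar> \<le> 1/2}"
  have gm[measurable]: "g \<in> borel_measurable borel" using borel_measurable_continuous_onI[OF g] .
  have cont: "continuous_on UNIV (hproj \<nu> c)" unfolding hproj_def by (intro continuous_intros)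
  have "closed (hproj \<nu> c -` S \<inter> {x. \<bar>\<nu> \<bullet> x - c\<bar> \<le> 1/2})"
    using \<open>compact S\<close> cont
    by (intro closed_Int continuous_closed_vimage closed_Collect_le continuous_intros)
       (auto simp: continuous_on_eq_continuous_at compact_imp_closed)
  then have cl: "closed ?A" by (simp add: vimage_def Collect_conj_eq)
  obtain R where R: "\<And>x. x \<in> S \<Longrightarrow> norm x \<le> R" using compact_imp_bounded[OF \<open>compact S\<close>] by (auto simp: bounded_iff)
  have "norm x \<le> R + 1" if "x \<in> ?A" for x
  proof -
    have "norm x \<le> norm (hproj \<nu> c x) + norm ((\<nu> \<bullet> x - c) *\<^sub>R \<nu>)"
      using norm_triangle_ineq[of "hproj \<nu> c x" "(\<nu> \<bullet> x - c) *\<^sub>R \<nu>"] by (simp add: hproj_def)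
    then show ?thesis using that R[of "hproj \<nu> c x"] \<nu> by auto
  qed
  then have "bounded ?A" unfolding bounded_iff by blast
  then have "compact ?A" using cl by (simp add: compact_eq_bounded_closed)
  then have "integrable lborel (\<lambda>x. indicator ?A x *\<^sub>R g (hproj \<nu> c x))"
    by (intro borel_integrable_compact continuous_on_compose2[OF g continuous_on_subset[OF cont]]) auto
  then show ?thesis unfolding surface_integrable_iff[OF gm] indicator_prism by simp
qed

text \<open>On the ray \<open>P + r (s - P)\<close> the integrand times \<open>r ^ (d - 1)\<close>
  is the derivative in \<open>r\<close> of \<open>r ^ d\<close> times \<theta>. The integral along
  the ray thus collapses to the value of \<theta> at the base point; the factor \<open>r ^ d\<close>
  removes the apex.\<close>

lemma cone_formula:
  fixes P :: 'a and \<theta> :: "'a \<Rightarrow> real"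
  assumes P: "\<nu> \<bullet> P = c + h" and h: "0 < h" and cS: "compact S"
    and T: "T = (\<lambda>(r, s). P + r *\<^sub>R (s - P)) ` ({0..1} \<times> S)"
    and sm: "smooth \<theta>"
  shows "(LINT x|lborel. indicator T x * ((x - P) \<bullet> gradient \<theta> x + DIM('a) * \<theta> x)) =
    h * (LINT s|surface_measure S. \<theta> s)"
proof -
  have SH: "S \<subseteq> {x. \<nu> \<bullet> x = c}" using aff hull_subset by metis
  have "compact T" unfolding T
    by (intro compact_continuous_image compact_Times cS) (auto simp: case_prod_beta intro!: continuous_intros)
  then have [measurable]: "T \<in> sets borel" by (simp add: borel_compact)
  define f where "f x = (x - P) \<bullet> gradient \<theta> x + DIM('a) * \<theta> x" for x
  have fc: "continuous_on UNIV f" unfolding f_def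
    by (intro continuous_intros smooth_continuous_gradient smooth_continuous sm)
  have [measurable]: "f \<in> borel_measurable borel" using borel_measurable_continuous_onI[OF fc] .
  have thetam[measurable]: "\<theta> \<in> borel_measurable borel" using borel_measurable_continuous_onI[OF smooth_continuous[OF sm]] .
  define k where "k x = ((if \<bar>\<nu> \<bullet> x - c\<bar> \<le> 1/2 then 1 else 0) * indicator S (hproj \<nu> c x) :: real)" for x
  define W where "W y t = k y * indicator {0<..<h} t * (1 - t / h) ^ (DIM('a) - 1)" for y t
  define \<Phi> where "\<Phi> = (\<lambda>(y, t). P + (1 - t / h) *\<^sub>R (hproj \<nu> c y - P))"
  have [measurable]: "k \<in> borel_measurable borel" unfolding k_def by measurable
  have Wm[measurable]: "(\<lambda>(y, t). W y t) \<in> borel_measurable (lborel \<Otimes>\<^sub>M lborel)" unfolding W_def by measurable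
  have \<Phi>m[measurable]: "\<Phi> \<in> measurable (lborel \<Otimes>\<^sub>M lborel) borel" unfolding \<Phi>_def by measurable
  have k0: "0 \<le> k y" for y by (simp add: k_def)
  have W0: "0 \<le> W y t" for y t using h k0 by (auto simp: W_def indicator_def)
  \<comment> \<open>The change of variables is phrased as an equality of measures, so that it
    carries over from nonnegative integrands to the signed \<open>f\<close>.\<close>
  define M where "M = density (lborel \<Otimes>\<^sub>M lborel) (\<lambda>p. ennreal ((\<lambda>(y, t). W y t) p))"
  have Meq: "density lborel (\<lambda>x. ennreal (indicator T x)) = distr M borel \<Phi>"
  proof (rule measure_eqI)
    fix A assume "A \<in> sets (density lborel (\<lambda>x. ennreal (indicator T x)))"
    then have [measurable]: "A \<in> sets borel" by simp
    have "emeasure (density lborel (\<lambda>x. ennreal (indicator T x))) A = (\<integral>\<^sup>+x. indicator T x * indicator A x \<partial>lborel)"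
      by (subst emeasure_density) (auto intro!: nn_integral_cong simp: indicator_def)
    also have "\<dots> = (\<integral>\<^sup>+t. (\<integral>\<^sup>+y. ennreal (W y t) * indicator A (\<Phi> (y, t)) \<partial>lborel) \<partial>lborel)"
      unfolding W_def k_def \<Phi>_def prod.case by (rule cone_nn_integral[OF \<nu> _ P h SH _ T]) measurable
    also have "\<dots> = (\<integral>\<^sup>+p. ennreal ((\<lambda>(y, t). W y t) p) * indicator A (\<Phi> p) \<partial>(lborel \<Otimes>\<^sub>M lborel))"
      by (subst lborel_pair.nn_integral_snd[symmetric]) (auto simp: case_prod_beta)
    also have "\<dots> = emeasure (distr M borel \<Phi>) A"
    proof -
      have pre: "\<Phi> -` A \<inter> space (lborel \<Otimes>\<^sub>M lborel) \<in> sets (lborel \<Otimes>\<^sub>M lborel)"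
        by (rule measurable_sets[OF \<Phi>m]) simp
      have "emeasure (distr M borel \<Phi>) A = emeasure M (\<Phi> -` A \<inter> space M)"
        by (rule emeasure_distr) (auto simp: M_def)
      also have "\<dots> = (\<integral>\<^sup>+p. ennreal ((\<lambda>(y, t). W y t) p) * indicator (\<Phi> -` A \<inter> space (lborel \<Otimes>\<^sub>M lborel)) p \<partial>(lborel \<Otimes>\<^sub>M lborel))"
        unfolding M_def space_density using pre Wm by (intro emeasure_density) auto
      also have "\<dots> = (\<integral>\<^sup>+p. ennreal ((\<lambda>(y, t). W y t) p) * indicator A (\<Phi> p) \<partial>(lborel \<Otimes>\<^sub>M lborel))"
        by (intro nn_integral_cong) (simp add: indicator_def)
      finally show ?thesis by simp
    qed
    finally show "emeasure (density lborel (\<lambda>x. ennreal (indicator T x))) A = emeasure (distr M borel \<Phi>) A" .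
  qed simp
  have "integrable (density lborel (\<lambda>x. ennreal (indicator T x))) f"
    using borel_integrable_compact[OF \<open>compact T\<close> continuous_on_subset[OF fc]]
    by (subst integrable_density) auto
  then have int2: "integrable (lborel \<Otimes>\<^sub>M lborel) (\<lambda>p. (\<lambda>(y, t). W y t) p *\<^sub>R f (\<Phi> p))"
    unfolding Meq M_def using W0
    by (subst (asm) integrable_distr_eq, simp, simp, subst (asm) integrable_density) (auto simp: case_prod_beta)
  have "(LINT x|lborel. indicator T x * f x) = (LINT x|density lborel (\<lambda>x. ennreal (indicator T x)). f x)"
    by (subst integral_density) auto
  also have "\<dots> = (LINT p|M. f (\<Phi> p))"
    unfolding Meq by (rule integral_distr) (auto simp: M_def)
  also have "\<dots> = (LINT p|(lborel \<Otimes>\<^sub>M lborel). (\<lambda>(y, t). W y t) p *\<^sub>R f (\<Phi> p))"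
    unfolding M_def using W0 by (subst integral_density) (auto simp: case_prod_beta)
  also have "\<dots> = (LINT y|lborel. LINT t|lborel. W y t * f (\<Phi> (y, t)))"
    using lborel_pair.integral_fst'[OF int2] by simp
  also have "\<dots> = (LINT y|lborel. k y * (h * \<theta> (hproj \<nu> c y)))"
  proof (intro Bochner_Integration.integral_cong refl)
    fix y :: 'a
    define s where "s = hproj \<nu> c y"
    \<comment> \<open>An antiderivative along the ray: it equals \<open>- h * \<theta> s\<close> at
      the base \<open>t = 0\<close> and vanishes at the apex \<open>t = h\<close>.\<close>
    define F where "F t = - h * (1 - t / h) ^ DIM('a) * \<theta> (P + (1 - t / h) *\<^sub>R (s - P))" for t
    define F' where "F' t = (1 - t / h) ^ (DIM('a) - 1) * f (P + (1 - t / h) *\<^sub>R (s - P))" for t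
    have D: "DERIV F t :> F' t" for t
    proof -
      define r where "r = 1 - t / h"
      have "((\<lambda>t. P + (1 - t / h) *\<^sub>R (s - P)) has_derivative (\<lambda>v. (- v / h) *\<^sub>R (s - P))) (at t)"
        using h by (auto intro!: derivative_eq_intros)
      from has_derivative_compose[OF this smooth_has_derivative[OF sm]]
      have d1: "((\<lambda>t. \<theta> (P + (1 - t / h) *\<^sub>R (s - P))) has_real_derivative
        (- 1 / h * (gradient \<theta> (P + r *\<^sub>R (s - P)) \<bullet> (s - P)))) (at t)"
        unfolding has_field_derivative_def r_def by (rule has_derivative_eq_rhs) (auto simp: fun_eq_iff)
      have d2: "((\<lambda>t. - h * (1 - t / h) ^ DIM('a)) has_real_derivative (real DIM('a) * r ^ (DIM('a) - 1))) (at t)"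
      proof -
        have "((\<lambda>t. 1 - t / h) has_real_derivative (- 1 / h)) (at t)"
          using h by (auto intro!: derivative_eq_intros)
        from DERIV_cmult[OF DERIV_power[OF this, of "DIM('a)"], of "- h"] show ?thesis
          using h by (simp add: r_def)
      qed
      have p: "r ^ DIM('a) = r ^ (DIM('a) - 1) * r"
        by (metis DIM_positive Suc_diff_1 power_Suc2)
      have "DERIV F t :> (real DIM('a) * r ^ (DIM('a) - 1)) * \<theta> (P + r *\<^sub>R (s - P)) +
          (- 1 / h * (gradient \<theta> (P + r *\<^sub>R (s - P)) \<bullet> (s - P))) * (- h * r ^ DIM('a))"
        unfolding F_def using DERIV_mult[OF d2 d1] unfolding r_def by simp
      also have "(real DIM('a) * r ^ (DIM('a) - 1)) * \<theta> (P + r *\<^sub>R (s - P)) +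
          (- 1 / h * (gradient \<theta> (P + r *\<^sub>R (s - P)) \<bullet> (s - P))) * (- h * r ^ DIM('a)) = F' t"
        using h unfolding F'_def f_def r_def[symmetric] p
        by (simp add: algebra_simps inner_commute)
      finally show ?thesis .
    qed
    have "(LINT t|lborel. W y t * f (\<Phi> (y, t))) = (LINT t|lborel. k y * (F' t * indicator {0..h} t))"
    proof (rule integral_cong_AE)
      have [measurable]: "(\<lambda>t. W y t) \<in> borel_measurable lborel" unfolding W_def by measurable
      show "(\<lambda>t. W y t * f (\<Phi> (y, t))) \<in> borel_measurable lborel" by measurable
      show "(\<lambda>t. k y * (F' t * indicat_real {0..h} t)) \<in> borel_measurable lborel" unfolding F'_def by measurable
      have "AE t in lborel. t \<noteq> 0 \<and> t \<noteq> h" using AE_lborel_singleton[of 0] AE_lborel_singleton[of h] by eventually_elim auto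
      then show "AE t in lborel. W y t * f (\<Phi> (y, t)) = k y * (F' t * indicator {0..h} t)"
        by eventually_elim (auto simp: W_def F'_def \<Phi>_def s_def indicator_def)
    qed
    also have "\<dots> = k y * (LINT t|lborel. F' t * indicator {0..h} t)" by simp
    also have "(LINT t|lborel. F' t * indicator {0..h} t) = F h - F 0"
    proof (rule integral_FTC_Icc_real)
      show "isCont F' t" for t unfolding F'_def
        by (intro continuous_intros continuous_on_interior[OF continuous_on_compose2[OF fc, of UNIV]]) (use h in auto)
    qed (use h D in auto)
    also have "F h - F 0 = h * \<theta> s" using h by (simp add: F_def)
    finally show "(LINT t|lborel. W y t * f (\<Phi> (y, t))) = k y * (h * \<theta> (hproj \<nu> c y))" by (simp add: s_def)
  qed
  also have "\<dots> = h * (LINT s|surface_measure S. \<theta> s)"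
    unfolding surface_integral_eq[OF thetam] k_def by (simp add: mult.left_commute[of _ h])
  finally show ?thesis unfolding f_def .
qed

end

text \<open>Lebesgue measure is complete, so the part of a preimage inside the exceptional null set
  is measurable. This gives measurability of \<open>weak_grad\<close> and \<open>weak_div\<close>,
  which are chosen rather than constructed.\<close>

lemma borel_measurable_lebesgue_AE:
  fixes f g :: "'a::euclidean_space \<Rightarrow> 'b::topological_space"
  assumes f: "f \<in> borel_measurable lebesgue" and fg: "AE x in lebesgue. f x = g x"
  shows "g \<in> borel_measurable lebesgue"
proof (rule measurableI)
  fix A :: "'b set" assume A: "A \<in> sets borel"
  obtain N where N: "{x. f x \<noteq> g x} \<subseteq> N" "N \<in> null_sets lebesgue"
    using fg unfolding eventually_ae_filter by auto
  have "negligible (N \<inter> g -` A)"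
    using N(2) negligible_iff_null_sets negligible_subset by (metis inf_le1)
  then have "N \<inter> g -` A \<in> sets lebesgue" by (auto simp: negligible_iff_null_sets)
  moreover have "f -` A \<in> sets lebesgue" using measurable_sets[OF f A] by simp
  ultimately have "(f -` A - N) \<union> (N \<inter> g -` A) \<in> sets lebesgue" using N(2) by auto
  also have "(f -` A - N) \<union> (N \<inter> g -` A) = g -` A \<inter> space lebesgue" using N(1) by (auto; metis (mono_tags, lifting) mem_Collect_eq subsetD)
  finally show "g -` A \<inter> space lebesgue \<in> sets lebesgue" .
qed simp

text \<open>Elements lie in the closure of \<Omega>, but the frontier of a convex set is negligible,
  so it is enough that the interior lies in \<Omega>.\<close>

lemma AE_convex_interior:
  fixes T :: "'a::euclidean_space set"
  assumes "convex T" "interior T \<subseteq> \<Omega>" "\<Omega> \<in> sets lebesgue" "T \<in> sets lebesgue"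
    and "AE x in lebesgue_on \<Omega>. Q x"
  shows "AE x in lebesgue_on T. Q x"
proof -
  have 1: "AE x in lebesgue. x \<in> \<Omega> \<longrightarrow> Q x" using assms by (simp add: AE_restrict_space_iff)
  have 2: "AE x in lebesgue. x \<notin> frontier T"
    using negligible_convex_frontier[OF assms(1)] by (intro AE_not_in) (simp add: negligible_iff_null_sets)
  have "AE x in lebesgue. x \<in> T \<longrightarrow> Q x" using 1 2
  proof eventually_elim
    case (elim x)
    then show ?case using assms(2) closure_subset[of T] by (auto simp: frontier_def)
  qed
  then show ?thesis using assms by (simp add: AE_restrict_space_iff)
qed

lemma integrable_convex_interior:
  fixes T :: "'a::euclidean_space set" and f :: "'a \<Rightarrow> 'b::euclidean_space"
  assumes "convex T" "interior T \<subseteq> \<Omega>" "\<Omega> \<in> sets lebesgue" "T \<in> sets lebesgue"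
    and "integrable (lebesgue_on \<Omega>) f"
  shows "integrable (lebesgue_on T) f"
proof -
  have "integrable lebesgue (\<lambda>x. indicator \<Omega> x *\<^sub>R f x)" using assms by (simp add: integrable_restrict_space)
  then have i: "integrable lebesgue (\<lambda>x. indicator T x *\<^sub>R (indicator \<Omega> x *\<^sub>R f x))"
    using assms(4) by (rule integrable_mult_indicator[rotated])
  have 2: "AE x in lebesgue. x \<notin> frontier T"
    using negligible_convex_frontier[OF assms(1)] by (intro AE_not_in) (simp add: negligible_iff_null_sets)
  then have e: "AE x in lebesgue. indicator T x *\<^sub>R (indicator \<Omega> x *\<^sub>R f x) = indicator T x *\<^sub>R f x"
  proof eventually_elim
    case (elim x)
    then have "x \<in> T \<Longrightarrow> x \<in> \<Omega>" using assms(2) closure_subset[of T] by (auto simp: frontier_def)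
    then show ?case by (cases "x \<in> T") auto
  qed
  have "integrable lebesgue (\<lambda>x. indicator T x *\<^sub>R f x)"
    by (rule integrable_cong_AE_imp[OF i borel_measurable_lebesgue_AE[OF borel_measurable_integrable[OF i] e] e])
  then show ?thesis using assms(4) by (simp add: integrable_restrict_space)
qed

lemma Lspace_1_iff: "f \<in> Lspace 1 \<Omega> \<longleftrightarrow> integrable (lebesgue_on \<Omega>) f"
proof -
  have "integrable (lebesgue_on \<Omega>) (\<lambda>x. norm (f x)) \<Longrightarrow> f \<in> borel_measurable (lebesgue_on \<Omega>) \<Longrightarrow> integrable (lebesgue_on \<Omega>) f"
    by (simp add: integrable_norm_iff)
  then show ?thesis by (auto simp: Lspace_def)
qed

text \<open>Membership supplies some integrable weak gradient; integrability passes to the chosen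
  \<open>weak_grad\<close> because the two agree almost everywhere.\<close>

lemma sobolev_1_cases:
  assumes "w \<in> sobolev 1 \<Omega>" "open \<Omega>"
  shows "integrable (lebesgue_on \<Omega>) w" "integrable (lebesgue_on \<Omega>) (weak_grad \<Omega> w)"
    "has_weak_grad \<Omega> w (weak_grad \<Omega> w)"
proof -
  obtain G where G: "integrable (lebesgue_on \<Omega>) G" "has_weak_grad \<Omega> w G" and w: "integrable (lebesgue_on \<Omega>) w"
    using assms by (auto simp: sobolev_def Lspace_1_iff)
  show "integrable (lebesgue_on \<Omega>) w" by fact
  show hw: "has_weak_grad \<Omega> w (weak_grad \<Omega> w)" using has_weak_grad_weak_grad[OF G(2)] .
  have Om: "\<Omega> \<in> sets lebesgue" using assms(2) by simp
  have e: "AE x in lebesgue. indicator \<Omega> x *\<^sub>R G x = indicator \<Omega> x *\<^sub>R weak_grad \<Omega> w x"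
    using weak_grad_AE_eq[OF assms(2) G(2)] Om unfolding AE_restrict_space_iff[OF Om[THEN sets.Int_space_eq2[THEN arg_cong2[where f="(\<in>)"], THEN iffD2]]]
    by (auto simp: indicator_def AE_restrict_space_iff elim: eventually_mono)
  have i: "integrable lebesgue (\<lambda>x. indicator \<Omega> x *\<^sub>R G x)" using G(1) Om by (simp add: integrable_restrict_space)
  have "integrable lebesgue (\<lambda>x. indicator \<Omega> x *\<^sub>R weak_grad \<Omega> w x)"
    by (rule integrable_cong_AE_imp[OF i borel_measurable_lebesgue_AE[OF borel_measurable_integrable[OF i] e] e])
  then show "integrable (lebesgue_on \<Omega>) (weak_grad \<Omega> w)" using Om by (simp add: integrable_restrict_space)
qed

lemma integrable_continuous_bounded:
  fixes f :: "'a::euclidean_space \<Rightarrow> 'b::euclidean_space"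
  assumes "continuous_on UNIV f" "bounded \<Omega>" "\<Omega> \<in> sets lebesgue"
  shows "integrable (lebesgue_on \<Omega>) f"
proof -
  have "compact (closure \<Omega>)" using assms(2) by simp
  then have "integrable lborel (\<lambda>x. indicator (closure \<Omega>) x *\<^sub>R f x)"
    by (intro borel_integrable_compact continuous_on_subset[OF assms(1)]) auto
  then have "integrable lebesgue (\<lambda>x. indicator (closure \<Omega>) x *\<^sub>R f x)"
    by (subst integrable_completion) auto
  then have "integrable lebesgue (\<lambda>x. indicator \<Omega> x *\<^sub>R (indicator (closure \<Omega>) x *\<^sub>R f x))"
    by (rule integrable_mult_indicator[OF assms(3)])
  also have "(\<lambda>x. indicator \<Omega> x *\<^sub>R (indicator (closure \<Omega>) x *\<^sub>R f x)) = (\<lambda>x. indicator \<Omega> x *\<^sub>R f x)"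
    using closure_subset[of \<Omega>] by (intro ext) (auto simp: indicator_def subset_iff)
  finally show ?thesis using assms(3) by (simp add: integrable_restrict_space)
qed

lemma integrable_bounded_mult:
  fixes f :: "'a::euclidean_space \<Rightarrow> 'b::euclidean_space"
  assumes "integrable M f" "g \<in> borel_measurable M" "AE x in M. \<bar>g x\<bar> \<le> C"
  shows "integrable M (\<lambda>x. g x *\<^sub>R f x)"
proof (rule Bochner_Integration.integrable_bound)
  show "integrable M (\<lambda>x. C *\<^sub>R norm (f x))" using assms(1) by (intro integrable_scaleR_right integrable_norm)
  show "(\<lambda>x. g x *\<^sub>R f x) \<in> borel_measurable M" using assms(1,2) by (intro borel_measurable_scaleR) auto
  show "AE x in M. norm (g x *\<^sub>R f x) \<le> norm (C *\<^sub>R norm (f x))"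
    using assms(3) by eventually_elim (auto simp: abs_mult intro!: mult_right_mono)
qed

lemma continuous_measurable_lebesgue_on:
  fixes f :: "'a::euclidean_space \<Rightarrow> 'b::euclidean_space"
  assumes "continuous_on UNIV f" shows "f \<in> borel_measurable (lebesgue_on A)"
  using borel_measurable_continuous_onI[OF assms] by (intro measurable_restrict_space1 measurable_completion) simp

lemma compact_continuous_bound:
  fixes f :: "'a::euclidean_space \<Rightarrow> 'b::real_normed_vector"
  assumes "continuous_on UNIV f" "compact K"
  obtains C where "0 \<le> C" "\<And>x. x \<in> K \<Longrightarrow> norm (f x) \<le> C"
proof -
  obtain C where C: "\<And>x. x \<in> K \<Longrightarrow> norm (f x) \<le> C"
    using compact_imp_bounded[OF compact_continuous_image[OF continuous_on_subset[OF assms(1)] assms(2)]]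
    by (auto simp: bounded_iff)
  show ?thesis by (rule that[of "max 0 C"]) (auto intro: order_trans[OF C])
qed

lemma norm_integral_le_AE:
  fixes f :: "'a \<Rightarrow> 'b::{banach, second_countable_topology}"
  assumes "integrable M f" "integrable M g" "AE x in M. norm (f x) \<le> g x"
  shows "norm (LINT x|M. f x) \<le> (LINT x|M. g x)"
  by (rule order_trans[OF integral_norm_bound integral_mono_AE]) (use assms in auto)

text \<open>The products of \<eta> with the smooth approximations from the definition of the trace
  are smooth, so the cone formula applies to them. In the limit the volume side converges by
  approximation in \<open>W^{1,1}\<close> and the surface side by approximation in
  \<open>L^1\<close>, since \<eta> and its gradient are bounded on the compact cone. The weight
  \<eta> later localizes the formula near one side.\<close>

lemma trace_cone_formula:
  fixes \<nu> P :: "'a::euclidean_space" and \<eta> w :: "'a \<Rightarrow> real"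
  assumes \<nu>: "norm \<nu> = 1" and aff: "affine hull S = {x. \<nu> \<bullet> x = c}"
    and P: "\<nu> \<bullet> P = c + h" and h: "0 < h" and cS: "compact S"
    and T: "T = (\<lambda>(r, s). P + r *\<^sub>R (s - P)) ` ({0..1} \<times> S)" and "convex T"
    and Om: "open \<Omega>" "bounded \<Omega>" "interior T \<subseteq> \<Omega>"
    and tr: "has_trace \<Omega> S w g" and sm: "smooth \<eta>"
  shows "(LINT x|lebesgue_on T. (x - P) \<bullet> (\<eta> x *\<^sub>R weak_grad \<Omega> w x + w x *\<^sub>R gradient \<eta> x) + DIM('a) * (\<eta> x * w x)) =
    h * (LINT s|surface_measure S. \<eta> s * g s)"
proof -
  let ?G = "weak_grad \<Omega> w"
  have [measurable]: "S \<in> sets borel" using cS by (simp add: borel_compact)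
  have Oml: "\<Omega> \<in> sets lebesgue" using Om by simp
  have "compact T" unfolding T
    by (intro compact_continuous_image compact_Times cS) (auto simp: case_prod_beta intro!: continuous_intros)
  then have Tl: "T \<in> sets lebesgue" and Tb: "T \<in> sets borel" by (auto intro: lmeasurable_compact fmeasurableD borel_compact)
  note conv = \<open>convex T\<close> Om(3) Oml Tl
  have w: "w \<in> sobolev 1 \<Omega>" and g: "integrable (surface_measure S) g" using tr by (auto simp: has_trace_def)
  obtain \<theta> :: "nat \<Rightarrow> 'a \<Rightarrow> real" where th: "\<And>j. smooth (\<theta> j)"
      "(\<lambda>j. sobolev_norm 1 \<Omega> (\<lambda>x. \<theta> j x - w x)) \<longlonglongrightarrow> 0"
      "(\<lambda>j. LINT x|surface_measure S. \<bar>\<theta> j x - g x\<bar>) \<longlonglongrightarrow> 0"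
    using tr by (auto simp: has_trace_def)
  note wi = sobolev_1_cases[OF w Om(1)]
  have thi: "integrable (lebesgue_on \<Omega>) (\<theta> j)" "integrable (lebesgue_on \<Omega>) (gradient (\<theta> j))" for j
    by (intro integrable_continuous_bounded smooth_continuous smooth_continuous_gradient th Om(2) Oml)+
  have ae: "AE x in lebesgue_on \<Omega>. weak_grad \<Omega> (\<lambda>x. \<theta> j x - w x) x = gradient (\<theta> j) x - ?G x" for j
    by (intro weak_grad_AE_eq Om has_weak_grad_diff Oml smooth_has_weak_grad th wi)
  define e where "e j x = \<bar>\<theta> j x - w x\<bar>" for j x
  define e' where "e' j x = norm (gradient (\<theta> j) x - ?G x)" for j x
  have ei: "integrable (lebesgue_on \<Omega>) (e j)" "integrable (lebesgue_on \<Omega>) (e' j)" for j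
    unfolding e_def e'_def using thi wi by auto
  have eiT: "integrable (lebesgue_on T) (e j)" "integrable (lebesgue_on T) (e' j)" for j
    using integrable_convex_interior[OF conv] ei by blast+
  \<comment> \<open>The norm in the definition of the trace involves the chosen weak gradient of the
    difference, which equals \<open>gradient (\<theta> j) x - ?G x\<close> only almost
    everywhere.\<close>
  have norm: "sobolev_norm 1 \<Omega> (\<lambda>x. \<theta> j x - w x) = (LINT x|lebesgue_on \<Omega>. e j x) + (LINT x|lebesgue_on \<Omega>. e' j x)" for j
  proof -
    have "(LINT x|lebesgue_on \<Omega>. norm (weak_grad \<Omega> (\<lambda>x. \<theta> j x - w x) x)) = (LINT x|lebesgue_on \<Omega>. e' j x)"
    proof (rule integral_cong_AE)
      have "weak_grad \<Omega> (\<lambda>x. \<theta> j x - w x) \<in> borel_measurable (lebesgue_on \<Omega>)"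
      proof -
        have s: "(\<lambda>x. \<theta> j x - w x) \<in> sobolev 1 \<Omega>"
          unfolding sobolev_def Lspace_1_iff using thi wi
          by (auto simp: Lspace_1_iff intro!: bexI[of _ "\<lambda>x. gradient (\<theta> j) x - ?G x"] has_weak_grad_diff Oml smooth_has_weak_grad th)
        show ?thesis using sobolev_1_cases(2)[OF s Om(1)] by auto
      qed
      then show "(\<lambda>x. norm (weak_grad \<Omega> (\<lambda>x. \<theta> j x - w x) x)) \<in> borel_measurable (lebesgue_on \<Omega>)" by measurable
      show "e' j \<in> borel_measurable (lebesgue_on \<Omega>)" using ei by auto
      show "AE x in lebesgue_on \<Omega>. norm (weak_grad \<Omega> (\<lambda>x. \<theta> j x - w x) x) = e' j x"
        using ae[of j] by eventually_elim (simp add: e'_def)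
    qed
    moreover have "0 \<le> (LINT x|lebesgue_on \<Omega>. e j x)" "0 \<le> (LINT x|lebesgue_on \<Omega>. e' j x)"
      by (auto intro!: Bochner_Integration.integral_nonneg simp: e_def e'_def)
    ultimately show ?thesis unfolding sobolev_norm_def by (simp add: e_def)
  qed
  note ce = smooth_continuous[OF sm] and cg = smooth_continuous_gradient[OF sm]
  have c1: "continuous_on UNIV (\<lambda>x. \<eta> x *\<^sub>R (x - P))" by (intro continuous_intros ce)
  have c2: "continuous_on UNIV (\<lambda>x. (x - P) \<bullet> gradient \<eta> x + DIM('a) * \<eta> x)" by (intro continuous_intros ce cg)
  obtain C where C: "0 \<le> C" "\<And>x. x \<in> T \<Longrightarrow> norm (\<eta> x *\<^sub>R (x - P)) \<le> C"
    using compact_continuous_bound[OF c1 \<open>compact T\<close>] by blast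
  obtain C' where C': "0 \<le> C'" "\<And>x. x \<in> T \<Longrightarrow> norm ((x - P) \<bullet> gradient \<eta> x + DIM('a) * \<eta> x) \<le> C'"
    using compact_continuous_bound[OF c2 \<open>compact T\<close>] by blast
  obtain C'' where C'': "0 \<le> C''" "\<And>x. x \<in> S \<Longrightarrow> norm (\<eta> x) \<le> C''"
    using compact_continuous_bound[OF smooth_continuous[OF sm] cS] by blast
  \<comment> \<open>The volume integrand as a linear expression in a function \<open>v\<close> and
    its gradient \<open>V\<close>, so that the approximation error can be inserted for both.\<close>
  define A where "A v V x = (x - P) \<bullet> (\<eta> x *\<^sub>R V x + v x *\<^sub>R gradient \<eta> x) + DIM('a) * (\<eta> x * v x)" for v :: "'a \<Rightarrow> real" and V :: "'a \<Rightarrow> 'a" and x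
  have A: "A v V x = (\<eta> x *\<^sub>R (x - P)) \<bullet> V x + ((x - P) \<bullet> gradient \<eta> x + DIM('a) * \<eta> x) * v x" for v V x
    unfolding A_def by (simp add: inner_add_right algebra_simps)
  have Ab: "\<bar>A v V x\<bar> \<le> C * norm (V x) + C' * \<bar>v x\<bar>" if "x \<in> T" for v V x
  proof -
    have "\<bar>A v V x\<bar> \<le> \<bar>(\<eta> x *\<^sub>R (x - P)) \<bullet> V x\<bar> + \<bar>((x - P) \<bullet> gradient \<eta> x + DIM('a) * \<eta> x) * v x\<bar>"
      unfolding A by (rule abs_triangle_ineq)
    also have "\<bar>(\<eta> x *\<^sub>R (x - P)) \<bullet> V x\<bar> \<le> C * norm (V x)"
      by (rule order_trans[OF Cauchy_Schwarz_ineq2 mult_right_mono[OF C(2)[OF that] norm_ge_zero]])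
    also have "\<bar>((x - P) \<bullet> gradient \<eta> x + DIM('a) * \<eta> x) * v x\<bar> \<le> C' * \<bar>v x\<bar>"
      using C'(2)[OF that] unfolding abs_mult real_norm_def by (intro mult_right_mono) auto
    finally show ?thesis by simp
  qed
  have iA: "integrable (lebesgue_on T) (A v V)" if v: "integrable (lebesgue_on \<Omega>) v" and V: "integrable (lebesgue_on \<Omega>) V" for v V
  proof (rule Bochner_Integration.integrable_bound)
    have iT: "integrable (lebesgue_on T) v" "integrable (lebesgue_on T) V" using integrable_convex_interior[OF conv] v V by blast+
    then show "integrable (lebesgue_on T) (\<lambda>x. C * norm (V x) + C' * norm (v x))" by auto
    have Afun: "A v V = (\<lambda>x. (\<eta> x *\<^sub>R (x - P)) \<bullet> V x + ((x - P) \<bullet> gradient \<eta> x + DIM('a) * \<eta> x) * v x)"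
      by (rule ext) (rule A)
    show "A v V \<in> borel_measurable (lebesgue_on T)" unfolding Afun
      by (rule borel_measurable_add[OF borel_measurable_inner[OF continuous_measurable_lebesgue_on[OF c1] borel_measurable_integrable[OF iT(2)]]
        borel_measurable_times[OF continuous_measurable_lebesgue_on[OF c2] borel_measurable_integrable[OF iT(1)]]])
    show "AE x in lebesgue_on T. norm (A v V x) \<le> norm (C * norm (V x) + C' * norm (v x))"
    proof (rule AE_I2)
      fix x assume "x \<in> space (lebesgue_on T)"
      then have x: "x \<in> T" by simp
      show "norm (A v V x) \<le> norm (C * norm (V x) + C' * norm (v x))"
        using Ab[OF x, of v V] by simp
    qed
  qed
  have limA: "(\<lambda>j. LINT x|lebesgue_on T. A (\<theta> j) (gradient (\<theta> j)) x) \<longlonglongrightarrow> (LINT x|lebesgue_on T. A w ?G x)"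
  proof (rule LIM_zero_cancel, rule Lim_null_comparison)
    show "(\<lambda>j. (C + C') * sobolev_norm 1 \<Omega> (\<lambda>x. \<theta> j x - w x)) \<longlonglongrightarrow> 0"
      using tendsto_mult_right_zero[OF th(2)] by simp
    show "\<forall>\<^sub>F j in sequentially. norm ((LINT x|lebesgue_on T. A (\<theta> j) (gradient (\<theta> j)) x) - (LINT x|lebesgue_on T. A w ?G x)) \<le>
      (C + C') * sobolev_norm 1 \<Omega> (\<lambda>x. \<theta> j x - w x)"
    proof (rule always_eventually, rule allI)
      fix j
      have "(LINT x|lebesgue_on T. A (\<theta> j) (gradient (\<theta> j)) x) - (LINT x|lebesgue_on T. A w ?G x) =
        (LINT x|lebesgue_on T. A (\<theta> j) (gradient (\<theta> j)) x - A w ?G x)"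
        using iA[OF thi] iA[OF wi(1,2)] by simp
      also have "\<dots> = (LINT x|lebesgue_on T. A (\<lambda>x. \<theta> j x - w x) (\<lambda>x. gradient (\<theta> j) x - ?G x) x)"
        by (intro Bochner_Integration.integral_cong) (auto simp: A inner_diff_right algebra_simps)
      also have "norm \<dots> \<le> (LINT x|lebesgue_on T. C * e' j x + C' * e j x)"
      proof (rule norm_integral_le_AE)
        show "integrable (lebesgue_on T) (A (\<lambda>x. \<theta> j x - w x) (\<lambda>x. gradient (\<theta> j) x - ?G x))"
          by (intro iA Bochner_Integration.integrable_diff thi wi)
        show "integrable (lebesgue_on T) (\<lambda>x. C * e' j x + C' * e j x)" using eiT by auto
        show "AE x in lebesgue_on T. norm (A (\<lambda>x. \<theta> j x - w x) (\<lambda>x. gradient (\<theta> j) x - ?G x) x) \<le> C * e' j x + C' * e j x"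
          using Ab[of _ "\<lambda>x. \<theta> j x - w x" "\<lambda>x. gradient (\<theta> j) x - ?G x"] by (intro AE_I2) (simp add: e_def e'_def)
      qed
      also have "\<dots> = C * (LINT x|lebesgue_on T. e' j x) + C' * (LINT x|lebesgue_on T. e j x)" using eiT by simp
      also have "\<dots> \<le> C * (LINT x|lebesgue_on \<Omega>. e' j x) + C' * (LINT x|lebesgue_on \<Omega>. e j x)"
      proof -
        have mono: "(LINT x|lebesgue_on T. f x) \<le> (LINT x|lebesgue_on \<Omega>. f x)"
          if f: "integrable (lebesgue_on \<Omega>) f" and f0: "\<And>x. 0 \<le> f x" for f :: "'a \<Rightarrow> real"
        proof -
          have 2: "AE x in lebesgue. x \<notin> frontier T"
            using negligible_convex_frontier[OF \<open>convex T\<close>] by (intro AE_not_in) (simp add: negligible_iff_null_sets)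
          have "(LINT x|lebesgue. indicator T x *\<^sub>R f x) \<le> (LINT x|lebesgue. indicator \<Omega> x *\<^sub>R f x)"
          proof (rule integral_mono_AE)
            show "integrable lebesgue (\<lambda>x. indicator T x *\<^sub>R f x)"
              using integrable_convex_interior[OF conv f] Tl by (simp add: integrable_restrict_space)
            show "integrable lebesgue (\<lambda>x. indicator \<Omega> x *\<^sub>R f x)" using f Oml by (simp add: integrable_restrict_space)
            show "AE x in lebesgue. indicator T x *\<^sub>R f x \<le> indicator \<Omega> x *\<^sub>R f x" using 2
            proof eventually_elim
              case (elim x)
              then have "x \<in> T \<Longrightarrow> x \<in> \<Omega>" using Om(3) closure_subset[of T] by (auto simp: frontier_def)
              then show ?case using f0[of x] by (auto simp: indicator_def)
            qed
          qed
          then show ?thesis using Tl Oml by (simp add: integral_restrict_space)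
        qed
        show ?thesis using C(1) C'(1) mono[OF ei(1)[of j]] mono[OF ei(2)[of j]]
          by (intro add_mono mult_left_mono) (auto simp: e_def e'_def)
      qed
      also have "\<dots> \<le> (C + C') * sobolev_norm 1 \<Omega> (\<lambda>x. \<theta> j x - w x)"
      proof -
        have "0 \<le> (LINT x|lebesgue_on \<Omega>. e j x)" "0 \<le> (LINT x|lebesgue_on \<Omega>. e' j x)"
          by (auto intro!: Bochner_Integration.integral_nonneg simp: e_def e'_def)
        then show ?thesis unfolding norm using C(1) C'(1) by (simp add: algebra_simps)
      qed
      finally show "norm ((LINT x|lebesgue_on T. A (\<theta> j) (gradient (\<theta> j)) x) - (LINT x|lebesgue_on T. A w ?G x)) \<le>
        (C + C') * sobolev_norm 1 \<Omega> (\<lambda>x. \<theta> j x - w x)" .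
    qed
  qed
  have eqA: "(LINT x|lebesgue_on T. A (\<theta> j) (gradient (\<theta> j)) x) = h * (LINT s|surface_measure S. \<eta> s * \<theta> j s)" for j
  proof -
    have sp: "smooth (\<lambda>x. \<eta> x * \<theta> j x)" using sm th(1)[of j] by (auto intro: Ck_mult)
    have gr: "gradient (\<lambda>x. \<eta> x * \<theta> j x) x = \<eta> x *\<^sub>R gradient (\<theta> j) x + \<theta> j x *\<^sub>R gradient \<eta> x" for x
      by (intro gradient_mult smooth_differentiable sm th)
    have Am: "A (\<theta> j) (gradient (\<theta> j)) \<in> borel_measurable borel"
      unfolding A_def
      by (intro borel_measurable_continuous_onI continuous_intros ce cg smooth_continuous[OF th(1)] smooth_continuous_gradient[OF th(1)])
    have "(LINT x|lebesgue_on T. A (\<theta> j) (gradient (\<theta> j)) x) = (LINT x|lebesgue. indicator T x *\<^sub>R A (\<theta> j) (gradient (\<theta> j)) x)"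
      using Tl by (intro integral_restrict_space) simp
    also have "\<dots> = (LINT x|lborel. indicator T x *\<^sub>R A (\<theta> j) (gradient (\<theta> j)) x)"
      using Am Tb by (intro integral_completion borel_measurable_scaleR borel_measurable_indicator) auto
    also have "\<dots> = h * (LINT s|surface_measure S. \<eta> s * \<theta> j s)"
      using cone_formula[OF \<nu> aff _ P h cS T sp] unfolding gr A_def by simp
    finally show ?thesis .
  qed
  have limB: "(\<lambda>j. LINT s|surface_measure S. \<eta> s * \<theta> j s) \<longlonglongrightarrow> (LINT s|surface_measure S. \<eta> s * g s)"
  proof (rule LIM_zero_cancel, rule Lim_null_comparison)
    have SAE: "AE s in surface_measure S. s \<in> S"
      unfolding surface_measure_eq[OF \<nu> aff]
      by (subst AE_distr_iff[OF hproj_measurable_lebesgue_on[OF \<nu> aff]]) (auto intro!: AE_I2)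
    have ti: "integrable (surface_measure S) (\<theta> j)" for j
      by (rule surface_integrable_continuous[OF \<nu> aff _ smooth_continuous[OF th(1)] cS]) simp
    have em: "\<eta> \<in> borel_measurable (surface_measure S)"
      using borel_measurable_continuous_onI[OF smooth_continuous[OF sm]] by measurable
    have eb: "AE s in surface_measure S. \<bar>\<eta> s\<bar> \<le> C''" using SAE by eventually_elim (use C'' in auto)
    have i1: "integrable (surface_measure S) (\<lambda>s. \<eta> s * \<theta> j s)" for j
      using integrable_bounded_mult[OF ti em eb] by simp
    have i2: "integrable (surface_measure S) (\<lambda>s. \<eta> s * g s)"
      using integrable_bounded_mult[OF g em eb] by simp
    show "(\<lambda>j. C'' * (LINT x|surface_measure S. \<bar>\<theta> j x - g x\<bar>)) \<longlonglongrightarrow> 0"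
      using tendsto_mult_right_zero[OF th(3)] by simp
    show "\<forall>\<^sub>F j in sequentially. norm ((LINT s|surface_measure S. \<eta> s * \<theta> j s) - (LINT s|surface_measure S. \<eta> s * g s)) \<le> C'' * (LINT x|surface_measure S. \<bar>\<theta> j x - g x\<bar>)"
    proof (rule always_eventually, rule allI)
      fix j
      have "(LINT s|surface_measure S. \<eta> s * \<theta> j s) - (LINT s|surface_measure S. \<eta> s * g s) = (LINT s|surface_measure S. \<eta> s * \<theta> j s - \<eta> s * g s)"
        using i1 i2 by simp
      also have "norm \<dots> \<le> (LINT s|surface_measure S. C'' * \<bar>\<theta> j s - g s\<bar>)"
      proof (rule norm_integral_le_AE)
        show "integrable (surface_measure S) (\<lambda>s. \<eta> s * \<theta> j s - \<eta> s * g s)" using i1 i2 by simp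
        show "integrable (surface_measure S) (\<lambda>s. C'' * \<bar>\<theta> j s - g s\<bar>)" using ti g by simp
        show "AE s in surface_measure S. norm (\<eta> s * \<theta> j s - \<eta> s * g s) \<le> C'' * \<bar>\<theta> j s - g s\<bar>"
          using eb by eventually_elim (auto simp: abs_mult intro: mult_right_mono simp flip: right_diff_distrib)
      qed
      finally show "norm ((LINT s|surface_measure S. \<eta> s * \<theta> j s) - (LINT s|surface_measure S. \<eta> s * g s)) \<le> C'' * (LINT x|surface_measure S. \<bar>\<theta> j x - g x\<bar>)"
        by simp
    qed
  qed
  have "(LINT x|lebesgue_on T. A w ?G x) = h * (LINT s|surface_measure S. \<eta> s * g s)"
    using LIMSEQ_unique[OF limA] tendsto_mult_left[OF limB, of h] unfolding eqA by blast
  then show ?thesis unfolding A_def .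
qed

section \<open>A single simplex\<close>

text \<open>The normalization makes \<open>l P\<close> the gradient of the barycentric coordinate of the vertex \<open>P\<close>.\<close>

locale nd_simplex =
  fixes C :: "'a::euclidean_space set" and l :: "'a \<Rightarrow> 'a"
  assumes indep: "\<not> affine_dependent C" and card_C: "card C = DIM('a) + 1"
    and l: "\<And>P Q. P \<in> C \<Longrightarrow> Q \<in> C \<Longrightarrow> Q \<noteq> P \<Longrightarrow> l P \<bullet> (Q - P) = - 1"

text \<open>The opposite facet spans a hyperplane \<open>a \<bullet> x = b\<close> that misses
  \<open>P\<close>. Dividing \<open>a\<close> by \<open>a \<bullet> P - b\<close> makes the affine
  function rise by one from the facet to \<open>P\<close>.\<close>

lemma nd_simplex_exists:
  fixes T :: "'a::euclidean_space set"
  assumes "int DIM('a) simplex T"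
  obtains C l where "nd_simplex C l" "T = convex hull C"
proof -
  obtain C where C: "\<not> affine_dependent C" "card C = DIM('a) + 1" "T = convex hull C"
    using assms by (auto simp: simplex_def)
  have fin: "finite C" using C(1) by (rule aff_independent_finite)
  have "\<exists>l. \<forall>Q\<in>C. Q \<noteq> P \<longrightarrow> l \<bullet> (Q - P) = - 1" if P: "P \<in> C" for P
  proof -
    have ind': "\<not> affine_dependent (C - {P})" using C(1) by (rule affine_independent_subset) auto
    have "int (card (C - {P})) = aff_dim (C - {P}) + 1" by (rule aff_dim_affine_independent[OF ind'])
    then have "aff_dim (C - {P}) = DIM('a) - 1" using C(2) P fin by simp
    then obtain a b where ab: "a \<noteq> 0" "affine hull (C - {P}) = {x. a \<bullet> x = b}"
      unfolding aff_dim_eq_hyperplane by metis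
    have "P \<notin> affine hull (C - {P})" using C(1) P unfolding affine_dependent_def by blast
    then have nz: "a \<bullet> P - b \<noteq> 0" using ab by auto
    have "((1 / (a \<bullet> P - b)) *\<^sub>R a) \<bullet> (Q - P) = - 1" if "Q \<in> C" "Q \<noteq> P" for Q
    proof -
      have "a \<bullet> Q = b" using that ab hull_subset[of "C - {P}" affine] by blast
      then have "a \<bullet> (Q - P) = - (a \<bullet> P - b)" by (simp add: inner_diff_right)
      then show ?thesis using nz by (simp del: inner_diff_right minus_diff_eq)
    qed
    then show ?thesis by blast
  qed
  then obtain l where "\<And>P Q. P \<in> C \<Longrightarrow> Q \<in> C \<Longrightarrow> Q \<noteq> P \<Longrightarrow> l P \<bullet> (Q - P) = - 1" by metis
  then have "nd_simplex C l" using C by unfold_locales auto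
  then show ?thesis using that C(3) by blast
qed

context nd_simplex
begin

lemma finite_C: "finite C" using indep by (rule aff_independent_finite)

text \<open>The affine function with value 1 at the vertex \<open>P\<close> and 0 at the other
  vertices, that is, the barycentric coordinate of \<open>x\<close> belonging to
  \<open>P\<close>.\<close>

definition bary :: "'a \<Rightarrow> 'a \<Rightarrow> real" where
  "bary P x = 1 + l P \<bullet> (x - P)"

abbreviation "T \<equiv> convex hull C"

abbreviation "facet P \<equiv> convex hull (C - {P})"

text \<open>When \<open>x - P\<close> is expanded in the edges at \<open>P\<close>, testing with
  \<open>l P\<close> gives -1 on every edge and hence minus the sum of the other coefficients, which
  is \<open>u P - 1\<close>.\<close>

lemma bary_affine_combination:
  assumes "P \<in> C" "sum u C = 1" "x = (\<Sum>Q\<in>C. u Q *\<^sub>R Q)"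
  shows "bary P x = u P"
proof -
  have "x - P = (\<Sum>Q\<in>C. u Q *\<^sub>R (Q - P))"
    using assms(2,3) by (simp add: scaleR_diff_right sum_subtractf flip: scaleR_sum_left)
  then have "l P \<bullet> (x - P) = (\<Sum>Q\<in>C. u Q * (l P \<bullet> (Q - P)))" by (simp add: inner_sum_right)
  also have "\<dots> = u P * (l P \<bullet> (P - P)) + (\<Sum>Q\<in>C - {P}. u Q * (l P \<bullet> (Q - P)))"
    using assms(1) finite_C by (subst sum.remove[of _ P]) auto
  also have "(\<Sum>Q\<in>C - {P}. u Q * (l P \<bullet> (Q - P))) = (\<Sum>Q\<in>C - {P}. - u Q)"
    using assms(1) l by (intro sum.cong) auto
  also have "\<dots> = u P - 1"
    using assms(1,2) finite_C sum.remove[of C P u] by (simp add: sum_negf)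
  finally show ?thesis by (simp add: bary_def)
qed

lemma affine_hull_C: "affine hull C = UNIV"
  using aff_dim_affine_independent[OF indep] card_C by (intro affine_hull_UNIV) simp

lemma bary_representation: "(\<Sum>P\<in>C. bary P x) = 1" "(\<Sum>P\<in>C. bary P x *\<^sub>R P) = x"
proof -
  have "x \<in> affine hull C" by (simp add: affine_hull_C)
  then obtain u where u: "sum u C = 1" "(\<Sum>v\<in>C. u v *\<^sub>R v) = x" using affine_hull_finite[OF finite_C] by auto
  have "bary P x = u P" if "P \<in> C" for P using bary_affine_combination[OF that u(1)] u(2) by simp
  then show "(\<Sum>P\<in>C. bary P x) = 1" "(\<Sum>P\<in>C. bary P x *\<^sub>R P) = x" using u by simp_all
qed

lemma bary_diff: "bary P (x + v) - bary P x = l P \<bullet> v"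
  by (simp add: bary_def inner_add_right inner_diff_right)

text \<open>This identity and the next one are the derivatives, in direction \<open>v\<close>, of
  the two equations in \<open>bary_representation\<close>.\<close>

lemma sum_l: "(\<Sum>P\<in>C. l P \<bullet> v) = 0"
  unfolding bary_diff[of _ 0, symmetric] by (simp add: sum_subtractf bary_representation)

lemma sum_l_scaleR: "(\<Sum>P\<in>C. (l P \<bullet> v) *\<^sub>R P) = v"
  unfolding bary_diff[of _ 0, symmetric] by (simp add: scaleR_diff_left sum_subtractf bary_representation)

lemma mem_T_iff: "x \<in> T \<longleftrightarrow> (\<forall>P\<in>C. 0 \<le> bary P x)"
proof
  assume "x \<in> T"
  then obtain u where "\<forall>x\<in>C. 0 \<le> u x" "sum u C = 1" "(\<Sum>v\<in>C. u v *\<^sub>R v) = x"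
    using convex_hull_finite[OF finite_C] by auto
  then show "\<forall>P\<in>C. 0 \<le> bary P x" using bary_affine_combination by metis
next
  assume "\<forall>P\<in>C. 0 \<le> bary P x"
  then show "x \<in> T" unfolding convex_hull_finite[OF finite_C]
    using bary_representation[of x] by (auto intro!: exI[of _ "\<lambda>P. bary P x"])
qed

lemma card_ge_2: "2 \<le> card C"
  using card_C DIM_positive[where 'a='a] by linarith

lemma vertices_Diff_nonempty: "C - {P} \<noteq> {}"
proof
  assume "C - {P} = {}"
  then have "card C \<le> card {P}" by (intro card_mono) auto
  then show False using card_ge_2 by simp
qed

lemma l_nonzero:
  assumes "P \<in> C" shows "l P \<noteq> 0"
proof -
  obtain Q where "Q \<in> C" "Q \<noteq> P" using vertices_Diff_nonempty[of P] by auto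
  then show ?thesis using l[OF assms] by fastforce
qed

lemma continuous_bary: "continuous_on UNIV (bary P)"
  unfolding bary_def by (intro continuous_intros)

lemma open_bary_pos: "open {x. \<forall>P\<in>C. 0 < bary P x}"
proof -
  have "{x. \<forall>P\<in>C. 0 < bary P x} = (\<Inter>P\<in>C. {x. 0 < bary P x})" by auto
  then show ?thesis using finite_C by (auto intro!: open_INT open_Collect_less continuous_intros continuous_bary)
qed

text \<open>If a coordinate were not positive at an interior point, a step against its gradient
  would leave the simplex. Conversely the strict inequalities describe an open subset of the
  simplex.\<close>

lemma mem_interior_iff: "x \<in> interior T \<longleftrightarrow> (\<forall>P\<in>C. 0 < bary P x)"
proof
  assume x: "x \<in> interior T"
  show "\<forall>P\<in>C. 0 < bary P x"
  proof (rule ccontr)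
    assume "\<not> ?thesis"
    then obtain P where P: "P \<in> C" "bary P x \<le> 0" by force
    obtain e where e: "0 < e" "cball x e \<subseteq> T" using x mem_interior_cball by blast
    define y where "y = x + (- e / norm (l P)) *\<^sub>R l P"
    have "y \<in> cball x e" using e(1) l_nonzero[OF P(1)] by (simp add: y_def dist_norm)
    then have "0 \<le> bary P y" using e(2) P(1) mem_T_iff by blast
    moreover have "bary P y = bary P x - e * norm (l P)"
      using bary_diff[of P x "(- e / norm (l P)) *\<^sub>R l P"] l_nonzero[OF P(1)]
      by (simp add: y_def dot_square_norm power2_eq_square)
    ultimately show False using P(2) e(1) l_nonzero[OF P(1)] by (smt (verit) mult_pos_pos zero_less_norm_iff)
  qed
next
  assume "\<forall>P\<in>C. 0 < bary P x"
  then show "x \<in> interior T"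
    using interiorI[OF open_bary_pos, of x T] by (force simp: mem_T_iff)
qed

lemma extend_coefficients:
  assumes "sum u (C - {P}) = 1" "(\<Sum>v\<in>C - {P}. u v *\<^sub>R v) = x"
  shows "\<exists>u'. u' P = 0 \<and> (\<forall>Q\<in>C - {P}. u' Q = u Q) \<and> sum u' C = 1 \<and> (\<Sum>v\<in>C. u' v *\<^sub>R v) = x"
proof (intro exI conjI)
  let ?u = "\<lambda>Q. if Q = P then 0 else u Q"
  have "sum ?u C = sum u (C - {P})"
    by (rule sum.mono_neutral_cong_right) (auto simp: finite_C)
  then show "sum ?u C = 1" using assms by simp
  have "(\<Sum>v\<in>C. ?u v *\<^sub>R v) = (\<Sum>v\<in>C - {P}. u v *\<^sub>R v)"
    by (rule sum.mono_neutral_cong_right) (auto simp: finite_C)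
  then show "(\<Sum>v\<in>C. ?u v *\<^sub>R v) = x" using assms by simp
qed auto

lemma facet_bary_iff:
  assumes "P \<in> C" shows "x \<in> facet P \<longleftrightarrow> bary P x = 0 \<and> (\<forall>Q\<in>C. 0 \<le> bary Q x)"
proof
  assume "x \<in> facet P"
  then obtain u where u: "\<forall>x\<in>C - {P}. 0 \<le> u x" "sum u (C - {P}) = 1" "(\<Sum>v\<in>C - {P}. u v *\<^sub>R v) = x"
    using convex_hull_finite[of "C - {P}"] finite_C by auto
  obtain u' where u': "u' P = 0" "\<And>Q. Q \<in> C - {P} \<Longrightarrow> u' Q = u Q" "sum u' C = 1" "(\<Sum>v\<in>C. u' v *\<^sub>R v) = x"
    using extend_coefficients[OF u(2,3)] by metis
  then have "bary Q x = u' Q" if "Q \<in> C" for Q using bary_affine_combination[OF that u'(3)] u'(4) by simp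
  moreover have "0 \<le> u' Q" if "Q \<in> C" for Q using u(1) u'(1,2) that by (cases "Q = P") auto
  ultimately show "bary P x = 0 \<and> (\<forall>Q\<in>C. 0 \<le> bary Q x)" using assms u'(1) by simp
next
  assume a: "bary P x = 0 \<and> (\<forall>Q\<in>C. 0 \<le> bary Q x)"
  have "(\<Sum>Q\<in>C - {P}. bary Q x) = 1" "(\<Sum>Q\<in>C - {P}. bary Q x *\<^sub>R Q) = x"
    using bary_representation[of x] a assms finite_C by (simp_all add: sum.remove[of C P])
  then show "x \<in> facet P" unfolding convex_hull_finite[OF finite_Diff[OF finite_C]]
    using a by (auto intro!: exI[of _ "\<lambda>Q. bary Q x"])
qed

lemma rel_interior_facet_iff:
  assumes "P \<in> C" shows "x \<in> rel_interior (facet P) \<longleftrightarrow> bary P x = 0 \<and> (\<forall>Q\<in>C - {P}. 0 < bary Q x)"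
proof -
  have ind': "\<not> affine_dependent (C - {P})" using indep by (rule affine_independent_subset) auto
  show ?thesis
  proof
    assume "x \<in> rel_interior (facet P)"
    then obtain u where u: "\<forall>x\<in>C - {P}. 0 < u x" "sum u (C - {P}) = 1" "(\<Sum>v\<in>C - {P}. u v *\<^sub>R v) = x"
      unfolding rel_interior_convex_hull_explicit[OF ind'] by auto
    obtain u' where u': "u' P = 0" "\<And>Q. Q \<in> C - {P} \<Longrightarrow> u' Q = u Q" "sum u' C = 1" "(\<Sum>v\<in>C. u' v *\<^sub>R v) = x"
      using extend_coefficients[OF u(2,3)] by metis
    then have "bary Q x = u' Q" if "Q \<in> C" for Q using bary_affine_combination[OF that u'(3)] u'(4) by simp
    then show "bary P x = 0 \<and> (\<forall>Q\<in>C - {P}. 0 < bary Q x)" using u(1) assms by (auto simp: u')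
  next
    assume a: "bary P x = 0 \<and> (\<forall>Q\<in>C - {P}. 0 < bary Q x)"
    have "(\<Sum>Q\<in>C - {P}. bary Q x) = 1" "(\<Sum>Q\<in>C - {P}. bary Q x *\<^sub>R Q) = x"
      using bary_representation[of x] a assms finite_C by (simp_all add: sum.remove[of C P])
    then show "x \<in> rel_interior (facet P)" unfolding rel_interior_convex_hull_explicit[OF ind']
      using a by (auto intro!: exI[of _ "\<lambda>Q. bary Q x"])
  qed
qed

lemma facet_of_T_iff: "S facet_of T \<longleftrightarrow> (\<exists>P\<in>C. S = facet P)"
proof -
  have "facet P \<noteq> {}" if "P \<in> C" for P
    using vertices_Diff_nonempty by simp
  then show ?thesis unfolding facet_of_convex_hull_affine_independent[OF indep] by blast
qed

lemma barycenter_T: "barycenter T = (\<Sum>v\<in>C. v) /\<^sub>R (real DIM('a) + 1)"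
  unfolding barycenter_def extreme_point_of_convex_hull_affine_independent[OF indep] using card_C by simp

lemma barycenter_facet: 
  assumes "P \<in> C" shows "barycenter (facet P) = (\<Sum>v\<in>C - {P}. v) /\<^sub>R real DIM('a)"
proof -
  have ind': "\<not> affine_dependent (C - {P})" using indep by (rule affine_independent_subset) auto
  have "{v. v extreme_point_of facet P} = C - {P}"
    using extreme_point_of_convex_hull_affine_independent[OF ind'] by auto
  then show ?thesis unfolding barycenter_def using card_C assms finite_C by simp
qed

lemma bary_barycenter_T:
  assumes "P \<in> C" shows "bary P (barycenter T) = 1 / (real DIM('a) + 1)"
  by (rule bary_affine_combination[OF assms])
     (use card_C in \<open>simp_all add: barycenter_T scaleR_sum_right divide_simps\<close>)

lemma bary_barycenter_facet:
  assumes "P \<in> C" "Q \<in> C" shows "bary Q (barycenter (facet P)) = (if Q = P then 0 else 1 / real DIM('a))"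
proof (rule bary_affine_combination[OF assms(2), where u = "\<lambda>Q. if Q = P then 0 else 1 / real DIM('a)"])
  have c: "card (C - {P}) = DIM('a)" using card_C assms finite_C by simp
  show "(\<Sum>Q\<in>C. if Q = P then 0 else 1 / real DIM('a)) = 1"
    using assms finite_C c by (simp add: sum.remove[of C P])
  show "barycenter (facet P) = (\<Sum>Q\<in>C. (if Q = P then 0 else 1 / real DIM('a)) *\<^sub>R Q)"
    using assms finite_C by (simp add: barycenter_facet sum.remove[of C P] scaleR_sum_right divide_inverse)
qed

lemma barycenter_interior: "barycenter T \<in> interior T"
  unfolding mem_interior_iff using bary_barycenter_T by simp

lemma barycenter_rel_interior: "P \<in> C \<Longrightarrow> barycenter (facet P) \<in> rel_interior (facet P)"
  by (simp add: rel_interior_facet_iff bary_barycenter_facet)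

text \<open>The line from a vertex through the barycenter of the simplex hits the opposite facet in
  the barycenter of the facet, beyond the former by one d-th of its distance to the vertex. The
  algebra for both finite element spaces rests on this relation.\<close>

lemma barycenter_facet_eq:
  assumes "P \<in> C"
  shows "barycenter (facet P) = barycenter T + (barycenter T - P) /\<^sub>R real DIM('a)"
proof -
  let ?d = "real DIM('a)"
  have d: "?d > 0" using DIM_positive by simp
  have T: "(\<Sum>v\<in>C. v) = (?d + 1) *\<^sub>R barycenter T" unfolding barycenter_T by simp
  have "(\<Sum>v\<in>C - {P}. v) = (?d + 1) *\<^sub>R barycenter T - P"
    using sum.remove[OF finite_C assms, of "\<lambda>v. v"] T by simp
  then have "barycenter (facet P) = inverse ?d *\<^sub>R ((?d + 1) *\<^sub>R barycenter T - P)"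
    by (simp add: barycenter_facet[OF assms])
  also have "\<dots> = barycenter T + (barycenter T - P) /\<^sub>R ?d"
    using d by (simp add: scaleR_diff_right scaleR_add_right scaleR_add_left algebra_simps)
  finally show ?thesis .
qed

section \<open>Volume, heights and averages of traces on the facets\<close>

lemma compact_T: "compact T" using finite_C by (simp add: finite_imp_compact_convex_hull)

lemma T_lebesgue: "T \<in> sets lebesgue" using compact_T by (auto intro: lmeasurable_compact fmeasurableD)

lemma measure_T_pos: "0 < measure lebesgue T"
proof -
  have "\<not> negligible (interior T)" using barycenter_interior by (intro open_not_negligible) auto
  then have "\<not> negligible T" using negligible_subset interior_subset by blast
  then show ?thesis
    using compact_T by (metis lmeasurable_compact measure_nonneg negligible_iff_measure order_less_le)
qed

text \<open>\<open>\<nu> P\<close> is the unit normal of the facet opposite \<open>P\<close> that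
  points into the simplex, and \<open>ht P\<close> is the height of \<open>P\<close> above that
  facet, because \<open>bary P\<close> grows from 0 to 1 over it.\<close>

definition "\<nu> P = l P /\<^sub>R norm (l P)"
definition "ht P = 1 / norm (l P)"

lemma norm_\<nu>: "P \<in> C \<Longrightarrow> norm (\<nu> P) = 1"
  using l_nonzero by (simp add: \<nu>_def)

lemma ht_pos: "P \<in> C \<Longrightarrow> 0 < ht P"
  using l_nonzero by (simp add: ht_def)

lemma affine_hull_facet:
  assumes "P \<in> C" shows "affine hull (facet P) = {x. \<nu> P \<bullet> x = \<nu> P \<bullet> P - ht P}"
proof -
  have n: "norm (l P) > 0" using l_nonzero[OF assms] by simp
  have iff: "\<nu> P \<bullet> x = \<nu> P \<bullet> P - ht P \<longleftrightarrow> bary P x = 0" for x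
    using n by (simp add: \<nu>_def ht_def bary_def inner_diff_right field_simps)
  show ?thesis unfolding iff
  proof (intro equalityI subsetI)
    fix x assume "x \<in> affine hull (facet P)"
    then have "x \<in> affine hull (C - {P})" by simp
    then obtain u where u: "sum u (C - {P}) = 1" "(\<Sum>v\<in>C - {P}. u v *\<^sub>R v) = x"
      using affine_hull_finite[of "C - {P}"] finite_C by auto
    obtain u' where u': "u' P = 0" "\<And>Q. Q \<in> C - {P} \<Longrightarrow> u' Q = u Q" "sum u' C = 1" "(\<Sum>v\<in>C. u' v *\<^sub>R v) = x"
      using extend_coefficients[OF u] by metis
    then show "x \<in> {x. bary P x = 0}" using bary_affine_combination[OF assms u'(3)] u'(1,4) by simp
  next
    fix x assume "x \<in> {x. bary P x = 0}"
    then have "(\<Sum>Q\<in>C - {P}. bary Q x) = 1" "(\<Sum>Q\<in>C - {P}. bary Q x *\<^sub>R Q) = x"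
      using bary_representation[of x] assms finite_C by (simp_all add: sum.remove[of C P])
    then have "x \<in> affine hull (C - {P})"
      unfolding affine_hull_finite[OF finite_Diff[OF finite_C]] by (auto intro!: exI[of _ "\<lambda>Q. bary Q x"])
    then show "x \<in> affine hull (facet P)" by simp
  qed
qed

lemma T_cone:
  assumes "P \<in> C" shows "T = (\<lambda>(r, s). P + r *\<^sub>R (s - P)) ` ({0..1} \<times> facet P)"
proof -
  have "T = convex hull (insert P (C - {P}))" using assms by (simp add: insert_absorb)
  also have "\<dots> = {x. \<exists>u\<ge>0. \<exists>v\<ge>0. \<exists>b. (u + v = 1) \<and> b \<in> facet P \<and> (x = u *\<^sub>R P + v *\<^sub>R b)}"
    by (rule convex_hull_insert[OF vertices_Diff_nonempty])
  also have "\<dots> = (\<lambda>(r, s). P + r *\<^sub>R (s - P)) ` ({0..1} \<times> facet P)"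
  proof (intro equalityI subsetI)
    fix x assume "x \<in> {x. \<exists>u\<ge>0. \<exists>v\<ge>0. \<exists>b. (u + v = 1) \<and> b \<in> facet P \<and> (x = u *\<^sub>R P + v *\<^sub>R b)}"
    then obtain u v b where uvb: "0 \<le> u" "0 \<le> v" "u + v = 1" "b \<in> facet P" "x = u *\<^sub>R P + v *\<^sub>R b" by blast
    then have u: "u = 1 - v" by simp
    have "x = P + v *\<^sub>R (b - P)" unfolding uvb(5) u by (simp add: algebra_simps)
    then show "x \<in> (\<lambda>(r, s). P + r *\<^sub>R (s - P)) ` ({0..1} \<times> facet P)"
      using uvb by (intro image_eqI[of _ _ "(v, b)"]) auto
  next
    fix x assume "x \<in> (\<lambda>(r, s). P + r *\<^sub>R (s - P)) ` ({0..1} \<times> facet P)"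
    then obtain r s where rs: "0 \<le> r" "r \<le> 1" "s \<in> facet P" "x = P + r *\<^sub>R (s - P)" by auto
    have "x = (1 - r) *\<^sub>R P + r *\<^sub>R s" using rs by (simp add: algebra_simps)
    then show "x \<in> {x. \<exists>u\<ge>0. \<exists>v\<ge>0. \<exists>b. (u + v = 1) \<and> b \<in> facet P \<and> (x = u *\<^sub>R P + v *\<^sub>R b)}"
    proof -
      have "0 \<le> 1 - r" "(1 - r) + r = 1" using rs by auto
      then show ?thesis using rs(1,3) \<open>x = (1 - r) *\<^sub>R P + r *\<^sub>R s\<close> by blast
    qed
  qed
  finally show ?thesis .
qed

lemma compact_facet: "compact (facet P)"
  using finite_C by (simp add: finite_imp_compact_convex_hull)

lemma trace_formula:
  fixes w \<eta> :: "'a \<Rightarrow> real"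
  assumes P: "P \<in> C" and "open \<Omega>" "bounded \<Omega>" "interior T \<subseteq> \<Omega>" "has_trace \<Omega> (facet P) w g" "smooth \<eta>"
  shows "(LINT x|lebesgue_on T. (x - P) \<bullet> (\<eta> x *\<^sub>R weak_grad \<Omega> w x + w x *\<^sub>R gradient \<eta> x) + DIM('a) * (\<eta> x * w x)) =
    ht P * (LINT s|surface_measure (facet P). \<eta> s * g s)"
  by (rule trace_cone_formula[OF norm_\<nu>[OF P] affine_hull_facet[OF P] _ ht_pos[OF P] compact_facet T_cone[OF P]])
     (use assms in auto)

text \<open>The cone formula for the constant function 1: volume is base times height divided by the
  dimension.\<close>

lemma ht_measure_facet:
  assumes P: "P \<in> C"
  shows "ht P * measure (surface_measure (facet P)) UNIV = DIM('a) * measure lebesgue T"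
proof -
  have sm: "smooth (\<lambda>x::'a. 1::real)" by (simp add: Ck_const)
  have g0: "gradient (\<lambda>x::'a. 1::real) x = 0" for x by (rule gradient_eqI) simp
  have "(LINT x|lborel. indicator T x * real DIM('a)) = ht P * (LINT s|surface_measure (facet P). 1)"
    using cone_formula[OF norm_\<nu>[OF P] affine_hull_facet[OF P] _ _ ht_pos[OF P] compact_facet T_cone[OF P] sm]
    unfolding g0 by (simp add: borel_compact[OF compact_facet])
  moreover have "(LINT x|lborel. indicator T x * real DIM('a)) = measure lebesgue T * DIM('a)"
    using compact_T by (simp add: borel_compact)
  ultimately show ?thesis by simp
qed

text \<open>The trace formula with weight 1. Its volume side does not mention \<open>g\<close>, so
  any two traces of \<open>w\<close> on a facet have the same average.\<close>

lemma side_average_eq: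
  fixes w :: "'a \<Rightarrow> real"
  assumes P: "P \<in> C" and Om: "open \<Omega>" "bounded \<Omega>" "interior T \<subseteq> \<Omega>" and tr: "has_trace \<Omega> (facet P) w g"
  shows "side_average (facet P) g =
    (LINT x|lebesgue_on T. (x - P) \<bullet> weak_grad \<Omega> w x + DIM('a) * w x) / (DIM('a) * measure lebesgue T)"
proof -
  have sm: "smooth (\<lambda>x::'a. 1::real)" by (simp add: Ck_const)
  have g0: "gradient (\<lambda>x::'a. 1::real) x = 0" for x by (rule gradient_eqI) simp
  have "(LINT x|lebesgue_on T. (x - P) \<bullet> weak_grad \<Omega> w x + DIM('a) * w x) = ht P * (LINT s|surface_measure (facet P). g s)"
    using trace_formula[OF P Om tr sm] unfolding g0 by simp
  then show ?thesis
    unfolding side_average_def ht_measure_facet[OF P, symmetric] using ht_pos[OF P] by simp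
qed

end

text \<open>Discrete functions are prescribed as polynomials on the interiors of the elements; the
  frontier of a convex element is negligible.\<close>

lemma integral_interior_cong:
  fixes f g :: "'a::euclidean_space \<Rightarrow> 'b::euclidean_space"
  assumes T: "convex T" "T \<in> sets lebesgue" and g: "integrable (lebesgue_on T) g"
    and fg: "\<And>x. x \<in> interior T \<Longrightarrow> f x = g x"
  shows "integrable (lebesgue_on T) f" "(LINT x|lebesgue_on T. f x) = (LINT x|lebesgue_on T. g x)"
proof -
  have 2: "AE x in lebesgue. x \<notin> frontier T"
    using negligible_convex_frontier[OF T(1)] by (intro AE_not_in) (simp add: negligible_iff_null_sets)
  have e: "AE x in lebesgue. indicator T x *\<^sub>R g x = indicator T x *\<^sub>R f x" using 2
  proof eventually_elim
    case (elim x)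
    then have "x \<in> T \<Longrightarrow> x \<in> interior T" using closure_subset[of T] by (auto simp: frontier_def)
    then show ?case using fg by (cases "x \<in> T") auto
  qed
  have i: "integrable lebesgue (\<lambda>x. indicator T x *\<^sub>R g x)" using g T(2) by (simp add: integrable_restrict_space)
  note m = borel_measurable_lebesgue_AE[OF borel_measurable_integrable[OF i] e]
  have "integrable lebesgue (\<lambda>x. indicator T x *\<^sub>R f x)"
    by (rule integrable_cong_AE_imp[OF i m e])
  then show "integrable (lebesgue_on T) f" using T(2) by (simp add: integrable_restrict_space)
  have "(LINT x|lebesgue. indicator T x *\<^sub>R g x) = (LINT x|lebesgue. indicator T x *\<^sub>R f x)"
    by (rule integral_cong_AE[OF borel_measurable_integrable[OF i] m e])
  then show "(LINT x|lebesgue_on T. f x) = (LINT x|lebesgue_on T. g x)" using T(2) by (simp add: integral_restrict_space)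
qed

section \<open>Quadrature, side values and interpolation on one simplex\<close>

context nd_simplex
begin

lemma convex_T: "convex T" by simp

lemma integrable_continuous_T:
  fixes f :: "'a \<Rightarrow> 'b::euclidean_space"
  shows "continuous_on UNIV f \<Longrightarrow> integrable (lebesgue_on T) f"
  using compact_T by (intro integrable_continuous_bounded T_lebesgue compact_imp_bounded)

lemma AE_surface_facet:
  assumes "P \<in> C" shows "AE s in surface_measure (facet P). s \<in> facet P"
proof -
  note * = norm_\<nu>[OF assms] affine_hull_facet[OF assms] borel_compact[OF compact_facet]
  show ?thesis
    unfolding surface_measure_eq[OF *(1,2)]
    by (subst AE_distr_iff[OF hproj_measurable_lebesgue_on[OF *]])
       (auto intro!: AE_I2 borel_compact[OF compact_facet])
qed

lemma integral_const_T: "(LINT x|lebesgue_on T. (c::real)) = c * measure lebesgue T"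
  using T_lebesgue by (simp add: measure_restrict_space)

text \<open>The cone formula for \<open>bary P\<close> itself, which vanishes on the facet opposite
  \<open>P\<close>. As \<open>(x - P) \<bullet> l P = bary P x - 1\<close>, the function
  \<open>(d + 1) * bary P x - 1\<close> has integral zero.\<close>

lemma integral_bary:
  assumes P: "P \<in> C" shows "(LINT x|lebesgue_on T. bary P x) = measure lebesgue T / (real DIM('a) + 1)"
proof -
  have sm: "smooth (bary P)"
  proof -
    have "bary P = (\<lambda>x. (1 - l P \<bullet> P) + l P \<bullet> x)" by (auto simp: bary_def inner_diff_right)
    then show ?thesis by (simp add: Ck_affine)
  qed
  have gr: "gradient (bary P) x = l P" for x
  proof -
    have "bary P = (\<lambda>x. (1 - l P \<bullet> P) + l P \<bullet> x)" by (auto simp: bary_def inner_diff_right)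
    then show ?thesis by (simp add: gradient_affine)
  qed
  have "(LINT s|surface_measure (facet P). bary P s) = (LINT s|surface_measure (facet P). 0)"
  proof (rule integral_cong_AE)
    show "AE s in surface_measure (facet P). bary P s = 0"
      using AE_surface_facet[OF P] by eventually_elim (simp add: facet_bary_iff[OF P])
    show "bary P \<in> borel_measurable (surface_measure (facet P))"
      using borel_measurable_continuous_onI[OF continuous_bary] by measurable
  qed simp
  then have "(LINT x|lborel. indicator T x * ((x - P) \<bullet> l P + DIM('a) * bary P x)) = 0"
    using cone_formula[OF norm_\<nu>[OF P] affine_hull_facet[OF P] _ _ ht_pos[OF P] compact_facet T_cone[OF P] sm]
    unfolding gr by (simp add: borel_compact[OF compact_facet])
  moreover have "(LINT x|lborel. indicator T x * ((x - P) \<bullet> l P + DIM('a) * bary P x)) =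
      (LINT x|lebesgue_on T. (x - P) \<bullet> l P + DIM('a) * bary P x)"
  proof -
    have "(LINT x|lborel. indicator T x * ((x - P) \<bullet> l P + DIM('a) * bary P x)) = (LINT x|lebesgue. indicator T x * ((x - P) \<bullet> l P + DIM('a) * bary P x))"
      using compact_T unfolding bary_def by (intro integral_completion[symmetric] borel_measurable_times borel_measurable_indicator) (auto simp: borel_compact)
    then show ?thesis using T_lebesgue by (simp add: integral_restrict_space)
  qed
  moreover have "(x - P) \<bullet> l P + DIM('a) * bary P x = (real DIM('a) + 1) * bary P x - 1" for x
    by (simp add: bary_def inner_commute algebra_simps)
  ultimately have "(LINT x|lebesgue_on T. (real DIM('a) + 1) * bary P x - 1) = 0" by simp
  moreover have "integrable (lebesgue_on T) (bary P)" by (rule integrable_continuous_T[OF continuous_bary])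
  moreover have "integrable (lebesgue_on T) (\<lambda>x. 1::real)" by (rule integrable_continuous_T) simp
  ultimately have "(real DIM('a) + 1) * (LINT x|lebesgue_on T. bary P x) - measure lebesgue T = 0"
    using integral_const_T[of 1] by simp
  then show ?thesis by (simp add: field_simps)
qed

lemma affine_bary: "\<alpha> + \<beta> \<bullet> x = (\<Sum>P\<in>C. bary P x * (\<alpha> + \<beta> \<bullet> P))"
proof -
  have "(\<Sum>P\<in>C. bary P x * (\<alpha> + \<beta> \<bullet> P)) = (\<Sum>P\<in>C. bary P x) * \<alpha> + \<beta> \<bullet> (\<Sum>P\<in>C. bary P x *\<^sub>R P)"
    by (simp add: distrib_left sum.distrib sum_distrib_right inner_sum_right)
  then show ?thesis by (simp add: bary_representation)
qed

text \<open>An affine function combines the coordinates with its vertex values as coefficients, and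
  the mean of each coordinate is its value at the barycenter. So the one-point rule is
  exact.\<close>

lemma integral_affine:
  "(LINT x|lebesgue_on T. \<alpha> + \<beta> \<bullet> x) = measure lebesgue T * (\<alpha> + \<beta> \<bullet> barycenter T)"
proof -
  have i: "integrable (lebesgue_on T) (bary P)" for P by (rule integrable_continuous_T[OF continuous_bary])
  have "(LINT x|lebesgue_on T. \<alpha> + \<beta> \<bullet> x) = (LINT x|lebesgue_on T. (\<Sum>P\<in>C. bary P x * (\<alpha> + \<beta> \<bullet> P)))"
    by (intro Bochner_Integration.integral_cong refl affine_bary)
  also have "\<dots> = (\<Sum>P\<in>C. (LINT x|lebesgue_on T. bary P x) * (\<alpha> + \<beta> \<bullet> P))"
    using i by (subst Bochner_Integration.integral_sum) auto
  also have "\<dots> = (\<Sum>P\<in>C. measure lebesgue T * (bary P (barycenter T) * (\<alpha> + \<beta> \<bullet> P)))"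
    by (intro sum.cong refl) (simp add: integral_bary bary_barycenter_T)
  also have "\<dots> = measure lebesgue T * (\<alpha> + \<beta> \<bullet> barycenter T)"
    unfolding affine_bary[of \<alpha> \<beta> "barycenter T"] by (rule sum_distrib_left[symmetric])
  finally show ?thesis .
qed

lemma integral_RT:
  "(LINT x|lebesgue_on T. a + b *\<^sub>R (x - barycenter T)) = measure lebesgue T *\<^sub>R a"
proof (rule euclidean_eqI)
  fix i :: 'a assume "i \<in> Basis"
  have int: "integrable (lebesgue_on T) (\<lambda>x. a + b *\<^sub>R (x - barycenter T))"
    by (intro integrable_continuous_T continuous_intros)
  have "(LINT x|lebesgue_on T. a + b *\<^sub>R (x - barycenter T)) \<bullet> i = (LINT x|lebesgue_on T. (a + b *\<^sub>R (x - barycenter T)) \<bullet> i)"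
    using int by simp
  also have "\<dots> = (LINT x|lebesgue_on T. (a \<bullet> i - b * (barycenter T \<bullet> i)) + (b *\<^sub>R i) \<bullet> x)"
    by (intro Bochner_Integration.integral_cong) (auto simp: inner_add_left inner_diff_left inner_diff_right algebra_simps inner_commute)
  also have "\<dots> = measure lebesgue T * (a \<bullet> i)" unfolding integral_affine by (simp add: inner_commute)
  finally show "(LINT x|lebesgue_on T. a + b *\<^sub>R (x - barycenter T)) \<bullet> i = (measure lebesgue T *\<^sub>R a) \<bullet> i" by simp
qed

text \<open>The vertices may be shifted by any \<open>Q0\<close>, since the coefficients
  \<open>l P \<bullet> v\<close> sum to zero; only edge vectors enter.\<close>

lemma inner_eq_sum_edges:
  assumes "Q0 \<in> C" shows "e \<bullet> v = (\<Sum>P\<in>C. (l P \<bullet> v) * (e \<bullet> (P - Q0)))"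
proof -
  have "e \<bullet> v = e \<bullet> (\<Sum>P\<in>C. (l P \<bullet> v) *\<^sub>R P)" by (simp add: sum_l_scaleR)
  also have "\<dots> = (\<Sum>P\<in>C. (l P \<bullet> v) * (e \<bullet> P)) - (\<Sum>P\<in>C. l P \<bullet> v) * (e \<bullet> Q0)"
    by (simp add: sum_l inner_sum_right)
  finally show ?thesis by (simp add: inner_diff_right right_diff_distrib sum_subtractf sum_distrib_right)
qed

lemma eq_0_if_edges_orthogonal:
  assumes "\<And>P Q. P \<in> C \<Longrightarrow> Q \<in> C \<Longrightarrow> e \<bullet> (Q - P) = 0" shows "e = 0"
proof -
  obtain Q0 where "Q0 \<in> C" using card_ge_2 by fastforce
  then have "e \<bullet> e = 0" using inner_eq_sum_edges[of Q0 e e] assms by simp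
  then show ?thesis by simp
qed

text \<open>Expanding \<open>n\<close> in the edges from a vertex \<open>Q0\<close> of the facet
  leaves only the term of \<open>P\<close>, so \<open>n\<close> is a multiple of \<open>l P\<close>.
  Its length fixes the factor up to the sign \<open>s\<close>.\<close>

lemma facet_normal:
  assumes P: "P \<in> C" and n: "norm n = 1" "\<And>x y. x \<in> facet P \<Longrightarrow> y \<in> facet P \<Longrightarrow> n \<bullet> (x - y) = 0"
  shows "\<exists>s. \<bar>s\<bar> = 1 \<and> l P = (s / ht P) *\<^sub>R n"
proof -
  obtain Q0 where Q0: "Q0 \<in> C" "Q0 \<noteq> P" using vertices_Diff_nonempty[of P] by auto
  have Q: "Q \<in> facet P" if "Q \<in> C" "Q \<noteq> P" for Q using that by (intro hull_inc) auto
  define k where "k = n \<bullet> (P - Q0)"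
  have "n \<bullet> v = k * (l P \<bullet> v)" for v
  proof -
    have "n \<bullet> v = (\<Sum>R\<in>C. (l R \<bullet> v) * (n \<bullet> (R - Q0)))" by (rule inner_eq_sum_edges[OF Q0(1)])
    also have "\<dots> = (l P \<bullet> v) * (n \<bullet> (P - Q0)) + (\<Sum>R\<in>C - {P}. (l R \<bullet> v) * (n \<bullet> (R - Q0)))"
      using P finite_C by (rule sum.remove[rotated])
    also have "(\<Sum>R\<in>C - {P}. (l R \<bullet> v) * (n \<bullet> (R - Q0))) = 0"
      using n(2) Q Q0 by (intro sum.neutral) auto
    finally show ?thesis by (simp add: k_def)
  qed
  then have nk: "n = k *\<^sub>R l P" by (intro vector_eq_rdot[THEN iffD1]) (auto simp: inner_commute)
  have kl: "\<bar>k\<bar> * norm (l P) = 1" using n(1) nk by (metis norm_scaleR)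
  have "l P = (sgn k / ht P) *\<^sub>R n"
  proof -
    have "(sgn k / ht P) *\<^sub>R n = (sgn k * k * norm (l P)) *\<^sub>R l P" by (subst nk) (simp add: ht_def mult_ac)
    also have "sgn k * k = \<bar>k\<bar>" by (simp add: abs_sgn mult.commute)
    finally show ?thesis using kl by simp
  qed
  moreover have "\<bar>sgn k\<bar> = 1" using kl by (auto simp: abs_sgn_eq)
  ultimately show ?thesis by blast
qed

text \<open>Side values are limits from within all elements together. Restriction to one element
  yields the value of the continuous extension \<open>g\<close>, and the limit is unique because the
  barycenter of the facet is a limit point of the interior of that element.\<close>

lemma facet_limit_unique:
  fixes f :: "'a \<Rightarrow> real"
  assumes P: "P \<in> C" and lim: "(f \<longlongrightarrow> c) (at (barycenter (facet P)) within A)" and sub: "interior T \<subseteq> A"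
    and fg: "\<And>x. x \<in> interior T \<Longrightarrow> f x = g x" and g: "continuous_on UNIV g"
  shows "c = g (barycenter (facet P))"
proof -
  let ?x = "barycenter (facet P)"
  have "(f \<longlongrightarrow> c) (at ?x within interior T)" using lim sub by (rule tendsto_within_subset)
  then have 1: "(g \<longlongrightarrow> c) (at ?x within interior T)"
    by (rule Lim_transform_eventually) (auto simp: eventually_at_filter fg)
  have 2: "(g \<longlongrightarrow> g ?x) (at ?x within interior T)"
    using g by (auto simp: continuous_on_def intro: tendsto_within_subset)
  have "?x \<in> T" unfolding mem_T_iff using bary_barycenter_facet[OF P] by simp
  moreover have "?x \<notin> interior T" unfolding mem_interior_iff by (rule notI, drule bspec[OF _ P], simp add: bary_barycenter_facet[OF P P])
  moreover have "closure (interior T) = T"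
    using convex_closure_interior[OF convex_T] barycenter_interior compact_T by (auto simp: compact_imp_closed)
  ultimately have "?x \<in> closure (interior T)" "?x \<notin> interior T" by simp_all
  then have "?x islimpt interior T" by (simp add: closure_def)
  then have "at ?x within interior T \<noteq> bot" by (simp add: trivial_limit_within)
  then show ?thesis using 1 2 tendsto_unique by blast
qed

text \<open>Subtracting the average formulas for the facets opposite \<open>P\<close> and
  \<open>Q\<close> cancels the terms with \<open>w\<close> and leaves the constant field
  \<open>Q - P\<close> against the weak gradient. The facet barycenters differ by
  \<open>(Q - P) / d\<close>, so \<beta> and the mean gradient have the same product with every
  edge.\<close>

lemma CR_gradient:
  fixes w :: "'a \<Rightarrow> real"
  assumes Om: "open \<Omega>" "bounded \<Omega>" "interior T \<subseteq> \<Omega>" and w: "w \<in> sobolev 1 \<Omega>"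
    and tr: "\<And>P. P \<in> C \<Longrightarrow> has_trace \<Omega> (facet P) w (g P)"
    and val: "\<And>P. P \<in> C \<Longrightarrow> \<alpha> + \<beta> \<bullet> barycenter (facet P) = side_average (facet P) (g P)"
  shows "\<beta> = (LINT x|lebesgue_on T. weak_grad \<Omega> w x) /\<^sub>R measure lebesgue T"
proof -
  let ?d = "real DIM('a)" and ?m = "measure lebesgue T"
  have d: "?d > 0" using DIM_positive by simp
  note m = measure_T_pos
  define G where "G = (LINT x|lebesgue_on T. weak_grad \<Omega> w x)"
  note conv = convex_T Om(3) lmeasurable_open[OF Om(2,1), THEN fmeasurableD] T_lebesgue
  note wi = sobolev_1_cases[OF w Om(1)]
  have wT: "integrable (lebesgue_on T) w" and GT: "integrable (lebesgue_on T) (weak_grad \<Omega> w)"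
    using integrable_convex_interior[OF conv wi(1)] integrable_convex_interior[OF conv wi(2)] by auto
  have "(\<beta> - G /\<^sub>R ?m) \<bullet> (Q - P) = 0" if P: "P \<in> C" and Q: "Q \<in> C" for P Q
  proof -
    have i: "integrable (lebesgue_on T) (\<lambda>x. (x - P) \<bullet> weak_grad \<Omega> w x + ?d * w x)" for P
    proof -
      have "integrable (lebesgue_on T) (\<lambda>x. (x - P) \<bullet> weak_grad \<Omega> w x)"
      proof -
        obtain B where B: "\<And>x. x \<in> T \<Longrightarrow> norm (x - P) \<le> B"
          using compact_continuous_bound[OF continuous_on_diff[OF continuous_on_id continuous_on_const] compact_T, of P] by blast
        show ?thesis
        proof (rule Bochner_Integration.integrable_bound)
          show "integrable (lebesgue_on T) (\<lambda>x. B * norm (weak_grad \<Omega> w x))" using GT by simp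
          show "(\<lambda>x. (x - P) \<bullet> weak_grad \<Omega> w x) \<in> borel_measurable (lebesgue_on T)"
            by (rule borel_measurable_inner[OF continuous_measurable_lebesgue_on borel_measurable_integrable[OF GT]])
               (intro continuous_intros)
          show "AE x in lebesgue_on T. norm ((x - P) \<bullet> weak_grad \<Omega> w x) \<le> norm (B * norm (weak_grad \<Omega> w x))"
          proof (rule AE_I2)
            fix x assume "x \<in> space (lebesgue_on T)"
            then have "x \<in> T" by simp
            have "norm ((x - P) \<bullet> weak_grad \<Omega> w x) \<le> norm (x - P) * norm (weak_grad \<Omega> w x)"
              using Cauchy_Schwarz_ineq2 by simp
            also have "\<dots> \<le> B * norm (weak_grad \<Omega> w x)" by (rule mult_right_mono[OF B[OF \<open>x \<in> T\<close>] norm_ge_zero])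
            finally show "norm ((x - P) \<bullet> weak_grad \<Omega> w x) \<le> norm (B * norm (weak_grad \<Omega> w x))" by simp
          qed
        qed
      qed
      then show ?thesis using wT by auto
    qed
    have v: "?d * ?m * (\<alpha> + \<beta> \<bullet> barycenter (facet P)) = (LINT x|lebesgue_on T. (x - P) \<bullet> weak_grad \<Omega> w x + ?d * w x)" if "P \<in> C" for P
      using val[OF that] side_average_eq[OF that Om tr[OF that]] d m by simp
    have "?d * ?m * (\<beta> \<bullet> (barycenter (facet P) - barycenter (facet Q))) =
      (LINT x|lebesgue_on T. (x - P) \<bullet> weak_grad \<Omega> w x + ?d * w x) - (LINT x|lebesgue_on T. (x - Q) \<bullet> weak_grad \<Omega> w x + ?d * w x)"
      unfolding v[OF P, symmetric] v[OF Q, symmetric] by (simp add: inner_diff_right algebra_simps)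
    also have "\<dots> = (LINT x|lebesgue_on T. (Q - P) \<bullet> weak_grad \<Omega> w x)"
      unfolding Bochner_Integration.integral_diff[OF i i, symmetric] by (simp add: inner_diff_left algebra_simps)
    also have "\<dots> = (Q - P) \<bullet> G" unfolding G_def using GT by simp
    finally have "?d * ?m * (\<beta> \<bullet> (barycenter (facet P) - barycenter (facet Q))) = (Q - P) \<bullet> G" .
    moreover have "barycenter (facet P) - barycenter (facet Q) = (Q - P) /\<^sub>R ?d"
      unfolding barycenter_facet_eq[OF P] barycenter_facet_eq[OF Q] by (simp flip: scaleR_diff_right)
    ultimately have "?d * ?m * (inverse ?d * (\<beta> \<bullet> (Q - P))) = (Q - P) \<bullet> G" by simp
    moreover have "?d * ?m * (inverse ?d * X) = ?m * X" for X using d by (simp add: field_simps)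
    ultimately have "?m * (\<beta> \<bullet> (Q - P)) = (Q - P) \<bullet> G" by simp
    then have "\<beta> \<bullet> (Q - P) = inverse ?m * (G \<bullet> (Q - P))" using m by (simp add: inner_commute field_simps)
    then show ?thesis by (simp add: inner_diff_left)
  qed
  then have "\<beta> - G /\<^sub>R ?m = 0" by (rule eq_0_if_edges_orthogonal)
  then show ?thesis by (simp add: G_def)
qed

text \<open>From the barycenter of the simplex to that of the facet the coordinate
  \<open>bary P\<close> falls from \<open>1 / (d + 1)\<close> to 0.\<close>

lemma RT_flux_facet:
  assumes P: "P \<in> C"
  shows "(a + b *\<^sub>R (barycenter (facet P) - barycenter T)) \<bullet> l P = l P \<bullet> a - b / (real DIM('a) + 1)"
proof -
  have lt: "l P \<bullet> (barycenter T - P) = - real DIM('a) / (real DIM('a) + 1)"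
    using bary_barycenter_T[OF P] by (simp add: bary_def field_simps)
  have "(a + b *\<^sub>R (barycenter (facet P) - barycenter T)) \<bullet> l P = l P \<bullet> a + b * (inverse (real DIM('a)) * (l P \<bullet> (barycenter T - P)))"
    unfolding barycenter_facet_eq[OF P] by (simp add: inner_commute[of _ "l P"] inner_add_right)
  also have "inverse (real DIM('a)) * (l P \<bullet> (barycenter T - P)) = - 1 / (real DIM('a) + 1)"
    unfolding lt by (simp add: divide_simps)
  finally show ?thesis by simp
qed

text \<open>The constant part cancels because the \<open>l P\<close> sum to zero, and each of the
  \<open>d + 1\<close> facets contributes \<open>- b / (d + 1)\<close>. The sign is that of the
  inward gradients \<open>l P\<close>.\<close>

lemma sum_RT_flux:
  fixes b :: real
  shows "(\<Sum>P\<in>C. (a + b *\<^sub>R (barycenter (facet P) - barycenter T)) \<bullet> l P) = - b"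
proof -
  have c: "real (card C) = real DIM('a) + 1" "real DIM('a) + 1 \<noteq> 0" using card_C by auto
  have "(\<Sum>P\<in>C. (a + b *\<^sub>R (barycenter (facet P) - barycenter T)) \<bullet> l P) = (\<Sum>P\<in>C. l P \<bullet> a - b / (real DIM('a) + 1))"
    by (intro sum.cong refl RT_flux_facet)
  also have "\<dots> = - (real (card C) * (b / (real DIM('a) + 1)))" by (simp add: sum_subtractf sum_l)
  finally show ?thesis unfolding c(1) using c(2) by simp
qed

text \<open>Integration by parts of an affine function against a Raviart-Thomas field on one
  element, divided by its volume. The divergence of the field is \<open>d * b\<close>, both volume
  integrals are one-point values, and the minus sign reflects that \<open>l P\<close> points inward.
  The identity is algebra with barycentric coordinates.\<close>

lemma discrete_integration_by_parts:
  fixes \<alpha> b :: real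
  shows "a \<bullet> \<beta> + DIM('a) * b * (\<alpha> + \<beta> \<bullet> barycenter T) =
    - (DIM('a) * (\<Sum>P\<in>C. (\<alpha> + \<beta> \<bullet> barycenter (facet P)) * ((a + b *\<^sub>R (barycenter (facet P) - barycenter T)) \<bullet> l P)))"
proof -
  let ?d = "real DIM('a)" and ?x = "barycenter T"
  have d: "?d > 0" using DIM_positive by simp
  \<comment> \<open>Each term is split so that summation over \<open>P\<close> meets only known
    sums: the total flux, \<open>sum_l\<close>, \<open>sum_l_scaleR\<close> and the vanishing first
    moment \<open>s1\<close>.\<close>
  have t: "(\<alpha> + \<beta> \<bullet> barycenter (facet P)) * ((a + b *\<^sub>R (barycenter (facet P) - ?x)) \<bullet> l P) =
      (\<alpha> + \<beta> \<bullet> ?x) * ((a + b *\<^sub>R (barycenter (facet P) - ?x)) \<bullet> l P)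
      + (\<beta> \<bullet> ?x) * (l P \<bullet> a) / ?d - (\<beta> \<bullet> ((l P \<bullet> a) *\<^sub>R P)) / ?d - b / (?d * (?d + 1)) * (\<beta> \<bullet> (?x - P))" if P: "P \<in> C" for P
  proof -
    have e: "(a + b *\<^sub>R (barycenter (facet P) - ?x)) \<bullet> l P = l P \<bullet> a - b / (?d + 1)"
      by (rule RT_flux_facet[OF P])
    define B where "B = \<beta> \<bullet> (?x - P)"
    have v: "\<alpha> + \<beta> \<bullet> barycenter (facet P) = (\<alpha> + \<beta> \<bullet> ?x) + B / ?d"
      unfolding barycenter_facet_eq[OF P] B_def by (simp add: inner_add_right divide_inverse mult.commute)
    have BL: "B * (l P \<bullet> a) / ?d = (\<beta> \<bullet> ?x) * (l P \<bullet> a) / ?d - (\<beta> \<bullet> ((l P \<bullet> a) *\<^sub>R P)) / ?d"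
      unfolding B_def by (simp add: inner_diff_right left_diff_distrib right_diff_distrib diff_divide_distrib mult.commute)
    have "B / ?d * (l P \<bullet> a - b / (?d + 1)) = B * (l P \<bullet> a) / ?d - b / (?d * (?d + 1)) * B"
      by (simp add: right_diff_distrib mult.commute)
    then show ?thesis unfolding v distrib_right B_def[symmetric] e BL by simp
  qed
  have s1: "(\<Sum>P\<in>C. \<beta> \<bullet> (?x - P)) = 0"
  proof -
    have "(\<Sum>v\<in>C. v) = (?d + 1) *\<^sub>R ?x" unfolding barycenter_T by simp
    then show ?thesis using card_C
      by (simp add: sum_subtractf inner_diff_right inner_sum_right[symmetric])
  qed
  have "(\<Sum>P\<in>C. (\<alpha> + \<beta> \<bullet> barycenter (facet P)) * ((a + b *\<^sub>R (barycenter (facet P) - ?x)) \<bullet> l P)) =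
     (\<alpha> + \<beta> \<bullet> ?x) * (\<Sum>P\<in>C. (a + b *\<^sub>R (barycenter (facet P) - ?x)) \<bullet> l P)
      + (\<beta> \<bullet> ?x) * (\<Sum>P\<in>C. l P \<bullet> a) / ?d - (\<beta> \<bullet> (\<Sum>P\<in>C. (l P \<bullet> a) *\<^sub>R P)) / ?d - b / (?d * (?d + 1)) * (\<Sum>P\<in>C. \<beta> \<bullet> (?x - P))"
    by (simp add: t sum.distrib sum_subtractf sum_distrib_left sum_divide_distrib inner_sum_right cong: sum.cong)
  also have "\<dots> = - b * (\<alpha> + \<beta> \<bullet> ?x) - (\<beta> \<bullet> a) / ?d"
    unfolding sum_RT_flux sum_l sum_l_scaleR s1 by simp
  finally have *: "(\<Sum>P\<in>C. (\<alpha> + \<beta> \<bullet> barycenter (facet P)) * ((a + b *\<^sub>R (barycenter (facet P) - ?x)) \<bullet> l P)) =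
    - b * (\<alpha> + \<beta> \<bullet> ?x) - (\<beta> \<bullet> a) / ?d" .
  show ?thesis unfolding * using d by (simp add: field_simps inner_commute)
qed

lemma integrable_inner_T:
  assumes "integrable (lebesgue_on T) V" shows "integrable (lebesgue_on T) (\<lambda>x. (x - P) \<bullet> V x)"
proof (rule Bochner_Integration.integrable_bound)
  obtain B where B: "\<And>x. x \<in> T \<Longrightarrow> norm (x - P) \<le> B"
    using compact_continuous_bound[OF continuous_on_diff[OF continuous_on_id continuous_on_const] compact_T, of P] by blast
  then have "norm (barycenter T - P) \<le> B" using barycenter_interior interior_subset by blast
  then have "0 \<le> B" using norm_ge_zero order_trans by blast
  show "integrable (lebesgue_on T) (\<lambda>x. (SOME B. \<forall>x\<in>T. norm (x - P) \<le> B) * norm (V x))" using assms by simp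
  show "(\<lambda>x. (x - P) \<bullet> V x) \<in> borel_measurable (lebesgue_on T)"
    by (rule borel_measurable_inner[OF continuous_measurable_lebesgue_on borel_measurable_integrable[OF assms]])
       (intro continuous_intros)
  have some: "\<forall>x\<in>T. norm (x - P) \<le> (SOME B. \<forall>x\<in>T. norm (x - P) \<le> B)"
    by (rule someI[where x = B]) (use B in blast)
  show "AE x in lebesgue_on T. norm ((x - P) \<bullet> V x) \<le> norm ((SOME B. \<forall>x\<in>T. norm (x - P) \<le> B) * norm (V x))"
  proof (rule AE_I2)
    fix x assume "x \<in> space (lebesgue_on T)"
    then have x: "x \<in> T" by simp
    have "norm ((x - P) \<bullet> V x) \<le> norm (x - P) * norm (V x)" using Cauchy_Schwarz_ineq2 by simp
    also have "\<dots> \<le> (SOME B. \<forall>x\<in>T. norm (x - P) \<le> B) * norm (V x)"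
      by (rule mult_right_mono[OF bspec[OF some x] norm_ge_zero])
    finally show "norm ((x - P) \<bullet> V x) \<le> norm ((SOME B. \<forall>x\<in>T. norm (x - P) \<le> B) * norm (V x))" by simp
  qed
qed

text \<open>The average formula for \<open>z \<bullet> n P\<close> is summed over all facets. In
  \<open>(x - P) \<bullet> J x (l P)\<close> the part with \<open>x\<close> cancels because the
  \<open>l P\<close> sum to zero, while the part with \<open>P\<close> contracts by
  \<open>sum_l_scaleR\<close> to the trace of the Jacobian, which is the divergence.\<close>

lemma RT_divergence:
  fixes z :: "'a \<Rightarrow> 'a" and b :: real
  assumes Om: "open \<Omega>" "bounded \<Omega>" "interior T \<subseteq> \<Omega>"
    and z: "\<And>i. i \<in> Basis \<Longrightarrow> (\<lambda>x. z x \<bullet> i) \<in> sobolev 1 \<Omega>"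
    and n: "\<And>P. P \<in> C \<Longrightarrow> l P = k P *\<^sub>R n P"
    and tr: "\<And>P. P \<in> C \<Longrightarrow> has_trace \<Omega> (facet P) (\<lambda>x. z x \<bullet> n P) (g P)"
    and val: "\<And>P. P \<in> C \<Longrightarrow> (a + b *\<^sub>R (barycenter (facet P) - barycenter T)) \<bullet> n P = side_average (facet P) (g P)"
  shows "DIM('a) * measure lebesgue T * b = (LINT x|lebesgue_on T. (\<Sum>i\<in>Basis. weak_grad \<Omega> (\<lambda>x. z x \<bullet> i) x \<bullet> i))"
proof -
  let ?d = "real DIM('a)" and ?m = "measure lebesgue T"
  have d: "?d > 0" using DIM_positive by simp
  note m = measure_T_pos
  define G where "G i = weak_grad \<Omega> (\<lambda>x. z x \<bullet> i)" for i
  \<comment> \<open>\<open>J x v\<close> represents the weak gradient of the component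
    \<open>z \<bullet> v\<close>. It is linear in \<open>v\<close>, so the formula for
    \<open>n P\<close> can be rescaled to one for \<open>l P\<close>.\<close>
  define J where "J x v = (\<Sum>i\<in>Basis. (v \<bullet> i) *\<^sub>R G i x)" for x v
  have Oml: "\<Omega> \<in> sets lebesgue" using Om(1) by simp
  note conv = convex_T Om(3) Oml T_lebesgue
  have GT: "integrable (lebesgue_on T) (G i)" if "i \<in> Basis" for i
    unfolding G_def using integrable_convex_interior[OF conv sobolev_1_cases(2)[OF z[OF that] Om(1)]] .
  have zT: "integrable (lebesgue_on T) (\<lambda>x. z x \<bullet> v)" for v
  proof -
    have "integrable (lebesgue_on T) (\<lambda>x. \<Sum>i\<in>Basis. (z x \<bullet> i) * (v \<bullet> i))"
      using integrable_convex_interior[OF conv sobolev_1_cases(1)[OF z Om(1)]]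
      by (intro Bochner_Integration.integrable_sum) auto
    then show ?thesis by (subst euclidean_inner)
  qed
  have JT: "integrable (lebesgue_on T) (\<lambda>x. J x v)" for v
    unfolding J_def using GT by (intro Bochner_Integration.integrable_sum integrable_scaleR_right) auto
  have iJ: "integrable (lebesgue_on T) (\<lambda>x. (x - P) \<bullet> J x v)" for P v by (rule integrable_inner_T[OF JT])
  have flux: "?d * ?m * ((a + b *\<^sub>R (barycenter (facet P) - barycenter T)) \<bullet> l P) =
      (LINT x|lebesgue_on T. (x - P) \<bullet> J x (l P)) + ?d * (LINT x|lebesgue_on T. z x \<bullet> l P)" if P: "P \<in> C" for P
  proof -
    have w: "(\<lambda>x. z x \<bullet> n P) \<in> sobolev 1 \<Omega>" using tr[OF P] by (simp add: has_trace_def)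
    have "has_weak_grad \<Omega> (\<lambda>x. \<Sum>i\<in>Basis. (n P \<bullet> i) * (z x \<bullet> i)) (\<lambda>x. J x (n P))"
      unfolding J_def G_def by (intro has_weak_grad_lincomb Oml sobolev_1_cases(3)[OF z Om(1)])
    moreover have "(\<lambda>x. \<Sum>i\<in>Basis. (n P \<bullet> i) * (z x \<bullet> i)) = (\<lambda>x. z x \<bullet> n P)"
      by (intro ext) (subst euclidean_inner, simp add: mult.commute)
    ultimately have "has_weak_grad \<Omega> (\<lambda>x. z x \<bullet> n P) (\<lambda>x. J x (n P))" by simp
    then have ae: "AE x in lebesgue_on T. weak_grad \<Omega> (\<lambda>x. z x \<bullet> n P) x = J x (n P)"
      by (intro AE_convex_interior[OF conv] weak_grad_AE_eq Om)
    have iw: "integrable (lebesgue_on T) (weak_grad \<Omega> (\<lambda>x. z x \<bullet> n P))"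
      by (rule integrable_convex_interior[OF conv sobolev_1_cases(2)[OF w Om(1)]])
    have "side_average (facet P) (g P) * (?d * ?m) = (LINT x|lebesgue_on T. (x - P) \<bullet> weak_grad \<Omega> (\<lambda>x. z x \<bullet> n P) x + ?d * (z x \<bullet> n P))"
      using side_average_eq[OF P Om tr[OF P]] d m by simp
    also have "\<dots> = (LINT x|lebesgue_on T. (x - P) \<bullet> weak_grad \<Omega> (\<lambda>x. z x \<bullet> n P) x) + ?d * (LINT x|lebesgue_on T. z x \<bullet> n P)"
      using integrable_inner_T[OF iw] zT by simp
    also have "(LINT x|lebesgue_on T. (x - P) \<bullet> weak_grad \<Omega> (\<lambda>x. z x \<bullet> n P) x) = (LINT x|lebesgue_on T. (x - P) \<bullet> J x (n P))"
      by (rule integral_cong_AE[OF borel_measurable_integrable[OF integrable_inner_T[OF iw]] borel_measurable_integrable[OF iJ]])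
         (use ae in eventually_elim, simp)
    finally have "k P * (side_average (facet P) (g P) * (?d * ?m)) = (LINT x|lebesgue_on T. k P * ((x - P) \<bullet> J x (n P))) + ?d * (LINT x|lebesgue_on T. k P * (z x \<bullet> n P))"
      using iJ zT by (simp add: distrib_left)
    moreover have "k P * ((x - P) \<bullet> J x (n P)) = (x - P) \<bullet> J x (l P)" for x
      unfolding J_def n[OF P] by (simp add: inner_sum_right sum_distrib_left mult.assoc)
    moreover have "k P * (z x \<bullet> n P) = z x \<bullet> l P" for x unfolding n[OF P] by simp
    moreover have "(a + b *\<^sub>R (barycenter (facet P) - barycenter T)) \<bullet> l P = k P * side_average (facet P) (g P)"
      unfolding n[OF P] using val[OF P] by simp
    ultimately show ?thesis by (simp add: mult_ac)
  qed
  have "- (?d * ?m * b) = ?d * ?m * (\<Sum>P\<in>C. (a + b *\<^sub>R (barycenter (facet P) - barycenter T)) \<bullet> l P)"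
    unfolding sum_RT_flux by simp
  also have "\<dots> = (\<Sum>P\<in>C. (LINT x|lebesgue_on T. (x - P) \<bullet> J x (l P)) + ?d * (LINT x|lebesgue_on T. z x \<bullet> l P))"
    unfolding sum_distrib_left by (intro sum.cong refl flux)
  also have "\<dots> = (LINT x|lebesgue_on T. (\<Sum>P\<in>C. (x - P) \<bullet> J x (l P) + ?d * (z x \<bullet> l P)))"
    using iJ zT by (subst Bochner_Integration.integral_sum) auto
  also have "\<dots> = (LINT x|lebesgue_on T. - (\<Sum>i\<in>Basis. G i x \<bullet> i))"
  proof (intro Bochner_Integration.integral_cong refl)
    fix x
    have lin: "(\<Sum>P\<in>C. x \<bullet> J x (l P)) = 0"
    proof -
      have "(\<Sum>P\<in>C. x \<bullet> J x (l P)) = (\<Sum>i\<in>Basis. (\<Sum>P\<in>C. l P \<bullet> i) * (x \<bullet> G i x))"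
        unfolding J_def inner_sum_right inner_scaleR_right sum_distrib_right by (rule sum.swap)
      then show ?thesis by (simp add: sum_l)
    qed
    have "(\<Sum>P\<in>C. P \<bullet> J x (l P)) = (\<Sum>i\<in>Basis. (\<Sum>P\<in>C. (l P \<bullet> i) *\<^sub>R P) \<bullet> G i x)"
      unfolding J_def inner_sum_right inner_scaleR_right inner_sum_left inner_scaleR_left by (rule sum.swap)
    also have "\<dots> = (\<Sum>i\<in>Basis. G i x \<bullet> i)" unfolding sum_l_scaleR by (simp add: inner_commute)
    finally have P: "(\<Sum>P\<in>C. P \<bullet> J x (l P)) = (\<Sum>i\<in>Basis. G i x \<bullet> i)" .
    have "(\<Sum>P\<in>C. z x \<bullet> l P) = 0" using sum_l[of "z x"] by (simp add: inner_commute)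
    then show "(\<Sum>P\<in>C. (x - P) \<bullet> J x (l P) + ?d * (z x \<bullet> l P)) = - (\<Sum>i\<in>Basis. G i x \<bullet> i)"
      using lin P by (simp add: inner_diff_left sum.distrib sum_subtractf flip: sum_distrib_left)
  qed
  finally show ?thesis unfolding G_def by simp
qed

end

section \<open>Meshes\<close>

text \<open>A Lipschitz boundary has no slits. At a frontier point surrounded by the closure, a step
  in the direction \<open>- e\<close> leads strictly below the graph, into an open set that lies in
  the closure of \<Omega> and yet avoids \<Omega>.\<close>

lemma interior_closure_lipschitz:
  fixes \<Omega> :: "'a::euclidean_space set"
  assumes "open \<Omega>" "lipschitz_boundary \<Omega>"
  shows "interior (closure \<Omega>) = \<Omega>"
proof
  show "\<Omega> \<subseteq> interior (closure \<Omega>)" using closure_subset assms(1) by (rule interior_maximal)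
  show "interior (closure \<Omega>) \<subseteq> \<Omega>"
  proof
    fix x assume x: "x \<in> interior (closure \<Omega>)"
    show "x \<in> \<Omega>"
    proof (rule ccontr)
      assume "x \<notin> \<Omega>"
      then have "x \<in> frontier \<Omega>" using x interior_subset assms(1) by (auto simp: frontier_def interior_open)
      then obtain U e L \<gamma> where U: "open U" "x \<in> U" "norm e = 1" "lipschitz_on L {y. y \<bullet> e = 0} \<gamma>"
        "\<Omega> \<inter> U = {y \<in> U. \<gamma> (y - (y \<bullet> e) *\<^sub>R e) < y \<bullet> e}"
        using bspec[OF assms(2)[unfolded lipschitz_boundary_def] \<open>x \<in> frontier \<Omega>\<close>]
        by (elim exE conjE) (rule that)
      define g where "g y = \<gamma> (y - (y \<bullet> e) *\<^sub>R e) - y \<bullet> e" for y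
      have "continuous_on UNIV (\<lambda>y. \<gamma> (y - (y \<bullet> e) *\<^sub>R e))"
        by (rule continuous_on_compose2[OF lipschitz_on_continuous_on[OF U(4)]])
           (use U(3) in \<open>auto intro!: continuous_intros simp: inner_diff_left dot_square_norm\<close>)
      then have gc: "continuous_on UNIV g" unfolding g_def by (intro continuous_intros)
      define N where "N = U \<inter> interior (closure \<Omega>)"
      have N: "open N" "x \<in> N" using U x by (auto simp: N_def)
      obtain r where r: "0 < r" "cball x r \<subseteq> N" using N open_contains_cball by blast
      \<comment> \<open>The shift along \<open>e\<close> keeps the argument of the graph function
        \<gamma> and lowers the height, so \<open>g\<close> grows by exactly
        \<open>r\<close>.\<close>
      define y where "y = x - r *\<^sub>R e"
      have y: "y \<in> N" using r U(3) by (auto simp: y_def dist_norm)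
      have "g y = g x + r" using U(3) unfolding g_def y_def
        by (simp add: inner_diff_left dot_square_norm algebra_simps)
      moreover have "0 \<le> g x" using U(2,5) \<open>x \<notin> \<Omega>\<close> unfolding g_def by force
      ultimately have "0 < g y" using r by simp
      define W where "W = N \<inter> {y. 0 < g y}"
      have "open W" unfolding W_def using N(1) gc by (intro open_Int open_Collect_less continuous_intros) auto
      moreover have "y \<in> W" using y \<open>0 < g y\<close> by (simp add: W_def)
      moreover have "W \<subseteq> closure \<Omega>" using interior_subset by (auto simp: W_def N_def)
      ultimately have "W \<inter> \<Omega> \<noteq> {}"
        by (metis Int_commute closure_iff_nhds_not_empty open_Int_closure_eq_empty disjoint_iff subsetD)
      then obtain q where q: "q \<in> W" "q \<in> \<Omega>" by blast
      then have "q \<in> \<Omega> \<inter> U" by (auto simp: W_def N_def)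
      then show False using q(1) unfolding U(5) W_def g_def by auto
    qed
  qed
qed

locale fe_mesh =
  fixes \<Omega> :: "'a::euclidean_space set" and \<T> :: "'a set set"
  assumes domain: "polyhedral_lipschitz_domain \<Omega>" and mesh: "regular_triangulation \<Omega> \<T>"
begin

lemma open_Om: "open \<Omega>" and bounded_Om: "bounded \<Omega>" and lip: "lipschitz_boundary \<Omega>"
  using domain by (auto simp: polyhedral_lipschitz_domain_def)

lemma Om_lebesgue: "\<Omega> \<in> sets lebesgue" using open_Om by simp

lemma finite_mesh: "finite \<T>" and face_mesh: "T \<in> \<T> \<Longrightarrow> T' \<in> \<T> \<Longrightarrow> (T \<inter> T') face_of T"
  and simplex_mesh: "T \<in> \<T> \<Longrightarrow> int DIM('a) simplex T" and Union_mesh: "\<Union>\<T> = closure \<Omega>"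
  using mesh by (auto simp: regular_triangulation_def triangulation_def)

lemma mesh_nd_simplex:
  assumes "T \<in> \<T>" obtains C l where "nd_simplex C l" "T = convex hull C"
  using nd_simplex_exists[OF simplex_mesh[OF assms]] by blast

lemma convex_elem: "T \<in> \<T> \<Longrightarrow> convex T" and compact_elem: "T \<in> \<T> \<Longrightarrow> compact T"
proof -
  assume "T \<in> \<T>"
  then obtain C l where Cl: "nd_simplex C l" "T = convex hull C" using mesh_nd_simplex by blast
  interpret nd_simplex C l by fact
  show "convex T" "compact T" using Cl(2) compact_T by auto
qed

lemma elem_lebesgue: "T \<in> \<T> \<Longrightarrow> T \<in> sets lebesgue"
  using compact_elem by (auto intro: lmeasurable_compact fmeasurableD)

lemma interior_closure_Om: "interior (closure \<Omega>) = \<Omega>"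
  by (rule interior_closure_lipschitz[OF open_Om lip])

lemma interior_elem_subset: "T \<in> \<T> \<Longrightarrow> interior T \<subseteq> \<Omega>"
  using interior_mono[of T "closure \<Omega>"] Union_mesh interior_closure_Om by auto

text \<open>The intersection of two elements is a face of each, and a face that meets the relative
  interior of a convex set is the whole set.\<close>

lemma interiors_disjoint:
  assumes "T \<in> \<T>" "T' \<in> \<T>" "interior T \<inter> interior T' \<noteq> {}"
  shows "T = T'"
proof -
  have sub: "T \<subseteq> T'" if mem: "T \<in> \<T>" "T' \<in> \<T>" and meet: "interior T \<inter> interior T' \<noteq> {}" for T T'
  proof -
    have "(T \<inter> T') face_of T" by (rule face_mesh[OF mem])
    moreover obtain x where x: "x \<in> interior T" "x \<in> interior T'" using meet by blast
    then have "x \<in> T \<inter> T'" "x \<in> rel_interior T"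
      using interior_subset interior_subset_rel_interior by blast+
    then have "\<not> disjnt (T \<inter> T') (rel_interior T)" unfolding disjnt_iff by blast
    ultimately have "T \<subseteq> T \<inter> T'" by (intro subset_of_face_of[OF _ subset_refl]) (auto simp: disjnt_def)
    then show ?thesis by simp
  qed
  show ?thesis using sub[of T T'] sub[of T' T] assms by auto
qed

lemma AE_not_frontier: "AE x in lebesgue. \<forall>T\<in>\<T>. x \<notin> frontier T"
proof -
  have "AE x in lebesgue. x \<notin> frontier T" if "T \<in> \<T>" for T
    using negligible_convex_frontier[OF convex_elem[OF that]] by (intro AE_not_in) (simp add: negligible_iff_null_sets)
  then show ?thesis using finite_mesh by (subst AE_ball_countable) (auto intro: countable_finite)
qed

text \<open>The elements cover \<Omega>, while their interiors are disjoint and contained in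
  \<Omega>.\<close>

lemma elements_of_generic_point:
  assumes "\<forall>T\<in>\<T>. x \<notin> frontier T"
  shows "(if x \<in> \<Omega> then 1 else 0) = (\<Sum>T\<in>\<T>. indicator T x :: real)"
proof -
  have int: "x \<in> T \<longleftrightarrow> x \<in> interior T" if "T \<in> \<T>" for T
    using assms that closure_subset[of T] interior_subset[of T] by (auto simp: frontier_def)
  show ?thesis
  proof (cases "x \<in> \<Omega>")
    case True
    then have "x \<in> \<Union>\<T>" using Union_mesh closure_subset by auto
    then obtain T where T: "T \<in> \<T>" "x \<in> T" by auto
    have "(\<Sum>T\<in>\<T>. indicator T x :: real) = (\<Sum>T'\<in>\<T>. if T' = T then 1 else 0)"
    proof (intro sum.cong refl)
      fix T' assume T': "T' \<in> \<T>"
      show "(indicator T' x :: real) = (if T' = T then 1 else 0)"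
        using interiors_disjoint[OF T' T(1)] int[OF T'] int[OF T(1)] T(2) by (auto simp: indicator_def)
    qed
    then show ?thesis using True T(1) finite_mesh by simp
  next
    case False
    then have "x \<notin> T" if "T \<in> \<T>" for T using int[OF that] interior_elem_subset[OF that] by auto
    then show ?thesis using False by simp
  qed
qed

section \<open>Elementwise integration, projections and gradients\<close>

lemma AE_indicator_elements:
  fixes f :: "'a \<Rightarrow> 'b::euclidean_space"
  shows "AE x in lebesgue. indicator \<Omega> x *\<^sub>R f x = (\<Sum>T\<in>\<T>. indicator T x *\<^sub>R f x)"
  using AE_not_frontier
proof eventually_elim
  case (elim x)
  have "indicator \<Omega> x *\<^sub>R f x = (\<Sum>T\<in>\<T>. indicator T x) *\<^sub>R f x"
    unfolding elements_of_generic_point[OF elim, symmetric] by (simp add: indicator_def)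
  then show ?case by (simp add: scaleR_sum_left)
qed

lemma integral_elements:
  fixes f :: "'a \<Rightarrow> 'b::euclidean_space"
  assumes "\<And>T. T \<in> \<T> \<Longrightarrow> integrable (lebesgue_on T) f"
  shows "integrable (lebesgue_on \<Omega>) f" "(LINT x|lebesgue_on \<Omega>. f x) = (\<Sum>T\<in>\<T>. LINT x|lebesgue_on T. f x)"
proof -
  have iT: "integrable lebesgue (\<lambda>x. indicator T x *\<^sub>R f x)" if "T \<in> \<T>" for T
    using assms[OF that] elem_lebesgue[OF that] by (simp add: integrable_restrict_space)
  have i: "integrable lebesgue (\<lambda>x. \<Sum>T\<in>\<T>. indicator T x *\<^sub>R f x)"
    by (intro Bochner_Integration.integrable_sum iT)
  have e: "AE x in lebesgue. (\<Sum>T\<in>\<T>. indicator T x *\<^sub>R f x) = indicator \<Omega> x *\<^sub>R f x"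
    using AE_indicator_elements[of f] by eventually_elim simp
  note m = borel_measurable_lebesgue_AE[OF borel_measurable_integrable[OF i] e]
  show "integrable (lebesgue_on \<Omega>) f"
    using integrable_cong_AE_imp[OF i m e] Om_lebesgue by (simp add: integrable_restrict_space)
  have "(LINT x|lebesgue_on \<Omega>. f x) = (LINT x|lebesgue. indicator \<Omega> x *\<^sub>R f x)"
    using Om_lebesgue by (simp add: integral_restrict_space)
  also have "\<dots> = (LINT x|lebesgue. (\<Sum>T\<in>\<T>. indicator T x *\<^sub>R f x))"
    by (rule integral_cong_AE[OF borel_measurable_integrable[OF i] m e, symmetric])
  also have "\<dots> = (\<Sum>T\<in>\<T>. LINT x|lebesgue. indicator T x *\<^sub>R f x)"
    by (rule Bochner_Integration.integral_sum[OF iT])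
  also have "\<dots> = (\<Sum>T\<in>\<T>. LINT x|lebesgue_on T. f x)"
    using elem_lebesgue by (intro sum.cong refl) (simp add: integral_restrict_space)
  finally show "(LINT x|lebesgue_on \<Omega>. f x) = (\<Sum>T\<in>\<T>. LINT x|lebesgue_on T. f x)" .
qed

lemma integrable_elem:
  fixes f :: "'a \<Rightarrow> 'b::euclidean_space"
  shows "T \<in> \<T> \<Longrightarrow> integrable (lebesgue_on \<Omega>) f \<Longrightarrow> integrable (lebesgue_on T) f"
  by (rule integrable_convex_interior[OF convex_elem interior_elem_subset Om_lebesgue elem_lebesgue])

lemma AE_elem: "T \<in> \<T> \<Longrightarrow> AE x in lebesgue_on \<Omega>. Q x \<Longrightarrow> AE x in lebesgue_on T. Q x"
  by (rule AE_convex_interior[OF convex_elem interior_elem_subset Om_lebesgue elem_lebesgue])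

lemma measure_elem_pos: 
  assumes "T \<in> \<T>" shows "0 < measure lebesgue T"
proof -
  obtain C l where Cl: "nd_simplex C l" "T = convex hull C" using mesh_nd_simplex[OF assms] .
  interpret nd_simplex C l by fact
  show ?thesis using measure_T_pos Cl(2) by simp
qed

lemma integral_const_elem: "T \<in> \<T> \<Longrightarrow> integrable (lebesgue_on T) (\<lambda>x. c::'b::euclidean_space)"
  "T \<in> \<T> \<Longrightarrow> (LINT x|lebesgue_on T. c) = measure lebesgue T *\<^sub>R (c::'b)"
proof -
  assume T: "T \<in> \<T>"
  show "integrable (lebesgue_on T) (\<lambda>x. c)"
    using compact_elem[OF T] by (intro integrable_continuous_bounded elem_lebesgue T compact_imp_bounded) auto
  show "(LINT x|lebesgue_on T. c) = measure lebesgue T *\<^sub>R c"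
    using elem_lebesgue[OF T] by (simp add: measure_restrict_space)
qed

lemma integral_elementwise_constant:
  fixes f :: "'a \<Rightarrow> 'b::euclidean_space"
  assumes c: "\<And>T x. T \<in> \<T> \<Longrightarrow> x \<in> interior T \<Longrightarrow> f x = c T"
  shows "integrable (lebesgue_on \<Omega>) f" "(LINT x|lebesgue_on \<Omega>. f x) = (\<Sum>T\<in>\<T>. measure lebesgue T *\<^sub>R c T)"
proof -
  have 1: "integrable (lebesgue_on T) f" "(LINT x|lebesgue_on T. f x) = measure lebesgue T *\<^sub>R c T" if "T \<in> \<T>" for T
    using integral_interior_cong[OF convex_elem[OF that] elem_lebesgue[OF that] integral_const_elem(1)[OF that] c[OF that]]
      integral_const_elem(2)[OF that] by auto
  then show "integrable (lebesgue_on \<Omega>) f" "(LINT x|lebesgue_on \<Omega>. f x) = (\<Sum>T\<in>\<T>. measure lebesgue T *\<^sub>R c T)"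
    using integral_elements[of f] by auto
qed

lemma interior_unique_indicator:
  assumes "T \<in> \<T>" "x \<in> interior T" "T' \<in> \<T>" shows "indicator (interior T') x = (if T' = T then 1 else 0 :: real)"
  using interiors_disjoint[OF assms(3,1)] assms by (auto simp: indicator_def)

lemma proj0_elem:
  fixes v :: "'a \<Rightarrow> 'b::euclidean_space"
  assumes "T \<in> \<T>" "x \<in> interior T"
  shows "proj0 \<T> v x = (LINT y|lebesgue_on T. v y) /\<^sub>R measure lebesgue T"
proof -
  have "proj0 \<T> v x = (\<Sum>T'\<in>\<T>. if T' = T then (LINT y|lebesgue_on T'. v y) /\<^sub>R measure lebesgue T' else 0)"
    unfolding proj0_def by (intro sum.cong refl) (simp add: interior_unique_indicator[OF assms])
  then show ?thesis using finite_mesh assms(1) by simp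
qed

lemma elem_interiors_mem: "T \<in> \<T> \<Longrightarrow> interior T \<subseteq> elem_interiors \<T>"
  by (auto simp: elem_interiors_def)

lemma grad_h_elem:
  assumes "T \<in> \<T>" "x \<in> interior T" "\<And>y. y \<in> interior T \<Longrightarrow> v y = \<alpha> + \<beta> \<bullet> y"
  shows "grad_h \<T> v x = \<beta>"
proof -
  have "((\<lambda>y. \<alpha> + \<beta> \<bullet> y) has_derivative (\<lambda>h. \<beta> \<bullet> h)) (at x)" by (auto intro!: derivative_eq_intros)
  then have "(v has_derivative (\<lambda>h. \<beta> \<bullet> h)) (at x)"
    by (rule has_derivative_transform_within_open[OF _ open_interior assms(2)]) (simp add: assms(3))
  then have "gradient v x = \<beta>" by (rule gradient_eqI)
  then show ?thesis using assms elem_interiors_mem by (auto simp: grad_h_def)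
qed

end

section \<open>How elements meet along a side\<close>

context nd_simplex
begin

text \<open>Along \<open>v\<close> the coordinate \<open>bary P\<close> grows from zero, and the
  other coordinates stay positive for a short while by continuity.\<close>

lemma eventually_interior_from_facet:
  assumes P: "P \<in> C" and x: "x \<in> rel_interior (facet P)" and v: "0 < l P \<bullet> v"
  shows "\<forall>\<^sub>F e in at_right 0. x + e *\<^sub>R v \<in> interior T"
proof -
  have "\<forall>\<^sub>F e in at_right 0. 0 < bary Q (x + e *\<^sub>R v)" if Q: "Q \<in> C" for Q
  proof (cases "Q = P")
    case True
    have "bary P (x + e *\<^sub>R v) = e * (l P \<bullet> v)" for e
      using bary_diff[of P x "e *\<^sub>R v"] x by (simp add: rel_interior_facet_iff[OF P])
    then show ?thesis using v True
      by (auto intro!: eventually_mono[OF eventually_at_right_less[of 0]])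
  next
    case False
    then have pos: "0 < bary Q x" using x Q by (simp add: rel_interior_facet_iff[OF P])
    have "((\<lambda>e. x + e *\<^sub>R v) \<longlongrightarrow> x + 0 *\<^sub>R v) (at_right 0)" by (intro tendsto_intros)
    moreover have "isCont (bary Q) (x + 0 *\<^sub>R v)"
      using continuous_bary[of Q] by (auto simp: continuous_on_eq_continuous_at)
    ultimately have "((\<lambda>e. bary Q (x + e *\<^sub>R v)) \<longlongrightarrow> bary Q (x + 0 *\<^sub>R v)) (at_right 0)"
      by (rule isCont_tendsto_compose[rotated])
    then show ?thesis using pos by (auto intro: order_tendstoD)
  qed
  then have "\<forall>\<^sub>F e in at_right 0. \<forall>Q\<in>C. 0 < bary Q (x + e *\<^sub>R v)"
    using finite_C by (simp add: eventually_ball_finite)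
  then show ?thesis by (rule eventually_mono) (simp add: mem_interior_iff)
qed

lemma inj_facet: "inj_on (\<lambda>P. facet P) C"
proof (rule inj_onI)
  fix P Q assume PQ: "P \<in> C" "Q \<in> C" "facet P = facet Q"
  then have "barycenter (facet P) \<in> rel_interior (facet Q)" using barycenter_rel_interior[OF PQ(1)] by simp
  then have "bary Q (barycenter (facet P)) = 0" using rel_interior_facet_iff[OF PQ(2)] by simp
  then show "P = Q" using bary_barycenter_facet[OF PQ(1,2)] by (auto split: if_splits)
qed

lemma extreme_points_T: "{v. v extreme_point_of T} = C"
  using extreme_point_of_convex_hull_affine_independent[OF indep] by auto

text \<open>Testing \<open>l P\<close> with the vector from the barycenter of the simplex to that of
  the facet gives \<open>- 1 / (d + 1)\<close>. So the sign depends on the side and the element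
  alone and can be named without the vertex \<open>P\<close>.\<close>

lemma facet_sign:
  assumes P: "P \<in> C" and n: "\<bar>s\<bar> = 1" "l P = (s / ht P) *\<^sub>R n"
  shows "s = - sgn (n \<bullet> (barycenter (facet P) - barycenter T))"
proof -
  have s: "s * s = 1" using n(1) by (metis abs_mult_self_eq mult_1)
  have h: "0 < ht P" by (rule ht_pos[OF P])
  have "l P \<bullet> (barycenter (facet P) - barycenter T) = bary P (barycenter (facet P)) - bary P (barycenter T)"
    by (simp add: bary_def inner_diff_right)
  also have "\<dots> = - 1 / (real DIM('a) + 1)"
    using bary_barycenter_facet[OF P P] bary_barycenter_T[OF P] by simp
  finally have "s / ht P * (n \<bullet> (barycenter (facet P) - barycenter T)) = - 1 / (real DIM('a) + 1)"
    unfolding n(2) by simp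
  then have "(s * s) * (n \<bullet> (barycenter (facet P) - barycenter T)) = - (s * ht P) / (real DIM('a) + 1)"
    using h by (simp add: field_simps)
  then have "n \<bullet> (barycenter (facet P) - barycenter T) = - (s * (ht P / (real DIM('a) + 1)))"
    unfolding s by simp
  then have "sgn (n \<bullet> (barycenter (facet P) - barycenter T)) = - (sgn s * sgn (ht P / (real DIM('a) + 1)))"
    by (simp add: sgn_mult sgn_minus)
  moreover have "sgn (ht P / (real DIM('a) + 1)) = 1" using h by simp
  moreover have "sgn s = s" using n(1) by (auto simp: abs_if split: if_splits)
  ultimately show ?thesis by simp
qed

end

context fe_mesh
begin

text \<open>Vertices and coordinate gradients are made functions of the element, so that sums over
  the whole mesh can refer to them.\<close>

definition vert :: "'a set \<Rightarrow> 'a set" where "vert T = {v. v extreme_point_of T}"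

definition bgrad :: "'a set \<Rightarrow> 'a \<Rightarrow> 'a" where "bgrad T = (SOME l. nd_simplex (vert T) l)"

lemma nd_simplex_vert: "T \<in> \<T> \<Longrightarrow> nd_simplex (vert T) (bgrad T)" and hull_vert: "T \<in> \<T> \<Longrightarrow> convex hull (vert T) = T"
proof -
  assume T: "T \<in> \<T>"
  obtain C l where Cl: "nd_simplex C l" "T = convex hull C" using mesh_nd_simplex[OF T] .
  interpret nd_simplex C l by fact
  have C: "vert T = C" unfolding vert_def Cl(2) by (rule extreme_points_T)
  show "nd_simplex (vert T) (bgrad T)" unfolding bgrad_def by (rule someI[where x = l]) (use C Cl in simp)
  show "convex hull (vert T) = T" using C Cl by simp
qed

lemma facet_of_elem_iff: "T \<in> \<T> \<Longrightarrow> S facet_of T \<longleftrightarrow> (\<exists>P\<in>vert T. S = convex hull (vert T - {P}))"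
  using nd_simplex.facet_of_T_iff[OF nd_simplex_vert] hull_vert by simp

text \<open>The face \<open>T \<inter> T'\<close> of \<open>T\<close> contains a point of the
  relative interior of \<open>S\<close>, hence all of \<open>S\<close>. So \<open>S\<close> is a
  face of \<open>T'\<close> as well, and equal dimensions make it a facet.\<close>

lemma facet_of_neighbour:
  assumes T: "T \<in> \<T>" "S facet_of T" and T': "T' \<in> \<T>" and x: "x \<in> rel_interior S" "x \<in> T'"
  shows "S facet_of T'"
proof -
  have Sf: "S face_of T" "S \<noteq> {}" "aff_dim S = aff_dim T - 1" using T(2) by (auto simp: facet_of_def)
  have ST: "S \<subseteq> T" by (rule face_of_imp_subset[OF Sf(1)])
  have xT: "x \<in> T" using x(1) rel_interior_subset ST by blast
  have "(T \<inter> T') \<inter> rel_interior S \<noteq> {}" using x xT by blast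
  then have sub: "S \<subseteq> T \<inter> T'"
    by (rule subset_of_face_of[OF face_mesh[OF T(1) T'] ST])
  have "S face_of (T \<inter> T')" by (rule face_of_subset[OF Sf(1) sub]) auto
  moreover have "(T \<inter> T') face_of T'" using face_mesh[OF T' T(1)] by (simp add: Int_commute)
  ultimately have "S face_of T'" by (rule face_of_trans)
  moreover have "aff_dim T = aff_dim T'"
    using simplex_mesh[OF T(1)] simplex_mesh[OF T'] by (simp add: aff_dim_simplex)
  ultimately show ?thesis using Sf by (simp add: facet_of_def)
qed

text \<open>The finitely many elements that miss \<open>x\<close> form a closed set, so they also
  miss a ball around \<open>x\<close>.\<close>

lemma facet_neighbourhood:
  assumes T: "T \<in> \<T>" "S facet_of T" and x: "x \<in> rel_interior S"
  obtains e where "0 < e" "\<And>T'. T' \<in> \<T> \<Longrightarrow> T' \<inter> ball x e \<noteq> {} \<Longrightarrow> S facet_of T'"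
proof -
  let ?A = "\<Union>{T'\<in>\<T>. x \<notin> T'}"
  have "closed ?A" using finite_mesh compact_elem by (intro closed_Union) (auto intro: compact_imp_closed)
  then have "open (- ?A)" "x \<in> - ?A" by auto
  then obtain e where e: "0 < e" "ball x e \<subseteq> - ?A" using open_contains_ball by blast
  show thesis
  proof (rule that[OF e(1)])
    fix T' assume T': "T' \<in> \<T>" "T' \<inter> ball x e \<noteq> {}"
    then have "x \<in> T'" using e(2) by blast
    then show "S facet_of T'" using facet_of_neighbour[OF T T'(1) x] by simp
  qed
qed

context
  fixes n :: "'a set \<Rightarrow> 'a"
  assumes normals: "unit_normals \<T> n"
begin

text \<open>For a side of \<open>T\<close> this is 1 if the fixed normal \<open>n S\<close> points
  into \<open>T\<close> and -1 if it points out of \<open>T\<close>.\<close>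

definition side_sign :: "'a set \<Rightarrow> 'a set \<Rightarrow> real" where
  "side_sign T S = - sgn (n S \<bullet> (barycenter S - barycenter T))"

lemma bgrad_normal:
  assumes T: "T \<in> \<T>" and P: "P \<in> vert T" and S: "S = convex hull (vert T - {P})"
  shows "\<bar>side_sign T S\<bar> = 1" "bgrad T P = (side_sign T S / nd_simplex.ht (bgrad T) P) *\<^sub>R n S"
proof -
  interpret nd_simplex "vert T" "bgrad T" by (rule nd_simplex_vert[OF T])
  have "S facet_of T" using facet_of_elem_iff[OF T] P S by auto
  then have "S \<in> sides \<T>" using T by (auto simp: sides_def)
  then obtain s where s: "\<bar>s\<bar> = 1" "bgrad T P = (s / ht P) *\<^sub>R n S"
    using facet_normal[OF P, of "n S"] normals S unfolding unit_normals_def by auto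
  have "s = side_sign T S"
    unfolding side_sign_def using facet_sign[OF P s] S hull_vert[OF T] by simp
  then show "\<bar>side_sign T S\<bar> = 1" "bgrad T P = (side_sign T S / ht P) *\<^sub>R n S" using s by auto
qed

text \<open>From the barycenter of \<open>S\<close> a small step along
  \<open>side_sign T S *\<^sub>R n S\<close> enters the interiors of both elements, and distinct
  elements have disjoint interiors.\<close>

lemma same_side_imp_eq:
  assumes T: "T \<in> \<T>" "S facet_of T" and T': "T' \<in> \<T>" "S facet_of T'" and s: "side_sign T S = side_sign T' S"
  shows "T = T'"
proof -
  obtain P where P: "P \<in> vert T" "S = convex hull (vert T - {P})" using facet_of_elem_iff[OF T(1)] T(2) by auto
  obtain P' where P': "P' \<in> vert T'" "S = convex hull (vert T' - {P'})" using facet_of_elem_iff[OF T'(1)] T'(2) by auto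
  interpret A: nd_simplex "vert T" "bgrad T" by (rule nd_simplex_vert[OF T(1)])
  interpret B: nd_simplex "vert T'" "bgrad T'" by (rule nd_simplex_vert[OF T'(1)])
  define v where "v = side_sign T S *\<^sub>R n S"
  have "S \<in> sides \<T>" using T by (auto simp: sides_def)
  then have n1: "n S \<bullet> n S = 1" using normals by (simp add: unit_normals_def dot_square_norm)
  have ss: "side_sign T S * side_sign T S = 1" using bgrad_normal(1)[OF T(1) P] by (metis abs_mult_self_eq mult_1)
  have "bgrad T P \<bullet> v = 1 / A.ht P" "bgrad T' P' \<bullet> v = 1 / B.ht P'"
    unfolding bgrad_normal(2)[OF T(1) P] bgrad_normal(2)[OF T'(1) P'] s[symmetric] v_def using n1 ss by simp_all
  then have pos: "0 < bgrad T P \<bullet> v" "0 < bgrad T' P' \<bullet> v" using A.ht_pos[OF P(1)] B.ht_pos[OF P'(1)] by auto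
  let ?x = "barycenter S"
  have x: "?x \<in> rel_interior (convex hull (vert T - {P}))" "?x \<in> rel_interior (convex hull (vert T' - {P'}))"
    using A.barycenter_rel_interior[OF P(1)] B.barycenter_rel_interior[OF P'(1)] P(2) P'(2) by metis+
  have "\<forall>\<^sub>F e in at_right 0. ?x + e *\<^sub>R v \<in> interior T \<and> ?x + e *\<^sub>R v \<in> interior T'"
    using A.eventually_interior_from_facet[OF P(1) x(1) pos(1)] B.eventually_interior_from_facet[OF P'(1) x(2) pos(2)]
    unfolding hull_vert[OF T(1)] hull_vert[OF T'(1)] by eventually_elim simp
  then obtain e where "?x + e *\<^sub>R v \<in> interior T \<inter> interior T'"
    using eventually_happens'[of "at_right (0::real)"] by auto
  then show ?thesis using interiors_disjoint[OF T(1) T'(1)] by blast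
qed

lemma side_signs_opposite:
  assumes T: "T \<in> \<T>" "S facet_of T" and T': "T' \<in> \<T>" "S facet_of T'" and "T \<noteq> T'"
  shows "side_sign T' S = - side_sign T S"
proof -
  obtain P where P: "P \<in> vert T" "S = convex hull (vert T - {P})" using facet_of_elem_iff[OF T(1)] T(2) by auto
  obtain P' where P': "P' \<in> vert T'" "S = convex hull (vert T' - {P'})" using facet_of_elem_iff[OF T'(1)] T'(2) by auto
  show ?thesis
    using bgrad_normal(1)[OF T(1) P] bgrad_normal(1)[OF T'(1) P'] same_side_imp_eq[OF T T'] \<open>T \<noteq> T'\<close>
    by (auto simp: abs_if split: if_splits)
qed

text \<open>A relative interior point of \<open>S\<close> that lies in \<Omega> is pushed slightly
  across \<open>S\<close>. The new point is still in \<Omega>, hence in an element; this is not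
  \<open>T\<close>, and by \<open>facet_neighbourhood\<close> it has \<open>S\<close> as a
  facet.\<close>

lemma interior_side_neighbour:
  assumes T: "T \<in> \<T>" "S facet_of T" and S: "\<not> S \<subseteq> frontier \<Omega>"
  shows "\<exists>T'\<in>\<T>. T' \<noteq> T \<and> S facet_of T'"
proof -
  obtain P where P: "P \<in> vert T" "S = convex hull (vert T - {P})" using facet_of_elem_iff[OF T(1)] T(2) by auto
  interpret A: nd_simplex "vert T" "bgrad T" by (rule nd_simplex_vert[OF T(1)])
  have "convex S" "S \<noteq> {}" using P A.vertices_Diff_nonempty by auto
  have "S \<subseteq> closure (rel_interior S)" using convex_closure_rel_interior[OF \<open>convex S\<close>] closure_subset by blast
  then have "\<not> rel_interior S \<subseteq> frontier \<Omega>" using S closure_minimal[OF _ frontier_closed] by blast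
  then obtain x where x: "x \<in> rel_interior S" "x \<notin> frontier \<Omega>" by auto
  have "S \<subseteq> T" using T(2) by (auto simp: facet_of_def dest: face_of_imp_subset)
  then have "x \<in> closure \<Omega>" using x(1) rel_interior_subset T(1) Union_mesh by blast
  then have "x \<in> \<Omega>" using x(2) open_Om by (auto simp: frontier_def interior_open)
  obtain e where e: "0 < e" "\<And>T'. T' \<in> \<T> \<Longrightarrow> T' \<inter> ball x e \<noteq> {} \<Longrightarrow> S facet_of T'"
    using facet_neighbourhood[OF T x(1)] by blast
  obtain e' where e': "0 < e'" "ball x e' \<subseteq> \<Omega>" using \<open>x \<in> \<Omega>\<close> open_Om open_contains_ball by blast
  \<comment> \<open>The displacement has length half the smaller radius. As \<open>bgrad T P\<close>
    points into \<open>T\<close>, the minus sign in \<open>y\<close> leads out of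
    \<open>T\<close>.\<close>
  define t where "t = min e e' / (2 * norm (bgrad T P))"
  have l0: "norm (bgrad T P) > 0" using A.l_nonzero[OF P(1)] by simp
  have t: "0 < t" "t * norm (bgrad T P) < e" "t * norm (bgrad T P) < e'" using e(1) e'(1) l0 by (auto simp: t_def field_simps min_def)
  define y where "y = x + (- t) *\<^sub>R bgrad T P"
  have "dist x y = t * norm (bgrad T P)" using t(1) by (simp add: y_def dist_norm)
  then have y: "y \<in> ball x e" "y \<in> \<Omega>" using t e'(2) by auto
  then have "y \<in> \<Union>\<T>" using Union_mesh closure_subset by auto
  then obtain T' where T': "T' \<in> \<T>" "y \<in> T'" by auto
  have "S facet_of T'" using e(2)[OF T'(1)] T'(2) y(1) by blast
  moreover have "y \<notin> T"
  proof -
    have "A.bary P y - A.bary P x = - t * (bgrad T P \<bullet> bgrad T P)" unfolding y_def A.bary_diff by simp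
    moreover have "A.bary P x = 0" using x(1) A.rel_interior_facet_iff[OF P(1)] P(2) by simp
    moreover have "0 < bgrad T P \<bullet> bgrad T P" using l0 by simp
    ultimately have "A.bary P y < 0" using t(1) by (simp add: mult_pos_pos)
    then show ?thesis using A.mem_T_iff[of y] P(1) hull_vert[OF T(1)] by force
  qed
  ultimately show ?thesis using T' by metis
qed

text \<open>Near \<open>x\<close> one side of \<open>S\<close> belongs to \<open>T\<close> and the
  other to \<open>T'\<close>, because their coordinates vanishing on \<open>S\<close> have opposite
  gradients up to scaling. So \<open>x\<close> is interior to the closure of \<Omega>, which for a
  Lipschitz boundary means that \<open>x\<close> is in \<Omega>.\<close>

lemma two_sided_subset:
  assumes T: "T \<in> \<T>" "S facet_of T" and T': "T' \<in> \<T>" "S facet_of T'" and ne: "T \<noteq> T'"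
  shows "rel_interior S \<subseteq> \<Omega>"
proof
  fix x assume x: "x \<in> rel_interior S"
  obtain P where P: "P \<in> vert T" "S = convex hull (vert T - {P})" using facet_of_elem_iff[OF T(1)] T(2) by auto
  obtain P' where P': "P' \<in> vert T'" "S = convex hull (vert T' - {P'})" using facet_of_elem_iff[OF T'(1)] T'(2) by auto
  interpret A: nd_simplex "vert T" "bgrad T" by (rule nd_simplex_vert[OF T(1)])
  interpret B: nd_simplex "vert T'" "bgrad T'" by (rule nd_simplex_vert[OF T'(1)])
  have xA: "A.bary P x = 0" "\<And>Q. Q \<in> vert T - {P} \<Longrightarrow> 0 < A.bary Q x" using x A.rel_interior_facet_iff[OF P(1)] P(2) by auto
  have xB: "B.bary P' x = 0" "\<And>Q. Q \<in> vert T' - {P'} \<Longrightarrow> 0 < B.bary Q x" using x B.rel_interior_facet_iff[OF P'(1)] P'(2) by auto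
  \<comment> \<open>A neighbourhood on which all coordinates of both elements are positive, except
    the two that vanish on \<open>S\<close>.\<close>
  define U where "U = (\<Inter>Q\<in>vert T - {P}. {y. 0 < A.bary Q y}) \<inter> (\<Inter>Q\<in>vert T' - {P'}. {y. 0 < B.bary Q y})"
  have "open U" unfolding U_def using A.finite_C B.finite_C
    by (intro open_Int open_INT) (auto intro!: open_Collect_less continuous_intros A.continuous_bary B.continuous_bary)
  moreover have "x \<in> U" using xA xB by (auto simp: U_def)
  moreover have "U \<subseteq> closure \<Omega>"
  proof
    fix y assume y: "y \<in> U"
    have a: "A.bary P y = bgrad T P \<bullet> (y - x)" using A.bary_diff[of P x "y - x"] xA(1) by simp
    have b: "B.bary P' y = bgrad T' P' \<bullet> (y - x)" using B.bary_diff[of P' x "y - x"] xB(1) by simp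
    have "y \<in> T \<or> y \<in> T'"
    proof (cases "0 \<le> A.bary P y")
      case True
      have "0 \<le> A.bary Q y" if "Q \<in> vert T" for Q using y that True by (cases "Q = P") (auto simp: U_def intro: less_imp_le)
      then show ?thesis using A.mem_T_iff[of y] hull_vert[OF T(1)] by auto
    next
      case False
      have hA: "0 < A.ht P" and hB: "0 < B.ht P'" using A.ht_pos[OF P(1)] B.ht_pos[OF P'(1)] .
      have "side_sign T S / A.ht P * (n S \<bullet> (y - x)) < 0"
        using False unfolding a bgrad_normal(2)[OF T(1) P] by simp
      from mult_pos_neg[OF hA this] have "side_sign T S * (n S \<bullet> (y - x)) < 0" using hA by simp
      then have "0 < side_sign T' S * (n S \<bullet> (y - x))" using side_signs_opposite[OF T T' ne] by simp
      then have "0 \<le> B.bary P' y" using hB unfolding b bgrad_normal(2)[OF T'(1) P'] by (simp add: zero_le_divide_iff)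
      then have "0 \<le> B.bary Q y" if "Q \<in> vert T'" for Q using y that by (cases "Q = P'") (auto simp: U_def intro: less_imp_le)
      then show ?thesis using B.mem_T_iff[of y] hull_vert[OF T'(1)] by auto
    qed
    then show "y \<in> closure \<Omega>" using T(1) T'(1) Union_mesh by auto
  qed
  ultimately have "x \<in> interior (closure \<Omega>)" by (rule interiorI)
  then show "x \<in> \<Omega>" using interior_closure_Om by simp
qed

text \<open>Two elements at \<open>S\<close> would put its relative interior into the open set
  \<Omega>, which is disjoint from its frontier.\<close>

lemma boundary_side_unique:
  assumes T: "T \<in> \<T>" "S facet_of T" and T': "T' \<in> \<T>" "S facet_of T'" and S: "S \<subseteq> frontier \<Omega>"
  shows "T = T'"
proof (rule ccontr)
  assume ne: "T \<noteq> T'"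
  have "S \<noteq> {}" "convex S" using T(2) convex_elem[OF T(1)] by (auto simp: facet_of_def face_of_imp_convex)
  then obtain x where x: "x \<in> rel_interior S" using rel_interior_eq_empty by blast
  then have "x \<in> \<Omega>" using two_sided_subset[OF T T' ne] by blast
  moreover have "x \<in> frontier \<Omega>" using x rel_interior_subset S by blast
  ultimately show False using open_Om by (simp add: frontier_def interior_open)
qed

text \<open>An inner side has a second element. There is no third one, since distinct elements at a
  side have opposite signs and only two signs exist.\<close>

lemma sum_side_signs:
  assumes "S \<in> sides \<T>" "\<not> S \<subseteq> frontier \<Omega>"
  shows "(\<Sum>T | T \<in> \<T> \<and> S facet_of T. side_sign T S) = 0"
proof -
  obtain T where T: "T \<in> \<T>" "S facet_of T" using assms(1) by (auto simp: sides_def)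
  obtain T' where T': "T' \<in> \<T>" "S facet_of T'" "T' \<noteq> T" using interior_side_neighbour[OF T assms(2)] by auto
  have "T'' = T \<or> T'' = T'" if T'': "T'' \<in> \<T>" "S facet_of T''" for T''
  proof (rule ccontr)
    assume "\<not> ?thesis"
    then have "side_sign T'' S = - side_sign T S" "side_sign T'' S = - side_sign T' S"
      using side_signs_opposite[OF T T''] side_signs_opposite[OF T'(1,2) T''] by auto
    then show False using same_side_imp_eq[OF T T'(1,2)] T'(3) by simp
  qed
  then have "{T \<in> \<T>. S facet_of T} = {T, T'}" using T T' by blast
  then show ?thesis using side_signs_opposite[OF T T'(1,2)] T'(3) by (simp add: Collect_conj_eq)
qed

lemma finite_sides: "finite (sides \<T>)"
proof -
  have "sides \<T> \<subseteq> (\<Union>T\<in>\<T>. (\<lambda>P. convex hull (vert T - {P})) ` vert T)"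
    unfolding sides_def using facet_of_elem_iff by auto
  moreover have "finite (vert T)" if "T \<in> \<T>" for T using nd_simplex.finite_C[OF nd_simplex_vert[OF that]] .
  then have "finite (\<Union>T\<in>\<T>. (\<lambda>P. convex hull (vert T - {P})) ` vert T)"
    using finite_mesh by (intro finite_UN_I finite_imageI) auto
  ultimately show ?thesis by (rule finite_subset)
qed

text \<open>An exchange of the double sum over incident pairs of elements and sides; the facets of
  an element are listed once each by their opposite vertices.\<close>

lemma sum_over_sides:
  fixes F :: "'a set \<Rightarrow> 'a set \<Rightarrow> real"
  shows "(\<Sum>T\<in>\<T>. \<Sum>P\<in>vert T. F T (convex hull (vert T - {P}))) = (\<Sum>S\<in>sides \<T>. \<Sum>T | T \<in> \<T> \<and> S facet_of T. F T S)"
proof -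
  have "(\<Sum>P\<in>vert T. F T (convex hull (vert T - {P}))) = (\<Sum>S | S \<in> sides \<T> \<and> S facet_of T. F T S)" if T: "T \<in> \<T>" for T
  proof -
    have "{S. S \<in> sides \<T> \<and> S facet_of T} = (\<lambda>P. convex hull (vert T - {P})) ` vert T"
      using facet_of_elem_iff[OF T] T by (auto simp: sides_def)
    then show ?thesis
      using sum.reindex[OF nd_simplex.inj_facet[OF nd_simplex_vert[OF T]], of "F T"] by simp
  qed
  then have "(\<Sum>T\<in>\<T>. \<Sum>P\<in>vert T. F T (convex hull (vert T - {P}))) = (\<Sum>T\<in>\<T>. \<Sum>S | S \<in> sides \<T> \<and> S facet_of T. F T S)"
    by simp
  also have "\<dots> = (\<Sum>S\<in>sides \<T>. \<Sum>T | T \<in> \<T> \<and> S facet_of T. F T S)"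
    by (rule sum.swap_restrict[OF finite_mesh finite_sides])
  finally show ?thesis .
qed

text \<open>The identities on the elements are summed and regrouped by sides. Both neighbours of a
  side see the same value \<open>vs S\<close> and the same normal component \<open>c S\<close>, so
  inner sides cancel by opposite signs; on a boundary side one of these two factors is zero.\<close>

lemma global_integration_by_parts:
  fixes \<alpha> b :: "'a set \<Rightarrow> real" and \<beta> a :: "'a set \<Rightarrow> 'a"
  assumes resolved: "boundary_resolved \<T> \<Omega> \<Gamma>D"
    and v: "v \<in> CR_D \<T> \<Omega> \<Gamma>D" "\<And>T x. T \<in> \<T> \<Longrightarrow> x \<in> interior T \<Longrightarrow> v x = \<alpha> T + \<beta> T \<bullet> x"
    and y: "\<And>T x. T \<in> \<T> \<Longrightarrow> x \<in> interior T \<Longrightarrow> y x = a T + b T *\<^sub>R (x - barycenter T)"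
    and c: "\<And>S. S \<in> sides \<T> \<Longrightarrow> has_normal_component \<T> n y S (c S)"
    and c0: "\<And>S. S \<in> sides_in \<T> \<Omega> (frontier \<Omega> - \<Gamma>D) \<Longrightarrow> c S = 0"
  shows "(\<Sum>T\<in>\<T>. measure lebesgue T * (a T \<bullet> \<beta> T + DIM('a) * b T * (\<alpha> T + \<beta> T \<bullet> barycenter T))) = 0"
proof -
  let ?d = "real DIM('a)"
  have "\<exists>vs. \<forall>S\<in>sides \<T>. has_side_value \<T> v S (vs S) \<and> (S \<in> sides_in \<T> \<Omega> \<Gamma>D \<longrightarrow> vs S = 0)"
  proof (rule bchoice, rule ballI)
    fix S assume S: "S \<in> sides \<T>"
    show "\<exists>c. has_side_value \<T> v S c \<and> (S \<in> sides_in \<T> \<Omega> \<Gamma>D \<longrightarrow> c = 0)"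
    proof (cases "S \<in> sides_in \<T> \<Omega> \<Gamma>D")
      case True
      then show ?thesis using v(1) by (auto simp: CR_D_def)
    next
      case False
      then show ?thesis using v(1) S by (auto simp: CR_D_def CR_def)
    qed
  qed
  then obtain vs where vs: "\<And>S. S \<in> sides \<T> \<Longrightarrow> has_side_value \<T> v S (vs S)"
    "\<And>S. S \<in> sides \<T> \<Longrightarrow> S \<in> sides_in \<T> \<Omega> \<Gamma>D \<Longrightarrow> vs S = 0" by blast
  \<comment> \<open>The contribution of a side to an element. Since \<open>d |T|\<close> is
    \<open>ht P\<close> times the area of the side and \<open>bgrad T P\<close> is the signed normal
    divided by \<open>ht P\<close>, the heights cancel and only data of the side and the sign are
    left.\<close>
  define F where "F T S = - (side_sign T S * (vs S * c S * measure (surface_measure S) UNIV))" for T S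
  have elem: "measure lebesgue T * (a T \<bullet> \<beta> T + ?d * b T * (\<alpha> T + \<beta> T \<bullet> barycenter T)) =
      (\<Sum>P\<in>vert T. F T (convex hull (vert T - {P})))" if T: "T \<in> \<T>" for T
  proof -
    interpret nd_simplex "vert T" "bgrad T" by (rule nd_simplex_vert[OF T])
    note hT = hull_vert[OF T]
    have "a T \<bullet> \<beta> T + ?d * b T * (\<alpha> T + \<beta> T \<bullet> barycenter T) =
      - (?d * (\<Sum>P\<in>vert T. (\<alpha> T + \<beta> T \<bullet> barycenter (facet P)) * ((a T + b T *\<^sub>R (barycenter (facet P) - barycenter T)) \<bullet> bgrad T P)))"
      using discrete_integration_by_parts[of "a T" "\<beta> T" "b T" "\<alpha> T"] unfolding hT .
    then have "measure lebesgue T * (a T \<bullet> \<beta> T + ?d * b T * (\<alpha> T + \<beta> T \<bullet> barycenter T)) =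
      (\<Sum>P\<in>vert T. - (?d * measure lebesgue T * ((\<alpha> T + \<beta> T \<bullet> barycenter (facet P)) * ((a T + b T *\<^sub>R (barycenter (facet P) - barycenter T)) \<bullet> bgrad T P))))"
      by (simp add: sum_distrib_left sum_negf mult_ac)
    also have "\<dots> = (\<Sum>P\<in>vert T. F T (facet P))"
    proof (rule sum.cong[OF refl])
      fix P assume P: "P \<in> vert T"
      let ?S = "facet P"
      have S: "?S \<in> sides \<T>" using facet_of_elem_iff[OF T] P T by (auto simp: sides_def)
      have v1: "vs ?S = \<alpha> T + \<beta> T \<bullet> barycenter ?S"
        using vs(1)[OF S] unfolding has_side_value_def
        by (rule facet_limit_unique[OF P, where g = "\<lambda>x. \<alpha> T + \<beta> T \<bullet> x"])
           (use elem_interiors_mem[OF T] v(2)[OF T] hT in \<open>auto intro!: continuous_intros\<close>)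
      have "((\<lambda>x. y x \<bullet> n ?S) \<longlongrightarrow> c ?S) (at (barycenter ?S) within elem_interiors \<T>)"
        using c[OF S] barycenter_rel_interior[OF P] unfolding has_normal_component_def by blast
      then have c1: "c ?S = (a T + b T *\<^sub>R (barycenter ?S - barycenter T)) \<bullet> n ?S"
        by (rule facet_limit_unique[OF P, where g = "\<lambda>x. (a T + b T *\<^sub>R (x - barycenter T)) \<bullet> n ?S"])
           (use elem_interiors_mem[OF T] y[OF T] hT in \<open>auto intro!: continuous_intros\<close>)
      have m: "?d * measure lebesgue T = ht P * measure (surface_measure ?S) UNIV"
        using ht_measure_facet[OF P] hT by simp
      have "?d * measure lebesgue T * (vs ?S * ((a T + b T *\<^sub>R (barycenter ?S - barycenter T)) \<bullet> bgrad T P)) =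
        side_sign T ?S * (vs ?S * c ?S * measure (surface_measure ?S) UNIV)"
        unfolding m bgrad_normal(2)[OF T P refl] using ht_pos[OF P] by (simp add: c1)
      then show "- (?d * measure lebesgue T * ((\<alpha> T + \<beta> T \<bullet> barycenter ?S) * ((a T + b T *\<^sub>R (barycenter ?S - barycenter T)) \<bullet> bgrad T P))) = F T ?S"
        unfolding F_def v1[symmetric] by simp
    qed
    finally show ?thesis .
  qed
  have "(\<Sum>T\<in>\<T>. measure lebesgue T * (a T \<bullet> \<beta> T + ?d * b T * (\<alpha> T + \<beta> T \<bullet> barycenter T))) = (\<Sum>S\<in>sides \<T>. \<Sum>T | T \<in> \<T> \<and> S facet_of T. F T S)"
    using sum_over_sides[of F] elem by simp
  also have "\<dots> = 0"
  proof (rule sum.neutral, rule ballI)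
    fix S assume S: "S \<in> sides \<T>"
    have e: "(\<Sum>T | T \<in> \<T> \<and> S facet_of T. F T S) = - ((\<Sum>T | T \<in> \<T> \<and> S facet_of T. side_sign T S) * (vs S * c S * measure (surface_measure S) UNIV))"
      unfolding F_def sum_negf sum_distrib_right ..
    show "(\<Sum>T | T \<in> \<T> \<and> S facet_of T. F T S) = 0"
    proof (cases "S \<subseteq> frontier \<Omega>")
      case True
      then have "S \<in> sides_in \<T> \<Omega> \<Gamma>D \<or> S \<in> sides_in \<T> \<Omega> (frontier \<Omega> - \<Gamma>D)"
        using resolved S by (auto simp: boundary_resolved_def)
      then have "vs S * c S = 0" using vs(2)[OF S] c0 by auto
      then show ?thesis unfolding e by simp
    next
      case False
      then show ?thesis unfolding e sum_side_signs[OF S False] by simp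
    qed
  qed
  finally show ?thesis .
qed

end

end

section \<open>The Neumann boundary condition\<close>

lemma integrable_AE_lebesgue_on:
  fixes f g :: "'a::euclidean_space \<Rightarrow> 'b::euclidean_space"
  assumes "\<Omega> \<in> sets lebesgue" "integrable (lebesgue_on \<Omega>) f" "AE x in lebesgue_on \<Omega>. f x = g x"
  shows "integrable (lebesgue_on \<Omega>) g"
proof -
  have e: "AE x in lebesgue. indicator \<Omega> x *\<^sub>R f x = indicator \<Omega> x *\<^sub>R g x"
    using assms(3) unfolding AE_restrict_space_iff[of \<Omega> lebesgue, simplified, OF assms(1)]
    by eventually_elim (auto simp: indicator_def)
  have i: "integrable lebesgue (\<lambda>x. indicator \<Omega> x *\<^sub>R f x)" using assms(1,2) by (simp add: integrable_restrict_space)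
  have "integrable lebesgue (\<lambda>x. indicator \<Omega> x *\<^sub>R g x)"
    by (rule integrable_cong_AE_imp[OF i borel_measurable_lebesgue_AE[OF borel_measurable_integrable[OF i] e] e])
  then show ?thesis using assms(1) by (simp add: integrable_restrict_space)
qed

text \<open>\<open>sobolev_D\<close> speaks of arbitrary simplices in the frontier, whereas the mesh
  resolves \<Gamma>D on its own sides. If both pieces span the same hyperplane, their prisms agree
  over the intersection; otherwise the intersection lies in a lower-dimensional affine set and is
  null on \<open>F\<close>.\<close>

lemma surface_AE_transfer:
  fixes \<nu> \<mu> :: "'a::euclidean_space"
  assumes \<nu>: "norm \<nu> = 1" "affine hull F = {x. \<nu> \<bullet> x = c}" and F: "compact F"
    and \<mu>: "norm \<mu> = 1" "affine hull S = {x. \<mu> \<bullet> x = d}" and S: "compact S"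
    and ae: "AE x in surface_measure S. Q x"
  shows "AE x in surface_measure F. x \<in> S \<longrightarrow> Q x"
proof -
  have Fb[measurable]: "F \<in> sets borel" and Sb[measurable]: "S \<in> sets borel" using F S by (auto simp: borel_compact)
  obtain N where N: "N \<in> null_sets (surface_measure S)" "{x. \<not> Q x} \<subseteq> N"
    using ae unfolding eventually_ae_filter by auto
  then have Nb[measurable]: "N \<in> sets borel" using sets_surface_measure by (auto simp: null_sets_def)
  have SH: "S \<subseteq> {x. \<mu> \<bullet> x = d}" using \<mu>(2) hull_subset by metis
  let ?pF = "{x. hproj \<nu> c x \<in> F \<and> \<bar>\<nu> \<bullet> x - c\<bar> \<le> 1/2}" and ?pS = "{x. hproj \<mu> d x \<in> S \<and> \<bar>\<mu> \<bullet> x - d\<bar> \<le> 1/2}"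
  note pF = prism_borel[OF \<nu> Fb] and pS = prism_borel[OF \<mu> Sb]
  have emF: "emeasure (surface_measure F) A = emeasure lebesgue (hproj \<nu> c -` A \<inter> ?pF)" if A: "A \<in> sets borel" for A
    unfolding surface_measure_eq[OF \<nu>] using pF A
    by (subst emeasure_distr[OF hproj_measurable_lebesgue_on[OF \<nu> Fb] A]) (simp add: emeasure_restrict_space)
  have emS: "emeasure (surface_measure S) A = emeasure lebesgue (hproj \<mu> d -` A \<inter> ?pS)" if A: "A \<in> sets borel" for A
    unfolding surface_measure_eq[OF \<mu>] using pS A
    by (subst emeasure_distr[OF hproj_measurable_lebesgue_on[OF \<mu> Sb] A]) (simp add: emeasure_restrict_space)
  have vS: "hproj \<mu> d -` (N \<inter> S) \<inter> ?pS \<in> sets lebesgue"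
    using measurable_sets[OF hproj_measurable[of \<mu> d], of "N \<inter> S"] pS by (auto intro: sets_completionI_sets)
  have neg: "negligible (hproj \<nu> c -` (N \<inter> S) \<inter> ?pF)"
  proof (cases "{x. \<nu> \<bullet> x = c} = {x. \<mu> \<bullet> x = d}")
    case True
    have hp: "hproj \<nu> c = hproj \<mu> d"
      using closest_point_hyperplane[OF \<nu>(1), of c] closest_point_hyperplane[OF \<mu>(1), of d] True by metis
    have "dist x (hproj \<nu> c x) = \<bar>\<nu> \<bullet> x - c\<bar>" "dist x (hproj \<mu> d x) = \<bar>\<mu> \<bullet> x - d\<bar>" for x
      using \<nu>(1) \<mu>(1) by (simp_all add: hproj_def dist_norm)
    then have sl: "\<bar>\<nu> \<bullet> x - c\<bar> = \<bar>\<mu> \<bullet> x - d\<bar>" for x using hp by metis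
    have "emeasure lebesgue (hproj \<mu> d -` (N \<inter> S) \<inter> ?pS) = emeasure (surface_measure S) (N \<inter> S)"
      by (rule emS[symmetric]) measurable
    also have "\<dots> = 0"
    proof -
      have "emeasure (surface_measure S) (N \<inter> S) \<le> emeasure (surface_measure S) N"
        using N(1) by (intro emeasure_mono) auto
      then show ?thesis using N(1) by auto
    qed
    finally have "hproj \<mu> d -` (N \<inter> S) \<inter> ?pS \<in> null_sets lebesgue" using vS by (intro null_setsI)
    then have "negligible (hproj \<mu> d -` (N \<inter> S) \<inter> ?pS)" by (simp add: negligible_iff_null_sets)
    then show ?thesis by (rule negligible_subset) (auto simp: hp sl)
  next
    case False
    \<comment> \<open>Points that project into both hyperplanes satisfy an affine equation with
      linear part \<open>\<mu> - k *\<^sub>R \<nu>\<close>. It is trivial only if the hyperplanes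
      coincide.\<close>
    define k where "k = \<mu> \<bullet> \<nu>"
    have "\<mu> - k *\<^sub>R \<nu> \<noteq> 0 \<or> d - c * k \<noteq> 0"
    proof (rule ccontr)
      assume "\<not> ?thesis"
      then have e: "\<mu> = k *\<^sub>R \<nu>" "d = k * c" by auto
      have "k \<noteq> 0" using e(1) \<mu>(1) by auto
      then show False using False e by auto
    qed
    then have "negligible {x. (\<mu> - k *\<^sub>R \<nu>) \<bullet> x = d - c * k}" by (rule negligible_hyperplane)
    then show ?thesis
    proof (rule negligible_subset)
      show "hproj \<nu> c -` (N \<inter> S) \<inter> ?pF \<subseteq> {x. (\<mu> - k *\<^sub>R \<nu>) \<bullet> x = d - c * k}"
      proof
        fix x assume "x \<in> hproj \<nu> c -` (N \<inter> S) \<inter> ?pF"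
        then have "\<mu> \<bullet> hproj \<nu> c x = d" using SH by auto
        then show "x \<in> {x. (\<mu> - k *\<^sub>R \<nu>) \<bullet> x = d - c * k}"
          by (simp add: hproj_def k_def inner_diff_left inner_diff_right algebra_simps)
      qed
    qed
  qed
  have "emeasure (surface_measure F) (N \<inter> S) = 0"
    using neg by (subst emF) (auto simp: negligible_iff_null_sets)
  then have "N \<inter> S \<in> null_sets (surface_measure F)"
    by (intro null_setsI) (auto simp: sets_surface_measure)
  then show ?thesis by (rule AE_I') (use N(2) in auto)
qed

lemma simplex_hyperplane:
  fixes F :: "'a::euclidean_space set"
  assumes "(int DIM('a) - 1) simplex F"
  obtains \<nu> c where "norm \<nu> = 1" "affine hull F = {x. \<nu> \<bullet> x = c}"
proof -
  have "aff_dim F = int (DIM('a) - 1)" using aff_dim_simplex[OF assms] by (simp add: of_nat_diff)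
  then have "\<exists>a b. a \<noteq> 0 \<and> affine hull F = {x. a \<bullet> x = b}" using aff_dim_eq_hyperplane[of F] by simp
  then obtain a b where ab: "a \<noteq> 0" "affine hull F = {x. a \<bullet> x = b}" by blast
  show ?thesis
  proof (rule that)
    show "norm (a /\<^sub>R norm a) = 1" using ab(1) by simp
    show "affine hull F = {x. (a /\<^sub>R norm a) \<bullet> x = b / norm a}" using ab by (auto simp: field_simps)
  qed
qed

lemma compact_simplex: "k simplex F \<Longrightarrow> compact (F::'a::euclidean_space set)"
  by (auto simp: simplex_def aff_independent_finite finite_imp_compact_convex_hull)

lemma smooth_in_sobolev_1:
  assumes "smooth \<eta>" "open \<Omega>" "bounded \<Omega>" shows "\<eta> \<in> sobolev 1 \<Omega>"
proof -
  have Om: "\<Omega> \<in> sets lebesgue" using assms(2) by simp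
  have "integrable (lebesgue_on \<Omega>) \<eta>" "integrable (lebesgue_on \<Omega>) (gradient \<eta>)"
    by (rule integrable_continuous_bounded[OF smooth_continuous[OF assms(1)] assms(3) Om])
       (rule integrable_continuous_bounded[OF smooth_continuous_gradient[OF assms(1)] assms(3) Om])
  then show ?thesis using smooth_has_weak_grad[OF assms(1) Om] unfolding sobolev_def Lspace_1_iff by (auto simp: Lspace_1_iff)
qed

lemma smooth_has_trace:
  fixes \<eta> :: "'a::euclidean_space \<Rightarrow> real"
  assumes sm: "smooth \<eta>" and Om: "open \<Omega>" "bounded \<Omega>" and F: "(int DIM('a) - 1) simplex F"
  shows "has_trace \<Omega> F \<eta> \<eta>"
proof -
  obtain \<nu> c where \<nu>: "norm \<nu> = 1" "affine hull F = {x. \<nu> \<bullet> x = c}" using simplex_hyperplane[OF F] .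
  have cF: "compact F" using compact_simplex[OF F] .
  have "integrable (surface_measure F) \<eta>"
    by (rule surface_integrable_continuous[OF \<nu> borel_compact[OF cF] smooth_continuous[OF sm] cF])
  moreover have "sobolev_norm 1 \<Omega> (\<lambda>x. \<eta> x - \<eta> x) = 0"
  proof -
    have sm0: "smooth (\<lambda>x::'a. 0)" by (simp add: Ck_const)
    have g0: "gradient (\<lambda>x::'a. 0) x = 0" for x by (rule gradient_eqI) simp
    have "AE x in lebesgue_on \<Omega>. weak_grad \<Omega> (\<lambda>x. 0) x = 0"
      using weak_grad_AE_eq[OF Om(1) smooth_has_weak_grad[OF sm0]] Om(1) by (simp add: g0)
    then have "(LINT x|lebesgue_on \<Omega>. norm (weak_grad \<Omega> (\<lambda>x. 0) x) powr 1) = 0"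
      by (intro integral_eq_zero_AE) (auto elim: eventually_mono)
    then show ?thesis by (simp add: sobolev_norm_def)
  qed
  ultimately show ?thesis unfolding has_trace_def
    using sm smooth_in_sobolev_1[OF sm Om] by (auto intro!: exI[of _ "\<lambda>j::nat. \<eta>"])
qed

text \<open>The exponent \<infinity> is the one conjugate to 1, the exponent of the regularity of
  \<open>z\<close>. A smooth function is its own trace, approximated by the constant
  sequence.\<close>

lemma smooth_in_sobolev_D:
  fixes \<eta> :: "'a::euclidean_space \<Rightarrow> real"
  assumes sm: "smooth \<eta>" and Om: "open \<Omega>" "bounded \<Omega>"
    and zero: "\<And>F. (int DIM('a) - 1) simplex F \<Longrightarrow> F \<subseteq> frontier \<Omega> \<Longrightarrow> AE x in surface_measure F. x \<in> \<Gamma>D \<longrightarrow> \<eta> x = 0"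
  shows "\<eta> \<in> sobolev_D \<infinity> \<Omega> \<Gamma>D"
proof -
  have Oml: "\<Omega> \<in> sets lebesgue" using Om(1) by simp
  have b: "f \<in> Lspace \<infinity> \<Omega>" if cf: "continuous_on UNIV f" for f :: "'a \<Rightarrow> 'b::euclidean_space"
  proof -
    obtain C where C: "\<And>x. x \<in> closure \<Omega> \<Longrightarrow> norm (f x) \<le> C"
      using compact_continuous_bound[OF cf, of "closure \<Omega>"] Om(2) by auto
    then have "AE x in lebesgue_on \<Omega>. norm (f x) \<le> C"
      using closure_subset by (intro AE_I2) auto
    then show ?thesis using continuous_measurable_lebesgue_on[OF cf] by (auto simp: Lspace_def)
  qed
  have "\<eta> \<in> sobolev \<infinity> \<Omega>"
    unfolding sobolev_def using b[OF smooth_continuous[OF sm]] b[OF smooth_continuous_gradient[OF sm]] smooth_has_weak_grad[OF sm Oml]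
    by blast
  then show ?thesis unfolding sobolev_D_def using smooth_has_trace[OF sm Om] zero by blast
qed

text \<open>With \<open>y = 1 / t\<close> the bound reads \<open>y + y ^ 2 \<le> 3 * exp y\<close>,
  and \<open>exp y\<close> is at least \<open>1 + y + y ^ 2 / 2\<close>. For
  \<open>t = m * bary P x - 1\<close> it controls, uniformly in \<open>m\<close>, the slope of a
  cutoff multiplied by \<open>bary P x\<close>.\<close>

lemma flat_exp_2_bound: "(t + 1) * flat_exp 2 t \<le> 3" "0 \<le> (t + 1) * flat_exp 2 t"
proof -
  have "(t + 1) * flat_exp 2 t \<le> 3 \<and> 0 \<le> (t + 1) * flat_exp 2 t"
  proof (cases "0 < t")
    case True
    have e3: "1 + 1 / t + (1 / t)\<^sup>2 / 2 \<le> exp (1 / t)" using True by (intro exp_lower_Taylor_quadratic) auto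
    have "(t + 1) / t\<^sup>2 = 1 / t + (1 / t)\<^sup>2" using True by (simp add: power2_eq_square field_simps)
    also have "\<dots> \<le> 3 * exp (1 / t)"
    proof -
      have "0 \<le> 1 / t" "0 \<le> (1 / t)\<^sup>2" using True by auto
      then show ?thesis using e3 by linarith
    qed
    finally have "(t + 1) / t\<^sup>2 \<le> 3 * exp (1 / t)" .
    then have "(t + 1) / t\<^sup>2 * exp (- 1 / t) \<le> 3 * exp (1 / t) * exp (- 1 / t)" by (intro mult_right_mono) auto
    also have "\<dots> = 3" by (simp add: mult.assoc flip: exp_add)
    finally show ?thesis using True by (simp add: flat_exp_def)
  qed (simp add: flat_exp_def)
  then show "(t + 1) * flat_exp 2 t \<le> 3" "0 \<le> (t + 1) * flat_exp 2 t" by auto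
qed

lemma flat_exp_2_tendsto:
  assumes "0 < s" shows "(\<lambda>m. real m * flat_exp 2 (real m * s - 1) * s) \<longlonglongrightarrow> 0"
proof -
  have lim: "filterlim (\<lambda>m. real m * s - 1) at_top sequentially" using assms by real_asymp
  have "((\<lambda>t::real. (t + 1) * (exp (- 1 / t) / t\<^sup>2)) \<longlongrightarrow> 0) at_top" by real_asymp
  from filterlim_compose[OF this lim]
  have l: "(\<lambda>m. (real m * s - 1 + 1) * (exp (- 1 / (real m * s - 1)) / (real m * s - 1)\<^sup>2)) \<longlonglongrightarrow> 0" .
  have "\<forall>\<^sub>F m in sequentially. 0 < real m * s - 1" using lim unfolding filterlim_at_top_dense by blast
  then have "\<forall>\<^sub>F m in sequentially. (real m * s - 1 + 1) * (exp (- 1 / (real m * s - 1)) / (real m * s - 1)\<^sup>2) = real m * flat_exp 2 (real m * s - 1) * s"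
    by (rule eventually_mono) (simp add: flat_exp_def)
  then show ?thesis by (rule Lim_transform_eventually[OF l])
qed

section \<open>Cutoffs that vanish near a facet\<close>

context nd_simplex
begin

lemma bary_affine: "bary P x = (1 - l P \<bullet> P) + l P \<bullet> x"
  by (simp add: bary_def inner_diff_right)

text \<open>Zero wherever \<open>m * bary P x \<le> 1\<close>, that is, near the facet opposite
  \<open>P\<close> and beyond it, and convergent to 1 in the interior of the simplex.\<close>

definition cutoff :: "'a \<Rightarrow> nat \<Rightarrow> 'a \<Rightarrow> real" where
  "cutoff P m x = flat_exp 0 (real m * bary P x - 1)"

lemma cutoff_affine: "cutoff P m x = flat_exp 0 ((real m * (1 - l P \<bullet> P) - 1) + (real m *\<^sub>R l P) \<bullet> x)"
  unfolding cutoff_def bary_affine by (simp add: algebra_simps)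

lemma smooth_cutoff: "smooth (cutoff P m)"
  unfolding cutoff_affine[abs_def] by (intro allI Ck_flat_exp)

lemma gradient_cutoff: "gradient (cutoff P m) x = (real m * flat_exp 2 (real m * bary P x - 1)) *\<^sub>R l P"
proof -
  have e: "(real m * (1 - l P \<bullet> P) - 1) + (real m *\<^sub>R l P) \<bullet> x = real m * bary P x - 1"
    unfolding bary_affine by (simp add: algebra_simps)
  show ?thesis unfolding cutoff_affine[abs_def] gradient_flat_exp e by (simp add: mult.commute)
qed

lemma cutoff_bounds: "0 \<le> cutoff P m x" "cutoff P m x \<le> 1"
  by (auto simp: cutoff_def flat_exp_nonneg flat_exp_le_1)

lemma AE_off_frontier:
  assumes "\<Omega> \<in> sets lebesgue" shows "AE x in lebesgue_on \<Omega>. x \<notin> frontier T"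
proof -
  have "AE x in lebesgue. x \<notin> frontier T"
    using negligible_convex_frontier[OF convex_T] by (intro AE_not_in) (simp add: negligible_iff_null_sets)
  then show ?thesis using assms by (simp add: AE_restrict_space_iff) (auto elim: eventually_mono)
qed

lemma integral_cutoff_tendsto:
  fixes f :: "'a \<Rightarrow> real"
  assumes Om: "\<Omega> \<in> sets lebesgue" and f: "integrable (lebesgue_on \<Omega>) f" and zero: "\<And>x. x \<in> \<Omega> \<Longrightarrow> x \<notin> T \<Longrightarrow> f x = 0" and P: "P \<in> C"
  shows "(\<lambda>m. LINT x|lebesgue_on \<Omega>. cutoff P m x * f x) \<longlonglongrightarrow> (LINT x|lebesgue_on \<Omega>. f x)"
proof (rule integral_dominated_convergence[where w = "\<lambda>x. norm (f x)"])
  have cm: "cutoff P m \<in> borel_measurable (lebesgue_on \<Omega>)" for m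
    by (rule continuous_measurable_lebesgue_on[OF smooth_continuous[OF smooth_cutoff]])
  show "f \<in> borel_measurable (lebesgue_on \<Omega>)" using f by auto
  show "(\<lambda>x. cutoff P m x * f x) \<in> borel_measurable (lebesgue_on \<Omega>)" for m
    using cm f by (intro borel_measurable_times) auto
  show "integrable (lebesgue_on \<Omega>) (\<lambda>x. norm (f x))" using f by simp
  show "AE x in lebesgue_on \<Omega>. norm (cutoff P m x * f x) \<le> norm (f x)" for m
    using cutoff_bounds[of P m] by (intro AE_I2) (auto simp: abs_mult intro!: mult_left_le_one_le)
  show "AE x in lebesgue_on \<Omega>. (\<lambda>m. cutoff P m x * f x) \<longlonglongrightarrow> f x"
    using AE_off_frontier[OF Om] AE_space
  proof eventually_elim
    case (elim x)
    show ?case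
    proof (cases "x \<in> T")
      case True
      then have "x \<in> interior T" using elim(1) closure_subset[of T] by (auto simp: frontier_def)
      then have "0 < bary P x" using mem_interior_iff P by blast
      then have "(\<lambda>m. cutoff P m x * f x) \<longlonglongrightarrow> 1 * f x"
        unfolding cutoff_def by (intro tendsto_mult tendsto_const flat_exp_tendsto_1)
      then show ?thesis by simp
    next
      case False
      then show ?thesis using zero elim(2) by simp
    qed
  qed
qed

text \<open>The slope of the cutoff is not bounded in \<open>m\<close>. Multiplied by
  \<open>bary P\<close> it is at most 3 and tends to zero at every interior point, so dominated
  convergence applies.\<close>

lemma integral_cutoff_gradient_tendsto:
  fixes f :: "'a \<Rightarrow> real"
  assumes Om: "\<Omega> \<in> sets lebesgue" and f: "integrable (lebesgue_on \<Omega>) f" and zero: "\<And>x. x \<in> \<Omega> \<Longrightarrow> x \<notin> T \<Longrightarrow> f x = 0" and P: "P \<in> C"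
  shows "(\<lambda>m. LINT x|lebesgue_on \<Omega>. real m * flat_exp 2 (real m * bary P x - 1) * bary P x * f x) \<longlonglongrightarrow> 0"
    and "integrable (lebesgue_on \<Omega>) (\<lambda>x. real m * flat_exp 2 (real m * bary P x - 1) * bary P x * f x)"
proof -
  have Q: "real m * flat_exp 2 (real m * bary P x - 1) * bary P x = (real m * bary P x - 1 + 1) * flat_exp 2 (real m * bary P x - 1)" for m x
    by simp
  have bd: "\<bar>real m * flat_exp 2 (real m * bary P x - 1) * bary P x\<bar> \<le> 3" for m x
    unfolding Q using flat_exp_2_bound[of "real m * bary P x - 1"] by simp
  have cont: "continuous_on UNIV (\<lambda>x. real m * flat_exp 2 (real m * bary P x - 1) * bary P x)" for m
  proof -
    have "continuous_on UNIV (\<lambda>x. flat_exp 2 ((real m * (1 - l P \<bullet> P) - 1) + (real m *\<^sub>R l P) \<bullet> x))"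
      by (rule Ck_flat_exp[of 0, unfolded Ck.simps])
    moreover have "(real m * (1 - l P \<bullet> P) - 1) + (real m *\<^sub>R l P) \<bullet> x = real m * bary P x - 1" for x
      unfolding bary_affine by (simp add: algebra_simps)
    ultimately have "continuous_on UNIV (\<lambda>x. flat_exp 2 (real m * bary P x - 1))" by (simp only:)
    then show ?thesis by (intro continuous_intros continuous_bary)
  qed
  note cm = continuous_measurable_lebesgue_on[OF cont, where A = \<Omega>]
  show "integrable (lebesgue_on \<Omega>) (\<lambda>x. real m * flat_exp 2 (real m * bary P x - 1) * bary P x * f x)"
    using integrable_bounded_mult[OF f cm AE_I2[OF bd]] by simp
  have "(\<lambda>m. LINT x|lebesgue_on \<Omega>. real m * flat_exp 2 (real m * bary P x - 1) * bary P x * f x) \<longlonglongrightarrow> (LINT x|lebesgue_on \<Omega>. 0)"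
  proof (rule integral_dominated_convergence[where w = "\<lambda>x. 3 * norm (f x)"])
    show "(\<lambda>x. real m * flat_exp 2 (real m * bary P x - 1) * bary P x * f x) \<in> borel_measurable (lebesgue_on \<Omega>)" for m
      using cm f by (intro borel_measurable_times[of "\<lambda>x. real m * flat_exp 2 (real m * bary P x - 1) * bary P x"]) auto
    show "integrable (lebesgue_on \<Omega>) (\<lambda>x. 3 * norm (f x))" using f by simp
    show "AE x in lebesgue_on \<Omega>. norm (real m * flat_exp 2 (real m * bary P x - 1) * bary P x * f x) \<le> 3 * norm (f x)" for m
    proof (rule AE_I2)
      fix x
      show "norm (real m * flat_exp 2 (real m * bary P x - 1) * bary P x * f x) \<le> 3 * norm (f x)"
        using mult_right_mono[OF bd[of m x] abs_ge_zero[of "f x"]]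
        unfolding real_norm_def abs_mult[of _ "f x"] .
    qed
    show "AE x in lebesgue_on \<Omega>. (\<lambda>m. real m * flat_exp 2 (real m * bary P x - 1) * bary P x * f x) \<longlonglongrightarrow> 0"
      using AE_off_frontier[OF Om] AE_space
    proof eventually_elim
      case (elim x)
      show ?case
      proof (cases "x \<in> T")
        case True
        then have "x \<in> interior T" using elim(1) closure_subset[of T] by (auto simp: frontier_def)
        then have "0 < bary P x" using mem_interior_iff P by blast
        from tendsto_mult[OF flat_exp_2_tendsto[OF this] tendsto_const[of "f x"]] show ?thesis by simp
      next
        case False
        then show ?thesis using zero elim(2) by simp
      qed
    qed
  qed simp
  then show "(\<lambda>m. LINT x|lebesgue_on \<Omega>. real m * flat_exp 2 (real m * bary P x - 1) * bary P x * f x) \<longlonglongrightarrow> 0" by simp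
qed

end

lemma integrable_continuous_inner:
  fixes V W :: "'a::euclidean_space \<Rightarrow> 'b::euclidean_space"
  assumes V: "integrable (lebesgue_on \<Omega>) V" and W: "continuous_on UNIV W" and Om: "bounded \<Omega>"
  shows "integrable (lebesgue_on \<Omega>) (\<lambda>x. W x \<bullet> V x)"
proof -
  obtain C where C: "\<And>x. x \<in> closure \<Omega> \<Longrightarrow> norm (W x) \<le> C"
    using compact_continuous_bound[OF W, of "closure \<Omega>"] Om by auto
  show ?thesis
  proof (rule Bochner_Integration.integrable_bound)
    show "integrable (lebesgue_on \<Omega>) (\<lambda>x. C * norm (V x))" using V by simp
    show "(\<lambda>x. W x \<bullet> V x) \<in> borel_measurable (lebesgue_on \<Omega>)"
      by (rule borel_measurable_inner[OF continuous_measurable_lebesgue_on[OF W] borel_measurable_integrable[OF V]])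
    show "AE x in lebesgue_on \<Omega>. norm (W x \<bullet> V x) \<le> norm (C * norm (V x))"
    proof (rule AE_I2)
      fix x assume "x \<in> space (lebesgue_on \<Omega>)"
      then have x: "x \<in> closure \<Omega>" using closure_subset by auto
      have "norm (W x \<bullet> V x) \<le> norm (W x) * norm (V x)" using Cauchy_Schwarz_ineq2 by simp
      also have "\<dots> \<le> C * norm (V x)" by (rule mult_right_mono[OF C[OF x] norm_ge_zero])
      finally show "norm (W x \<bullet> V x) \<le> norm (C * norm (V x))" by simp
    qed
  qed
qed

lemma integrable_continuous_mult:
  fixes V W :: "'a::euclidean_space \<Rightarrow> real"
  assumes "integrable (lebesgue_on \<Omega>) V" "continuous_on UNIV W" "bounded \<Omega>"
  shows "integrable (lebesgue_on \<Omega>) (\<lambda>x. W x * V x)"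
  using integrable_continuous_inner[OF assms] by simp

lemma integrable_if_components:
  fixes z :: "'a \<Rightarrow> 'b::euclidean_space"
  assumes "\<And>b. b \<in> Basis \<Longrightarrow> integrable M (\<lambda>x. z x \<bullet> b)" shows "integrable M z"
proof -
  have "integrable M (\<lambda>x. \<Sum>b\<in>Basis. (z x \<bullet> b) *\<^sub>R b)"
    using assms by (intro Bochner_Integration.integrable_sum integrable_scaleR_left) auto
  then show ?thesis by (simp add: euclidean_representation)
qed

section \<open>A Green formula localized at one facet\<close>

context nd_simplex
begin

lemma integral_zero_off_T:
  fixes f :: "'a \<Rightarrow> real"
  assumes Om: "\<Omega> \<in> sets lebesgue" "interior T \<subseteq> \<Omega>" and f: "integrable (lebesgue_on \<Omega>) f" and zero: "\<And>x. x \<in> \<Omega> \<Longrightarrow> x \<notin> T \<Longrightarrow> f x = 0"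
  shows "(LINT x|lebesgue_on \<Omega>. f x) = (LINT x|lebesgue_on T. f x)"
proof -
  have "AE x in lebesgue. x \<notin> frontier T"
    using negligible_convex_frontier[OF convex_T] by (intro AE_not_in) (simp add: negligible_iff_null_sets)
  then have "AE x in lebesgue. indicator \<Omega> x *\<^sub>R f x = indicator T x *\<^sub>R f x"
  proof eventually_elim
    case (elim x)
    then have "x \<in> T \<Longrightarrow> x \<in> \<Omega>" using Om(2) closure_subset[of T] by (auto simp: frontier_def)
    then show ?case using zero[of x] by (auto simp: indicator_def)
  qed
  moreover have "integrable lebesgue (\<lambda>x. indicator \<Omega> x *\<^sub>R f x)" "integrable lebesgue (\<lambda>x. indicator T x *\<^sub>R f x)"
    using f Om(1) integrable_convex_interior[OF convex_T Om(2,1) T_lebesgue f] T_lebesgue by (simp_all add: integrable_restrict_space)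
  ultimately have "(LINT x|lebesgue. indicator \<Omega> x *\<^sub>R f x) = (LINT x|lebesgue. indicator T x *\<^sub>R f x)"
    by (intro integral_cong_AE) auto
  then show ?thesis using Om(1) T_lebesgue by (simp add: integral_restrict_space)
qed

text \<open>An integral identity over \<Omega> becomes an identity on one facet. The conditions
  \<open>Ka\<close> and \<open>Kb\<close> say that within \<open>K\<close> the domain lies in the
  simplex and that the facet opposite \<open>P\<close> is the only part of its boundary within
  reach.\<close>

lemma Green_zero:
  fixes z :: "'a \<Rightarrow> 'a" and \<eta> g dz :: "'a \<Rightarrow> real"
  assumes Om: "open \<Omega>" "bounded \<Omega>" "interior T \<subseteq> \<Omega>" and P: "P \<in> C"
    and z: "\<And>i. i \<in> Basis \<Longrightarrow> (\<lambda>x. z x \<bullet> i) \<in> sobolev 1 \<Omega>"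
    and n: "l P = k *\<^sub>R n" and tr: "has_trace \<Omega> (facet P) (\<lambda>x. z x \<bullet> n) g"
    and sm: "smooth \<eta>" and K: "compact K" "\<And>x. x \<notin> K \<Longrightarrow> \<eta> x = 0"
    and Ka: "\<And>x. x \<in> K \<Longrightarrow> 0 < bary P x \<Longrightarrow> x \<in> interior T"
    and Kb: "\<And>x. x \<in> K \<Longrightarrow> x \<in> \<Omega> \<Longrightarrow> x \<in> T"
    and dz: "has_weak_div \<Omega> z dz" "integrable (lebesgue_on \<Omega>) dz"
    and div0: "(LINT x|lebesgue_on \<Omega>. z x \<bullet> gradient \<eta> x + \<eta> x * dz x) = 0"
  shows "(LINT s|surface_measure (facet P). \<eta> s * g s) = 0"
proof -
  let ?d = "real DIM('a)"
  have Oml: "\<Omega> \<in> sets lebesgue" using Om(1) by simp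
  have k0: "k \<noteq> 0" using n l_nonzero[OF P] by auto
  define w where "w x = z x \<bullet> n" for x
  define G where "G = weak_grad \<Omega> w"
  have w: "w \<in> sobolev 1 \<Omega>" using tr by (simp add: has_trace_def w_def[abs_def])
  note wi = sobolev_1_cases[OF w Om(1), folded G_def]
  have zi: "integrable (lebesgue_on \<Omega>) z" by (rule integrable_if_components[OF sobolev_1_cases(1)[OF z Om(1)]])
  have g0: "gradient \<eta> x = 0" if "x \<notin> K" for x
    by (rule gradient_outside_support[OF compact_imp_closed[OF K(1)] K(2) that])
  note ce = smooth_continuous[OF sm] and cg = smooth_continuous_gradient[OF sm]
  define \<kappa> where "\<kappa> = cutoff P"
  define R where "R m x = real m * flat_exp 2 (real m * bary P x - 1)" for m x
  have cchi: "continuous_on UNIV (\<kappa> m)" for m unfolding \<kappa>_def by (rule smooth_continuous[OF smooth_cutoff])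
  have gchi: "gradient (\<kappa> m) x = R m x *\<^sub>R l P" for m x unfolding \<kappa>_def R_def by (rule gradient_cutoff)
  have cR: "continuous_on UNIV (R m)" for m
  proof -
    have e: "real m * bary P x - 1 = (real m * (1 - l P \<bullet> P) - 1) + (real m *\<^sub>R l P) \<bullet> x" for x
      unfolding bary_affine by (simp add: algebra_simps)
    have "R m = (\<lambda>x. real m * flat_exp 2 ((real m * (1 - l P \<bullet> P) - 1) + (real m *\<^sub>R l P) \<bullet> x))"
      unfolding R_def by (simp only: e)
    moreover have "continuous_on UNIV (\<lambda>x. flat_exp 2 ((real m * (1 - l P \<bullet> P) - 1) + (real m *\<^sub>R l P) \<bullet> x))"
      by (rule Ck_flat_exp[of 0, unfolded Ck.simps])
    ultimately show ?thesis by (simp only: continuous_on_mult_left)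
  qed
  define \<zeta> where "\<zeta> m x = \<eta> x * \<kappa> m x" for m x
  have smz: "smooth (\<zeta> m)" for m unfolding \<zeta>_def \<kappa>_def by (intro allI Ck_mult sm[rule_format] smooth_cutoff[rule_format])
  have gz: "gradient (\<zeta> m) x = \<eta> x *\<^sub>R (R m x *\<^sub>R l P) + \<kappa> m x *\<^sub>R gradient \<eta> x" for m x
    unfolding \<zeta>_def gchi[symmetric] \<kappa>_def by (intro gradient_mult smooth_differentiable sm smooth_cutoff)
  have test: "test_function \<Omega> (\<zeta> m)" for m
  proof (rule test_functionI[OF smz])
    \<comment> \<open>Multiplication by the cutoff removes the layer where
      \<open>m * bary P x < 1\<close>; by \<open>Ka\<close> the rest of \<open>K\<close> lies in the
      interior of the simplex, so the product has compact support in \<Omega>.\<close>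
    let ?K = "K \<inter> {x. 1 \<le> real m * bary P x}"
    show "compact ?K" using K(1) by (intro compact_Int_closed closed_Collect_le continuous_intros continuous_bary)
    show "?K \<subseteq> \<Omega>"
    proof
      fix x assume x: "x \<in> ?K"
      then have "0 < real m * bary P x" by simp
      then have "0 < bary P x" by (simp add: zero_less_mult_iff)
      then show "x \<in> \<Omega>" using x Ka Om(3) by blast
    qed
    show "\<zeta> m x = 0" if "x \<notin> ?K" for x
      using that K(2)[of x] by (auto simp: \<zeta>_def \<kappa>_def cutoff_def flat_exp_0_iff)
  qed
  have zero: "\<eta> x = 0" "gradient \<eta> x = 0" if "x \<in> \<Omega>" "x \<notin> T" for x using that Kb K(2) g0 by blast+

  text \<open>Testing with \<open>\<eta> \<kappa>\<^sub>m\<close>, where \<open>\<kappa>\<^sub>m\<close> vanishes near the side and tends to one inside, the terms with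
    \<open>\<nabla>\<kappa>\<^sub>m\<close> tend to zero by \<open>div0\<close>; for the radial field \<open>(x - P) \<eta> w\<close> the same terms tend to the
    boundary integral.\<close>
  define f1 where "f1 x = z x \<bullet> gradient \<eta> x + \<eta> x * dz x" for x
  have i1: "integrable (lebesgue_on \<Omega>) f1" unfolding f1_def
    using integrable_continuous_inner[OF zi cg Om(2)] integrable_continuous_mult[OF dz(2) ce Om(2)] by (simp add: inner_commute)
  have iw: "integrable (lebesgue_on \<Omega>) (\<lambda>x. (\<eta> x * R m x) * w x)" for m
    by (intro integrable_continuous_mult[OF wi(1) _ Om(2)] continuous_intros ce cR)
  have eq1: "(LINT x|lebesgue_on \<Omega>. \<kappa> m x * f1 x) = - k * (LINT x|lebesgue_on \<Omega>. (\<eta> x * R m x) * w x)" for m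
  proof -
    have "(LINT x|lebesgue_on \<Omega>. z x \<bullet> gradient (\<zeta> m) x) = - (LINT x|lebesgue_on \<Omega>. \<zeta> m x * dz x)"
      using dz(1) test[of m] unfolding has_weak_div_def by blast
    moreover have "integrable (lebesgue_on \<Omega>) (\<lambda>x. z x \<bullet> gradient (\<zeta> m) x)"
      using integrable_continuous_inner[OF zi smooth_continuous_gradient[OF smz] Om(2)] by (simp add: inner_commute)
    moreover have "integrable (lebesgue_on \<Omega>) (\<lambda>x. \<zeta> m x * dz x)"
      by (rule integrable_continuous_mult[OF dz(2) smooth_continuous[OF smz] Om(2)])
    ultimately have "(LINT x|lebesgue_on \<Omega>. z x \<bullet> gradient (\<zeta> m) x + \<zeta> m x * dz x) = 0" by simp
    also have "(\<lambda>x. z x \<bullet> gradient (\<zeta> m) x + \<zeta> m x * dz x) = (\<lambda>x. \<kappa> m x * f1 x + k * ((\<eta> x * R m x) * w x))"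
      unfolding gz \<zeta>_def f1_def w_def n by (intro ext) (simp add: inner_add_right algebra_simps)
    finally show ?thesis
      using integrable_continuous_mult[OF i1 cchi Om(2)] iw by simp
  qed
  have "(\<lambda>m. LINT x|lebesgue_on \<Omega>. \<kappa> m x * f1 x) \<longlonglongrightarrow> (LINT x|lebesgue_on \<Omega>. f1 x)"
    unfolding \<kappa>_def by (rule integral_cutoff_tendsto[OF Oml i1 _ P]) (simp add: f1_def zero)
  then have "(\<lambda>m. - k * (LINT x|lebesgue_on \<Omega>. (\<eta> x * R m x) * w x)) \<longlonglongrightarrow> 0"
    unfolding eq1 using div0 by (simp add: f1_def)
  from tendsto_mult[OF tendsto_const[of "- 1 / k"] this]
  have lim1: "(\<lambda>m. LINT x|lebesgue_on \<Omega>. (\<eta> x * R m x) * w x) \<longlonglongrightarrow> 0" using k0 by simp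

  define f2 where "f2 x = (x - P) \<bullet> (\<eta> x *\<^sub>R G x + w x *\<^sub>R gradient \<eta> x) + ?d * (\<eta> x * w x)" for x
  have i2: "integrable (lebesgue_on \<Omega>) f2"
  proof -
    have "integrable (lebesgue_on \<Omega>) (\<lambda>x. (\<eta> x *\<^sub>R (x - P)) \<bullet> G x)"
      by (intro integrable_continuous_inner[OF wi(2) _ Om(2)] continuous_intros ce)
    moreover have "integrable (lebesgue_on \<Omega>) (\<lambda>x. ((x - P) \<bullet> gradient \<eta> x + ?d * \<eta> x) * w x)"
      by (intro integrable_continuous_mult[OF wi(1) _ Om(2)] continuous_intros ce cg)
    ultimately have "integrable (lebesgue_on \<Omega>) (\<lambda>x. (\<eta> x *\<^sub>R (x - P)) \<bullet> G x + ((x - P) \<bullet> gradient \<eta> x + ?d * \<eta> x) * w x)"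
      by simp
    also have "(\<lambda>x. (\<eta> x *\<^sub>R (x - P)) \<bullet> G x + ((x - P) \<bullet> gradient \<eta> x + ?d * \<eta> x) * w x) = f2"
      unfolding f2_def by (intro ext) (simp add: inner_add_right algebra_simps)
    finally show ?thesis .
  qed
  have ie: "integrable (lebesgue_on \<Omega>) (\<lambda>x. \<eta> x * w x)" by (rule integrable_continuous_mult[OF wi(1) ce Om(2)])
  note gt = integral_cutoff_gradient_tendsto[OF Oml ie _ P]
  have lim2: "(\<lambda>m. LINT x|lebesgue_on \<Omega>. R m x * bary P x * (\<eta> x * w x)) \<longlonglongrightarrow> 0"
    and i3: "integrable (lebesgue_on \<Omega>) (\<lambda>x. R m x * bary P x * (\<eta> x * w x))" for m
    unfolding R_def by (rule gt; simp add: zero)+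
  have eq2: "(LINT x|lebesgue_on \<Omega>. \<kappa> m x * f2 x) =
      (LINT x|lebesgue_on \<Omega>. (\<eta> x * R m x) * w x) - (LINT x|lebesgue_on \<Omega>. R m x * bary P x * (\<eta> x * w x))" for m
  proof -
    \<comment> \<open>\<open>q b\<close> is the \<open>b\<close>-component of the field
      \<open>(x - P) \<zeta>\<close>. Testing the weak gradient of \<open>w\<close> in direction
      \<open>b\<close> with it and summing over the basis gives the divergence identity for
      \<open>(x - P) \<zeta> w\<close>.\<close>
    define q where "q b x = (- (P \<bullet> b) + b \<bullet> x) * \<zeta> m x" for b x
    have tq: "test_function \<Omega> (q b)" for b
      unfolding q_def by (rule test_function_mult[OF test]) (intro allI Ck_affine)
    have gq: "gradient (q b) x = (- (P \<bullet> b) + b \<bullet> x) *\<^sub>R gradient (\<zeta> m) x + \<zeta> m x *\<^sub>R b" for b x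
    proof -
      have sma: "smooth (\<lambda>x. - (P \<bullet> b) + b \<bullet> x)" by (intro allI Ck_affine)
      show ?thesis
        unfolding q_def gradient_mult[OF smooth_differentiable[OF sma] smooth_differentiable[OF smz]] gradient_affine ..
    qed
    have loc: "loc_integrable \<Omega> w" "loc_integrable \<Omega> G" using wi(3) by (auto simp: has_weak_grad_def)
    have s1: "(\<Sum>b\<in>Basis. w x * (gradient (q b) x \<bullet> b)) = w x * ((x - P) \<bullet> gradient (\<zeta> m) x + ?d * \<zeta> m x)" for x
    proof -
      have "(\<Sum>b\<in>Basis. gradient (q b) x \<bullet> b) = (\<Sum>b\<in>Basis. ((x - P) \<bullet> b) * (gradient (\<zeta> m) x \<bullet> b)) + (\<Sum>b\<in>(Basis::'a set). \<zeta> m x)"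
        unfolding gq sum.distrib[symmetric]
        by (intro sum.cong refl) (simp add: inner_add_left inner_add_right inner_diff_left inner_diff_right inner_commute inner_same_Basis)
      also have "\<dots> = (x - P) \<bullet> gradient (\<zeta> m) x + ?d * \<zeta> m x" by (simp add: euclidean_inner[symmetric])
      finally show ?thesis by (simp flip: sum_distrib_left)
    qed
    have s2: "(\<Sum>b\<in>Basis. q b x * (G x \<bullet> b)) = \<zeta> m x * ((x - P) \<bullet> G x)" for x
    proof -
      have "(\<Sum>b\<in>Basis. q b x * (G x \<bullet> b)) = (\<Sum>b\<in>Basis. \<zeta> m x * (((x - P) \<bullet> b) * (G x \<bullet> b)))"
        unfolding q_def by (intro sum.cong refl) (simp add: inner_diff_left inner_commute algebra_simps)
      also have "\<dots> = \<zeta> m x * ((x - P) \<bullet> G x)"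
        unfolding sum_distrib_left[symmetric] euclidean_inner[symmetric] ..
      finally show ?thesis .
    qed
    have a1: "integrable (lebesgue_on \<Omega>) (\<lambda>x. w x * (gradient (q b) x \<bullet> b))" for b
      using integrable_test_function_scaleR(2)[OF loc(1) Oml tq, of b b] by (simp add: mult.commute)
    have a2: "integrable (lebesgue_on \<Omega>) (\<lambda>x. q b x * (G x \<bullet> b))" for b
      using integrable_test_function_scaleR(1)[OF loc_integrable_inner[OF loc(2)] Oml tq, of b b] by simp
    have "(LINT x|lebesgue_on \<Omega>. w x * ((x - P) \<bullet> gradient (\<zeta> m) x + ?d * \<zeta> m x)) = (\<Sum>b\<in>Basis. LINT x|lebesgue_on \<Omega>. w x * (gradient (q b) x \<bullet> b))"
      unfolding s1[symmetric] by (rule Bochner_Integration.integral_sum[OF a1])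
    also have "\<dots> = (\<Sum>b\<in>Basis. - (LINT x|lebesgue_on \<Omega>. q b x * (G x \<bullet> b)))"
      by (intro sum.cong refl has_weak_grad_inner[OF wi(3) Oml tq])
    also have "\<dots> = - (LINT x|lebesgue_on \<Omega>. \<zeta> m x * ((x - P) \<bullet> G x))"
      unfolding s2[symmetric] sum_negf by (subst Bochner_Integration.integral_sum[OF a2]) simp
    finally have e: "(LINT x|lebesgue_on \<Omega>. w x * ((x - P) \<bullet> gradient (\<zeta> m) x + ?d * \<zeta> m x)) = - (LINT x|lebesgue_on \<Omega>. \<zeta> m x * ((x - P) \<bullet> G x))" .
    have j1: "integrable (lebesgue_on \<Omega>) (\<lambda>x. w x * ((x - P) \<bullet> gradient (\<zeta> m) x + ?d * \<zeta> m x))"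
      unfolding s1[symmetric] by (intro Bochner_Integration.integrable_sum a1)
    have j2: "integrable (lebesgue_on \<Omega>) (\<lambda>x. \<zeta> m x * ((x - P) \<bullet> G x))"
      unfolding s2[symmetric] by (intro Bochner_Integration.integrable_sum a2)
    have "(LINT x|lebesgue_on \<Omega>. w x * ((x - P) \<bullet> gradient (\<zeta> m) x + ?d * \<zeta> m x) + \<zeta> m x * ((x - P) \<bullet> G x)) = 0"
      using e j1 j2 by simp
    also have "(\<lambda>x. w x * ((x - P) \<bullet> gradient (\<zeta> m) x + ?d * \<zeta> m x) + \<zeta> m x * ((x - P) \<bullet> G x)) =
      (\<lambda>x. \<kappa> m x * f2 x + (R m x * bary P x * (\<eta> x * w x) - (\<eta> x * R m x) * w x))"
    proof
      fix x
      define y where "y = x - P"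
      \<comment> \<open>Since \<open>(x - P) \<bullet> l P = bary P x - 1\<close>, the radial
        derivative of the cutoff splits into the term of \<open>lim1\<close> and the small one of
        \<open>lim2\<close>.\<close>
      have b: "bary P x = y \<bullet> l P + 1" by (simp add: y_def bary_def inner_commute)
      show "w x * ((x - P) \<bullet> gradient (\<zeta> m) x + ?d * \<zeta> m x) + \<zeta> m x * ((x - P) \<bullet> G x) =
        \<kappa> m x * f2 x + (R m x * bary P x * (\<eta> x * w x) - (\<eta> x * R m x) * w x)"
        unfolding gz \<zeta>_def f2_def b y_def[symmetric] by (simp add: inner_add_right algebra_simps)
    qed
    finally show ?thesis
      using integrable_continuous_mult[OF i2 cchi Om(2)] iw i3 by simp
  qed
  have "(\<lambda>m. LINT x|lebesgue_on \<Omega>. \<kappa> m x * f2 x) \<longlonglongrightarrow> (LINT x|lebesgue_on \<Omega>. f2 x)"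
    unfolding \<kappa>_def by (rule integral_cutoff_tendsto[OF Oml i2 _ P]) (simp add: f2_def zero)
  moreover have "(\<lambda>m. LINT x|lebesgue_on \<Omega>. \<kappa> m x * f2 x) \<longlonglongrightarrow> 0"
    unfolding eq2 using tendsto_diff[OF lim1 lim2] by simp
  ultimately have "(LINT x|lebesgue_on \<Omega>. f2 x) = 0" by (rule LIMSEQ_unique)
  moreover have "(LINT x|lebesgue_on \<Omega>. f2 x) = (LINT x|lebesgue_on T. f2 x)"
    by (rule integral_zero_off_T[OF Oml Om(3) i2]) (simp add: f2_def zero)
  moreover have "(LINT x|lebesgue_on T. f2 x) = ht P * (LINT s|surface_measure (facet P). \<eta> s * g s)"
    unfolding f2_def G_def using trace_formula[OF P Om tr sm] by (simp add: w_def[abs_def])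
  ultimately show ?thesis using ht_pos[OF P] by simp
qed

end

lemma AE_surface_mem:
  fixes \<nu> :: "'a::euclidean_space"
  assumes "norm \<nu> = 1" "affine hull F = {x. \<nu> \<bullet> x = c}" "F \<in> sets borel"
  shows "AE s in surface_measure F. s \<in> F"
  unfolding surface_measure_eq[OF assms(1,2)]
  by (subst AE_distr_iff[OF hproj_measurable_lebesgue_on[OF assms]]) (auto intro!: AE_I2 assms(3))

section \<open>Bumps around one side\<close>

context nd_simplex
begin

text \<open>On the hyperplane of the facet \<open>bary Q\<close> is an affine function that is 1 at
  \<open>Q\<close> and 0 at a third vertex \<open>R\<close>, which exists from dimension two on. A
  nonconstant affine function vanishes on a null set.\<close>

lemma AE_surface_bary_nonzero:
  assumes dim: "2 \<le> DIM('a)" and P: "P \<in> C" and Q: "Q \<in> C" "Q \<noteq> P"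
  shows "AE s in surface_measure (facet P). bary Q s \<noteq> 0"
proof -
  define c where "c = \<nu> P \<bullet> P - ht P"
  note \<nu> = norm_\<nu>[OF P] affine_hull_facet[OF P, folded c_def]
  have Sb: "facet P \<in> sets borel" by (rule borel_compact[OF compact_facet])
  have "C - {P, Q} \<noteq> {}"
  proof
    assume "C - {P, Q} = {}"
    then have "card C \<le> card {P, Q}" by (intro card_mono) auto
    then show False using card_C dim Q by simp
  qed
  then obtain R where R: "R \<in> C" "R \<noteq> P" "R \<noteq> Q" by auto
  have H: "\<nu> P \<bullet> Z = c" if "Z \<in> C" "Z \<noteq> P" for Z
  proof -
    have "Z \<in> facet P" using that by (intro hull_inc) auto
    then have "Z \<in> affine hull (facet P)" by (rule hull_inc)
    then show ?thesis unfolding \<nu>(2) by simp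
  qed
  \<comment> \<open>The tangential part of \<open>l Q\<close>, which is the linear part of
    \<open>bary Q\<close> after projection to the hyperplane. The tangential edge
    \<open>R - Q\<close> shows that it is nonzero.\<close>
  define m where "m = l Q - (l Q \<bullet> \<nu> P) *\<^sub>R \<nu> P"
  have "m \<bullet> (R - Q) = - 1"
    unfolding m_def inner_diff_left[of "l Q"] using l[OF Q(1) R(1,3)] H[OF Q] H[OF R(1,2)] by (simp add: inner_diff_right)
  then have "m \<noteq> 0" by auto
  then have "negligible {x. m \<bullet> x = - (1 - l Q \<bullet> Q + c * (l Q \<bullet> \<nu> P))}" by (intro negligible_hyperplane) simp
  then have "AE x in lebesgue. x \<notin> {x. m \<bullet> x = - (1 - l Q \<bullet> Q + c * (l Q \<bullet> \<nu> P))}"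
    by (intro AE_not_in) (simp add: negligible_iff_null_sets)
  then have ae: "AE x in lebesgue. bary Q (hproj (\<nu> P) c x) \<noteq> 0"
  proof eventually_elim
    case (elim x)
    have "bary Q (hproj (\<nu> P) c x) = m \<bullet> x + (1 - l Q \<bullet> Q + c * (l Q \<bullet> \<nu> P))"
      unfolding bary_def hproj_def m_def by (simp add: inner_diff_left inner_diff_right algebra_simps)
    then show ?case using elim by auto
  qed
  have "{x \<in> space borel. bary Q x \<noteq> 0} \<in> sets borel"
    using borel_measurable_continuous_onI[OF continuous_bary] by measurable
  moreover have "AE x in lebesgue_on {x. hproj (\<nu> P) c x \<in> facet P \<and> \<bar>\<nu> P \<bullet> x - c\<bar> \<le> 1/2}. bary Q (hproj (\<nu> P) c x) \<noteq> 0"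
    using ae prism_borel[OF \<nu> Sb] by (subst AE_restrict_space_iff) (auto elim: eventually_mono)
  ultimately show ?thesis
    unfolding surface_measure_eq[OF \<nu>] by (subst AE_distr_iff[OF hproj_measurable_lebesgue_on[OF \<nu> Sb]]) auto
qed

lemma closed_bary_le: "closed {x. c \<le> real j * bary Q x}"
  by (intro closed_Collect_le continuous_intros continuous_bary)

text \<open>A layer around the facet opposite \<open>P\<close>, of half-width \<delta> in the
  coordinate \<open>bary P\<close>, kept away from the relative boundary of the facet by the bounds
  on the other coordinates.\<close>

definition side_region :: "'a \<Rightarrow> nat \<Rightarrow> real \<Rightarrow> 'a set" where
  "side_region P j \<delta> = {x. \<bar>bary P x\<bar> \<le> \<delta> \<and> (\<forall>Q\<in>C - {P}. 1 \<le> real j * bary Q x)}"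

lemma side_region_pos: "x \<in> side_region P j \<delta> \<Longrightarrow> Q \<in> C - {P} \<Longrightarrow> 0 < bary Q x"
  unfolding side_region_def by (smt (verit) mem_Collect_eq mult_nonneg_nonpos of_nat_0_le_iff)

text \<open>The other coordinates are positive with sum \<open>1 - bary P x\<close>, at most 2;
  bounded coordinates bound the point.\<close>

lemma compact_side_region:
  assumes P: "P \<in> C" and \<delta>: "\<delta> \<le> 1" shows "compact (side_region P j \<delta>)"
proof -
  have "closed (side_region P j \<delta>)"
  proof -
    have "side_region P j \<delta> = {x. \<bar>bary P x\<bar> \<le> \<delta>} \<inter> (\<Inter>Q\<in>C - {P}. {x. 1 \<le> real j * bary Q x})"
      by (auto simp: side_region_def)
    then show ?thesis
      by (auto intro!: closed_Int closed_INT closed_bary_le closed_Collect_le continuous_intros continuous_bary)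
  qed
  moreover have "norm x \<le> (\<Sum>Q\<in>C. 2 * norm Q)" if x: "x \<in> side_region P j \<delta>" for x
  proof -
    have nn: "0 \<le> bary Q x" if "Q \<in> C - {P}" for Q using side_region_pos[OF x that] by simp
    have bP: "\<bar>bary P x\<bar> \<le> 1" using x \<delta> by (auto simp: side_region_def)
    have b: "\<bar>bary Q x\<bar> \<le> 2" if Q: "Q \<in> C" for Q
    proof (cases "Q = P")
      case False
      have "bary Q x \<le> (\<Sum>Q\<in>C - {P}. bary Q x)"
        using Q False finite_C nn by (intro member_le_sum) auto
      also have "\<dots> = 1 - bary P x" using bary_representation(1)[of x] P finite_C by (simp add: sum.remove[of C P])
      finally show ?thesis using bP nn[of Q] Q False by auto
    qed (use bP in simp)
    have "norm x = norm (\<Sum>Q\<in>C. bary Q x *\<^sub>R Q)" by (simp add: bary_representation)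
    also have "\<dots> \<le> (\<Sum>Q\<in>C. norm (bary Q x *\<^sub>R Q))" by (rule norm_sum)
    also have "\<dots> \<le> (\<Sum>Q\<in>C. 2 * norm Q)" using b by (intro sum_mono) (auto intro: mult_right_mono)
    finally show ?thesis .
  qed
  then have "bounded (side_region P j \<delta>)" unfolding bounded_iff by blast
  ultimately show ?thesis by (simp add: compact_eq_bounded_closed)
qed

text \<open>On the compact part of \<open>A\<close> in the layer of half-width 1 the absolute value
  of \<open>bary P\<close> has a minimum. A zero would be a point of \<open>A\<close> in the
  relative interior of the facet, so half the minimum, capped at 1, is thin enough.\<close>

lemma thin_side_region:
  assumes P: "P \<in> C" and A: "closed A" "A \<inter> rel_interior (facet P) = {}"
  obtains \<delta> where "0 < \<delta>" "\<delta> \<le> 1" "side_region P j \<delta> \<inter> A = {}"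
proof (cases "side_region P j 1 \<inter> A = {}")
  case True
  then show thesis using that[of 1] by simp
next
  case False
  have "compact (side_region P j 1 \<inter> A)" using compact_side_region[OF P] A(1) by (intro compact_Int_closed) auto
  then obtain x0 where x0: "x0 \<in> side_region P j 1 \<inter> A" "\<And>x. x \<in> side_region P j 1 \<inter> A \<Longrightarrow> \<bar>bary P x0\<bar> \<le> \<bar>bary P x\<bar>"
    using continuous_attains_inf[of "side_region P j 1 \<inter> A" "\<lambda>x. \<bar>bary P x\<bar>"] False
    by (auto intro!: continuous_intros continuous_on_subset[OF continuous_bary])
  have "bary P x0 \<noteq> 0"
  proof
    assume "bary P x0 = 0"
    then have "x0 \<in> rel_interior (facet P)"
      unfolding rel_interior_facet_iff[OF P] using side_region_pos x0(1) by blast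
    then show False using A(2) x0(1) by blast
  qed
  then show thesis
  proof (intro that[of "min 1 (\<bar>bary P x0\<bar> / 2)"])
    show "side_region P j (min 1 (\<bar>bary P x0\<bar> / 2)) \<inter> A = {}"
    proof (rule ccontr)
      assume "\<not> ?thesis"
      then obtain x where x: "x \<in> side_region P j (min 1 (\<bar>bary P x0\<bar> / 2))" "x \<in> A" by blast
      then have "x \<in> side_region P j 1 \<inter> A" by (auto simp: side_region_def)
      from x0(2)[OF this] show False using x(1) \<open>bary P x0 \<noteq> 0\<close> by (auto simp: side_region_def)
    qed
  qed auto
qed

text \<open>The product of cutoffs keeps away from the relative boundary of the facet. The last two
  factors confine the support to the layer and are constant on the facet, where
  \<open>bary P\<close> vanishes.\<close>

definition side_bump :: "'a \<Rightarrow> nat \<Rightarrow> real \<Rightarrow> 'a \<Rightarrow> real" where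
  "side_bump P j \<delta> x = (\<Prod>Q\<in>C - {P}. cutoff Q j x) *
     (flat_exp 0 (1 - bary P x / \<delta>) * flat_exp 0 (1 + bary P x / \<delta>))"

lemma smooth_side_bump: "smooth (side_bump P j \<delta>)"
proof -
  have "1 - bary P x / \<delta> = (1 - (1 - l P \<bullet> P) / \<delta>) + ((- 1 / \<delta>) *\<^sub>R l P) \<bullet> x"
    "1 + bary P x / \<delta> = (1 + (1 - l P \<bullet> P) / \<delta>) + ((1 / \<delta>) *\<^sub>R l P) \<bullet> x" for x
    unfolding bary_affine by (simp_all add: diff_divide_distrib add_divide_distrib)
  then show ?thesis unfolding side_bump_def
    by (simp only:) (intro allI Ck_mult Ck_prod Ck_flat_exp smooth_cutoff[rule_format])
qed

lemma side_bump_zero: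
  assumes "0 < \<delta>" "x \<notin> side_region P j \<delta>" shows "side_bump P j \<delta> x = 0"
proof (cases "\<bar>bary P x\<bar> \<le> \<delta>")
  case True
  then obtain Q where Q: "Q \<in> C - {P}" "real j * bary Q x < 1" using assms(2) by (auto simp: side_region_def not_le)
  then have "(\<Prod>Q\<in>C - {P}. cutoff Q j x) = 0"
    using finite_C by (intro prod_zero) (auto simp: cutoff_def flat_exp_0_iff intro!: bexI[of _ Q])
  then show ?thesis by (simp add: side_bump_def)
next
  case False
  then have "1 - bary P x / \<delta> \<le> 0 \<or> 1 + bary P x / \<delta> \<le> 0" using assms(1) by (auto simp: field_simps abs_le_iff)
  then have "flat_exp 0 (1 - bary P x / \<delta>) * flat_exp 0 (1 + bary P x / \<delta>) = 0"
    unfolding mult_eq_0_iff flat_exp_0_iff .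
  then show ?thesis by (simp add: side_bump_def)
qed

end

section \<open>Vanishing normal averages on Neumann sides\<close>

context fe_mesh
begin

context
  fixes n :: "'a set \<Rightarrow> 'a"
  assumes normals: "unit_normals \<T> n"
begin

text \<open>The weak Neumann condition is tested with a bump around \<open>S\<close> so thin that it
  meets no other element. The part of the frontier where the bump is nonzero lies in
  \<open>S\<close>, which meets \<Gamma>D in a null set, so the bump is admissible.
  \<open>Green_zero\<close> turns the test into an integral over \<open>S\<close>, and as
  \<open>j\<close> grows the cutoffs exhaust \<open>S\<close>.\<close>

lemma Neumann_side_average_zero:
  fixes z :: "'a \<Rightarrow> 'a"
  assumes dim: "2 \<le> DIM('a)" and S: "S \<in> sides_in \<T> \<Omega> (frontier \<Omega> - \<Gamma>D)"
    and zN: "z \<in> div_space_N 1 \<Omega> \<Gamma>D" and zs: "\<And>i. i \<in> Basis \<Longrightarrow> (\<lambda>x. z x \<bullet> i) \<in> sobolev 1 \<Omega>"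
    and tr: "has_trace \<Omega> S (\<lambda>x. z x \<bullet> n S) g"
  shows "side_average S g = 0"
proof -
  have Ss: "S \<in> sides \<T>" "S \<subseteq> frontier \<Omega>" and SAE: "AE x in surface_measure S. x \<in> frontier \<Omega> - \<Gamma>D"
    using S by (auto simp: sides_in_def)
  obtain T where T: "T \<in> \<T>" "S facet_of T" using Ss(1) by (auto simp: sides_def)
  obtain P where P: "P \<in> vert T" "S = convex hull (vert T - {P})" using facet_of_elem_iff[OF T(1)] T(2) by auto
  interpret A: nd_simplex "vert T" "bgrad T" by (rule nd_simplex_vert[OF T(1)])
  note hT = hull_vert[OF T(1)]
  define c where "c = A.\<nu> P \<bullet> P - A.ht P"
  note \<nu> = A.norm_\<nu>[OF P(1)] A.affine_hull_facet[OF P(1), folded c_def, folded P(2)]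
  have cS: "compact S" unfolding P(2) by (rule A.compact_facet)
  let ?A = "\<Union>{T'\<in>\<T>. T' \<noteq> T}"
  have clA: "closed ?A" using finite_mesh compact_elem by (intro closed_Union) (auto intro: compact_imp_closed)
  \<comment> \<open>An element reaching the relative interior of \<open>S\<close> has
    \<open>S\<close> as a facet, and a boundary side belongs to one element.\<close>
  have disj: "?A \<inter> rel_interior (convex hull (vert T - {P})) = {}"
    using facet_of_neighbour[OF T] boundary_side_unique[OF normals T _ _ Ss(2)] P(2) by blast
  define dz where "dz = weak_div \<Omega> z"
  obtain r where r: "integrable (lebesgue_on \<Omega>) r" "has_weak_div \<Omega> z r"
    using zN by (auto simp: div_space_N_def Lspace_1_iff)
  have dz: "has_weak_div \<Omega> z dz" unfolding dz_def by (rule has_weak_div_weak_div[OF r(2)])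
  have dzi: "integrable (lebesgue_on \<Omega>) dz"
    by (rule integrable_AE_lebesgue_on[OF Om_lebesgue r(1)])
       (use weak_div_AE_eq[OF open_Om r(2)] in \<open>auto simp: dz_def elim: eventually_mono\<close>)
  have zi: "integrable (lebesgue_on \<Omega>) z" by (rule integrable_if_components[OF sobolev_1_cases(1)[OF zs open_Om]])
  have gi: "integrable (surface_measure S) g" using tr by (simp add: has_trace_def)
  have step: "(LINT s|surface_measure S. (\<Prod>Q\<in>vert T - {P}. A.cutoff Q j s) * g s) = 0" for j
  proof -
    obtain \<delta> where \<delta>: "0 < \<delta>" "\<delta> \<le> 1" "A.side_region P j \<delta> \<inter> ?A = {}"
      using A.thin_side_region[OF P(1) clA disj] by blast
    define K where "K = A.side_region P j \<delta>"
    define \<eta> where "\<eta> = A.side_bump P j \<delta>"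
    have sm: "smooth \<eta>" unfolding \<eta>_def by (rule A.smooth_side_bump)
    have K: "compact K" "\<And>x. x \<notin> K \<Longrightarrow> \<eta> x = 0"
      using A.compact_side_region[OF P(1) \<delta>(2)] A.side_bump_zero[OF \<delta>(1)] by (auto simp: K_def \<eta>_def)
    have Kc: "x \<in> T" if x: "x \<in> K" "x \<in> closure \<Omega>" for x
    proof -
      obtain T' where "T' \<in> \<T>" "x \<in> T'" using x(2) Union_mesh by auto
      then show ?thesis using \<delta>(3) x(1) unfolding K_def by blast
    qed
    have pos: "0 < A.bary Q x" if "x \<in> K" "Q \<in> vert T - {P}" for x Q using A.side_region_pos that unfolding K_def by blast
    have Ka: "x \<in> interior (convex hull (vert T))" if x: "x \<in> K" "0 < A.bary P x" for x
      unfolding A.mem_interior_iff using pos[OF x(1)] x(2) by blast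
    have D: "\<eta> \<in> sobolev_D \<infinity> \<Omega> \<Gamma>D"
    proof (rule smooth_in_sobolev_D[OF sm open_Om bounded_Om])
      fix F :: "'a set" assume F: "(int DIM('a) - 1) simplex F" "F \<subseteq> frontier \<Omega>"
      obtain \<mu> d where \<mu>: "norm \<mu> = 1" "affine hull F = {x. \<mu> \<bullet> x = d}" using simplex_hyperplane[OF F(1)] .
      have cF: "compact F" by (rule compact_simplex[OF F(1)])
      show "AE x in surface_measure F. x \<in> \<Gamma>D \<longrightarrow> \<eta> x = 0"
        using surface_AE_transfer[OF \<mu> cF \<nu> cS SAE] AE_surface_mem[OF \<mu> borel_compact[OF cF]]
      proof eventually_elim
        case (elim x)
        show ?case
        proof (rule impI, rule ccontr)
          assume x: "x \<in> \<Gamma>D" "\<eta> x \<noteq> 0"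
          then have xK: "x \<in> K" using K(2) by blast
          have fr: "x \<in> frontier \<Omega>" using elim(2) F(2) by blast
          have "x \<in> closure \<Omega>" "x \<notin> \<Omega>" using fr open_Om by (auto simp: frontier_def interior_open)
          then have xT: "x \<in> convex hull (vert T)" "x \<notin> interior (convex hull (vert T))"
            using Kc[OF xK] interior_elem_subset[OF T(1)] hT by auto
          then have "A.bary P x = 0" using Ka[OF xK] A.mem_T_iff[of x] P(1) by force
          then have "x \<in> S" unfolding P(2) A.facet_bary_iff[OF P(1)] using xT(1) A.mem_T_iff[of x] by blast
          then show False using elim(1) x(1) by blast
        qed
      qed
    qed
    \<comment> \<open>The exponent conjugate to 1 is \<infinity>, so \<eta> is among the test
      functions in the definition of \<open>div_space_N 1\<close>.\<close>
    have "(LINT x|lebesgue_on \<Omega>. z x \<bullet> weak_grad \<Omega> \<eta> x + \<eta> x * dz x) = 0"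
      using zN D unfolding div_space_N_def dz_def by (auto simp: conj_exp_def)
    moreover have "(LINT x|lebesgue_on \<Omega>. z x \<bullet> weak_grad \<Omega> \<eta> x + \<eta> x * dz x) = (LINT x|lebesgue_on \<Omega>. z x \<bullet> gradient \<eta> x + \<eta> x * dz x)"
    proof (rule integral_cong_AE)
      have m1: "z \<in> borel_measurable (lebesgue_on \<Omega>)" "dz \<in> borel_measurable (lebesgue_on \<Omega>)" using zi dzi by auto
      have m2: "weak_grad \<Omega> \<eta> \<in> borel_measurable (lebesgue_on \<Omega>)"
        using sobolev_1_cases(2)[OF smooth_in_sobolev_1[OF sm open_Om bounded_Om] open_Om] by auto
      note m3 = continuous_measurable_lebesgue_on[OF smooth_continuous[OF sm], where A = \<Omega>]
      note m4 = continuous_measurable_lebesgue_on[OF smooth_continuous_gradient[OF sm], where A = \<Omega>]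
      show "(\<lambda>x. z x \<bullet> weak_grad \<Omega> \<eta> x + \<eta> x * dz x) \<in> borel_measurable (lebesgue_on \<Omega>)"
        by (intro borel_measurable_add borel_measurable_inner borel_measurable_times m1 m2 m3)
      show "(\<lambda>x. z x \<bullet> gradient \<eta> x + \<eta> x * dz x) \<in> borel_measurable (lebesgue_on \<Omega>)"
        by (intro borel_measurable_add borel_measurable_inner borel_measurable_times m1 m4 m3)
      show "AE x in lebesgue_on \<Omega>. z x \<bullet> weak_grad \<Omega> \<eta> x + \<eta> x * dz x = z x \<bullet> gradient \<eta> x + \<eta> x * dz x"
        using weak_grad_AE_eq[OF open_Om smooth_has_weak_grad[OF sm Om_lebesgue]] by eventually_elim simp
    qed
    ultimately have div0: "(LINT x|lebesgue_on \<Omega>. z x \<bullet> gradient \<eta> x + \<eta> x * dz x) = 0" by simp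
    have sub: "interior (convex hull (vert T)) \<subseteq> \<Omega>" using interior_elem_subset[OF T(1)] hT by simp
    have Kb: "x \<in> convex hull (vert T)" if "x \<in> K" "x \<in> \<Omega>" for x
      using Kc[OF that(1)] that(2) closure_subset hT by auto
    have trP: "has_trace \<Omega> (convex hull (vert T - {P})) (\<lambda>x. z x \<bullet> n S) g"
      by (subst P(2)[symmetric]) (rule tr)
    have "(LINT s|surface_measure (convex hull (vert T - {P})). \<eta> s * g s) = 0"
      by (rule A.Green_zero[OF open_Om bounded_Om sub P(1) zs bgrad_normal(2)[OF normals T(1) P] trP sm K Ka Kb dz dzi div0])
    then have z0: "(LINT s|surface_measure S. \<eta> s * g s) = 0" using P(2) by simp
    \<comment> \<open>The value of the two layer factors on \<open>S\<close>: nonzero and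
      independent of \<delta> and \<open>j\<close>, so it can be divided out.\<close>
    define e1 where "e1 = flat_exp 0 1 * flat_exp 0 1"
    have e1: "e1 \<noteq> 0" by (simp add: e1_def flat_exp_0_iff)
    have cm: "(\<lambda>s. \<Prod>Q\<in>vert T - {P}. A.cutoff Q j s) \<in> borel_measurable borel"
      by (intro borel_measurable_continuous_onI continuous_on_prod smooth_continuous[OF A.smooth_cutoff])
    have "(LINT s|surface_measure S. \<eta> s * g s) = (LINT s|surface_measure S. e1 * ((\<Prod>Q\<in>vert T - {P}. A.cutoff Q j s) * g s))"
    proof (rule integral_cong_AE)
      have gm: "g \<in> borel_measurable borel" using borel_measurable_integrable[OF gi] by (simp add: measurable_cong_sets[OF sets_surface_measure refl])
      have em: "\<eta> \<in> borel_measurable borel" by (rule borel_measurable_continuous_onI[OF smooth_continuous[OF sm]])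
      show "(\<lambda>s. \<eta> s * g s) \<in> borel_measurable (surface_measure S)" using borel_measurable_times[OF em gm] by (simp add: measurable_cong_sets[OF sets_surface_measure refl])
      show "(\<lambda>s. e1 * ((\<Prod>Q\<in>vert T - {P}. A.cutoff Q j s) * g s)) \<in> borel_measurable (surface_measure S)" using borel_measurable_times[OF borel_measurable_const[of e1] borel_measurable_times[OF cm gm]]
        by (simp add: measurable_cong_sets[OF sets_surface_measure refl])
      show "AE s in surface_measure S. \<eta> s * g s = e1 * ((\<Prod>Q\<in>vert T - {P}. A.cutoff Q j s) * g s)"
        using AE_surface_mem[OF \<nu> borel_compact[OF cS]]
      proof eventually_elim
        case (elim s)
        then have "A.bary P s = 0" unfolding P(2) A.facet_bary_iff[OF P(1)] by simp
        then show ?case by (simp add: \<eta>_def A.side_bump_def e1_def)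
      qed
    qed
    then show ?thesis using z0 e1 by simp
  qed
  have "(\<lambda>j. LINT s|surface_measure S. (\<Prod>Q\<in>vert T - {P}. A.cutoff Q j s) * g s) \<longlonglongrightarrow> (LINT s|surface_measure S. g s)"
  proof (rule integral_dominated_convergence[where w = "\<lambda>s. norm (g s)"])
    have gm: "g \<in> borel_measurable borel" using borel_measurable_integrable[OF gi] by (simp add: measurable_cong_sets[OF sets_surface_measure refl])
    have cm: "(\<lambda>s. \<Prod>Q\<in>vert T - {P}. A.cutoff Q j s) \<in> borel_measurable borel" for j
      by (intro borel_measurable_continuous_onI continuous_on_prod smooth_continuous[OF A.smooth_cutoff])
    show "g \<in> borel_measurable (surface_measure S)" using gi by auto
    show "(\<lambda>s. (\<Prod>Q\<in>vert T - {P}. A.cutoff Q j s) * g s) \<in> borel_measurable (surface_measure S)" for j using borel_measurable_times[OF cm gm]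
      by (simp add: measurable_cong_sets[OF sets_surface_measure refl])
    show "integrable (surface_measure S) (\<lambda>s. norm (g s))" using gi by simp
    show "AE s in surface_measure S. norm ((\<Prod>Q\<in>vert T - {P}. A.cutoff Q j s) * g s) \<le> norm (g s)" for j
    proof (rule AE_I2)
      fix s
      have "0 \<le> (\<Prod>Q\<in>vert T - {P}. A.cutoff Q j s)" "(\<Prod>Q\<in>vert T - {P}. A.cutoff Q j s) \<le> 1"
        using A.cutoff_bounds by (auto intro!: prod_nonneg prod_le_1)
      then show "norm ((\<Prod>Q\<in>vert T - {P}. A.cutoff Q j s) * g s) \<le> norm (g s)"
        by (simp add: abs_mult mult_left_le_one_le)
    qed
    have nz: "AE s in surface_measure S. \<forall>Q\<in>vert T - {P}. A.bary Q s \<noteq> 0"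
      using A.AE_surface_bary_nonzero[OF dim P(1)] A.finite_C P(2)
      by (subst AE_ball_countable) (auto intro: countable_finite)
    show "AE s in surface_measure S. (\<lambda>j. (\<Prod>Q\<in>vert T - {P}. A.cutoff Q j s) * g s) \<longlonglongrightarrow> g s"
      using AE_surface_mem[OF \<nu> borel_compact[OF cS]] nz
    proof eventually_elim
      case (elim s)
      have "(\<lambda>j. (\<Prod>Q\<in>vert T - {P}. A.cutoff Q j s) * g s) \<longlonglongrightarrow> (\<Prod>Q\<in>vert T - {P}. 1) * g s"
      proof (intro tendsto_mult tendsto_prod tendsto_const)
        fix Q assume Q: "Q \<in> vert T - {P}"
        then have "0 \<le> A.bary Q s" using elim(1) unfolding P(2) A.facet_bary_iff[OF P(1)] by blast
        then have "0 < A.bary Q s" using elim(2) Q by fastforce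
        then show "(\<lambda>j. A.cutoff Q j s) \<longlonglongrightarrow> 1" unfolding A.cutoff_def by (rule flat_exp_tendsto_1)
      qed
      then show ?case by simp
    qed
  qed
  then have "(LINT s|surface_measure S. g s) = 0" unfolding step by (simp add: LIMSEQ_const_iff)
  then show ?thesis by (simp add: side_average_def)
qed

end

end

section \<open>Convex conjugates and optimality conditions\<close>

lemma borel_measurable_lebesgue_on_AE:
  fixes f g :: "'a::euclidean_space \<Rightarrow> 'b::euclidean_space"
  assumes Om: "\<Omega> \<in> sets lebesgue" and f: "f \<in> borel_measurable (lebesgue_on \<Omega>)" and fg: "AE x in lebesgue_on \<Omega>. f x = g x"
  shows "g \<in> borel_measurable (lebesgue_on \<Omega>)"
proof -
  have "AE x in lebesgue. indicator \<Omega> x *\<^sub>R f x = indicator \<Omega> x *\<^sub>R g x"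
    using fg unfolding AE_restrict_space_iff[of \<Omega> lebesgue, simplified, OF Om]
    by eventually_elim (auto simp: indicator_def)
  moreover have "(\<lambda>x. indicator \<Omega> x *\<^sub>R f x) \<in> borel_measurable lebesgue"
    using f Om by (simp add: borel_measurable_restrict_space_iff)
  ultimately have "(\<lambda>x. indicator \<Omega> x *\<^sub>R g x) \<in> borel_measurable lebesgue"
    by (rule borel_measurable_lebesgue_AE[rotated])
  then show ?thesis using Om by (simp add: borel_measurable_restrict_space_iff)
qed

text \<open>The one-dimensional tangent inequality, applied on the line from \<open>x\<close> to
  \<open>y\<close>.\<close>

lemma gradient_inequality:
  fixes \<phi> :: "'a::euclidean_space \<Rightarrow> real"
  assumes conv: "convex_on UNIV \<phi>" and diff: "\<phi> differentiable (at x)"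
  shows "\<phi> x + gradient \<phi> x \<bullet> (y - x) \<le> \<phi> y"
proof -
  define h where "h t = \<phi> (x + t *\<^sub>R (y - x))" for t
  have "convex_on UNIV h"
  proof (rule convex_onI)
    fix t a b :: real assume t: "0 < t" "t < 1"
    have "x + ((1 - t) *\<^sub>R a + t *\<^sub>R b) *\<^sub>R (y - x) = (1 - t) *\<^sub>R (x + a *\<^sub>R (y - x)) + t *\<^sub>R (x + b *\<^sub>R (y - x))"
      by (simp add: algebra_simps)
    then show "h ((1 - t) *\<^sub>R a + t *\<^sub>R b) \<le> (1 - t) * h a + t * h b"
      unfolding h_def using convex_onD[OF conv, of t] t by simp
  qed simp
  moreover have "(h has_real_derivative (gradient \<phi> x \<bullet> (y - x))) (at 0 within UNIV)"
  proof -
    have "((\<lambda>t. x + t *\<^sub>R (y - x)) has_derivative (\<lambda>t. t *\<^sub>R (y - x))) (at 0)" by (auto intro!: derivative_eq_intros)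
    moreover have "(\<phi> has_derivative (\<lambda>v. gradient \<phi> x \<bullet> v)) (at (x + 0 *\<^sub>R (y - x)))"
      using has_derivative_gradient[OF diff] by simp
    ultimately have "(h has_derivative (\<lambda>t. gradient \<phi> x \<bullet> (t *\<^sub>R (y - x)))) (at 0)"
      unfolding h_def by (rule has_derivative_compose)
    then show ?thesis by (simp add: has_field_derivative_def mult_commute_abs)
  qed
  ultimately have "(gradient \<phi> x \<bullet> (y - x)) * (1 - 0) \<le> h 1 - h 0"
    by (intro convex_on_imp_above_tangent[where A = UNIV]) auto
  then show ?thesis by (simp add: h_def)
qed

context
  fixes \<phi> :: "'b::euclidean_space \<Rightarrow> real"
  assumes fin: "\<forall>t. fconj \<phi> t < \<infinity>"
begin

lemma fconj_real: "fconj \<phi> t = ereal (real_of_ereal (fconj \<phi> t))"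
proof -
  have "ereal (t \<bullet> 0 - \<phi> 0) \<le> fconj \<phi> t" unfolding fconj_def by (rule SUP_upper) simp
  then have "fconj \<phi> t \<noteq> - \<infinity>" by auto
  moreover have "fconj \<phi> t \<noteq> \<infinity>" using fin by (metis less_irrefl)
  ultimately show ?thesis by (cases "fconj \<phi> t") auto
qed

lemma Fenchel_Young: "t \<bullet> s \<le> \<phi> s + real_of_ereal (fconj \<phi> t)"
proof -
  have "ereal (t \<bullet> s - \<phi> s) \<le> fconj \<phi> t" unfolding fconj_def by (rule SUP_upper) simp
  then have "ereal (t \<bullet> s - \<phi> s) \<le> ereal (real_of_ereal (fconj \<phi> t))" using fconj_real by metis
  then show ?thesis by simp
qed

lemma fconj_le: "(\<And>s. t \<bullet> s - \<phi> s \<le> c) \<Longrightarrow> real_of_ereal (fconj \<phi> t) \<le> c"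
proof -
  assume "\<And>s. t \<bullet> s - \<phi> s \<le> c"
  then have "fconj \<phi> t \<le> ereal c" unfolding fconj_def by (intro SUP_least) simp
  then have "ereal (real_of_ereal (fconj \<phi> t)) \<le> ereal c" using fconj_real by metis
  then show ?thesis by simp
qed

lemma convex_fconj: "convex_on UNIV (\<lambda>t. real_of_ereal (fconj \<phi> t))"
proof (rule convex_onI)
  fix t :: real and x y :: 'b assume t: "0 < t" "t < 1"
  show "real_of_ereal (fconj \<phi> ((1 - t) *\<^sub>R x + t *\<^sub>R y)) \<le> (1 - t) * real_of_ereal (fconj \<phi> x) + t * real_of_ereal (fconj \<phi> y)"
  proof (rule fconj_le)
    fix s
    have "(1 - t) * (x \<bullet> s - \<phi> s) \<le> (1 - t) * real_of_ereal (fconj \<phi> x)"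
      using t Fenchel_Young[of x s] by (intro mult_left_mono) auto
    moreover have "t * (y \<bullet> s - \<phi> s) \<le> t * real_of_ereal (fconj \<phi> y)"
      using t Fenchel_Young[of y s] by (intro mult_left_mono) auto
    ultimately show "((1 - t) *\<^sub>R x + t *\<^sub>R y) \<bullet> s - \<phi> s \<le> (1 - t) * real_of_ereal (fconj \<phi> x) + t * real_of_ereal (fconj \<phi> y)"
      by (simp add: inner_add_left algebra_simps)
  qed
qed simp

text \<open>By Fenchel-Young the conjugate minus the linear function \<open>t \<bullet> q\<close> is
  minimal at \<open>z\<close>, where equality holds. All its directional derivatives vanish
  there.\<close>

lemma Fenchel_equality_imp_gradient:
  assumes diff: "(\<lambda>t. real_of_ereal (fconj \<phi> t)) differentiable (at z)"
    and eq: "\<phi> q + real_of_ereal (fconj \<phi> z) = z \<bullet> q"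
  shows "grad_conj \<phi> z = q"
proof -
  let ?F = "\<lambda>t. real_of_ereal (fconj \<phi> t)"
  have "(grad_conj \<phi> z - q) \<bullet> v = 0" for v
  proof -
    define h where "h t = ?F (z + t *\<^sub>R v) - t * (v \<bullet> q)" for t
    have "((\<lambda>t. z + t *\<^sub>R v) has_derivative (\<lambda>t. t *\<^sub>R v)) (at 0)" by (auto intro!: derivative_eq_intros)
    moreover have "(?F has_derivative (\<lambda>w. gradient ?F z \<bullet> w)) (at (z + 0 *\<^sub>R v))"
      using has_derivative_gradient[OF diff] by simp
    ultimately have "((\<lambda>t. ?F (z + t *\<^sub>R v)) has_derivative (\<lambda>t. gradient ?F z \<bullet> (t *\<^sub>R v))) (at 0)"
      by (rule has_derivative_compose)
    then have "((\<lambda>t. ?F (z + t *\<^sub>R v)) has_real_derivative (gradient ?F z \<bullet> v)) (at 0)"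
      by (simp add: has_field_derivative_def mult_commute_abs)
    then have D: "(h has_real_derivative (gradient ?F z \<bullet> v - v \<bullet> q)) (at 0)"
      unfolding h_def by (auto intro!: derivative_eq_intros)
    have "h 0 \<le> h t" for t
      using Fenchel_Young[of "z + t *\<^sub>R v" q] eq by (simp add: h_def inner_add_left)
    then have "gradient ?F z \<bullet> v - v \<bullet> q = 0" by (intro DERIV_local_min[OF D zero_less_one]) auto
    then show ?thesis by (simp add: grad_conj_def inner_diff_left inner_diff_right inner_commute)
  qed
  then have "(grad_conj \<phi> z - q) \<bullet> (grad_conj \<phi> z - q) = 0" .
  then show ?thesis by simp
qed

end

text \<open>The comparison takes place in the nonnegative integral, where \<open>F\<close> may have
  the value \<infinity>; the bound \<open>0 \<le> k x\<close> removes the negative part of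
  \<open>F\<close>.\<close>

lemma ext_integral_ge:
  assumes k: "integrable M k" and kF: "AE x in M. 0 \<le> k x \<and> k x \<le> F x"
  shows "ereal (LINT x|M. k x) \<le> ext_integral M (\<lambda>x. ereal (F x))"
proof -
  have "(\<integral>\<^sup>+x. e2ennreal (- ereal (F x)) \<partial>M) = (\<integral>\<^sup>+x. 0 \<partial>M)"
    by (rule nn_integral_cong_AE) (use kF in eventually_elim, simp add: ennreal_neg)
  moreover have "ennreal (LINT x|M. k x) \<le> (\<integral>\<^sup>+x. e2ennreal (ereal (F x)) \<partial>M)"
  proof -
    have "ennreal (LINT x|M. k x) = (\<integral>\<^sup>+x. ennreal (k x) \<partial>M)"
      using kF by (intro nn_integral_eq_integral[symmetric] k) (auto elim: eventually_mono)
    also have "\<dots> \<le> (\<integral>\<^sup>+x. e2ennreal (ereal (F x)) \<partial>M)"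
      by (rule nn_integral_mono_AE) (use kF in eventually_elim, auto simp: ennreal.abs_eq e2ennreal_mono simp flip: e2ennreal_ereal)
    finally show ?thesis .
  qed
  then have "enn2ereal (ennreal (LINT x|M. k x)) \<le> enn2ereal (\<integral>\<^sup>+x. e2ennreal (ereal (F x)) \<partial>M)"
    by (simp add: less_eq_ennreal.rep_eq)
  moreover have "0 \<le> (LINT x|M. k x)" using kF by (intro integral_nonneg_AE) (auto elim: eventually_mono)
  ultimately show ?thesis unfolding ext_integral_def by (simp add: enn2ereal_ennreal zero_ennreal.rep_eq)
qed

text \<open>In \<open>ereal\<close> the difference of two infinite values is \<infinity>, so a
  finite result forces both parts to be finite.\<close>

lemma ext_integral_finite:
  fixes f :: "'a \<Rightarrow> real"
  assumes f: "f \<in> borel_measurable M" and fin: "\<bar>ext_integral M (\<lambda>x. ereal (f x))\<bar> \<noteq> \<infinity>"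
  shows "integrable M f" "ext_integral M (\<lambda>x. ereal (f x)) = ereal (LINT x|M. f x)"
proof -
  let ?p = "\<integral>\<^sup>+x. ennreal (f x) \<partial>M" and ?q = "\<integral>\<^sup>+x. ennreal (- f x) \<partial>M"
  have e: "ext_integral M (\<lambda>x. ereal (f x)) = enn2ereal ?p - enn2ereal ?q"
    unfolding ext_integral_def by (simp add: e2ennreal_ereal)
  have "enn2ereal ?p \<noteq> \<infinity>" using fin unfolding e by auto
  then have p: "?p \<noteq> \<infinity>" by (auto simp: enn2ereal_top)
  have "enn2ereal ?q \<noteq> \<infinity>" using fin \<open>enn2ereal ?p \<noteq> \<infinity>\<close> unfolding e by (cases "enn2ereal ?p") auto
  then have q: "?q \<noteq> \<infinity>" by (auto simp: enn2ereal_top)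
  show i: "integrable M f" unfolding real_integrable_def using f p q by simp
  show "ext_integral M (\<lambda>x. ereal (f x)) = ereal (LINT x|M. f x)"
    unfolding e real_lebesgue_integral_def[OF i] using p q
    by (cases ?p; cases ?q) (auto simp: enn2ereal_ennreal)
qed

lemma ext_integral_AE_finite:
  assumes f: "f \<in> borel_measurable M" and fin: "ext_integral M f \<noteq> \<infinity>"
  shows "AE x in M. f x \<noteq> \<infinity>"
proof -
  have "enn2ereal (\<integral>\<^sup>+x. e2ennreal (f x) \<partial>M) \<noteq> \<infinity>" using fin unfolding ext_integral_def by auto
  then have "(\<integral>\<^sup>+x. e2ennreal (f x) \<partial>M) \<noteq> \<infinity>" by (auto simp: enn2ereal_top)
  then have "AE x in M. e2ennreal (f x) \<noteq> \<infinity>"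
    using f by (intro nn_integral_PInf_AE) auto
  then show ?thesis by eventually_elim (auto simp: e2ennreal_infty)
qed

text \<open>A Young inequality with crude constants: depending on which of \<open>a\<close> and
  \<open>b powr (p - 1)\<close> is larger, one of the two powers alone dominates the
  product.\<close>

lemma powr_conj_bound:
  fixes a b p p' :: real
  assumes p: "1 < p" "p' = p / (p - 1)" and a: "0 \<le> a" and b: "0 \<le> b"
  shows "a * b \<le> a powr p' + b powr p"
proof (cases "a \<le> b powr (p - 1)")
  case True
  have "a * b \<le> b powr (p - 1) * b" using True b by (rule mult_right_mono)
  also have "\<dots> = b powr p" using b p(1) by (cases "b = 0") (auto simp: powr_diff)
  finally show ?thesis by (smt (verit) powr_ge_zero)
next
  case False
  then have a0: "0 < a" using a powr_ge_zero[of b "p - 1"] by linarith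
  have "b \<le> a powr (1 / (p - 1))"
  proof (cases "b = 0")
    case False
    then have "b = (b powr (p - 1)) powr (1 / (p - 1))" using b p(1) by (simp add: powr_powr)
    also have "\<dots> \<le> a powr (1 / (p - 1))" using \<open>\<not> a \<le> b powr (p - 1)\<close> p(1) by (intro powr_mono2) auto
    finally show ?thesis .
  qed simp
  then have "a * b \<le> a * a powr (1 / (p - 1))" using a by (intro mult_left_mono) auto
  also have "\<dots> = a powr (1 + 1 / (p - 1))" using a0 by (simp add: powr_add)
  also have "1 + 1 / (p - 1) = p'" using p by (simp add: field_simps)
  finally show ?thesis by (smt (verit) powr_ge_zero)
qed

lemma Hoelder_integrable:
  fixes y G :: "'a::euclidean_space \<Rightarrow> 'b::euclidean_space"
  assumes p: "1 < p" "p' = p / (p - 1)" and y: "y \<in> Lspace (ereal p') \<Omega>" and G: "G \<in> Lspace (ereal p) \<Omega>"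
  shows "integrable (lebesgue_on \<Omega>) (\<lambda>x. y x \<bullet> G x)"
proof (rule Bochner_Integration.integrable_bound)
  show "integrable (lebesgue_on \<Omega>) (\<lambda>x. norm (y x) powr p' + norm (G x) powr p)"
    using y G by (auto simp: Lspace_def)
  show "(\<lambda>x. y x \<bullet> G x) \<in> borel_measurable (lebesgue_on \<Omega>)"
    using y G by (intro borel_measurable_inner) (auto simp: Lspace_def)
  show "AE x in lebesgue_on \<Omega>. norm (y x \<bullet> G x) \<le> norm (norm (y x) powr p' + norm (G x) powr p)"
  proof (rule AE_I2)
    fix x
    have "norm (y x \<bullet> G x) \<le> norm (y x) * norm (G x)" using Cauchy_Schwarz_ineq2 by simp
    also have "\<dots> \<le> norm (y x) powr p' + norm (G x) powr p" by (rule powr_conj_bound[OF p]) auto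
    finally show "norm (y x \<bullet> G x) \<le> norm (norm (y x) powr p' + norm (G x) powr p)" by simp
  qed
qed

lemma Lspace_2_square_integrable:
  fixes g :: "'a::euclidean_space \<Rightarrow> real"
  assumes "g \<in> Lspace 2 \<Omega>" shows "g \<in> borel_measurable (lebesgue_on \<Omega>)" "integrable (lebesgue_on \<Omega>) (\<lambda>x. (g x)\<^sup>2)"
proof -
  have e: "\<bar>y\<bar> powr 2 = y\<^sup>2" for y :: real by (cases "y = 0") (auto simp: powr_numeral)
  show "g \<in> borel_measurable (lebesgue_on \<Omega>)" using assms by (simp add: Lspace_def)
  have "real_of_ereal 2 = 2" by (metis real_of_ereal.simps(1) numeral_eq_ereal)
  then show "integrable (lebesgue_on \<Omega>) (\<lambda>x. (g x)\<^sup>2)" using assms by (simp add: Lspace_def e)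
qed

text \<open>The supremum of the linear function \<open>(t + c) * s\<close> over all
  \<open>s\<close>. In the dual functional it encodes the constraint
  \<open>div z = - f\<close>.\<close>

lemma fconj_linear:
  fixes c t :: real
  shows "fconj (\<lambda>s. - c * s) t = (if t = - c then 0 else \<infinity>)"
proof (cases "t = - c")
  case True
  then show ?thesis by (simp add: fconj_def zero_ereal_def)
next
  case False
  have "fconj (\<lambda>s. - c * s) t = \<infinity>"
    unfolding fconj_def
  proof (rule SUP_PInfty)
    fix m :: nat
    have "t \<bullet> (real m / (t + c)) - - c * (real m / (t + c)) = (t + c) * (real m / (t + c))"
      unfolding inner_real_def by algebra
    also have "\<dots> = real m" using False by simp
    finally show "\<exists>i\<in>UNIV. ereal (real m) \<le> ereal (t \<bullet> i - - c * i)" by (metis UNIV_I order_refl)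
  qed
  then show ?thesis using False by simp
qed

text \<open>Completing the square; the supremum is attained at \<open>s = t + c\<close>.\<close>

lemma fconj_quadratic:
  fixes c t :: real
  shows "fconj (\<lambda>s. (c - s)\<^sup>2 / 2) t = ereal (t\<^sup>2 / 2 + c * t)"
proof (rule antisym)
  have e: "t \<bullet> s - (c - s)\<^sup>2 / 2 = t\<^sup>2 / 2 + c * t - (t + c - s)\<^sup>2 / 2" for s
    by (simp add: power2_eq_square algebra_simps) (simp add: field_simps)
  show "fconj (\<lambda>s. (c - s)\<^sup>2 / 2) t \<le> ereal (t\<^sup>2 / 2 + c * t)"
    unfolding fconj_def e by (intro SUP_least) simp
  have "ereal (t \<bullet> (t + c) - (c - (t + c))\<^sup>2 / 2) \<le> fconj (\<lambda>s. (c - s)\<^sup>2 / 2) t"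
    unfolding fconj_def by (rule SUP_upper) simp
  then show "ereal (t\<^sup>2 / 2 + c * t) \<le> fconj (\<lambda>s. (c - s)\<^sup>2 / 2) t" unfolding e by simp
qed

section \<open>Interpolants, the discrete energy and discrete duality\<close>

context fe_mesh
begin

lemma pw_affine_coeffs:
  assumes "v \<in> pw_affine \<T>"
  obtains \<alpha> \<beta> where "\<And>T x. T \<in> \<T> \<Longrightarrow> x \<in> interior T \<Longrightarrow> v x = \<alpha> T + \<beta> T \<bullet> x"
proof -
  have "\<forall>T\<in>\<T>. \<exists>ab. \<forall>x\<in>interior T. v x = fst ab + snd ab \<bullet> x"
    using assms unfolding pw_affine_def by fastforce
  then obtain ab where "\<forall>T\<in>\<T>. \<forall>x\<in>interior T. v x = fst (ab T) + snd (ab T) \<bullet> x" by metis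
  then show thesis using that[of "\<lambda>T. fst (ab T)" "\<lambda>T. snd (ab T)"] by blast
qed

lemma proj0_affine:
  assumes T: "T \<in> \<T>" "x \<in> interior T" and v: "\<And>x. x \<in> interior T \<Longrightarrow> v x = \<alpha> + \<beta> \<bullet> x"
  shows "proj0 \<T> v x = \<alpha> + \<beta> \<bullet> barycenter T"
proof -
  interpret A: nd_simplex "vert T" "bgrad T" by (rule nd_simplex_vert[OF T(1)])
  note hT = hull_vert[OF T(1)]
  have "integrable (lebesgue_on T) (\<lambda>x. \<alpha> + \<beta> \<bullet> x)"
    by (rule A.integrable_continuous_T[of "\<lambda>x. \<alpha> + \<beta> \<bullet> x", unfolded hT]) (intro continuous_intros)
  from integral_interior_cong(2)[OF convex_elem[OF T(1)] elem_lebesgue[OF T(1)] this v]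
  have "(LINT x|lebesgue_on T. v x) = measure lebesgue T * (\<alpha> + \<beta> \<bullet> barycenter T)"
    using A.integral_affine[of \<alpha> \<beta>] unfolding hT by simp
  then show ?thesis using proj0_elem[OF T, of v] measure_elem_pos[OF T(1)] by simp
qed

lemma proj0_RT:
  assumes T: "T \<in> \<T>" "x \<in> interior T" and y: "\<And>x. x \<in> interior T \<Longrightarrow> y x = a + b *\<^sub>R (x - barycenter T)"
  shows "proj0 \<T> y x = a"
proof -
  interpret A: nd_simplex "vert T" "bgrad T" by (rule nd_simplex_vert[OF T(1)])
  note hT = hull_vert[OF T(1)]
  have "integrable (lebesgue_on T) (\<lambda>x. a + b *\<^sub>R (x - barycenter T))"
    by (rule A.integrable_continuous_T[of "\<lambda>x. a + b *\<^sub>R (x - barycenter T)", unfolded hT]) (intro continuous_intros)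
  from integral_interior_cong(2)[OF convex_elem[OF T(1)] elem_lebesgue[OF T(1)] this y]
  have "(LINT x|lebesgue_on T. y x) = measure lebesgue T *\<^sub>R a"
    using A.integral_RT[of a b] unfolding hT by simp
  then show ?thesis using proj0_elem[OF T, of y] measure_elem_pos[OF T(1)] by simp
qed

lemma facet_in_sides: "T \<in> \<T> \<Longrightarrow> P \<in> vert T \<Longrightarrow> convex hull (vert T - {P}) \<in> sides \<T>"
  using facet_of_elem_iff by (auto simp: sides_def)

lemma mesh_nonempty: "\<T> \<noteq> {}"
proof
  assume "\<T> = {}"
  then have "closure \<Omega> = {}" using Union_mesh by simp
  then show False using domain by (simp add: polyhedral_lipschitz_domain_def)
qed

text \<open>An interpolant comes with traces, and \<open>has_trace\<close> includes membership in
  \<open>W^{1,1}\<close>; the mesh has at least one side from which to read it.\<close>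

lemma CR_interpolant_sobolev:
  assumes "is_CR_interpolant \<T> \<Omega> w Iw" shows "w \<in> sobolev 1 \<Omega>"
proof -
  obtain T where T: "T \<in> \<T>" using mesh_nonempty by auto
  interpret A: nd_simplex "vert T" "bgrad T" by (rule nd_simplex_vert[OF T])
  obtain P where "P \<in> vert T" using A.card_ge_2 by fastforce
  then show ?thesis using assms facet_in_sides[OF T] unfolding is_CR_interpolant_def has_trace_def by blast
qed

lemma CR_interpolant_gradient:
  assumes I: "is_CR_interpolant \<T> \<Omega> w Iw" and T: "T \<in> \<T>" and v: "\<And>x. x \<in> interior T \<Longrightarrow> Iw x = \<alpha> + \<beta> \<bullet> x"
  shows "\<beta> = (LINT x|lebesgue_on T. weak_grad \<Omega> w x) /\<^sub>R measure lebesgue T"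
proof -
  interpret A: nd_simplex "vert T" "bgrad T" by (rule nd_simplex_vert[OF T])
  note hT = hull_vert[OF T]
  obtain g where g: "\<And>S. S \<in> sides \<T> \<Longrightarrow> has_trace \<Omega> S w (g S)"
    "\<And>S. S \<in> sides \<T> \<Longrightarrow> has_side_value \<T> Iw S (side_average S (g S))"
    using I unfolding is_CR_interpolant_def by metis
  have sub: "interior (convex hull (vert T)) \<subseteq> \<Omega>" using interior_elem_subset[OF T] hT by simp
  have val: "\<alpha> + \<beta> \<bullet> barycenter (convex hull (vert T - {P})) = side_average (convex hull (vert T - {P})) (g (convex hull (vert T - {P})))"
    if P: "P \<in> vert T" for P
  proof (rule sym)
    show "side_average (convex hull (vert T - {P})) (g (convex hull (vert T - {P}))) = \<alpha> + \<beta> \<bullet> barycenter (convex hull (vert T - {P}))"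
      using g(2)[OF facet_in_sides[OF T P]] unfolding has_side_value_def
      by (rule A.facet_limit_unique[OF P, where g = "\<lambda>x. \<alpha> + \<beta> \<bullet> x"])
         (use elem_interiors_mem[OF T] v hT in \<open>auto intro!: continuous_intros\<close>)
  qed
  show ?thesis
    using A.CR_gradient[OF open_Om bounded_Om sub CR_interpolant_sobolev[OF I] g(1)[OF facet_in_sides[OF T]] val]
    unfolding hT .
qed

text \<open>On a Dirichlet side there are two traces of \<open>w\<close>, one from
  \<open>sobolev_D\<close> that vanishes on \<Gamma>D and one from the interpolant. By
  \<open>side_average_eq\<close> both have the same average, which is zero.\<close>

lemma CR_interpolant_in_CR_D:
  assumes I: "is_CR_interpolant \<T> \<Omega> w Iw" and w: "w \<in> sobolev_D p \<Omega> \<Gamma>D"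
  shows "Iw \<in> CR_D \<T> \<Omega> \<Gamma>D"
proof -
  have "has_side_value \<T> Iw S 0" if S: "S \<in> sides_in \<T> \<Omega> \<Gamma>D" for S
  proof -
    have Ss: "S \<in> sides \<T>" "S \<subseteq> frontier \<Omega>" "AE x in surface_measure S. x \<in> \<Gamma>D" using S by (auto simp: sides_in_def)
    obtain T where T: "T \<in> \<T>" "S facet_of T" using Ss(1) by (auto simp: sides_def)
    obtain P where P: "P \<in> vert T" "S = convex hull (vert T - {P})" using facet_of_elem_iff[OF T(1)] T(2) by auto
    interpret A: nd_simplex "vert T" "bgrad T" by (rule nd_simplex_vert[OF T(1)])
    have sub: "interior (convex hull (vert T)) \<subseteq> \<Omega>" using interior_elem_subset[OF T(1)] hull_vert[OF T(1)] by simp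
    have "\<not> affine_dependent (vert T - {P})" using A.indep by (rule affine_independent_subset) auto
    moreover have "card (vert T - {P}) = DIM('a)" using A.card_C A.finite_C P(1) by simp
    ultimately have "(int DIM('a) - 1) simplex S" unfolding simplex_def P(2) by (intro exI[of _ "vert T - {P}"]) auto
    then obtain g' where g': "has_trace \<Omega> S w g'" "AE x in surface_measure S. x \<in> \<Gamma>D \<longrightarrow> g' x = 0"
      using w Ss(2) by (auto simp: sobolev_D_def)
    obtain g where g: "has_trace \<Omega> S w g" "has_side_value \<T> Iw S (side_average S g)"
      using I Ss(1) by (auto simp: is_CR_interpolant_def)
    have "side_average S g = side_average S g'"
      using A.side_average_eq[OF P(1) open_Om bounded_Om sub g(1)[unfolded P(2)]]
        A.side_average_eq[OF P(1) open_Om bounded_Om sub g'(1)[unfolded P(2)]] unfolding P(2) by simp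
    also have "(LINT s|surface_measure S. g' s) = 0"
      by (rule integral_eq_zero_AE) (use Ss(3) g'(2) in eventually_elim, simp)
    then have "side_average S g' = 0" by (simp add: side_average_def)
    finally show ?thesis using g(2) by simp
  qed
  then show ?thesis using I by (auto simp: CR_D_def is_CR_interpolant_def)
qed

lemma integral_proj0_pairing:
  fixes G :: "'a \<Rightarrow> 'a"
  assumes G: "integrable (lebesgue_on \<Omega>) G" and y: "\<And>T x. T \<in> \<T> \<Longrightarrow> x \<in> interior T \<Longrightarrow> Y x = a T"
  shows "integrable (lebesgue_on \<Omega>) (\<lambda>x. G x \<bullet> Y x)"
    "(LINT x|lebesgue_on \<Omega>. G x \<bullet> Y x) = (\<Sum>T\<in>\<T>. (LINT x|lebesgue_on T. G x) \<bullet> a T)"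
proof -
  have 1: "integrable (lebesgue_on T) (\<lambda>x. G x \<bullet> Y x)" "(LINT x|lebesgue_on T. G x \<bullet> Y x) = (LINT x|lebesgue_on T. G x) \<bullet> a T"
    if T: "T \<in> \<T>" for T
  proof -
    have i: "integrable (lebesgue_on T) G" by (rule integrable_elem[OF T G])
    then have i': "integrable (lebesgue_on T) (\<lambda>x. G x \<bullet> a T)" by simp
    show "integrable (lebesgue_on T) (\<lambda>x. G x \<bullet> Y x)" "(LINT x|lebesgue_on T. G x \<bullet> Y x) = (LINT x|lebesgue_on T. G x) \<bullet> a T"
      using integral_interior_cong[OF convex_elem[OF T] elem_lebesgue[OF T] i', of "\<lambda>x. G x \<bullet> Y x"] y[OF T] i by auto
  qed
  show "integrable (lebesgue_on \<Omega>) (\<lambda>x. G x \<bullet> Y x)"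
    "(LINT x|lebesgue_on \<Omega>. G x \<bullet> Y x) = (\<Sum>T\<in>\<T>. (LINT x|lebesgue_on T. G x) \<bullet> a T)"
    using integral_elements[of "\<lambda>x. G x \<bullet> Y x"] 1 by auto
qed

text \<open>The tangent of \<phi> at the mean value of \<open>G\<close> lies below \<phi>, and its
  linear part integrates to zero over the element.\<close>

lemma jensen_elem:
  fixes \<phi> :: "'b::euclidean_space \<Rightarrow> real"
  assumes conv: "convex_on UNIV \<phi>" and diff: "\<And>s. \<phi> differentiable (at s)" and T: "T \<in> \<T>"
    and G: "integrable (lebesgue_on T) G" and \<phi>G: "integrable (lebesgue_on T) (\<lambda>x. \<phi> (G x))"
  shows "measure lebesgue T * \<phi> ((LINT x|lebesgue_on T. G x) /\<^sub>R measure lebesgue T) \<le> (LINT x|lebesgue_on T. \<phi> (G x))"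
proof -
  let ?m = "measure lebesgue T"
  define \<beta> where "\<beta> = (LINT x|lebesgue_on T. G x) /\<^sub>R ?m"
  have m: "0 < ?m" by (rule measure_elem_pos[OF T])
  have ic: "integrable (lebesgue_on T) (\<lambda>x. c)" "(LINT x|lebesgue_on T. c) = ?m * c" for c :: real
    using integral_const_elem[OF T, of c] by auto
  have "(LINT x|lebesgue_on T. \<phi> \<beta> + (gradient \<phi> \<beta> \<bullet> G x - gradient \<phi> \<beta> \<bullet> \<beta>)) \<le> (LINT x|lebesgue_on T. \<phi> (G x))"
  proof (rule integral_mono)
    show "integrable (lebesgue_on T) (\<lambda>x. \<phi> \<beta> + (gradient \<phi> \<beta> \<bullet> G x - gradient \<phi> \<beta> \<bullet> \<beta>))"
      by (intro Bochner_Integration.integrable_add Bochner_Integration.integrable_diff ic(1)) (use G in simp)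
    show "\<phi> \<beta> + (gradient \<phi> \<beta> \<bullet> G x - gradient \<phi> \<beta> \<bullet> \<beta>) \<le> \<phi> (G x)" for x
      using gradient_inequality[OF conv diff, of \<beta> "G x"] by (simp add: inner_diff_right)
  qed (rule \<phi>G)
  also have "(LINT x|lebesgue_on T. \<phi> \<beta> + (gradient \<phi> \<beta> \<bullet> G x - gradient \<phi> \<beta> \<bullet> \<beta>)) =
     ?m * \<phi> \<beta> + (gradient \<phi> \<beta> \<bullet> (LINT x|lebesgue_on T. G x) - ?m * (gradient \<phi> \<beta> \<bullet> \<beta>))"
  proof -
    have "integrable (lebesgue_on T) (\<lambda>x. gradient \<phi> \<beta> \<bullet> G x)" using G by simp
    moreover have "measure (lebesgue_on T) T = ?m" using ic(2)[of 1] by simp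
    ultimately show ?thesis using ic(1) G by simp
  qed
  also have "(LINT x|lebesgue_on T. G x) = ?m *\<^sub>R \<beta>" using m by (simp add: \<beta>_def)
  finally show ?thesis unfolding \<beta>_def[symmetric] by simp
qed

lemma CR_D_combination:
  assumes "v \<in> CR_D \<T> \<Omega> \<Gamma>D" "h \<in> CR_D \<T> \<Omega> \<Gamma>D"
  shows "(\<lambda>x. v x + t * h x) \<in> CR_D \<T> \<Omega> \<Gamma>D"
proof -
  have pw: "v \<in> pw_affine \<T>" "h \<in> pw_affine \<T>" using assms by (auto simp: CR_D_def CR_def)
  have lim: "has_side_value \<T> (\<lambda>x. v x + t * h x) S (a + t * b)" if "has_side_value \<T> v S a" "has_side_value \<T> h S b" for S a b
    using that unfolding has_side_value_def by (intro tendsto_intros)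
  have "(\<lambda>x. v x + t * h x) \<in> pw_affine \<T>"
  proof -
    obtain \<alpha> \<beta> where v: "\<And>T x. T \<in> \<T> \<Longrightarrow> x \<in> interior T \<Longrightarrow> v x = \<alpha> T + \<beta> T \<bullet> x" using pw_affine_coeffs[OF pw(1)] by blast
    obtain \<alpha>' \<beta>' where h: "\<And>T x. T \<in> \<T> \<Longrightarrow> x \<in> interior T \<Longrightarrow> h x = \<alpha>' T + \<beta>' T \<bullet> x" using pw_affine_coeffs[OF pw(2)] by blast
    have "\<exists>a b. \<forall>x\<in>interior T. v x + t * h x = a + b \<bullet> x" if T: "T \<in> \<T>" for T
      by (rule exI[of _ "\<alpha> T + t * \<alpha>' T"], rule exI[of _ "\<beta> T + t *\<^sub>R \<beta>' T"])
         (simp add: v[OF T] h[OF T] inner_add_left algebra_simps)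
    moreover have "v x = 0" "h x = 0" if "x \<notin> elem_interiors \<T>" for x using pw that by (auto simp: pw_affine_def)
    ultimately show ?thesis by (simp add: pw_affine_def)
  qed
  moreover have "\<exists>c. has_side_value \<T> (\<lambda>x. v x + t * h x) S c" if S: "S \<in> sides \<T>" for S
  proof -
    obtain a where "has_side_value \<T> v S a" using assms(1) S by (auto simp: CR_D_def CR_def)
    moreover obtain b where "has_side_value \<T> h S b" using assms(2) S by (auto simp: CR_D_def CR_def)
    ultimately show ?thesis using lim by blast
  qed
  moreover have "has_side_value \<T> (\<lambda>x. v x + t * h x) S 0" if S: "S \<in> sides_in \<T> \<Omega> \<Gamma>D" for S
    using lim[of S 0 0] assms S by (auto simp: CR_D_def)
  ultimately show ?thesis by (simp add: CR_D_def CR_def)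
qed

text \<open>On the discrete space both energy densities are constant on each element, so the energy
  is a finite sum that can be differentiated term by term.\<close>

lemma primal_h_elementwise:
  assumes v: "\<And>T x. T \<in> \<T> \<Longrightarrow> x \<in> interior T \<Longrightarrow> v x = \<alpha> T + \<beta> T \<bullet> x"
    and q: "\<And>T x s. T \<in> \<T> \<Longrightarrow> x \<in> interior T \<Longrightarrow> \<psi>h x s = q T s"
  shows "primal_h \<phi> \<psi>h \<T> \<Omega> v = (\<Sum>T\<in>\<T>. measure lebesgue T * \<phi> (\<beta> T)) + (\<Sum>T\<in>\<T>. measure lebesgue T * q T (\<alpha> T + \<beta> T \<bullet> barycenter T))"
proof -
  have g: "grad_h \<T> v x = \<beta> T" if "T \<in> \<T>" "x \<in> interior T" for T x by (rule grad_h_elem[OF that v[OF that(1)]])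
  have p: "proj0 \<T> v x = \<alpha> T + \<beta> T \<bullet> barycenter T" if "T \<in> \<T>" "x \<in> interior T" for T x by (rule proj0_affine[OF that v[OF that(1)]])
  have "(LINT x|lebesgue_on \<Omega>. \<phi> (grad_h \<T> v x)) = (\<Sum>T\<in>\<T>. measure lebesgue T *\<^sub>R \<phi> (\<beta> T))"
    by (rule integral_elementwise_constant(2)) (simp add: g)
  moreover have "(LINT x|lebesgue_on \<Omega>. \<psi>h x (proj0 \<T> v x)) = (\<Sum>T\<in>\<T>. measure lebesgue T *\<^sub>R q T (\<alpha> T + \<beta> T \<bullet> barycenter T))"
    by (rule integral_elementwise_constant(2)) (simp add: q p)
  ultimately show ?thesis by (simp add: primal_h_def)
qed

text \<open>\<open>variation\<close> is a \<open>deriv\<close>, which is meaningful only for a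
  differentiable function. So the energy along the line is first written as a finite sum of
  differentiable functions; the line stays in the discrete space, hence \<open>t = 0\<close> is a
  minimum and the derivative is zero.\<close>

lemma variation_at_minimizer:
  assumes uh: "uh \<in> CR_D \<T> \<Omega> \<Gamma>D" "\<forall>vh\<in>CR_D \<T> \<Omega> \<Gamma>D. primal_h \<phi> \<psi>h \<T> \<Omega> uh \<le> primal_h \<phi> \<psi>h \<T> \<Omega> vh"
    and w: "w \<in> CR_D \<T> \<Omega> \<Gamma>D" and diff: "\<And>s. \<phi> differentiable (at s)"
    and q: "\<And>T x s. T \<in> \<T> \<Longrightarrow> x \<in> interior T \<Longrightarrow> \<psi>h x s = q T s" and qd: "\<And>T s. T \<in> \<T> \<Longrightarrow> q T differentiable (at s)"
  shows "variation (primal_h \<phi> \<psi>h \<T> \<Omega>) uh (\<lambda>x. w x - uh x) = 0"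
proof -
  define h where "h x = w x - uh x" for x
  have hD: "h \<in> CR_D \<T> \<Omega> \<Gamma>D" unfolding h_def using CR_D_combination[OF w uh(1), of "-1"] by simp
  have pw: "uh \<in> pw_affine \<T>" "h \<in> pw_affine \<T>" using uh(1) hD by (auto simp: CR_D_def CR_def)
  obtain \<alpha> \<beta> where v: "\<And>T x. T \<in> \<T> \<Longrightarrow> x \<in> interior T \<Longrightarrow> uh x = \<alpha> T + \<beta> T \<bullet> x" using pw_affine_coeffs[OF pw(1)] by blast
  obtain \<alpha>' \<beta>' where h: "\<And>T x. T \<in> \<T> \<Longrightarrow> x \<in> interior T \<Longrightarrow> h x = \<alpha>' T + \<beta>' T \<bullet> x" using pw_affine_coeffs[OF pw(2)] by blast
  define f where "f t = primal_h \<phi> \<psi>h \<T> \<Omega> (\<lambda>x. uh x + t * h x)" for t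
  have comb: "uh x + t * h x = (\<alpha> T + t * \<alpha>' T) + (\<beta> T + t *\<^sub>R \<beta>' T) \<bullet> x" if "T \<in> \<T>" "x \<in> interior T" for T x t
    by (simp add: v[OF that] h[OF that] inner_add_left algebra_simps)
  have f: "f = (\<lambda>t. (\<Sum>T\<in>\<T>. measure lebesgue T * \<phi> (\<beta> T + t *\<^sub>R \<beta>' T)) +
     (\<Sum>T\<in>\<T>. measure lebesgue T * q T ((\<alpha> T + t * \<alpha>' T) + (\<beta> T + t *\<^sub>R \<beta>' T) \<bullet> barycenter T)))"
    unfolding f_def by (intro ext primal_h_elementwise[OF comb q])
  have "f differentiable (at 0)"
    unfolding f
  proof (intro differentiable_add differentiable_sum ballI differentiable_mult differentiable_const finite_mesh)
    fix T assume T: "T \<in> \<T>"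
    have "((\<lambda>t. \<beta> T + t *\<^sub>R \<beta>' T) has_derivative (\<lambda>t. t *\<^sub>R \<beta>' T)) (at (0::real))"
      by (auto intro!: derivative_eq_intros)
    then have "(\<lambda>t. \<beta> T + t *\<^sub>R \<beta>' T) differentiable (at (0::real))" by (rule differentiableI)
    then show "(\<lambda>t. \<phi> (\<beta> T + t *\<^sub>R \<beta>' T)) differentiable (at (0::real))"
      using differentiable_compose[OF diff] by blast
    have "((\<lambda>t. (\<alpha> T + t * \<alpha>' T) + (\<beta> T + t *\<^sub>R \<beta>' T) \<bullet> barycenter T) has_derivative
        (\<lambda>t. t * \<alpha>' T + (t *\<^sub>R \<beta>' T) \<bullet> barycenter T)) (at (0::real))"
      by (auto intro!: derivative_eq_intros)
    then have "(\<lambda>t. (\<alpha> T + t * \<alpha>' T) + (\<beta> T + t *\<^sub>R \<beta>' T) \<bullet> barycenter T) differentiable (at (0::real))"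
      by (rule differentiableI)
    then show "(\<lambda>t. q T ((\<alpha> T + t * \<alpha>' T) + (\<beta> T + t *\<^sub>R \<beta>' T) \<bullet> barycenter T)) differentiable (at (0::real))"
      using differentiable_compose[OF qd[OF T]] by blast
  qed
  then obtain D where D: "(f has_real_derivative D) (at 0)" using real_differentiable_def by auto
  have "f 0 \<le> f t" for t
    unfolding f_def using uh(2) CR_D_combination[OF uh(1) hD, of t] by simp
  then have "D = 0" by (intro DERIV_local_min[OF D zero_less_one]) auto
  then have "deriv f 0 = 0" using D DERIV_imp_deriv by blast
  then show ?thesis unfolding variation_def f_def h_def .
qed

context
  fixes n :: "'a set \<Rightarrow> 'a"
  assumes normals: "unit_normals \<T> n"
begin

lemma RT_coeffs:
  assumes "y \<in> RT \<T> \<Omega>"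
  obtains a b where "\<And>T x. T \<in> \<T> \<Longrightarrow> x \<in> interior T \<Longrightarrow> y x = a T + b T *\<^sub>R (x - barycenter T)"
proof -
  have "\<forall>T\<in>\<T>. \<exists>ab. \<forall>x\<in>interior T. y x = fst ab + snd ab *\<^sub>R (x - barycenter T)"
    using assms unfolding RT_def by fastforce
  then obtain ab where "\<forall>T\<in>\<T>. \<forall>x\<in>interior T. y x = fst (ab T) + snd (ab T) *\<^sub>R (x - barycenter T)" by metis
  then show thesis using that[of "\<lambda>T. fst (ab T)" "\<lambda>T. snd (ab T)"] by blast
qed

text \<open>\<open>d * b\<close> is the constant divergence of the interpolant on \<open>T\<close>.
  The weak gradients of the components yield a weak divergence of \<open>z\<close>, which uniqueness
  identifies with \<open>weak_div\<close>.\<close>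

lemma RT_interpolant_divergence:
  fixes z Iz :: "'a \<Rightarrow> 'a"
  assumes I: "is_RT_interpolant \<T> \<Omega> n z Iz" and zs: "\<And>i. i \<in> Basis \<Longrightarrow> (\<lambda>x. z x \<bullet> i) \<in> sobolev 1 \<Omega>"
    and T: "T \<in> \<T>" and y: "\<And>x. x \<in> interior T \<Longrightarrow> Iz x = a + b *\<^sub>R (x - barycenter T)"
  shows "DIM('a) * measure lebesgue T * b = (LINT x|lebesgue_on T. weak_div \<Omega> z x)"
proof -
  interpret A: nd_simplex "vert T" "bgrad T" by (rule nd_simplex_vert[OF T])
  note hT = hull_vert[OF T]
  obtain g where g: "\<And>S. S \<in> sides \<T> \<Longrightarrow> has_trace \<Omega> S (\<lambda>x. z x \<bullet> n S) (g S)"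
    "\<And>S. S \<in> sides \<T> \<Longrightarrow> has_normal_component \<T> n Iz S (side_average S (g S))"
    using I unfolding is_RT_interpolant_def by metis
  let ?F = "\<lambda>P. convex hull (vert T - {P})"
  have sub: "interior (convex hull (vert T)) \<subseteq> \<Omega>" using interior_elem_subset[OF T] hT by simp
  have val: "(a + b *\<^sub>R (barycenter (?F P) - barycenter (convex hull (vert T)))) \<bullet> n (?F P) = side_average (?F P) (g (?F P))"
    if P: "P \<in> vert T" for P
  proof (rule sym)
    have "((\<lambda>x. Iz x \<bullet> n (?F P)) \<longlongrightarrow> side_average (?F P) (g (?F P))) (at (barycenter (?F P)) within elem_interiors \<T>)"
      using g(2)[OF facet_in_sides[OF T P]] A.barycenter_rel_interior[OF P] unfolding has_normal_component_def by blast
    then show "side_average (?F P) (g (?F P)) = (a + b *\<^sub>R (barycenter (?F P) - barycenter (convex hull (vert T)))) \<bullet> n (?F P)"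
      unfolding hT
      by (rule A.facet_limit_unique[OF P, where g = "\<lambda>x. (a + b *\<^sub>R (x - barycenter T)) \<bullet> n (?F P)"])
         (use elem_interiors_mem[OF T] y hT in \<open>auto intro!: continuous_intros\<close>)
  qed
  have "DIM('a) * measure lebesgue T * b = (LINT x|lebesgue_on T. (\<Sum>i\<in>Basis. weak_grad \<Omega> (\<lambda>x. z x \<bullet> i) x \<bullet> i))"
    using A.RT_divergence[OF open_Om bounded_Om sub zs bgrad_normal(2)[OF normals T _ refl] g(1)[OF facet_in_sides[OF T]] val]
    unfolding hT .
  also have "\<dots> = (LINT x|lebesgue_on T. weak_div \<Omega> z x)"
  proof -
    have hd: "has_weak_div \<Omega> z (\<lambda>x. \<Sum>i\<in>Basis. weak_grad \<Omega> (\<lambda>x. z x \<bullet> i) x \<bullet> i)"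
      by (rule has_weak_div_components[OF Om_lebesgue sobolev_1_cases(3)[OF zs open_Om]])
    have ae: "AE x in lebesgue_on \<Omega>. (\<Sum>i\<in>Basis. weak_grad \<Omega> (\<lambda>x. z x \<bullet> i) x \<bullet> i) = weak_div \<Omega> z x"
      using weak_div_AE_eq[OF open_Om hd] by eventually_elim simp
    have i: "integrable (lebesgue_on \<Omega>) (\<lambda>x. \<Sum>i\<in>Basis. weak_grad \<Omega> (\<lambda>x. z x \<bullet> i) x \<bullet> i)"
      using sobolev_1_cases(2)[OF zs open_Om] by (intro Bochner_Integration.integrable_sum integrable_inner_left) auto
    show ?thesis
      using integrable_elem[OF T i] integrable_elem[OF T integrable_AE_lebesgue_on[OF Om_lebesgue i ae]] AE_elem[OF T ae]
      by (intro integral_cong_AE) auto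
  qed
  finally show ?thesis .
qed

text \<open>The projections of \<open>v\<close> and \<open>Iz\<close> are their values at
  barycenters, and \<open>\<Pi> div z\<close> is the elementwise divergence of \<open>Iz\<close>, so
  this is \<open>global_integration_by_parts\<close>. Side values of \<open>v\<close> vanish on
  Dirichlet sides, normal components of \<open>Iz\<close> on Neumann sides by
  \<open>Neumann_side_average_zero\<close>.\<close>

lemma discrete_duality:
  fixes z Iz :: "'a \<Rightarrow> 'a"
  assumes dim: "2 \<le> DIM('a)" and resolved: "boundary_resolved \<T> \<Omega> \<Gamma>D"
    and I: "is_RT_interpolant \<T> \<Omega> n z Iz" and zs: "\<And>i. i \<in> Basis \<Longrightarrow> (\<lambda>x. z x \<bullet> i) \<in> sobolev 1 \<Omega>"
    and zN: "z \<in> div_space_N 1 \<Omega> \<Gamma>D" and v: "v \<in> CR_D \<T> \<Omega> \<Gamma>D"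
  shows "(LINT x|lebesgue_on \<Omega>. proj0 \<T> v x * proj0 \<T> (weak_div \<Omega> z) x) = - (LINT x|lebesgue_on \<Omega>. grad_h \<T> v x \<bullet> proj0 \<T> Iz x)"
proof -
  have "v \<in> pw_affine \<T>" using v by (auto simp: CR_D_def CR_def)
  then obtain \<alpha> \<beta> where va: "\<And>T x. T \<in> \<T> \<Longrightarrow> x \<in> interior T \<Longrightarrow> v x = \<alpha> T + \<beta> T \<bullet> x" using pw_affine_coeffs by blast
  obtain a b where y: "\<And>T x. T \<in> \<T> \<Longrightarrow> x \<in> interior T \<Longrightarrow> Iz x = a T + b T *\<^sub>R (x - barycenter T)"
    using RT_coeffs I unfolding is_RT_interpolant_def by metis
  obtain g where g: "\<And>S. S \<in> sides \<T> \<Longrightarrow> has_trace \<Omega> S (\<lambda>x. z x \<bullet> n S) (g S)"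
    "\<And>S. S \<in> sides \<T> \<Longrightarrow> has_normal_component \<T> n Iz S (side_average S (g S))"
    using I unfolding is_RT_interpolant_def by metis
  have c0: "side_average S (g S) = 0" if S: "S \<in> sides_in \<T> \<Omega> (frontier \<Omega> - \<Gamma>D)" for S
    by (rule Neumann_side_average_zero[OF normals dim S zN zs g(1)]) (use S in \<open>auto simp: sides_in_def\<close>)
  have *: "(\<Sum>T\<in>\<T>. measure lebesgue T * (a T \<bullet> \<beta> T + DIM('a) * b T * (\<alpha> T + \<beta> T \<bullet> barycenter T))) = 0"
    by (rule global_integration_by_parts[OF normals resolved v va y g(2) c0])
  have "(LINT x|lebesgue_on \<Omega>. grad_h \<T> v x \<bullet> proj0 \<T> Iz x) = (\<Sum>T\<in>\<T>. measure lebesgue T *\<^sub>R (a T \<bullet> \<beta> T))"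
    by (rule integral_elementwise_constant(2)) (simp add: grad_h_elem[OF _ _ va] proj0_RT[OF _ _ y] inner_commute)
  moreover have "(LINT x|lebesgue_on \<Omega>. proj0 \<T> v x * proj0 \<T> (weak_div \<Omega> z) x) = (\<Sum>T\<in>\<T>. measure lebesgue T *\<^sub>R (DIM('a) * b T * (\<alpha> T + \<beta> T \<bullet> barycenter T)))"
  proof (rule integral_elementwise_constant(2))
    fix T x assume T: "T \<in> \<T>" "x \<in> interior T"
    have "proj0 \<T> (weak_div \<Omega> z) x = DIM('a) * b T"
      using RT_interpolant_divergence[OF I zs T(1) y[OF T(1)], symmetric] measure_elem_pos[OF T(1)]
      unfolding proj0_elem[OF T] by (simp add: field_simps)
    then show "proj0 \<T> v x * proj0 \<T> (weak_div \<Omega> z) x = DIM('a) * b T * (\<alpha> T + \<beta> T \<bullet> barycenter T)"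
      using proj0_affine[OF T va[OF T(1)]] by simp
  qed
  ultimately show ?thesis using * by (simp add: distrib_left sum.distrib)
qed

end

end

section \<open>Optimality conditions from strong duality\<close>

lemma ext_integral_cong_AE: "AE x in M. f x = g x \<Longrightarrow> ext_integral M f = ext_integral M g"
proof -
  assume fg: "AE x in M. f x = g x"
  have "(\<integral>\<^sup>+x. e2ennreal (f x) \<partial>M) = (\<integral>\<^sup>+x. e2ennreal (g x) \<partial>M)"
    by (rule nn_integral_cong_AE) (use fg in eventually_elim, simp)
  moreover have "(\<integral>\<^sup>+x. e2ennreal (- f x) \<partial>M) = (\<integral>\<^sup>+x. e2ennreal (- g x) \<partial>M)"
    by (rule nn_integral_cong_AE) (use fg in eventually_elim, simp)
  ultimately show ?thesis by (simp add: ext_integral_def)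
qed

lemma ereal_add_finite: "\<bar>a + b\<bar> \<noteq> \<infinity> \<Longrightarrow> \<bar>a\<bar> \<noteq> \<infinity> \<and> \<bar>b :: ereal\<bar> \<noteq> \<infinity>"
  by (cases a; cases b) auto

text \<open>The infimum is attained at \<open>u\<close> and the supremum at \<open>z\<close>, so
  strong duality equates two values; the lower bound and properness make them finite.\<close>

lemma optimal_values:
  fixes F :: "'a \<Rightarrow> ereal" and D :: "'b \<Rightarrow> ereal"
  assumes "\<exists>c::real. \<forall>v\<in>A. ereal c \<le> F v" "\<exists>v\<in>A. F v \<noteq> \<infinity>" "(INF v\<in>A. F v) = (SUP y\<in>B. D y)"
    and u: "u \<in> A" "\<forall>v\<in>A. F u \<le> F v" and z: "z \<in> B" "\<forall>y\<in>B. D y \<le> D z"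
  shows "\<bar>F u\<bar> \<noteq> \<infinity>" "F u = D z"
proof -
  have "(INF v\<in>A. F v) = F u" using u by (intro antisym INF_lower INF_greatest) auto
  moreover have "(SUP y\<in>B. D y) = D z" using z by (intro antisym SUP_upper SUP_least) auto
  ultimately show "F u = D z" using assms(3) by simp
  obtain c where "ereal c \<le> F u" using assms(1) u(1) by blast
  moreover obtain v where "v \<in> A" "F v \<noteq> \<infinity>" using assms(2) by blast
  then have "F u \<noteq> \<infinity>" using u(2) by (metis ereal_infty_less_eq(1))
  ultimately show "\<bar>F u\<bar> \<noteq> \<infinity>" by (cases "F u") auto
qed

lemma conj_exp_conj:
  assumes "1 < p" "p' = p / (p - 1)" shows "conj_exp (ereal p') = ereal p"
proof -
  have "p' \<noteq> 1" "p' - 1 = 1 / (p - 1)" using assms by (auto simp: field_simps)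
  moreover have "ereal p' \<noteq> 1" using \<open>p' \<noteq> 1\<close> by (simp add: one_ereal_def)
  moreover have "ereal p' / (ereal p' - 1) = ereal (p' / (p' - 1))"
    using \<open>p' \<noteq> 1\<close> by (simp add: one_ereal_def)
  moreover have "p' / (p' - 1) = p" unfolding \<open>p' - 1 = 1 / (p - 1)\<close> using assms by simp
  ultimately show ?thesis by (simp add: conj_exp_def)
qed

text \<open>Both integrals are nonnegative, hence both are zero. In this way a single scalar
  identity gives two pointwise conditions.\<close>

lemma integral_sum_zero_AE:
  fixes a b :: "'a \<Rightarrow> real"
  assumes "integrable M a" "integrable M b" "\<And>x. x \<in> space M \<Longrightarrow> 0 \<le> a x" "\<And>x. x \<in> space M \<Longrightarrow> 0 \<le> b x" "(LINT x|M. a x) + (LINT x|M. b x) = 0"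
  shows "AE x in M. a x = 0" "AE x in M. b x = 0"
proof -
  have "0 \<le> (LINT x|M. a x)" "0 \<le> (LINT x|M. b x)" using assms by (auto intro!: Bochner_Integration.integral_nonneg)
  then have "(LINT x|M. a x) = 0" "(LINT x|M. b x) = 0" using assms(5) by auto
  then show "AE x in M. a x = 0" "AE x in M. b x = 0"
    using integral_nonneg_eq_0_iff_AE[OF assms(1)] integral_nonneg_eq_0_iff_AE[OF assms(2)] assms(3,4) by auto
qed

lemma convex_on_square_dist: "convex_on UNIV (\<lambda>s::real. (s - c)\<^sup>2)"
proof (rule convex_onI)
  fix t x y :: real assume t: "0 < t" "t < 1"
  have "(1 - t) * (x - c)\<^sup>2 + t * (y - c)\<^sup>2 - ((1 - t) *\<^sub>R x + t *\<^sub>R y - c)\<^sup>2 = (1 - t) * t * (x - y)\<^sup>2"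
    by (simp add: power2_eq_square algebra_simps)
  moreover have "0 \<le> (1 - t) * t * (x - y)\<^sup>2" using t by simp
  ultimately show "((1 - t) *\<^sub>R x + t *\<^sub>R y - c)\<^sup>2 \<le> (1 - t) * (x - c)\<^sup>2 + t * (y - c)\<^sup>2" by linarith
qed simp

lemma integrable_square_bound:
  fixes a b c :: "'a \<Rightarrow> real"
  assumes "integrable M (\<lambda>x. (b x)\<^sup>2)" "integrable M (\<lambda>x. (c x)\<^sup>2)" "a \<in> borel_measurable M" "\<And>x. a x = b x + c x"
  shows "integrable M (\<lambda>x. (a x)\<^sup>2)"
proof (rule Bochner_Integration.integrable_bound)
  show "integrable M (\<lambda>x. 2 * (b x)\<^sup>2 + 2 * (c x)\<^sup>2)" using assms(1,2) by simp
  show "(\<lambda>x. (a x)\<^sup>2) \<in> borel_measurable M" using assms(3) by simp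
  have "(a x)\<^sup>2 \<le> 2 * (b x)\<^sup>2 + 2 * (c x)\<^sup>2" for x
    unfolding assms(4) using zero_le_power2[of "b x - c x"] by (simp add: power2_sum power2_diff)
  then show "AE x in M. norm ((a x)\<^sup>2) \<le> norm (2 * (b x)\<^sup>2 + 2 * (c x)\<^sup>2)" by (intro AE_I2) simp
qed

lemma integrable_product_squares:
  fixes a b :: "'a \<Rightarrow> real"
  assumes "integrable M (\<lambda>x. (a x)\<^sup>2)" "integrable M (\<lambda>x. (b x)\<^sup>2)" "a \<in> borel_measurable M" "b \<in> borel_measurable M"
  shows "integrable M (\<lambda>x. a x * b x)"
proof (rule Bochner_Integration.integrable_bound)
  show "integrable M (\<lambda>x. (a x)\<^sup>2 + (b x)\<^sup>2)" using assms by simp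
  show "(\<lambda>x. a x * b x) \<in> borel_measurable M" using assms by simp
  have "\<bar>a x * b x\<bar> \<le> (a x)\<^sup>2 + (b x)\<^sup>2" for x
    using zero_le_power2[of "\<bar>a x\<bar> - \<bar>b x\<bar>"] zero_le_power2[of "a x"] zero_le_power2[of "b x"]
    unfolding power2_diff power2_abs abs_mult by linarith
  then show "AE x in M. norm (a x * b x) \<le> norm ((a x)\<^sup>2 + (b x)\<^sup>2)" by (intro AE_I2) simp
qed

context fe_mesh
begin

lemma weak_div_properties:
  assumes "z \<in> div_space_N q \<Omega> \<Gamma>D"
  shows "weak_div \<Omega> z \<in> borel_measurable (lebesgue_on \<Omega>)"
    "q = 1 \<Longrightarrow> integrable (lebesgue_on \<Omega>) (weak_div \<Omega> z)"
proof -
  obtain r where r: "r \<in> Lspace q \<Omega>" "has_weak_div \<Omega> z r" using assms by (auto simp: div_space_N_def)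
  have ae: "AE x in lebesgue_on \<Omega>. r x = weak_div \<Omega> z x"
    using weak_div_AE_eq[OF open_Om r(2)] by eventually_elim simp
  show "weak_div \<Omega> z \<in> borel_measurable (lebesgue_on \<Omega>)"
    by (rule borel_measurable_lebesgue_on_AE[OF Om_lebesgue _ ae]) (use r(1) in \<open>simp add: Lspace_def\<close>)
  show "integrable (lebesgue_on \<Omega>) (weak_div \<Omega> z)" if "q = 1"
    by (rule integrable_AE_lebesgue_on[OF Om_lebesgue _ ae]) (use r(1) that in \<open>simp add: Lspace_1_iff\<close>)
qed

text \<open>A finite sum in \<open>ereal\<close> has finite summands, so each of the four integrals
  in the two energies is finite and those of \<phi> and its conjugate are genuine. The last
  conclusion is the weak Neumann condition tested with \<open>u\<close> itself, whose exponent
  \<open>p\<close> is conjugate to \<open>p'\<close>.\<close>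

lemma duality_split:
  fixes z :: "'a \<Rightarrow> 'a"
  assumes p: "1 < p" "p' = p / (p - 1)"
    and phi_diff: "\<forall>s. \<phi> differentiable (at s)" and fin: "\<forall>t. fconj \<phi> t < \<infinity>"
    and conj_diff: "\<forall>t. (\<lambda>t. real_of_ereal (fconj \<phi> t)) differentiable (at t)"
    and u: "u \<in> sobolev_D (ereal p) \<Omega> \<Gamma>D" and z: "z \<in> div_space_N (ereal p') \<Omega> \<Gamma>D"
    and opt: "\<bar>primal \<phi> \<psi> \<Omega> u\<bar> \<noteq> \<infinity>" "primal \<phi> \<psi> \<Omega> u = dual \<phi> \<psi> \<Omega> z"
  shows "integrable (lebesgue_on \<Omega>) (\<lambda>x. \<phi> (weak_grad \<Omega> u x))"
    and "integrable (lebesgue_on \<Omega>) (\<lambda>x. real_of_ereal (fconj \<phi> (z x)))"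
    and "integrable (lebesgue_on \<Omega>) (\<lambda>x. z x \<bullet> weak_grad \<Omega> u x)"
    and "\<bar>ext_integral (lebesgue_on \<Omega>) (\<lambda>x. ereal (\<psi> x (u x)))\<bar> \<noteq> \<infinity>"
    and "\<bar>ext_integral (lebesgue_on \<Omega>) (\<lambda>x. fconj (\<psi> x) (weak_div \<Omega> z x))\<bar> \<noteq> \<infinity>"
    and "ereal ((LINT x|lebesgue_on \<Omega>. \<phi> (weak_grad \<Omega> u x)) + (LINT x|lebesgue_on \<Omega>. real_of_ereal (fconj \<phi> (z x)))) =
      - ext_integral (lebesgue_on \<Omega>) (\<lambda>x. ereal (\<psi> x (u x))) - ext_integral (lebesgue_on \<Omega>) (\<lambda>x. fconj (\<psi> x) (weak_div \<Omega> z x))"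
    and "(LINT x|lebesgue_on \<Omega>. z x \<bullet> weak_grad \<Omega> u x + u x * weak_div \<Omega> z x) = 0"
proof -
  let ?M = "lebesgue_on \<Omega>" and ?G = "weak_grad \<Omega> u"
  obtain G0 where G0: "G0 \<in> Lspace (ereal p) \<Omega>" "has_weak_grad \<Omega> u G0" using u by (auto simp: sobolev_D_def sobolev_def)
  have aeG: "AE x in ?M. G0 x = ?G x" using weak_grad_AE_eq[OF open_Om G0(2)] by eventually_elim simp
  have Gm: "?G \<in> borel_measurable ?M"
    by (rule borel_measurable_lebesgue_on_AE[OF Om_lebesgue _ aeG]) (use G0(1) in \<open>simp add: Lspace_def\<close>)
  have zL: "z \<in> Lspace (ereal p') \<Omega>" using z by (simp add: div_space_N_def)
  then have zm: "z \<in> borel_measurable ?M" by (simp add: Lspace_def)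
  have cphi: "continuous_on UNIV \<phi>" "continuous_on UNIV (\<lambda>t. real_of_ereal (fconj \<phi> t))"
    using phi_diff conj_diff by (auto intro!: continuous_at_imp_continuous_on differentiable_imp_continuous_within)
  note bphi = borel_measurable_continuous_onI[OF cphi(1)] borel_measurable_continuous_onI[OF cphi(2)]
  have m1: "(\<lambda>x. \<phi> (?G x)) \<in> borel_measurable ?M" using measurable_compose[OF Gm bphi(1)] .
  have m2: "(\<lambda>x. real_of_ereal (fconj \<phi> (z x))) \<in> borel_measurable ?M" using measurable_compose[OF zm bphi(2)] .
  define A where "A = ext_integral ?M (\<lambda>x. ereal (\<phi> (?G x)))"
  define B where "B = ext_integral ?M (\<lambda>x. ereal (\<psi> x (u x)))"
  define A' where "A' = ext_integral ?M (\<lambda>x. fconj \<phi> (z x))"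
  define B' where "B' = ext_integral ?M (\<lambda>x. fconj (\<psi> x) (weak_div \<Omega> z x))"
  have A'eq: "A' = ext_integral ?M (\<lambda>x. ereal (real_of_ereal (fconj \<phi> (z x))))"
    unfolding A'_def using fconj_real[OF fin] by simp
  have P: "\<bar>A + B\<bar> \<noteq> \<infinity>" using opt(1) by (simp add: primal_def A_def B_def)
  have D: "A + B = - A' - B'" using opt(2) by (simp add: primal_def dual_def A_def B_def A'_def B'_def)
  have fAB: "\<bar>A\<bar> \<noteq> \<infinity>" "\<bar>B\<bar> \<noteq> \<infinity>" using ereal_add_finite[OF P] by auto
  have "\<bar>- A' + - B'\<bar> \<noteq> \<infinity>" using P D by (simp add: minus_ereal_def)
  from ereal_add_finite[OF this] have fAB': "\<bar>A'\<bar> \<noteq> \<infinity>" "\<bar>B'\<bar> \<noteq> \<infinity>" by auto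
  show i1: "integrable ?M (\<lambda>x. \<phi> (?G x))" by (rule ext_integral_finite(1)[OF m1]) (use fAB in \<open>simp add: A_def\<close>)
  show i2: "integrable ?M (\<lambda>x. real_of_ereal (fconj \<phi> (z x)))" by (rule ext_integral_finite(1)[OF m2]) (use fAB' A'eq in simp)
  have e1: "A = ereal (LINT x|?M. \<phi> (?G x))" unfolding A_def by (rule ext_integral_finite(2)[OF m1]) (use fAB in \<open>simp add: A_def\<close>)
  have e2: "A' = ereal (LINT x|?M. real_of_ereal (fconj \<phi> (z x)))" unfolding A'eq by (rule ext_integral_finite(2)[OF m2]) (use fAB' A'eq in simp)
  show "\<bar>ext_integral ?M (\<lambda>x. ereal (\<psi> x (u x)))\<bar> \<noteq> \<infinity>" "\<bar>ext_integral ?M (\<lambda>x. fconj (\<psi> x) (weak_div \<Omega> z x))\<bar> \<noteq> \<infinity>"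
    using fAB(2) fAB'(2) by (simp_all add: B_def B'_def)
  show "ereal ((LINT x|?M. \<phi> (?G x)) + (LINT x|?M. real_of_ereal (fconj \<phi> (z x)))) = - ext_integral ?M (\<lambda>x. ereal (\<psi> x (u x))) - ext_integral ?M (\<lambda>x. fconj (\<psi> x) (weak_div \<Omega> z x))"
    using D fAB(2) fAB'(2) unfolding e1 e2 B_def[symmetric] B'_def[symmetric] by (cases B; cases B') auto
  show "integrable ?M (\<lambda>x. z x \<bullet> ?G x)"
    by (rule integrable_AE_lebesgue_on[OF Om_lebesgue Hoelder_integrable[OF p zL G0(1)]]) (use aeG in eventually_elim, simp)
  show "(LINT x|?M. z x \<bullet> ?G x + u x * weak_div \<Omega> z x) = 0"
    using z u unfolding div_space_N_def conj_exp_conj[OF p] by blast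
qed

text \<open>The conjugate of the linear term takes only the values 0 and \<infinity>; a finite
  integral forces \<open>div z = - f\<close> almost everywhere and removes the term. Strong duality
  and the weak Neumann condition for \<open>u\<close> then say that the Fenchel-Young gap of \<phi>
  integrates to zero.\<close>

lemma optimality_linear:
  fixes z :: "'a \<Rightarrow> 'a"
  assumes p: "1 < p" "p' = p / (p - 1)"
    and phi_diff: "\<forall>s. \<phi> differentiable (at s)" and fin: "\<forall>t. fconj \<phi> t < \<infinity>"
    and conj_diff: "\<forall>t. (\<lambda>t. real_of_ereal (fconj \<phi> t)) differentiable (at t)"
    and u: "u \<in> sobolev_D (ereal p) \<Omega> \<Gamma>D" and z: "z \<in> div_space_N (ereal p') \<Omega> \<Gamma>D"
    and opt: "\<bar>primal \<phi> \<psi> \<Omega> u\<bar> \<noteq> \<infinity>" "primal \<phi> \<psi> \<Omega> u = dual \<phi> \<psi> \<Omega> z"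
    and f: "f \<in> Lspace (ereal p') \<Omega>" and psi: "\<forall>x\<in>\<Omega>. \<forall>s. \<psi> x s = - f x * s"
  shows "AE x in lebesgue_on \<Omega>. \<phi> (weak_grad \<Omega> u x) + real_of_ereal (fconj \<phi> (z x)) = z x \<bullet> weak_grad \<Omega> u x"
    and "AE x in lebesgue_on \<Omega>. weak_div \<Omega> z x = - f x"
proof -
  let ?M = "lebesgue_on \<Omega>" and ?G = "weak_grad \<Omega> u" and ?r = "weak_div \<Omega> z"
  note d = duality_split[OF p phi_diff fin conj_diff u z opt]
  have um: "u \<in> borel_measurable ?M" using u by (auto simp: sobolev_D_def sobolev_def Lspace_def)
  have fm: "f \<in> borel_measurable ?M" using f by (simp add: Lspace_def)
  have rm: "?r \<in> borel_measurable ?M" by (rule weak_div_properties(1)[OF z])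
  have psi': "\<psi> x = (\<lambda>s. - f x * s)" if "x \<in> \<Omega>" for x using psi that by auto
  have Bc: "ext_integral ?M (\<lambda>x. ereal (\<psi> x (u x))) = ext_integral ?M (\<lambda>x. ereal (- f x * u x))"
    by (rule ext_integral_cong_AE) (use psi in \<open>auto intro!: AE_I2\<close>)
  have fum: "(\<lambda>x. - f x * u x) \<in> borel_measurable ?M" using fm um by (intro borel_measurable_times borel_measurable_uminus)
  have fB: "\<bar>ext_integral ?M (\<lambda>x. ereal (- f x * u x))\<bar> \<noteq> \<infinity>" using d(4) unfolding Bc .
  note B = ext_integral_finite[OF fum fB]
  have B'c: "ext_integral ?M (\<lambda>x. fconj (\<psi> x) (?r x)) = ext_integral ?M (\<lambda>x. if ?r x = - f x then 0 else \<infinity>)"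
    by (rule ext_integral_cong_AE, rule AE_I2) (simp only: psi' fconj_linear space_lebesgue_on)
  have "AE x in ?M. (if ?r x = - f x then 0 else \<infinity> :: ereal) \<noteq> \<infinity>"
  proof (rule ext_integral_AE_finite)
    have "(\<lambda>x. ?r x + f x) \<in> borel_measurable ?M" using rm fm by (rule borel_measurable_add)
    then have "{x \<in> space ?M. ?r x + f x = 0} \<in> sets ?M" by measurable
    moreover have "{x \<in> space ?M. ?r x + f x = 0} = {x \<in> space ?M. ?r x = - f x}" by auto
    ultimately show "(\<lambda>x. if ?r x = - f x then 0 else \<infinity> :: ereal) \<in> borel_measurable ?M" by (intro measurable_If) auto
    show "ext_integral ?M (\<lambda>x. if ?r x = - f x then 0 else \<infinity>) \<noteq> \<infinity>" using d(5) unfolding B'c by auto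
  qed
  then show r: "AE x in ?M. ?r x = - f x" by eventually_elim (auto split: if_splits)
  have B'0: "ext_integral ?M (\<lambda>x. fconj (\<psi> x) (?r x)) = 0"
  proof -
    have "ext_integral ?M (\<lambda>x. if ?r x = - f x then 0 else \<infinity>) = ext_integral ?M (\<lambda>x. 0)"
      by (rule ext_integral_cong_AE) (use r in eventually_elim, simp)
    then show ?thesis unfolding B'c by (simp add: ext_integral_def e2ennreal_neg)
  qed
  have s: "(LINT x|?M. \<phi> (?G x)) + (LINT x|?M. real_of_ereal (fconj \<phi> (z x))) = - (LINT x|?M. - f x * u x)"
    using d(6) unfolding Bc B(2) B'0 by simp
  have ur: "integrable ?M (\<lambda>x. u x * ?r x)" "(LINT x|?M. u x * ?r x) = (LINT x|?M. - f x * u x)"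
  proof -
    have ae: "AE x in ?M. - f x * u x = u x * ?r x" using r by eventually_elim simp
    show i: "integrable ?M (\<lambda>x. u x * ?r x)" by (rule integrable_AE_lebesgue_on[OF Om_lebesgue B(1) ae])
    show "(LINT x|?M. u x * ?r x) = (LINT x|?M. - f x * u x)"
      using B(1) i ae by (intro integral_cong_AE) (auto elim: eventually_mono)
  qed
  have "(LINT x|?M. z x \<bullet> ?G x) = - (LINT x|?M. - f x * u x)" using d(7) d(3) ur by simp
  then have "(LINT x|?M. \<phi> (?G x) + real_of_ereal (fconj \<phi> (z x)) - z x \<bullet> ?G x) + (LINT x|?M. 0) = 0"
    using s d(1-3) by simp
  then have "AE x in ?M. \<phi> (?G x) + real_of_ereal (fconj \<phi> (z x)) - z x \<bullet> ?G x = 0"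
    using d(1-3) Fenchel_Young[OF fin] by (intro integral_sum_zero_AE(1)[where b = "\<lambda>x. 0"]) auto
  then show "AE x in ?M. \<phi> (?G x) + real_of_ereal (fconj \<phi> (z x)) = z x \<bullet> ?G x" by eventually_elim simp
qed

text \<open>The gaps of \<phi> and of the quadratic are nonnegative and their integrals add up to
  zero. Finiteness of the energies makes \<open>u\<close> and \<open>div z\<close> square
  integrable, so that \<open>u * div z\<close> can be integrated on its own.\<close>

lemma optimality_quadratic:
  fixes z :: "'a \<Rightarrow> 'a"
  assumes p: "1 < p" "p' = p / (p - 1)"
    and phi_diff: "\<forall>s. \<phi> differentiable (at s)" and fin: "\<forall>t. fconj \<phi> t < \<infinity>"
    and conj_diff: "\<forall>t. (\<lambda>t. real_of_ereal (fconj \<phi> t)) differentiable (at t)"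
    and u: "u \<in> sobolev_D (ereal p) \<Omega> \<Gamma>D" and z: "z \<in> div_space_N (ereal p') \<Omega> \<Gamma>D"
    and opt: "\<bar>primal \<phi> \<psi> \<Omega> u\<bar> \<noteq> \<infinity>" "primal \<phi> \<psi> \<Omega> u = dual \<phi> \<psi> \<Omega> z"
    and g: "g \<in> Lspace 2 \<Omega>" and psi: "\<forall>x\<in>\<Omega>. \<forall>s. \<psi> x s = (g x - s)\<^sup>2 / 2"
  shows "AE x in lebesgue_on \<Omega>. \<phi> (weak_grad \<Omega> u x) + real_of_ereal (fconj \<phi> (z x)) = z x \<bullet> weak_grad \<Omega> u x"
    and "AE x in lebesgue_on \<Omega>. weak_div \<Omega> z x = u x - g x"
    and "integrable (lebesgue_on \<Omega>) (\<lambda>x. (u x)\<^sup>2)"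
proof -
  let ?M = "lebesgue_on \<Omega>" and ?G = "weak_grad \<Omega> u" and ?r = "weak_div \<Omega> z"
  note d = duality_split[OF p phi_diff fin conj_diff u z opt]
  have um: "u \<in> borel_measurable ?M" using u by (auto simp: sobolev_D_def sobolev_def Lspace_def)
  note gs = Lspace_2_square_integrable[OF g]
  have rm: "?r \<in> borel_measurable ?M" by (rule weak_div_properties(1)[OF z])
  have psi': "\<psi> x = (\<lambda>s. (g x - s)\<^sup>2 / 2)" if "x \<in> \<Omega>" for x using psi that by auto
  have Bc: "ext_integral ?M (\<lambda>x. ereal (\<psi> x (u x))) = ext_integral ?M (\<lambda>x. ereal ((g x - u x)\<^sup>2 / 2))"
    by (rule ext_integral_cong_AE) (use psi in \<open>auto intro!: AE_I2\<close>)
  have m1: "(\<lambda>x. (g x - u x)\<^sup>2 / 2) \<in> borel_measurable ?M" using gs(1) um by simp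
  have fB: "\<bar>ext_integral ?M (\<lambda>x. ereal ((g x - u x)\<^sup>2 / 2))\<bar> \<noteq> \<infinity>" using d(4) unfolding Bc .
  note B = ext_integral_finite[OF m1 fB]
  have B'c: "ext_integral ?M (\<lambda>x. fconj (\<psi> x) (?r x)) = ext_integral ?M (\<lambda>x. ereal ((?r x)\<^sup>2 / 2 + g x * ?r x))"
    by (rule ext_integral_cong_AE) (auto intro!: AE_I2 simp: psi' fconj_quadratic)
  have m2: "(\<lambda>x. (?r x)\<^sup>2 / 2 + g x * ?r x) \<in> borel_measurable ?M" using gs(1) rm by simp
  have fB': "\<bar>ext_integral ?M (\<lambda>x. ereal ((?r x)\<^sup>2 / 2 + g x * ?r x))\<bar> \<noteq> \<infinity>" using d(5) unfolding B'c .
  note B' = ext_integral_finite[OF m2 fB']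
  have gu: "integrable ?M (\<lambda>x. (u x - g x)\<^sup>2)"
    using integrable_mult_right[OF B(1), of 2] by (simp add: power2_commute[of "u _"])
  show u2: "integrable ?M (\<lambda>x. (u x)\<^sup>2)"
    by (rule integrable_square_bound[OF gu gs(2) um]) simp
  \<comment> \<open>Completing the square: twice the conjugate plus the square of \<open>g\<close>
    is the square of \<open>?r x + g x\<close>.\<close>
  have "integrable ?M (\<lambda>x. 2 * ((?r x)\<^sup>2 / 2 + g x * ?r x) + (g x)\<^sup>2)" 
    by (rule Bochner_Integration.integrable_add[OF integrable_mult_right[OF B'(1)] gs(2)])
  moreover have "2 * ((?r x)\<^sup>2 / 2 + g x * ?r x) + (g x)\<^sup>2 = (?r x + g x)\<^sup>2" for x by (simp add: power2_sum)
  ultimately have rg: "integrable ?M (\<lambda>x. (?r x + g x)\<^sup>2)" by simp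
  have mg: "integrable ?M (\<lambda>x. (- g x)\<^sup>2)" using gs(2) by simp
  have r2: "integrable ?M (\<lambda>x. (?r x)\<^sup>2)"
    by (rule integrable_square_bound[OF rg mg rm]) simp
  have ur: "integrable ?M (\<lambda>x. u x * ?r x)" by (rule integrable_product_squares[OF u2 r2 um rm])
  have s: "(LINT x|?M. \<phi> (?G x)) + (LINT x|?M. real_of_ereal (fconj \<phi> (z x))) = - (LINT x|?M. (g x - u x)\<^sup>2 / 2) - (LINT x|?M. (?r x)\<^sup>2 / 2 + g x * ?r x)"
    using d(6) unfolding Bc B(2) B'c B'(2) by simp
  have t: "(LINT x|?M. z x \<bullet> ?G x) + (LINT x|?M. u x * ?r x) = 0" using d(7) d(3) ur by simp
  define a where "a x = \<phi> (?G x) + real_of_ereal (fconj \<phi> (z x)) - z x \<bullet> ?G x" for x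
  define b where "b x = (g x - u x)\<^sup>2 / 2 + ((?r x)\<^sup>2 / 2 + g x * ?r x) - u x * ?r x" for x
  \<comment> \<open>The Fenchel-Young gap of the quadratic is half the squared residual of
    \<open>div z = u - g\<close>.\<close>
  have bq: "b x = (?r x - (u x - g x))\<^sup>2 / 2" for x unfolding b_def by (simp add: power2_eq_square field_simps)
  have ia: "integrable ?M a" and Ia: "(LINT x|?M. a x) = (LINT x|?M. \<phi> (?G x)) + (LINT x|?M. real_of_ereal (fconj \<phi> (z x))) - (LINT x|?M. z x \<bullet> ?G x)"
    unfolding a_def using d(1-3) by simp_all
  have ib: "integrable ?M b" and Ib: "(LINT x|?M. b x) = (LINT x|?M. (g x - u x)\<^sup>2 / 2) + (LINT x|?M. (?r x)\<^sup>2 / 2 + g x * ?r x) - (LINT x|?M. u x * ?r x)"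
    unfolding b_def
    by (intro Bochner_Integration.integrable_diff Bochner_Integration.integrable_add B(1) B'(1) ur)
       (subst Bochner_Integration.integral_diff[OF Bochner_Integration.integrable_add[OF B(1) B'(1)] ur], subst Bochner_Integration.integral_add[OF B(1) B'(1)], rule refl)
  have "0 \<le> a x" "0 \<le> b x" for x using Fenchel_Young[OF fin, of "z x" "?G x"] by (simp_all add: a_def bq)
  moreover have "(LINT x|?M. a x) + (LINT x|?M. b x) = 0" unfolding Ia Ib using s t by linarith
  ultimately have ab: "AE x in ?M. a x = 0" "AE x in ?M. b x = 0" using integral_sum_zero_AE[OF ia ib] by auto
  show "AE x in ?M. \<phi> (?G x) + real_of_ereal (fconj \<phi> (z x)) = z x \<bullet> ?G x" using ab(1) by eventually_elim (simp add: a_def)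
  show "AE x in ?M. ?r x = u x - g x" using ab(2) by eventually_elim (simp add: bq)
qed

section \<open>The energy gap and the projection error\<close>

context
  fixes n :: "'a set \<Rightarrow> 'a"
  assumes normals: "unit_normals \<T> n"
begin

text \<open>The common core of both cases. \<open>rep\<close> writes the lower-order energy as a
  pairing with \<open>\<Pi> div z\<close>, a remainder \<rho> and a constant \<open>E\<close> that
  cancels in the difference. \<open>discrete_duality\<close> turns the pairing into one of the
  discrete gradient with \<open>\<Pi> Iz\<close>; the energy of \<open>Iu\<close> is then bounded by
  Jensen, that of \<open>uh\<close> by Fenchel-Young.\<close>

lemma energy_gap:
  fixes z Iz :: "'a \<Rightarrow> 'a"
  assumes dim: "2 \<le> DIM('a)" and resolved: "boundary_resolved \<T> \<Omega> \<Gamma>D"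
    and conv: "convex_on UNIV \<phi>" and phi_diff: "\<forall>s. \<phi> differentiable (at s)" and fin: "\<forall>t. fconj \<phi> t < \<infinity>"
    and conj_diff: "\<forall>t. (\<lambda>t. real_of_ereal (fconj \<phi> t)) differentiable (at t)"
    and sc: "strongly_coercive (CR_D \<T> \<Omega> \<Gamma>D) (primal_h \<phi> \<psi>h \<T> \<Omega>) \<sigma>"
    and uh: "uh \<in> CR_D \<T> \<Omega> \<Gamma>D" "\<forall>vh\<in>CR_D \<T> \<Omega> \<Gamma>D. primal_h \<phi> \<psi>h \<T> \<Omega> uh \<le> primal_h \<phi> \<psi>h \<T> \<Omega> vh"
    and Iu: "is_CR_interpolant \<T> \<Omega> u Iu" "Iu \<in> CR_D \<T> \<Omega> \<Gamma>D"
    and Iz: "is_RT_interpolant \<T> \<Omega> n z Iz" and zs: "\<And>i. i \<in> Basis \<Longrightarrow> (\<lambda>x. z x \<bullet> i) \<in> sobolev 1 \<Omega>"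
    and zN: "z \<in> div_space_N 1 \<Omega> \<Gamma>D"
    and q: "\<And>T x s. T \<in> \<T> \<Longrightarrow> x \<in> interior T \<Longrightarrow> \<psi>h x s = q T s" and qd: "\<And>T s. T \<in> \<T> \<Longrightarrow> q T differentiable (at s)"
    and rep: "\<And>v. v \<in> CR_D \<T> \<Omega> \<Gamma>D \<Longrightarrow> (LINT x|lebesgue_on \<Omega>. \<psi>h x (proj0 \<T> v x)) =
       (LINT x|lebesgue_on \<Omega>. proj0 \<T> v x * proj0 \<T> (weak_div \<Omega> z) x) + \<rho> v - E" and rho: "0 \<le> \<rho> uh"
    and opt: "AE x in lebesgue_on \<Omega>. \<phi> (weak_grad \<Omega> u x) + real_of_ereal (fconj \<phi> (z x)) = z x \<bullet> weak_grad \<Omega> u x"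
    and iphi: "integrable (lebesgue_on \<Omega>) (\<lambda>x. \<phi> (weak_grad \<Omega> u x))"
  shows "ereal ((\<sigma> uh Iu)\<^sup>2) \<le> ext_integral (lebesgue_on \<Omega>)
       (\<lambda>x. ereal ((grad_conj \<phi> (z x) - grad_conj \<phi> (proj0 \<T> Iz x)) \<bullet> (z x - proj0 \<T> Iz x))) + ereal (\<rho> Iu)"
proof -
  let ?M = "lebesgue_on \<Omega>" and ?G = "weak_grad \<Omega> u" and ?Y = "proj0 \<T> Iz" and ?F = "\<lambda>t. real_of_ereal (fconj \<phi> t)"
  have pd: "\<And>s. \<phi> differentiable (at s)" using phi_diff by blast
  obtain a b where y: "\<And>T x. T \<in> \<T> \<Longrightarrow> x \<in> interior T \<Longrightarrow> Iz x = a T + b T *\<^sub>R (x - barycenter T)"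
    by (rule RT_coeffs[OF normals Iz[unfolded is_RT_interpolant_def, THEN conjunct1]], rule that)
  have Y: "?Y x = a T" if "T \<in> \<T>" "x \<in> interior T" for T x by (rule proj0_RT[OF that y[OF that(1)]])
  have Gi: "integrable ?M ?G" by (rule sobolev_1_cases(2)[OF CR_interpolant_sobolev[OF Iu(1)] open_Om])
  have GY: "integrable ?M (\<lambda>x. ?G x \<bullet> ?Y x)" "(LINT x|?M. ?G x \<bullet> ?Y x) = (\<Sum>T\<in>\<T>. (LINT x|lebesgue_on T. ?G x) \<bullet> a T)"
    by (rule integral_proj0_pairing[OF Gi], erule (1) Y)+
  have FY: "integrable ?M (\<lambda>x. ?F (?Y x))"
    by (rule integral_elementwise_constant(1)[where c = "\<lambda>T. ?F (a T)"]) (simp add: Y)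
  have elementwise: "integrable ?M (\<lambda>x. \<phi> (grad_h \<T> v x))" "integrable ?M (\<lambda>x. grad_h \<T> v x \<bullet> ?Y x)"
    "primal_h \<phi> \<psi>h \<T> \<Omega> v = (LINT x|?M. \<phi> (grad_h \<T> v x)) - (LINT x|?M. grad_h \<T> v x \<bullet> ?Y x) + \<rho> v - E"
    if v: "v \<in> CR_D \<T> \<Omega> \<Gamma>D" for v
  proof -
    have pv: "v \<in> pw_affine \<T>" using v by (auto simp: CR_D_def CR_def)
    obtain \<alpha> \<beta> where va: "\<And>T x. T \<in> \<T> \<Longrightarrow> x \<in> interior T \<Longrightarrow> v x = \<alpha> T + \<beta> T \<bullet> x" by (rule pw_affine_coeffs[OF pv], rule that)
    have gv: "grad_h \<T> v x = \<beta> T" if "T \<in> \<T>" "x \<in> interior T" for T x by (rule grad_h_elem[OF that va[OF that(1)]])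
    show "integrable ?M (\<lambda>x. \<phi> (grad_h \<T> v x))"
      by (rule integral_elementwise_constant(1)[where c = "\<lambda>T. \<phi> (\<beta> T)"]) (simp add: gv)
    show "integrable ?M (\<lambda>x. grad_h \<T> v x \<bullet> ?Y x)"
      by (rule integral_elementwise_constant(1)[where c = "\<lambda>T. \<beta> T \<bullet> a T"]) (simp add: gv Y)
    show "primal_h \<phi> \<psi>h \<T> \<Omega> v = (LINT x|?M. \<phi> (grad_h \<T> v x)) - (LINT x|?M. grad_h \<T> v x \<bullet> ?Y x) + \<rho> v - E"
      using discrete_duality[OF normals dim resolved Iz zs zN v] unfolding primal_h_def rep[OF v] by simp
  qed
  have pI: "Iu \<in> pw_affine \<T>" using Iu(2) by (auto simp: CR_D_def CR_def)
  obtain \<alpha> \<beta> where va: "\<And>T x. T \<in> \<T> \<Longrightarrow> x \<in> interior T \<Longrightarrow> Iu x = \<alpha> T + \<beta> T \<bullet> x" by (rule pw_affine_coeffs[OF pI], rule that)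
  have gv: "grad_h \<T> Iu x = \<beta> T" if "T \<in> \<T>" "x \<in> interior T" for T x by (rule grad_h_elem[OF that va[OF that(1)]])
  have bG: "\<beta> T = (LINT x|lebesgue_on T. ?G x) /\<^sub>R measure lebesgue T" if T: "T \<in> \<T>" for T
    by (rule CR_interpolant_gradient[OF Iu(1) T va[OF T]])
  have "(LINT x|?M. \<phi> (grad_h \<T> Iu x)) = (\<Sum>T\<in>\<T>. measure lebesgue T *\<^sub>R \<phi> (\<beta> T))"
    by (rule integral_elementwise_constant(2)) (simp add: gv)
  also have "\<dots> \<le> (\<Sum>T\<in>\<T>. LINT x|lebesgue_on T. \<phi> (?G x))"
    using jensen_elem[OF conv pd _ integrable_elem[OF _ Gi] integrable_elem[OF _ iphi]] by (intro sum_mono) (simp add: bG)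
  also have "\<dots> = (LINT x|?M. \<phi> (?G x))"
    using integral_elements(2)[of "\<lambda>x. \<phi> (?G x)"] integrable_elem[OF _ iphi] by simp
  finally have Jensen: "(LINT x|?M. \<phi> (grad_h \<T> Iu x)) \<le> (LINT x|?M. \<phi> (?G x))" .
  \<comment> \<open>\<open>?Y\<close> is constant on each element, so it does not distinguish the
    gradient of \<open>u\<close> from its elementwise mean.\<close>
  have "(LINT x|?M. grad_h \<T> Iu x \<bullet> ?Y x) = (\<Sum>T\<in>\<T>. measure lebesgue T *\<^sub>R (\<beta> T \<bullet> a T))"
    by (rule integral_elementwise_constant(2)) (simp add: gv Y)
  also have "\<dots> = (LINT x|?M. ?G x \<bullet> ?Y x)"
    unfolding GY(2)
  proof (rule sum.cong[OF refl])
    fix T assume T: "T \<in> \<T>"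
    show "measure lebesgue T *\<^sub>R (\<beta> T \<bullet> a T) = (LINT x|lebesgue_on T. ?G x) \<bullet> a T"
      unfolding bG[OF T] using measure_elem_pos[OF T] by simp
  qed
  finally have pair: "(LINT x|?M. grad_h \<T> Iu x \<bullet> ?Y x) = (LINT x|?M. ?G x \<bullet> ?Y x)" .
  have Fenchel: "(LINT x|?M. grad_h \<T> uh x \<bullet> ?Y x) \<le> (LINT x|?M. \<phi> (grad_h \<T> uh x)) + (LINT x|?M. ?F (?Y x))"
  proof -
    have "(LINT x|?M. grad_h \<T> uh x \<bullet> ?Y x) \<le> (LINT x|?M. \<phi> (grad_h \<T> uh x) + ?F (?Y x))"
    proof (rule integral_mono)
      show "grad_h \<T> uh x \<bullet> ?Y x \<le> \<phi> (grad_h \<T> uh x) + ?F (?Y x)" for x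
        using Fenchel_Young[OF fin, of "?Y x" "grad_h \<T> uh x"] by (simp only: inner_commute)
    qed (use elementwise(1,2)[OF uh(1)] FY in auto)
    then show ?thesis using elementwise(1)[OF uh(1)] FY by simp
  qed
  \<comment> \<open>The Fenchel-Young gap of \<phi> at the gradient of \<open>u\<close> and
    \<open>?Y\<close>: the excess left after the two discrete energies are compared.\<close>
  define k where "k x = \<phi> (?G x) - ?G x \<bullet> ?Y x + ?F (?Y x)" for x
  have ik: "integrable ?M k" and Ik: "(LINT x|?M. k x) = (LINT x|?M. \<phi> (?G x)) - (LINT x|?M. ?G x \<bullet> ?Y x) + (LINT x|?M. ?F (?Y x))"
    unfolding k_def using iphi GY(1) FY by simp_all
  have "variation (primal_h \<phi> \<psi>h \<T> \<Omega>) uh (\<lambda>x. Iu x - uh x) = 0"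
    by (rule variation_at_minimizer[OF uh Iu(2) pd q qd])
  moreover have "primal_h \<phi> \<psi>h \<T> \<Omega> uh + variation (primal_h \<phi> \<psi>h \<T> \<Omega>) uh (\<lambda>x. Iu x - uh x) + (\<sigma> uh Iu)\<^sup>2 \<le> primal_h \<phi> \<psi>h \<T> \<Omega> Iu"
    by (rule sc[unfolded strongly_coercive_def, THEN bspec, OF uh(1), THEN bspec, OF Iu(2), THEN conjunct2, THEN conjunct2])
  ultimately have "(\<sigma> uh Iu)\<^sup>2 \<le> primal_h \<phi> \<psi>h \<T> \<Omega> Iu - primal_h \<phi> \<psi>h \<T> \<Omega> uh" by linarith
  also have "\<dots> \<le> (LINT x|?M. k x) + \<rho> Iu"
    unfolding elementwise(3)[OF uh(1)] elementwise(3)[OF Iu(2)] Ik using Jensen pair Fenchel rho by linarith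
  finally have le: "(\<sigma> uh Iu)\<^sup>2 \<le> (LINT x|?M. k x) + \<rho> Iu" .
  have "ereal (LINT x|?M. k x) \<le> ext_integral ?M (\<lambda>x. ereal ((grad_conj \<phi> (z x) - grad_conj \<phi> (?Y x)) \<bullet> (z x - ?Y x)))"
  proof (rule ext_integral_ge[OF ik])
    show "AE x in ?M. 0 \<le> k x \<and> k x \<le> (grad_conj \<phi> (z x) - grad_conj \<phi> (?Y x)) \<bullet> (z x - ?Y x)"
      using opt
    proof eventually_elim
      case (elim x)
      \<comment> \<open>By optimality \<open>k x\<close> is the Bregman distance of the conjugate
        from \<open>z x\<close> to \<open>?Y x\<close>. Adding the distance in the reverse
        direction, which is nonnegative, produces the symmetric product of the claim.\<close>
      have "grad_conj \<phi> (z x) = ?G x" by (rule Fenchel_equality_imp_gradient[OF fin conj_diff[rule_format] elim])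
      moreover have "?F (?Y x) + grad_conj \<phi> (?Y x) \<bullet> (z x - ?Y x) \<le> ?F (z x)"
        unfolding grad_conj_def by (rule gradient_inequality[OF convex_fconj[OF fin] conj_diff[rule_format]])
      moreover have "0 \<le> k x" unfolding k_def using Fenchel_Young[OF fin, of "?Y x" "?G x"] by (simp add: inner_commute)
      ultimately show ?case using elim unfolding k_def
        by (simp add: inner_diff_left inner_diff_right inner_commute)
    qed
  qed
  then have "ereal (LINT x|?M. k x) + ereal (\<rho> Iu) \<le> ext_integral ?M (\<lambda>x. ereal ((grad_conj \<phi> (z x) - grad_conj \<phi> (?Y x)) \<bullet> (z x - ?Y x))) + ereal (\<rho> Iu)"
    by (intro add_right_mono)
  then show ?thesis by (rule order_trans[rotated]) (use le in simp)
qed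

end

lemma proj0_cong_AE:
  fixes f g :: "'a \<Rightarrow> 'b::euclidean_space"
  assumes g: "integrable (lebesgue_on \<Omega>) g" and ae: "AE x in lebesgue_on \<Omega>. g x = f x"
  shows "proj0 \<T> f = proj0 \<T> g"
proof
  fix x
  have f: "integrable (lebesgue_on \<Omega>) f" by (rule integrable_AE_lebesgue_on[OF Om_lebesgue g ae])
  have "(LINT y|lebesgue_on T. f y) = (LINT y|lebesgue_on T. g y)" if T: "T \<in> \<T>" for T
    by (rule integral_cong_AE[OF borel_measurable_integrable[OF integrable_elem[OF T f]] borel_measurable_integrable[OF integrable_elem[OF T g]]])
       (use AE_elem[OF T ae] in eventually_elim, simp)
  then show "proj0 \<T> f x = proj0 \<T> g x" by (simp add: proj0_def)
qed

lemma proj0_diff: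
  fixes f g :: "'a \<Rightarrow> 'b::euclidean_space"
  assumes "integrable (lebesgue_on \<Omega>) f" "integrable (lebesgue_on \<Omega>) g"
  shows "proj0 \<T> (\<lambda>x. f x - g x) = (\<lambda>x. proj0 \<T> f x - proj0 \<T> g x)"
proof
  fix x
  have "(LINT y|lebesgue_on T. f y - g y) = (LINT y|lebesgue_on T. f y) - (LINT y|lebesgue_on T. g y)" if "T \<in> \<T>" for T
    using integrable_elem[OF that assms(1)] integrable_elem[OF that assms(2)] by simp
  then show "proj0 \<T> (\<lambda>x. f x - g x) x = proj0 \<T> f x - proj0 \<T> g x"
    by (simp add: proj0_def scaleR_diff_right sum_subtractf)
qed

text \<open>\<open>proj0 \<T> w\<close> is constant on each element, so the difference of the
  projections is the projection of \<open>u - proj0 \<T> w\<close>, and Jensen for the square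
  applies elementwise. The spare factor 1/2 is given away.\<close>

lemma projection_error_le:
  fixes u w :: "'a \<Rightarrow> real"
  assumes u: "integrable (lebesgue_on \<Omega>) u" "integrable (lebesgue_on \<Omega>) (\<lambda>x. (u x)\<^sup>2)"
  shows "ereal (LINT x|lebesgue_on \<Omega>. (proj0 \<T> u x - proj0 \<T> w x)\<^sup>2 / 2) \<le>
    ext_integral (lebesgue_on \<Omega>) (\<lambda>x. ereal ((u x - proj0 \<T> w x)\<^sup>2))"
proof -
  let ?M = "lebesgue_on \<Omega>" and ?k = "\<lambda>x. (u x - proj0 \<T> w x)\<^sup>2"
  define m where "m T = (LINT y|lebesgue_on T. u y) /\<^sub>R measure lebesgue T" for T
  define c where "c T = (LINT y|lebesgue_on T. w y) /\<^sub>R measure lebesgue T" for T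
  have mc: "proj0 \<T> u x = m T" "proj0 \<T> w x = c T" if "T \<in> \<T>" "x \<in> interior T" for T x
    by (simp_all only: m_def c_def proj0_elem[OF that])
  have wm: "integrable ?M (proj0 \<T> w)" by (rule integral_elementwise_constant(1)[where c = c]) (rule mc(2))
  have w2: "integrable ?M (\<lambda>x. (- proj0 \<T> w x)\<^sup>2)"
    by (rule integral_elementwise_constant(1)[where c = "\<lambda>T. (c T)\<^sup>2"]) (simp add: mc)
  have "(\<lambda>x. u x - proj0 \<T> w x) \<in> borel_measurable ?M"
    using u(1) wm by (intro borel_measurable_diff borel_measurable_integrable)
  then have k: "integrable ?M ?k" by (rule integrable_square_bound[OF u(2) w2]) simp
  have jensen: "measure lebesgue T * (m T - c T)\<^sup>2 \<le> (LINT x|lebesgue_on T. ?k x)" if T: "T \<in> \<T>" for T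
  proof -
    have eq: "\<And>x. x \<in> interior T \<Longrightarrow> (u x - c T)\<^sup>2 = ?k x" using mc(2)[OF T] by simp
    have cong: "integrable (lebesgue_on T) (\<lambda>x. (u x - c T)\<^sup>2)" "(LINT x|lebesgue_on T. (u x - c T)\<^sup>2) = (LINT x|lebesgue_on T. ?k x)"
      by (rule integral_interior_cong[OF convex_elem[OF T] elem_lebesgue[OF T] integrable_elem[OF T k] eq], assumption)+
    have "(\<lambda>s. (s - c T)\<^sup>2) differentiable (at s)" for s :: real
      by (intro differentiable_power differentiable_diff differentiable_ident differentiable_const)
    from jensen_elem[OF convex_on_square_dist this T integrable_elem[OF T u(1)] cong(1)]
    show ?thesis unfolding cong(2) m_def .
  qed
  have "(LINT x|?M. (proj0 \<T> u x - proj0 \<T> w x)\<^sup>2 / 2) = (\<Sum>T\<in>\<T>. measure lebesgue T *\<^sub>R ((m T - c T)\<^sup>2 / 2))"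
    by (rule integral_elementwise_constant(2)) (simp add: mc)
  also have "\<dots> \<le> (\<Sum>T\<in>\<T>. LINT x|lebesgue_on T. ?k x)"
  proof (rule sum_mono)
    fix T assume T: "T \<in> \<T>"
    have "0 \<le> measure lebesgue T * (m T - c T)\<^sup>2" by simp
    then show "measure lebesgue T *\<^sub>R ((m T - c T)\<^sup>2 / 2) \<le> (LINT x|lebesgue_on T. ?k x)"
      unfolding real_scaleR_def times_divide_eq_right using jensen[OF T] by linarith
  qed
  also have "\<dots> = (LINT x|?M. ?k x)" using integral_elements(2)[of ?k] integrable_elem[OF _ k] by simp
  finally have "ereal (LINT x|?M. (proj0 \<T> u x - proj0 \<T> w x)\<^sup>2 / 2) \<le> ereal (LINT x|?M. ?k x)" by simp
  also have "\<dots> \<le> ext_integral ?M (\<lambda>x. ereal (?k x))" by (rule ext_integral_ge[OF k]) simp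
  finally show ?thesis .
qed

end

theorem proposition3p6:
  fixes \<Omega> \<Gamma>D :: "'a::euclidean_space set"
    and \<T> :: "'a set set"
    and n :: "'a set \<Rightarrow> 'a"
    and p p' :: real
    and \<phi> :: "'a \<Rightarrow> real"
    and \<psi> \<psi>h :: "'a \<Rightarrow> real \<Rightarrow> real"
    and \<sigma> :: "('a \<Rightarrow> real) \<Rightarrow> ('a \<Rightarrow> real) \<Rightarrow> real"
    and u uh Iu :: "'a \<Rightarrow> real"
    and z Iz :: "'a \<Rightarrow> 'a"
  assumes dim: "DIM('a) \<in> {2, 3}"
    and domain: "polyhedral_lipschitz_domain \<Omega>"
    and GammaD: "\<Gamma>D \<subseteq> frontier \<Omega>"
    and mesh: "regular_triangulation \<Omega> \<T>" "boundary_resolved \<T> \<Omega> \<Gamma>D" "unit_normals \<T> n"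
    and p: "1 < p" "p' = p / (p - 1)"
    and phi_convex: "convex_on UNIV \<phi>"
    and phi_diff: "\<forall>s. \<phi> differentiable (at s)"
    and phi_conj_finite: "\<forall>t. fconj \<phi> t < \<infinity>"
    and phi_conj_diff: "\<forall>t. (\<lambda>t. real_of_ereal (fconj \<phi> t)) differentiable (at t)"
    and bounded_below: "\<exists>c::real. \<forall>v\<in>sobolev_D (ereal p) \<Omega> \<Gamma>D. ereal c \<le> primal \<phi> \<psi> \<Omega> v"
    and coercive: "coercive_on p \<Omega> (sobolev_D (ereal p) \<Omega> \<Gamma>D) (primal \<phi> \<psi> \<Omega>)"
    and weakly_lsc: "weakly_lsc_on p \<Omega> (sobolev_D (ereal p) \<Omega> \<Gamma>D) (primal \<phi> \<psi> \<Omega>)"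
    and proper: "\<exists>v\<in>sobolev_D (ereal p) \<Omega> \<Gamma>D. primal \<phi> \<psi> \<Omega> v \<noteq> \<infinity>"
    and strong_duality: "(INF v\<in>sobolev_D (ereal p) \<Omega> \<Gamma>D. primal \<phi> \<psi> \<Omega> v) =
                         (SUP y\<in>div_space_N (ereal p') \<Omega> \<Gamma>D. dual \<phi> \<psi> \<Omega> y)"
    and strong_coercivity: "strongly_coercive (CR_D \<T> \<Omega> \<Gamma>D) (primal_h \<phi> \<psi>h \<T> \<Omega>) \<sigma>"
    and u: "u \<in> sobolev_D (ereal p) \<Omega> \<Gamma>D" "\<forall>v\<in>sobolev_D (ereal p) \<Omega> \<Gamma>D. primal \<phi> \<psi> \<Omega> u \<le> primal \<phi> \<psi> \<Omega> v"
    and uh: "uh \<in> CR_D \<T> \<Omega> \<Gamma>D" "\<forall>vh\<in>CR_D \<T> \<Omega> \<Gamma>D. primal_h \<phi> \<psi>h \<T> \<Omega> uh \<le> primal_h \<phi> \<psi>h \<T> \<Omega> vh"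
    and z: "z \<in> div_space_N (ereal p') \<Omega> \<Gamma>D" "\<forall>y\<in>div_space_N (ereal p') \<Omega> \<Gamma>D. dual \<phi> \<psi> \<Omega> y \<le> dual \<phi> \<psi> \<Omega> z"
    and z_regular: "z \<in> div_space_N 1 \<Omega> \<Gamma>D" "\<forall>b\<in>Basis. (\<lambda>x. z x \<bullet> b) \<in> sobolev 1 \<Omega>"
    and Iu: "is_CR_interpolant \<T> \<Omega> u Iu"
    and Iz: "is_RT_interpolant \<T> \<Omega> n z Iz"
  shows "(\<forall>f\<in>Lspace (ereal p') \<Omega>.
            (\<forall>x\<in>\<Omega>. \<forall>s. \<psi> x s = - f x * s) \<and> (\<forall>x\<in>\<Omega>. \<forall>s. \<psi>h x s = - proj0 \<T> f x * s) \<longrightarrow>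
            ereal ((\<sigma> uh Iu)\<^sup>2) \<le>
              ext_integral (lebesgue_on \<Omega>)
                (\<lambda>x. ereal ((grad_conj \<phi> (z x) - grad_conj \<phi> (proj0 \<T> Iz x)) \<bullet> (z x - proj0 \<T> Iz x)))) \<and>
         (\<forall>g\<in>Lspace 2 \<Omega>.
            (\<forall>x\<in>\<Omega>. \<forall>s. \<psi> x s = (g x - s)\<^sup>2 / 2) \<and> (\<forall>x\<in>\<Omega>. \<forall>s. \<psi>h x s = (proj0 \<T> g x - s)\<^sup>2 / 2) \<longrightarrow>
            ereal ((\<sigma> uh Iu)\<^sup>2) \<le>
              ext_integral (lebesgue_on \<Omega>)
                (\<lambda>x. ereal ((grad_conj \<phi> (z x) - grad_conj \<phi> (proj0 \<T> Iz x)) \<bullet> (z x - proj0 \<T> Iz x))) +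
              ext_integral (lebesgue_on \<Omega>) (\<lambda>x. ereal ((u x - proj0 \<T> Iu x)\<^sup>2)))"
proof (intro conjI ballI impI)
  note triangulation = mesh
  interpret fe_mesh \<Omega> \<T> using domain mesh(1) by unfold_locales
  let ?M = "lebesgue_on \<Omega>" and ?r = "weak_div \<Omega> z"
  have dim': "2 \<le> DIM('a)" using dim by auto
  note opt = optimal_values[OF bounded_below proper strong_duality u z]
  have IuD: "Iu \<in> CR_D \<T> \<Omega> \<Gamma>D" by (rule CR_interpolant_in_CR_D[OF Iu u(1)])
  have zs: "\<And>b. b \<in> Basis \<Longrightarrow> (\<lambda>x. z x \<bullet> b) \<in> sobolev 1 \<Omega>" using z_regular(2) by blast
  note iphi = duality_split(1)[OF p phi_diff phi_conj_finite phi_conj_diff u(1) z(1) opt]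
  have ir: "integrable ?M ?r" by (rule weak_div_properties(2)[OF z_regular(1) refl])
  note gap = energy_gap[OF triangulation(3) dim' triangulation(2) phi_convex phi_diff phi_conj_finite phi_conj_diff strong_coercivity
      uh Iu IuD Iz zs z_regular(1) _ _ _ _ _ iphi]
  {
    fix f assume f: "f \<in> Lspace (ereal p') \<Omega>"
      and fs: "(\<forall>x\<in>\<Omega>. \<forall>s. \<psi> x s = - f x * s) \<and> (\<forall>x\<in>\<Omega>. \<forall>s. \<psi>h x s = - proj0 \<T> f x * s)"
    note psi = fs[THEN conjunct1] and psih = fs[THEN conjunct2]
    note o = optimality_linear[OF p phi_diff phi_conj_finite phi_conj_diff u(1) z(1) opt f psi]
    \<comment> \<open>Projecting \<open>div z = - f\<close> replaces the discrete load by
      \<open>- \<Pi> div z\<close>, so the load term is exactly the pairing of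
      \<open>energy_gap\<close>, with zero remainder and zero constant.\<close>
    have "AE x in ?M. - ?r x = f x" using o(2) by eventually_elim simp
    then have "proj0 \<T> f = proj0 \<T> (\<lambda>x. - ?r x)" using ir by (intro proj0_cong_AE) auto
    then have pf: "proj0 \<T> f x = - proj0 \<T> ?r x" for x by (simp add: proj0_def sum_negf)
    define q where "q T s = - ((LINT y|lebesgue_on T. f y) /\<^sub>R measure lebesgue T) * s" for T s
    have q: "\<psi>h x s = q T s" if "T \<in> \<T>" "x \<in> interior T" for T x s
      using psih interior_elem_subset[OF that(1)] that proj0_elem[OF that, of f] by (auto simp: q_def)
    have qd: "q T differentiable (at s)" for T s unfolding q_def
      by (intro differentiable_mult differentiable_const differentiable_ident)
    have rep: "(LINT x|?M. \<psi>h x (proj0 \<T> v x)) = (LINT x|?M. proj0 \<T> v x * proj0 \<T> ?r x) + 0 - 0" for v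
      using psih by (auto intro!: Bochner_Integration.integral_cong simp: pf)
    show "ereal ((\<sigma> uh Iu)\<^sup>2) \<le> ext_integral ?M
        (\<lambda>x. ereal ((grad_conj \<phi> (z x) - grad_conj \<phi> (proj0 \<T> Iz x)) \<bullet> (z x - proj0 \<T> Iz x)))"
      using gap[OF _ q qd rep order_refl o(1)] by simp
  next
    fix g assume g: "g \<in> Lspace 2 \<Omega>"
      and gs: "(\<forall>x\<in>\<Omega>. \<forall>s. \<psi> x s = (g x - s)\<^sup>2 / 2) \<and> (\<forall>x\<in>\<Omega>. \<forall>s. \<psi>h x s = (proj0 \<T> g x - s)\<^sup>2 / 2)"
    note psi = gs[THEN conjunct1] and psih = gs[THEN conjunct2]
    note o = optimality_quadratic[OF p phi_diff phi_conj_finite phi_conj_diff u(1) z(1) opt g psi]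
    have iu: "integrable ?M u" by (rule sobolev_1_cases(1)[OF CR_interpolant_sobolev[OF Iu] open_Om])
    have "AE x in ?M. u x - ?r x = g x" using o(2) by eventually_elim simp
    then have "proj0 \<T> g = proj0 \<T> (\<lambda>x. u x - ?r x)" using iu ir by (intro proj0_cong_AE) auto
    then have pg: "proj0 \<T> ?r x = proj0 \<T> u x - proj0 \<T> g x" for x by (simp add: proj0_diff[OF iu ir])
    define q where "q T s = ((LINT y|lebesgue_on T. g y) /\<^sub>R measure lebesgue T - s)\<^sup>2 / 2" for T s
    have q: "\<psi>h x s = q T s" if "T \<in> \<T>" "x \<in> interior T" for T x s
      using psih interior_elem_subset[OF that(1)] that proj0_elem[OF that, of g] by (auto simp: q_def)
    have qd: "q T differentiable (at s)" for T s unfolding q_def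
      by (intro differentiable_divide differentiable_power differentiable_diff differentiable_const differentiable_ident) simp
    \<comment> \<open>With \<open>\<Pi> g = \<Pi> u - \<Pi> div z\<close> the square
      \<open>(\<Pi> g - \<Pi> v)^2 / 2\<close> expands into the pairing, the density of \<rho> and a
      term free of \<open>v\<close>. That term is minus the conjugate of the discrete quadratic at
      \<open>\<Pi> div z\<close>, whose integral is \<open>E\<close>.\<close>
    define \<rho> where "\<rho> v = (LINT x|?M. (proj0 \<T> u x - proj0 \<T> v x)\<^sup>2 / 2)" for v
    define E where "E = (LINT x|?M. (proj0 \<T> ?r x)\<^sup>2 / 2 + proj0 \<T> g x * proj0 \<T> ?r x)"
    define av where "av v T = (LINT y|lebesgue_on T. v y) /\<^sub>R measure lebesgue T" for v :: "'a \<Rightarrow> real" and T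
    have av: "proj0 \<T> v x = av v T" if "T \<in> \<T>" "x \<in> interior T" for v T x by (simp only: av_def proj0_elem[OF that])
    have rep: "(LINT x|?M. \<psi>h x (proj0 \<T> v x)) = (LINT x|?M. proj0 \<T> v x * proj0 \<T> ?r x) + \<rho> v - E" for v
    proof -
      have i1: "integrable ?M (\<lambda>x. proj0 \<T> v x * proj0 \<T> ?r x)"
        by (rule integral_elementwise_constant(1)[where c = "\<lambda>T. av v T * av ?r T"]) (simp add: av)
      have i2: "integrable ?M (\<lambda>x. (proj0 \<T> u x - proj0 \<T> v x)\<^sup>2 / 2)"
        by (rule integral_elementwise_constant(1)[where c = "\<lambda>T. (av u T - av v T)\<^sup>2 / 2"]) (simp add: av)
      have i3: "integrable ?M (\<lambda>x. (proj0 \<T> ?r x)\<^sup>2 / 2 + proj0 \<T> g x * proj0 \<T> ?r x)"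
        by (rule integral_elementwise_constant(1)[where c = "\<lambda>T. (av ?r T)\<^sup>2 / 2 + av g T * av ?r T"]) (simp add: av)
      have "(LINT x|?M. \<psi>h x (proj0 \<T> v x)) = (LINT x|?M. proj0 \<T> v x * proj0 \<T> ?r x + (proj0 \<T> u x - proj0 \<T> v x)\<^sup>2 / 2 -
          ((proj0 \<T> ?r x)\<^sup>2 / 2 + proj0 \<T> g x * proj0 \<T> ?r x))"
      proof (rule Bochner_Integration.integral_cong[OF refl])
        fix x assume "x \<in> space ?M"
        then have "\<psi>h x (proj0 \<T> v x) = (proj0 \<T> g x - proj0 \<T> v x)\<^sup>2 / 2" using psih by simp
        then show "\<psi>h x (proj0 \<T> v x) = proj0 \<T> v x * proj0 \<T> ?r x + (proj0 \<T> u x - proj0 \<T> v x)\<^sup>2 / 2 -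
          ((proj0 \<T> ?r x)\<^sup>2 / 2 + proj0 \<T> g x * proj0 \<T> ?r x)" by (simp add: pg power2_eq_square field_simps)
      qed
      also have "\<dots> = (LINT x|?M. proj0 \<T> v x * proj0 \<T> ?r x) + \<rho> v - E"
        unfolding \<rho>_def E_def Bochner_Integration.integral_diff[OF Bochner_Integration.integrable_add[OF i1 i2] i3]
          Bochner_Integration.integral_add[OF i1 i2] ..
      finally show ?thesis .
    qed
    have "0 \<le> \<rho> uh" unfolding \<rho>_def by (intro Bochner_Integration.integral_nonneg) simp
    note gap[OF _ q qd rep this o(1)]
    also have "ext_integral ?M (\<lambda>x. ereal ((grad_conj \<phi> (z x) - grad_conj \<phi> (proj0 \<T> Iz x)) \<bullet> (z x - proj0 \<T> Iz x))) + ereal (\<rho> Iu) \<le>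
       ext_integral ?M (\<lambda>x. ereal ((grad_conj \<phi> (z x) - grad_conj \<phi> (proj0 \<T> Iz x)) \<bullet> (z x - proj0 \<T> Iz x))) +
       ext_integral ?M (\<lambda>x. ereal ((u x - proj0 \<T> Iu x)\<^sup>2))"
      unfolding \<rho>_def by (rule add_left_mono[OF projection_error_le[OF iu o(3)]])
    finally show "ereal ((\<sigma> uh Iu)\<^sup>2) \<le>
       ext_integral ?M (\<lambda>x. ereal ((grad_conj \<phi> (z x) - grad_conj \<phi> (proj0 \<T> Iz x)) \<bullet> (z x - proj0 \<T> Iz x))) +
       ext_integral ?M (\<lambda>x. ereal ((u x - proj0 \<T> Iu x)\<^sup>2))" .
  }
qed

end
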